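(* Let $\mu\in(0,1)$. Let $\epsilon>0$ be such that $H(L_1)+\epsilon$ does not exceed the second smallest critical value of $H$ and such that $\overline{\Sigma}^{E,M}_c$ is of contact type for all $H(L_1)<c<H(L_1)+\epsilon$. Then there is no blue sky catastrophe for the (regularized) Hamiltonian vector field on $\overline{\Sigma}^E_c$ and $\overline{\Sigma}^M_c$ for $c<H(L_1)$, nor on $\overline{\Sigma}^{E,M}_c$ for $H(L_1)<c<H(L_1)+\epsilon$. Explicitly: let $c:[0,1]\to\mathbb{R}$ be smooth, and either let $c(s)<H(L_1)$ for all $s\in[0,1]$ and let $S_s$ be $\overline{\Sigma}^E_{c(s)}$ for all $s$ or $\overline{\Sigma}^M_{c(s)}$ for all $s$, or let $H(L_1)<c(s)<H(L_1)+\epsilon$ for all $s\in[0,1]$ and let $S_s=\overline{\Sigma}^{E,M}_{c(s)}$. If $(\gamma_s)_{s\in[0,1)}$ is a smooth $1$-parameter family of periodic orbits, with periods $\tau_s$, of the regularized Hamiltonian vector fields on $S_s$, then $\tau_s$ does not tend to infinity as $s\to1$.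
   Context: Hamiltonian. Put $E=(\mu,0,0)$, $M=(-(1-\mu),0,0)\in\mathbb{R}^3$ and $A=(\mathbb{R}^3\setminus\{E,M\})\times\mathbb{R}^3$ with coordinates $(q,p)$ and symplectic form $\omega=\sum_i dp_i\wedge dq_i$. Let $$H(q,p)=\tfrac12|p|^2-\frac{\mu}{|q-M|}-\frac{1-\mu}{|q-E|}+p_1q_2-p_2q_1 .$$ $H$ has five critical points; $L_1$ denotes the one whose position $l^1$ lies on the open segment between $E$ and $M$. $H(L_1)$ is the smallest critical value of $H$. Components of level sets. Let $\Sigma_c=H^{-1}(c)$, let $\pi(q,p)=q$, and let $\mathcal{K}_c=\pi(\Sigma_c)$. If $c<H(L_1)$, then $\mathcal{K}_c$ has three connected components, two of them bounded; the bounded ones are denoted $\mathcal{K}^M_c,\mathcal{K}^E_c$, where $M\in\overline{\mathcal{K}^M_c}$ and $E\in\overline{\mathcal{K}^E_c}$. Put $\Sigma^M_c=\pi^{-1}(\mathcal{K}^M_c)\cap\Sigma_c$ and $\Sigma^E_c=\pi^{-1}(\mathcal{K}^E_c)\cap\Sigma_c$. If $c$ is larger than $H(L_1)$ but smaller than the second smallest critical value of $H$, then $\mathcal{K}_c$ has two connected components, exactly one of them bounded, denoted $\mathcal{K}^{M,E}_c$ (its closure contains both $E$ and $M$), and $\Sigma^{M,E}_c=\pi^{-1}(\mathcal{K}^{M,E}_c)\cap\Sigma_c$. Moser regularization. Write $T^*S^3=\{(\xi,\eta)\in\mathbb{R}^4\times\mathbb{R}^4:\ |\xi|=1,\ \langle\xi,\eta\rangle=0\}$,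 $\xi=(\xi_0;\vec\xi)$, $\eta=(\eta_0;\vec\eta)$, with symplectic form the restriction of $\sum_i d\eta_i\wedge d\xi_i$, and let $N=(1,0,0,0)$. For $P\in\{E,M\}$, let $V_P=\{(\xi,\eta)\in T^*S^3:\ \eta\ne0,\ |\eta|(1-\xi_0)<\tfrac12\}$. The map $$q=P+(1-\xi_0)\vec\eta+\eta_0\vec\xi,\qquad p=-\frac{\vec\xi}{1-\xi_0}$$ is a symplectic diffeomorphism from $\{(\xi,\eta)\in V_P:\xi\neq N\}$ onto $\{(q,p)\in A: 0<|q-P|<\tfrac12\}$, with $|q-P|=|\eta|(1-\xi_0)$. Gluing $V_E$ and $V_M$ to $A$ along these two maps gives a symplectic manifold $(W,\omega)$ containing $A$. Put $C_M=\{(N,\eta)\in V_M:|\eta|=\mu\}$ and $C_E=\{(N,\eta)\in V_E:|\eta|=1-\mu\}$. The regularized energy hypersurfaces are the closed hypersurfaces of $W$ $$\overline{\Sigma}^M_c=\Sigma^M_c\cup C_M,\qquad \overline{\Sigma}^E_c=\Sigma^E_c\cup C_E,\qquad \overline{\Sigma}^{E,M}_c=\Sigma^{M,E}_c\cup C_E\cup C_M .$$ Regularized Hamiltonian vector field. Fix a smooth function $g:\mathbb{R}^3\setminus\{E,M\}\to(0,\infty)$ equal to $|q-M|$ near $M$ and to $|q-E|$ near $E$. Then $K_c=g(q)\,(H-c)$ extends smoothly over $W$, and $\overline{\Sigma}^M_c$, $\overline{\Sigma}^E_c$, $\overline{\Sigma}^{E,M}_c$ are components of $K_c^{-1}(0)$,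 which is regular there. The regularized Hamiltonian vector field on these hypersurfaces is the (non-vanishing) Hamiltonian vector field $X_{K_c}$, $dK_c=\omega(\cdot,X_{K_c})$; away from collisions it is a positive time-reparametrization of $X_H$. Whether periods blow up does not depend on the choice of $g$, since the hypersurfaces are compact. Contact type. A hypersurface $S$ in $(W,\omega)$ is of contact type if there is a vector field $X$ defined near $S$ with $\mathcal{L}_X\omega=\omega$ and transverse to $S$. Blue sky catastrophe. A smooth $1$-parameter family of non-vanishing vector fields $\{X_s\}_{s\in[0,1]}$ on a compact manifold has a blue sky catastrophe at $s=1$ if there is a smooth $1$-parameter family of periodic orbits $\gamma_s$ of $X_s$, $s\in[0,1)$, such that the period of $\gamma_s$ goes to infinity as $s\to1$. *)

theory Defs
  imports "HOL-Analysis.Analysis"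
begin

section \<open>Smooth maps and tangent vectors on subsets of Euclidean space\<close>

primrec Ck_on :: "nat \<Rightarrow> 'a::euclidean_space set \<Rightarrow> ('a \<Rightarrow> 'b::euclidean_space) \<Rightarrow> bool" where
  "Ck_on 0 U f \<longleftrightarrow> continuous_on U f"
| "Ck_on (Suc k) U f \<longleftrightarrow> (\<forall>x\<in>U. f differentiable (at x)) \<and>
     (\<forall>v. Ck_on k U (\<lambda>x. frechet_derivative f (at x) v))"

text \<open>Smoothness on an arbitrary subset (such as a half-open interval or a submanifold) means that
  the map extends, locally around each point of the subset, to a smooth map on an open set.\<close>

definition smooth_on :: "'a::euclidean_space set \<Rightarrow> ('a \<Rightarrow> 'b::euclidean_space) \<Rightarrow> bool" where
  "smooth_on S f \<longleftrightarrow> (\<forall>x\<in>S. \<exists>U F. open U \<and> x \<in> U \<and> (\<forall>k. Ck_on k U F) \<and> (\<forall>y\<in>S \<inter> U. F y = f y))"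

text \<open>Velocities of smooth curves in \<open>Z\<close> through \<open>z\<close>; for an embedded submanifold \<open>Z\<close> this is the
  usual tangent space. It is only used for submanifolds.\<close>

definition tangent_space :: "'a::euclidean_space set \<Rightarrow> 'a \<Rightarrow> 'a set" where
  "tangent_space Z z = {v. \<exists>\<gamma> d. 0 < d \<and> smooth_on {-d<..<d} \<gamma> \<and> \<gamma> ` {-d<..<d} \<subseteq> Z \<and>
     \<gamma> (0::real) = z \<and> (\<gamma> has_vector_derivative v) (at 0)}"

text \<open>\<open>\<Sum>\<^sub>i dy\<^sub>i \<and> dx\<^sub>i\<close> in coordinates \<open>(x, y)\<close>. It serves for \<open>(q, p)\<close> as well as for \<open>(\<xi>, \<eta>)\<close>.\<close>

definition symp :: "'v::euclidean_space \<times> 'v \<Rightarrow> 'v \<times> 'v \<Rightarrow> real" where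
  "symp u v = snd u \<bullet> fst v - fst u \<bullet> snd v"

text \<open>Lie derivative along \<open>X\<close> of the restriction of \<^const>\<open>symp\<close> to a submanifold \<open>Z\<close> to which \<open>X\<close> is
  tangent, evaluated at tangent vectors \<open>u, v\<close>. As the ambient form has constant coefficients,
  the coordinate formula for its Lie derivative along an extension of \<open>X\<close> reduces to these two
  terms, and Lie derivatives commute with restriction. A derivative within \<open>Z\<close> is determined on
  tangent vectors of \<open>Z\<close> only, which is all that matters.\<close>

definition lie_symp ::
  "('v::euclidean_space \<times> 'v) set \<Rightarrow> ('v \<times> 'v \<Rightarrow> 'v \<times> 'v) \<Rightarrow> 'v \<times> 'v \<Rightarrow> 'v \<times> 'v \<Rightarrow> 'v \<times> 'v \<Rightarrow> real" where
  "lie_symp Z X z u v = (let D = frechet_derivative X (at z within Z)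
     in symp (D u) v + symp u (D v))"

text \<open>The Hamiltonian vector field \<open>X\<close> on \<open>Z\<close>, with the sign convention \<open>dK = \<omega>(\<cdot>, X)\<close>.\<close>

definition ham_vf :: "('v::euclidean_space \<times> 'v) set \<Rightarrow> ('v \<times> 'v \<Rightarrow> real) \<Rightarrow> 'v \<times> 'v \<Rightarrow> 'v \<times> 'v" where
  "ham_vf Z K z = (THE x. x \<in> tangent_space Z z \<and>
     (\<forall>u\<in>tangent_space Z z. frechet_derivative K (at z within Z) u = symp u x))"

section \<open>The spatial circular restricted three body problem\<close>

type_synonym phase = "(real^3) \<times> (real^3)"

datatype primary = Earth | Moon

fun pos :: "real \<Rightarrow> primary \<Rightarrow> real^3" where
  "pos \<mu> Earth = vector [\<mu>, 0, 0]"
| "pos \<mu> Moon = vector [- (1 - \<mu>), 0, 0]"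

fun mass :: "real \<Rightarrow> primary \<Rightarrow> real" where
  "mass \<mu> Earth = 1 - \<mu>"
| "mass \<mu> Moon = \<mu>"

definition phase_space :: "real \<Rightarrow> phase set" where
  "phase_space \<mu> = (UNIV - {pos \<mu> Earth, pos \<mu> Moon}) \<times> UNIV"

definition H :: "real \<Rightarrow> phase \<Rightarrow> real" where
  "H \<mu> = (\<lambda>(q, p). (norm p)\<^sup>2 / 2
      - mass \<mu> Moon / norm (q - pos \<mu> Moon) - mass \<mu> Earth / norm (q - pos \<mu> Earth)
      + p $ 1 * q $ 2 - p $ 2 * q $ 1)"

definition critical_points :: "real \<Rightarrow> phase set" where
  "critical_points \<mu> = {z \<in> phase_space \<mu>. (H \<mu> has_derivative (\<lambda>_. 0)) (at z)}"

definition L1 :: "real \<Rightarrow> phase" where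
  "L1 \<mu> = (THE z. z \<in> critical_points \<mu> \<and> fst z \<in> open_segment (pos \<mu> Earth) (pos \<mu> Moon))"

text \<open>\<open>H (L1)\<close> is the smallest of the finitely many critical values, so the infimum below is the
  second smallest one.\<close>

definition second_critical_value :: "real \<Rightarrow> real" where
  "second_critical_value \<mu> = Inf (H \<mu> ` critical_points \<mu> - {H \<mu> (L1 \<mu>)})"

definition level_set :: "real \<Rightarrow> real \<Rightarrow> phase set" where
  "level_set \<mu> c = {z \<in> phase_space \<mu>. H \<mu> z = c}"

definition hill_region :: "real \<Rightarrow> real \<Rightarrow> (real^3) set" where
  "hill_region \<mu> c = fst ` level_set \<mu> c"

text \<open>For \<open>c < H (L1)\<close>.\<close>

definition hill_component :: "real \<Rightarrow> primary \<Rightarrow> real \<Rightarrow> (real^3) set" where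
  "hill_component \<mu> P c =
     (THE C. C \<in> components (hill_region \<mu> c) \<and> bounded C \<and> pos \<mu> P \<in> closure C)"

text \<open>For \<open>c\<close> between \<open>H (L1)\<close> and the second smallest critical value.\<close>

definition hill_component_EM :: "real \<Rightarrow> real \<Rightarrow> (real^3) set" where
  "hill_component_EM \<mu> c = (THE C. C \<in> components (hill_region \<mu> c) \<and> bounded C)"

section \<open>Moser regularization\<close>

text \<open>Vectors in \<open>\<real>\<^sup>4\<close> are split as \<open>(\<xi>\<^sub>0; \<xi>\<^sub>1, \<xi>\<^sub>2, \<xi>\<^sub>3)\<close>.\<close>

type_synonym R4 = "real \<times> (real^3)"

abbreviation north :: R4 where "north \<equiv> (1, 0)"

text \<open>The open subset of \<open>T\<^sup>*S\<^sup>3\<close> to be glued in; it is the same set for both primaries.\<close>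

definition V :: "(R4 \<times> R4) set" where
  "V = {(\<xi>, \<eta>). norm \<xi> = 1 \<and> \<xi> \<bullet> \<eta> = 0 \<and> \<eta> \<noteq> 0 \<and> norm \<eta> * (1 - fst \<xi>) < 1/2}"

definition moser :: "real \<Rightarrow> primary \<Rightarrow> R4 \<times> R4 \<Rightarrow> phase" where
  "moser \<mu> P = (\<lambda>(\<xi>, \<eta>).
     (pos \<mu> P + (1 - fst \<xi>) *\<^sub>R snd \<eta> + fst \<eta> *\<^sub>R snd \<xi>, - (snd \<xi> /\<^sub>R (1 - fst \<xi>))))"

text \<open>Points of the glued manifold \<open>W\<close> in normal form: the points of the phase space, together with
  those points \<open>(N, \<eta>)\<close> of the two copies of \<^const>\<open>V\<close> that are not identified with a point of the
  phase space; there \<open>\<eta>\<^sub>0 = 0\<close>, so only the last three components of \<open>\<eta>\<close> are recorded.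
  The maps \<open>Reg\<close> (on the phase space) and \<open>glue \<mu> P\<close> (on \<^const>\<open>V\<close>) are the canonical inclusions of
  the pieces into \<open>W\<close>; topology, smooth structure and symplectic form of \<open>W\<close> are defined through
  them.\<close>

datatype wpoint = Reg phase | Coll primary "real^3"

definition glue :: "real \<Rightarrow> primary \<Rightarrow> R4 \<times> R4 \<Rightarrow> wpoint" where
  "glue \<mu> P z = (if fst z = north then Coll P (snd (snd z)) else Reg (moser \<mu> P z))"

definition W :: "real \<Rightarrow> wpoint set" where
  "W \<mu> = Reg ` phase_space \<mu> \<union> (\<Union>P. glue \<mu> P ` V)"

definition open_W :: "real \<Rightarrow> wpoint set \<Rightarrow> bool" where
  "open_W \<mu> U \<longleftrightarrow> U \<subseteq> W \<mu> \<and>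
     openin (top_of_set (phase_space \<mu>)) (phase_space \<mu> \<inter> Reg -` U) \<and>
     (\<forall>P. openin (top_of_set V) (V \<inter> glue \<mu> P -` U))"

definition smooth_fun_W :: "real \<Rightarrow> (wpoint \<Rightarrow> real) \<Rightarrow> bool" where
  "smooth_fun_W \<mu> f \<longleftrightarrow> smooth_on (phase_space \<mu>) (f \<circ> Reg) \<and> (\<forall>P. smooth_on V (f \<circ> glue \<mu> P))"

definition smooth_lift_at ::
  "('m::euclidean_space \<Rightarrow> wpoint) \<Rightarrow> 'm set \<Rightarrow> 'a::euclidean_space set \<Rightarrow> ('a \<Rightarrow> wpoint) \<Rightarrow> 'a \<Rightarrow> bool" where
  "smooth_lift_at \<iota> Z D f x \<longleftrightarrow> (\<exists>U h. open U \<and> x \<in> U \<and> smooth_on (D \<inter> U) h \<and>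
     (\<forall>y\<in>D \<inter> U. h y \<in> Z \<and> f y = \<iota> (h y)))"

text \<open>Smooth maps into \<open>W\<close>, defined on a subset \<open>D\<close> of a Euclidean space: near each point of \<open>D\<close> they
  are given by a smooth map into one of the three pieces.\<close>

definition smooth_map_W :: "real \<Rightarrow> 'a::euclidean_space set \<Rightarrow> ('a \<Rightarrow> wpoint) \<Rightarrow> bool" where
  "smooth_map_W \<mu> D f \<longleftrightarrow> (\<forall>x\<in>D. smooth_lift_at Reg (phase_space \<mu>) D f x \<or>
     (\<exists>P. smooth_lift_at (glue \<mu> P) V D f x))"

text \<open>A vector field on an open subset \<open>U\<close> of \<open>W\<close> is given by its representations \<open>XA\<close> on the phase
  space and \<open>XV P\<close> on the two copies of \<^const>\<open>V\<close>, related by the gluing maps.\<close>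

definition vector_field_W ::
  "real \<Rightarrow> wpoint set \<Rightarrow> (phase \<Rightarrow> phase) \<Rightarrow> (primary \<Rightarrow> R4 \<times> R4 \<Rightarrow> R4 \<times> R4) \<Rightarrow> bool" where
  "vector_field_W \<mu> U XA XV \<longleftrightarrow>
     smooth_on (phase_space \<mu> \<inter> Reg -` U) XA \<and>
     (\<forall>P. smooth_on (V \<inter> glue \<mu> P -` U) (XV P) \<and>
        (\<forall>z\<in>V \<inter> glue \<mu> P -` U. XV P z \<in> tangent_space V z \<and>
           (fst z \<noteq> north \<longrightarrow>
              frechet_derivative (moser \<mu> P) (at z) (XV P z) = XA (moser \<mu> P z))))"

definition liouville_on ::
  "('v::euclidean_space \<times> 'v) set \<Rightarrow> ('v \<times> 'v \<Rightarrow> 'v \<times> 'v) \<Rightarrow> bool" where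
  "liouville_on Z X \<longleftrightarrow> (\<forall>z\<in>Z. \<forall>u\<in>tangent_space Z z. \<forall>v\<in>tangent_space Z z.
     lie_symp Z X z u v = symp u v)"

definition contact_type :: "real \<Rightarrow> wpoint set \<Rightarrow> bool" where
  "contact_type \<mu> S \<longleftrightarrow> (\<exists>U XA XV. open_W \<mu> U \<and> S \<subseteq> U \<and> vector_field_W \<mu> U XA XV \<and>
     liouville_on (phase_space \<mu> \<inter> Reg -` U) XA \<and>
     (\<forall>P. liouville_on (V \<inter> glue \<mu> P -` U) (XV P)) \<and>
     (\<forall>z\<in>phase_space \<mu> \<inter> Reg -` S. XA z \<notin> tangent_space (phase_space \<mu> \<inter> Reg -` S) z) \<and>
     (\<forall>P. \<forall>z\<in>V \<inter> glue \<mu> P -` S. XV P z \<notin> tangent_space (V \<inter> glue \<mu> P -` S) z))"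

section \<open>Regularized energy hypersurfaces\<close>

definition collision_set :: "real \<Rightarrow> primary \<Rightarrow> wpoint set" where
  "collision_set \<mu> P = glue \<mu> P ` {z \<in> V. fst z = north \<and> norm (snd z) = mass \<mu> P}"

definition reg_surface :: "real \<Rightarrow> primary \<Rightarrow> real \<Rightarrow> wpoint set" where
  "reg_surface \<mu> P c = Reg ` (fst -` hill_component \<mu> P c \<inter> level_set \<mu> c) \<union> collision_set \<mu> P"

definition reg_surface_EM :: "real \<Rightarrow> real \<Rightarrow> wpoint set" where
  "reg_surface_EM \<mu> c = Reg ` (fst -` hill_component_EM \<mu> c \<inter> level_set \<mu> c)
     \<union> collision_set \<mu> Earth \<union> collision_set \<mu> Moon"

section \<open>Regularized Hamiltonian flow\<close>

definition regularizing :: "real \<Rightarrow> (real^3 \<Rightarrow> real) \<Rightarrow> bool" where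
  "regularizing \<mu> g \<longleftrightarrow> smooth_on (UNIV - {pos \<mu> Earth, pos \<mu> Moon}) g \<and>
     (\<forall>q. q \<notin> {pos \<mu> Earth, pos \<mu> Moon} \<longrightarrow> 0 < g q) \<and>
     (\<forall>P. eventually (\<lambda>q. g q = norm (q - pos \<mu> P)) (at (pos \<mu> P)))"

text \<open>The smooth extension of \<open>g \<cdot> (H - c)\<close> to \<open>W\<close>. It is unique on \<open>W\<close> because the phase space is
  dense there.\<close>

definition reg_ham :: "real \<Rightarrow> (real^3 \<Rightarrow> real) \<Rightarrow> real \<Rightarrow> wpoint \<Rightarrow> real" where
  "reg_ham \<mu> g c = (SOME K. smooth_fun_W \<mu> K \<and>
     (\<forall>z\<in>phase_space \<mu>. K (Reg z) = g (fst z) * (H \<mu> z - c)))"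

definition solves_at ::
  "('v::euclidean_space \<times> 'v \<Rightarrow> wpoint) \<Rightarrow> ('v \<times> 'v) set \<Rightarrow> (wpoint \<Rightarrow> real) \<Rightarrow> (real \<Rightarrow> wpoint) \<Rightarrow> real \<Rightarrow> bool"
  where
  "solves_at \<iota> Z K \<gamma> t \<longleftrightarrow> (\<exists>h. (\<forall>\<^sub>F r in nhds t. h r \<in> Z \<and> \<gamma> r = \<iota> (h r)) \<and>
     (h has_vector_derivative ham_vf Z (K \<circ> \<iota>) (h t)) (at t))"

text \<open>Integral curves of \<open>X\<^sub>K\<close> on \<open>W\<close>. On overlaps it does not matter in which piece the equation is
  checked, since the gluing maps are symplectic.\<close>

definition integral_curve :: "real \<Rightarrow> (wpoint \<Rightarrow> real) \<Rightarrow> (real \<Rightarrow> wpoint) \<Rightarrow> bool" where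
  "integral_curve \<mu> K \<gamma> \<longleftrightarrow> (\<forall>t. solves_at Reg (phase_space \<mu>) K \<gamma> t \<or>
     (\<exists>P. solves_at (glue \<mu> P) V K \<gamma> t))"

text \<open>Smooth families of periodic orbits \<open>\<gamma> s\<close> with (not necessarily minimal) periods \<open>\<tau> s\<close> of the
  regularized flows on the hypersurfaces \<open>S (c s)\<close>, where \<open>0 \<le> s < 1\<close>.\<close>

definition periodic_orbit_family ::
  "real \<Rightarrow> (real^3 \<Rightarrow> real) \<Rightarrow> (real \<Rightarrow> wpoint set) \<Rightarrow> (real \<Rightarrow> real) \<Rightarrow>
   (real \<Rightarrow> real \<Rightarrow> wpoint) \<Rightarrow> (real \<Rightarrow> real) \<Rightarrow> bool" where
  "periodic_orbit_family \<mu> g S c \<gamma> \<tau> \<longleftrightarrow>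
     smooth_map_W \<mu> ({0..<1} \<times> UNIV) (\<lambda>(s, t). \<gamma> s t) \<and> smooth_on {0..<1} \<tau> \<and>
     (\<forall>s\<in>{0..<1}. 0 < \<tau> s \<and> range (\<gamma> s) \<subseteq> S (c s) \<and>
        integral_curve \<mu> (reg_ham \<mu> g (c s)) (\<gamma> s) \<and> (\<forall>t. \<gamma> s (t + \<tau> s) = \<gamma> s t))"

definition blue_sky_catastrophe ::
  "real \<Rightarrow> (real^3 \<Rightarrow> real) \<Rightarrow> (real \<Rightarrow> wpoint set) \<Rightarrow> (real \<Rightarrow> real) \<Rightarrow> bool" where
  "blue_sky_catastrophe \<mu> g S c \<longleftrightarrow>
     (\<exists>\<gamma> \<tau>. periodic_orbit_family \<mu> g S c \<gamma> \<tau> \<and> filterlim \<tau> at_top (at_left 1))"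

end

theory Submission imports Defs
begin

text \<open>Let \<open>\<gamma>\<^sub>s\<close> be a family of periodic orbits of period \<open>\<tau>\<^sub>s\<close> and \<open>X\<close> a Liouville field near the surface of
  energy \<open>c(1)\<close>. By compactness \<open>|dK(X)| \<ge> \<delta>\<close> on all nearby surfaces, so the action
  \<open>A(s) = \<integral>\<omega>(X, d\<gamma>\<^sub>s)\<close> has modulus at least \<open>\<delta> \<tau>\<^sub>s\<close>. Since \<open>d(\<iota>\<^sub>X \<omega>) = \<omega>\<close> and the orbits vary through energy
  levels with bounded speed, \<open>|A'(s)| \<le> C \<tau>\<^sub>s\<close>. Hence \<open>log |A|\<close>, and with it \<open>\<tau>\<^sub>s\<close>, stays bounded as
  \<open>s \<rightarrow> 1\<close>. Above the first critical value the field is given by the contact type hypothesis. Below it, the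
  radial field around the primary, \<open>(q - P) \<partial>\<^sub>q\<close>, which in Moser's chart is the fibrewise dilation
  \<open>\<eta> \<partial>\<^sub>\<eta>\<close>, is transverse to the component at \<open>P\<close>.\<close>


section \<open>Calculus of smooth maps\<close>

text \<open>The velocity of the family in \<open>s\<close> may blow up as s tends to 1, so no
  estimate may depend on its size. Rescale to period 1: Gamma(s,u) is the orbit s at time tau(s) u.
  Then the u-derivative of Gamma is tau X, and omega(d_s Gamma, d_u Gamma) = tau dK(d_s Gamma): only
  the energy component of d_s Gamma enters. It equals c'(s) g(q), since changing c changes K by a
  multiple of g, and g is bounded on the surfaces. Transversality of the radial field: on a ray with
  effective potential u(r) and squared sine w of the angle to the rotation axis, Cauchy-Schwarz
  reduces it to u'^2 > 2 w (c - u). The function u'^2/2 - w (c - u) has derivative u' (u'' + w),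
  which is nonpositive up to the sphere through L1, and for w > 0 it is positive on that sphere,
  because there u > c. Tangency in \<open>contact_type\<close> is a statement about curves. Turning
  its failure into dK(X) \<noteq> 0 takes the implicit function theorem, carried out inside T*S^3
  with the help of a retraction. Momenta are unbounded near a collision, so compactness there is
  obtained from a bound on |\<eta>| in Moser's chart.\<close>

definition smooth :: "'a::euclidean_space set \<Rightarrow> ('a \<Rightarrow> 'b::euclidean_space) \<Rightarrow> bool" where
  "smooth U f \<longleftrightarrow> (\<forall>k. Ck_on k U f)"

lemma Ck_on_cong:
  assumes "open U" "\<And>x. x \<in> U \<Longrightarrow> f x = g x" "Ck_on k U f"
  shows "Ck_on k U g"
  using assms(2,3)
proof (induction k arbitrary: f g)
  case 0
  then show ?case by (simp cong: continuous_on_cong)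
next
  case (Suc k)
  have D: "(g has_derivative frechet_derivative f (at x)) (at x)" if "x \<in> U" for x
    using Suc.prems that assms(1)
    by (metis Ck_on.simps(2) frechet_derivative_works has_derivative_transform_within_open)
  then have E: "frechet_derivative g (at x) = frechet_derivative f (at x)" if "x \<in> U" for x
    using that by (metis frechet_derivative_at)
  show ?case
    unfolding Ck_on.simps
  proof safe
    fix x assume "x \<in> U"
    then show "g differentiable (at x)" using D by (auto simp: differentiable_def)
  next
    fix v
    show "Ck_on k U (\<lambda>x. frechet_derivative g (at x) v)"
      by (rule Suc.IH[of "\<lambda>x. frechet_derivative f (at x) v"]) (use Suc.prems E in auto)
  qed
qed

lemma Ck_on_SucI:
  assumes "open U" "\<And>x. x \<in> U \<Longrightarrow> (f has_derivative f' x) (at x)" "\<And>v. Ck_on k U (\<lambda>x. f' x v)"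
  shows "Ck_on (Suc k) U f"
proof -
  have E: "f' x = frechet_derivative f (at x)" if "x \<in> U" for x
    using assms(2) that by (metis frechet_derivative_at)
  show ?thesis
    unfolding Ck_on.simps
  proof safe
    fix x assume "x \<in> U"
    then show "f differentiable (at x)" using assms(2) by (auto simp: differentiable_def)
  next
    fix v
    show "Ck_on k U (\<lambda>x. frechet_derivative f (at x) v)"
      by (rule Ck_on_cong[OF assms(1) _ assms(3)]) (use E in auto)
  qed
qed

lemma Ck_on_has_derivative:
  "Ck_on (Suc k) U f \<Longrightarrow> x \<in> U \<Longrightarrow> (f has_derivative frechet_derivative f (at x)) (at x)"
  by (simp add: frechet_derivative_works)

lemma Ck_on_Suc_imp: "Ck_on (Suc k) U f \<Longrightarrow> Ck_on k U f"
proof (induction k arbitrary: f)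
  case 0
  then show ?case
    by (auto intro!: continuous_at_imp_continuous_on differentiable_imp_continuous_within)
next
  case (Suc k)
  show ?case unfolding Ck_on.simps
  proof safe
    show "f differentiable (at x)" if "x \<in> U" for x using Suc.prems that by simp
    show "Ck_on k U (\<lambda>x. frechet_derivative f (at x) v)" for v
      by (rule Suc.IH) (use Suc.prems Ck_on.simps(2)[of "Suc k" U f] in blast)
  qed
qed

lemma Ck_on_continuous_on: "Ck_on k U f \<Longrightarrow> continuous_on U f"
proof (induction k)
  case (Suc k)
  then show ?case using Ck_on_Suc_imp by blast
qed simp

lemma Ck_on_subset: "T \<subseteq> U \<Longrightarrow> Ck_on k U f \<Longrightarrow> Ck_on k T f"
  by (induction k arbitrary: f) (auto intro: continuous_on_subset)

lemma Ck_on_local: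
  assumes "\<And>x. x \<in> U \<Longrightarrow> \<exists>N. open N \<and> x \<in> N \<and> Ck_on k N f"
  shows "Ck_on k U f"
  using assms
proof (induction k arbitrary: f)
  case 0
  show ?case unfolding Ck_on.simps
  proof (rule continuous_at_imp_continuous_on, safe)
    fix x assume "x \<in> U"
    from 0[OF this] obtain N where "open N" "x \<in> N" "continuous_on N f" by auto
    then show "isCont f x" by (simp add: continuous_on_eq_continuous_at)
  qed
next
  case (Suc k)
  show ?case unfolding Ck_on.simps
  proof safe
    show "f differentiable (at x)" if "x \<in> U" for x
      using Suc.prems[OF that] by auto
    show "Ck_on k U (\<lambda>x. frechet_derivative f (at x) v)" for v
    proof (rule Suc.IH)
      fix x assume "x \<in> U"
      from Suc.prems[OF this] show "\<exists>N. open N \<and> x \<in> N \<and> Ck_on k N (\<lambda>x. frechet_derivative f (at x) v)"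
        unfolding Ck_on.simps by blast
    qed
  qed
qed

lemma Ck_on_const [simp]: "Ck_on k U (\<lambda>x. a)"
  by (induction k arbitrary: a) auto

lemma Ck_on_linear: "open U \<Longrightarrow> bounded_linear f \<Longrightarrow> Ck_on k U f"
proof (induction k)
  case 0
  then show ?case by (simp add: linear_continuous_on)
next
  case (Suc k)
  then show ?case
    by (intro Ck_on_SucI[of U f "\<lambda>_. f"]) (auto simp: bounded_linear_imp_has_derivative)
qed

lemma Ck_on_add:
  assumes "open U" "Ck_on k U f" "Ck_on k U g"
  shows "Ck_on k U (\<lambda>x. f x + g x)"
  using assms(2,3)
proof (induction k arbitrary: f g)
  case 0
  then show ?case by (simp add: continuous_on_add)
next
  case (Suc k)
  show ?case
    by (rule Ck_on_SucI[OF assms(1) has_derivative_add[OF Ck_on_has_derivative Ck_on_has_derivative]])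
       (use Suc in auto)
qed

lemma Ck_on_sum:
  assumes "open U" "\<And>i. i \<in> I \<Longrightarrow> Ck_on k U (f i)"
  shows "Ck_on k U (\<lambda>x. \<Sum>i\<in>I. f i x)"
  using assms(2)
  by (induction I rule: infinite_finite_induct) (auto intro: Ck_on_add[OF assms(1)])

text \<open>One Leibniz rule for all products in use: real, scalar, inner product, and later the
  symplectic form.\<close>

lemma Ck_on_bilinear:
  assumes "open U" "bounded_bilinear B" "Ck_on k U f" "Ck_on k U g"
  shows "Ck_on k U (\<lambda>x. B (f x) (g x))"
  using assms(3,4)
proof (induction k arbitrary: f g)
  case 0
  then show ?case by (simp add: bounded_bilinear.continuous_on[OF assms(2)])
next
  case (Suc k)
  show ?case
  proof (rule Ck_on_SucI[OF assms(1) bounded_bilinear.FDERIV[OF assms(2) Ck_on_has_derivative Ck_on_has_derivative]])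
    fix v
    have fg: "Ck_on k U f" "Ck_on k U g"
      using Suc.prems Ck_on_Suc_imp by blast+
    then show "Ck_on k U (\<lambda>x. B (f x) (frechet_derivative g (at x) v) + B (frechet_derivative f (at x) v) (g x))"
      using Suc.prems by (intro Ck_on_add[OF assms(1)] Suc.IH) auto
  qed (use Suc.prems in \<open>simp_all only:\<close>)
qed

text \<open>The derivative of the composite in a fixed direction \<open>v\<close> is Df at
  \<open>g x\<close> in the direction Dg(x) v, which varies with x. Expanding this direction in the
  basis leaves only fixed directions of \<open>f\<close>, to which the induction hypothesis
  applies.\<close>

lemma Ck_on_compose:
  assumes "open U" "open T" "g ` U \<subseteq> T" "Ck_on k U g" "Ck_on k T f"
  shows "Ck_on k U (\<lambda>x. f (g x))"
  using assms(4,5)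
proof (induction k arbitrary: f)
  case 0
  then show ?case using assms(3) by (auto intro: continuous_on_compose2)
next
  case (Suc k)
  have D: "((\<lambda>x. f (g x)) has_derivative (\<lambda>v. frechet_derivative f (at (g x)) (frechet_derivative g (at x) v))) (at x)"
    if "x \<in> U" for x
    using diff_chain_at[OF Ck_on_has_derivative[OF Suc.prems(1) that] Ck_on_has_derivative[OF Suc.prems(2)]] that assms(3)
    by (auto simp: o_def)
  have lin: "frechet_derivative f (at (g x)) (frechet_derivative g (at x) v) =
      (\<Sum>i\<in>Basis. (frechet_derivative g (at x) v \<bullet> i) *\<^sub>R frechet_derivative f (at (g x)) i)" if "x \<in> U" for x v
  proof -
    have "linear (frechet_derivative f (at (g x)))"
      using Ck_on_has_derivative[OF Suc.prems(2), of "g x"] that assms(3)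
      by (auto intro: has_derivative_linear)
    then show ?thesis
      by (subst euclidean_representation[symmetric, of "frechet_derivative g (at x) v"])
        (simp add: linear_sum linear_scale)
  qed
  show ?case
  proof (rule Ck_on_SucI[OF assms(1) D])
    fix v
    have 1: "Ck_on k U (\<lambda>x. frechet_derivative g (at x) v \<bullet> i)" for i
      by (rule Ck_on_bilinear[OF assms(1) bounded_bilinear_inner]) (use Suc.prems in auto)
    have 2: "Ck_on k U (\<lambda>x. frechet_derivative f (at (g x)) i)" for i
      by (rule Suc.IH[OF Ck_on_Suc_imp[OF Suc.prems(1)]]) (use Suc.prems(2) in simp)
    have "Ck_on k U (\<lambda>x. \<Sum>i\<in>Basis. (frechet_derivative g (at x) v \<bullet> i) *\<^sub>R frechet_derivative f (at (g x)) i)"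
      by (intro Ck_on_sum Ck_on_bilinear[OF assms(1) bounded_bilinear_scaleR] 1 2 assms(1))
    then show "Ck_on k U (\<lambda>x. frechet_derivative f (at (g x)) (frechet_derivative g (at x) v))"
      by (rule Ck_on_cong[OF assms(1), rotated]) (simp add: lin)
  qed auto
qed

text \<open>The derivative -1/x^2 is a product of inverses again, so the induction closes.
  \<open>Ck_on_sqrt\<close> closes in the same way through 1/(2 sqrt x).\<close>

lemma Ck_on_inverse: "Ck_on k (-{0}) (inverse :: real \<Rightarrow> real)"
proof (induction k)
  case 0
  show ?case by (auto intro: continuous_intros)
next
  case (Suc k)
  show ?case
  proof (rule Ck_on_SucI)
    show "open (-{0::real})" by (rule open_Compl) auto
    show "(inverse has_derivative (\<lambda>h. - (inverse x * h * inverse x))) (at x)" if "x \<in> -{0}" for x :: real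
      using that by (auto intro: has_derivative_inverse')
    fix v :: real
    have "Ck_on k (-{0}) (\<lambda>x. (-v) * (inverse x * inverse x))"
      by (intro Ck_on_bilinear[OF _ bounded_bilinear_mult] Suc Ck_on_const) auto
    then show "Ck_on k (-{0}) (\<lambda>x. - (inverse x * v * inverse x))"
      by (rule Ck_on_cong[rotated 2]) (auto simp: open_Compl algebra_simps)
  qed
qed

lemma Ck_on_sqrt: "Ck_on k {0<..} sqrt"
proof (induction k)
  case 0
  show ?case by (auto intro: continuous_intros)
next
  case (Suc k)
  show ?case
  proof (rule Ck_on_SucI[of _ _ "\<lambda>x h. h * (inverse (sqrt x) / 2)"])
    show "(sqrt has_derivative (\<lambda>h. h * (inverse (sqrt x) / 2))) (at x)" if "x \<in> {0<..}" for x :: real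
      using DERIV_real_sqrt[of x] that by (auto simp: has_field_derivative_def elim!: has_derivative_eq_rhs)
    fix v :: real
    have "Ck_on k {0<..} (\<lambda>x. (v/2) *\<^sub>R inverse (sqrt x))"
      by (intro Ck_on_bilinear[OF _ bounded_bilinear_scaleR]
          Ck_on_compose[OF _ _ _ Suc Ck_on_inverse] Ck_on_const) auto
    then show "Ck_on k {0<..} (\<lambda>x. v * (inverse (sqrt x) / 2))"
      by (rule Ck_on_cong[rotated 2]) (auto simp: algebra_simps)
  qed auto
qed

lemma Ck_on_linear_compose:
  "open U \<Longrightarrow> bounded_linear f \<Longrightarrow> Ck_on k U g \<Longrightarrow> Ck_on k U (\<lambda>x. f (g x))"
  by (rule Ck_on_compose[of U UNIV g k f]) (simp_all add: Ck_on_linear)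

lemma Ck_on_Pair:
  assumes "open U" "Ck_on k U f" "Ck_on k U g" shows "Ck_on k U (\<lambda>x. (f x, g x))"
proof -
  have "Ck_on k U (\<lambda>x. (f x, 0) + (0, g x))"
    using assms
    by (intro Ck_on_add[OF assms(1)] Ck_on_linear_compose[where f="\<lambda>y. (y,0)" and g=f]
          Ck_on_linear_compose[where f="\<lambda>y. (0,y)" and g=g])
       (simp_all add: bounded_linear_Pair bounded_linear_ident bounded_linear_zero)
  then show ?thesis by simp
qed

section \<open>Closure rules for smooth maps on open sets\<close>

named_theorems smooth_intros

lemma smooth_cong:
  "open U \<Longrightarrow> (\<And>x. x \<in> U \<Longrightarrow> f x = g x) \<Longrightarrow> smooth U f \<Longrightarrow> smooth U g"
  unfolding smooth_def by (rule allI, rule Ck_on_cong[of U f g]) simp_all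

lemma smooth_subset: "smooth U f \<Longrightarrow> T \<subseteq> U \<Longrightarrow> smooth T f"
  unfolding smooth_def by (rule allI, erule Ck_on_subset, erule spec)

lemma smooth_local:
  assumes "\<And>x. x \<in> U \<Longrightarrow> \<exists>N. open N \<and> x \<in> N \<and> smooth N f"
  shows "smooth U f"
  unfolding smooth_def
proof
  fix k show "Ck_on k U f"
  proof (rule Ck_on_local)
    fix x assume "x \<in> U"
    from assms[OF this] show "\<exists>N. open N \<and> x \<in> N \<and> Ck_on k N f"
      unfolding smooth_def by blast
  qed
qed

lemma smooth_const [smooth_intros]: "smooth U (\<lambda>x. a)"
  by (simp add: smooth_def)

lemma smooth_linear: "open U \<Longrightarrow> bounded_linear f \<Longrightarrow> smooth U f"
  by (simp add: smooth_def Ck_on_linear)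

lemma smooth_id [smooth_intros]: "open U \<Longrightarrow> smooth U (\<lambda>x. x)"
  by (rule smooth_linear) (simp_all add: bounded_linear_ident)

lemma smooth_add [smooth_intros]:
  "open U \<Longrightarrow> smooth U f \<Longrightarrow> smooth U g \<Longrightarrow> smooth U (\<lambda>x. f x + g x)"
  by (simp add: smooth_def Ck_on_add)

lemma smooth_sum:
  assumes "open U" "\<And>i. i \<in> I \<Longrightarrow> smooth U (f i)"
  shows "smooth U (\<lambda>x. \<Sum>i\<in>I. f i x)"
  using assms(2)
  by (induction I rule: infinite_finite_induct) (simp_all add: smooth_const smooth_add[OF assms(1)])

lemma smooth_bilinear:
  "open U \<Longrightarrow> bounded_bilinear B \<Longrightarrow> smooth U f \<Longrightarrow> smooth U g \<Longrightarrow> smooth U (\<lambda>x. B (f x) (g x))"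
  by (simp add: smooth_def Ck_on_bilinear)

lemmas smooth_scaleR [smooth_intros] = smooth_bilinear[OF _ bounded_bilinear_scaleR]
  and smooth_mult [smooth_intros] = smooth_bilinear[OF _ bounded_bilinear_mult[where 'a=real]]
  and smooth_inner [smooth_intros] = smooth_bilinear[OF _ bounded_bilinear_inner]

lemma smooth_compose:
  "open U \<Longrightarrow> open T \<Longrightarrow> g ` U \<subseteq> T \<Longrightarrow> smooth U g \<Longrightarrow> smooth T f \<Longrightarrow> smooth U (\<lambda>x. f (g x))"
  unfolding smooth_def by (rule allI, rule Ck_on_compose[of U T g _ f]) (assumption | erule spec)+

lemma smooth_linear_compose:
  "open U \<Longrightarrow> bounded_linear f \<Longrightarrow> smooth U g \<Longrightarrow> smooth U (\<lambda>x. f (g x))"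
  by (rule smooth_compose[of U UNIV g f]) (simp_all add: smooth_linear)

lemmas smooth_fst [smooth_intros] = smooth_linear_compose[OF _ bounded_linear_fst]
  and smooth_snd [smooth_intros] = smooth_linear_compose[OF _ bounded_linear_snd]
  and smooth_minus [smooth_intros] = smooth_linear_compose[OF _ bounded_linear_minus[OF bounded_linear_ident]]
  and smooth_nth [smooth_intros] = smooth_linear_compose[OF _ bounded_linear_vec_nth[where 'a=real]]

lemma smooth_diff [smooth_intros]:
  assumes "open U" "smooth U f" "smooth U g"
  shows "smooth U (\<lambda>x. f x - g x)"
  using smooth_add[OF assms(1,2) smooth_minus[OF assms(1,3)]] by simp

lemma smooth_Pair [smooth_intros]:
  "open U \<Longrightarrow> smooth U f \<Longrightarrow> smooth U g \<Longrightarrow> smooth U (\<lambda>x. (f x, g x))"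
  by (simp add: smooth_def Ck_on_Pair)

lemma smooth_inverse_real: "smooth (-{0}) (inverse :: real \<Rightarrow> real)"
  and smooth_sqrt_real: "smooth {0<..} sqrt"
  by (simp_all add: smooth_def Ck_on_inverse Ck_on_sqrt)

lemma smooth_inverse [smooth_intros]:
  fixes f :: "'a::euclidean_space \<Rightarrow> real"
  shows "open U \<Longrightarrow> smooth U f \<Longrightarrow> (\<And>x. x \<in> U \<Longrightarrow> f x \<noteq> 0) \<Longrightarrow> smooth U (\<lambda>x. inverse (f x))"
  by (rule smooth_compose[of U "-{0}" f inverse]) (use smooth_inverse_real in \<open>auto simp: open_Compl\<close>)

lemma smooth_divide [smooth_intros]:
  fixes f :: "'a::euclidean_space \<Rightarrow> real"
  shows "open U \<Longrightarrow> smooth U f \<Longrightarrow> smooth U g \<Longrightarrow> (\<And>x. x \<in> U \<Longrightarrow> g x \<noteq> 0) \<Longrightarrow> smooth U (\<lambda>x. f x / g x)"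
  unfolding divide_inverse by (intro smooth_intros)

lemma smooth_sqrt [smooth_intros]:
  "open U \<Longrightarrow> smooth U f \<Longrightarrow> (\<And>x. x \<in> U \<Longrightarrow> 0 < f x) \<Longrightarrow> smooth U (\<lambda>x. sqrt (f x))"
  by (rule smooth_compose[of U "{0<..}" f sqrt]) (use smooth_sqrt_real in auto)

lemma smooth_power [smooth_intros]:
  fixes f :: "'a::euclidean_space \<Rightarrow> real"
  shows "open U \<Longrightarrow> smooth U f \<Longrightarrow> smooth U (\<lambda>x. f x ^ n)"
  by (induction n) (simp_all add: smooth_const smooth_mult)

lemma smooth_norm [smooth_intros]:
  "open U \<Longrightarrow> smooth U f \<Longrightarrow> (\<And>x. x \<in> U \<Longrightarrow> f x \<noteq> 0) \<Longrightarrow> smooth U (\<lambda>x. norm (f x))"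
  unfolding norm_eq_sqrt_inner by (intro smooth_intros) auto

lemma smooth_has_derivative:
  "smooth U f \<Longrightarrow> x \<in> U \<Longrightarrow> (f has_derivative frechet_derivative f (at x)) (at x)"
  unfolding smooth_def using Ck_on_has_derivative[of 0] by blast

lemma smooth_frechet: 
  assumes "smooth U f" shows "smooth U (\<lambda>x. frechet_derivative f (at x) v)"
  unfolding smooth_def
proof
  fix k
  from assms have "Ck_on (Suc k) U f" unfolding smooth_def by blast
  then show "Ck_on k U (\<lambda>x. frechet_derivative f (at x) v)" unfolding Ck_on.simps by blast
qed

text \<open>\<open>Ck_on\<close> controls derivatives in constant directions only; a direction field
  is handled by expanding it in the basis.\<close>

lemma smooth_frechet_vary:
  assumes "open U" "smooth U f" "smooth U w"
  shows "smooth U (\<lambda>x. frechet_derivative f (at x) (w x))"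
proof -
  have "smooth U (\<lambda>x. \<Sum>i\<in>Basis. (w x \<bullet> i) *\<^sub>R frechet_derivative f (at x) i)"
    by (intro smooth_sum smooth_scaleR smooth_inner smooth_frechet smooth_const assms)
  then show ?thesis
  proof (rule smooth_cong[OF assms(1), rotated])
    fix x assume "x \<in> U"
    then have "linear (frechet_derivative f (at x))"
      using smooth_has_derivative[OF assms(2)] by (auto intro: has_derivative_linear)
    then show "(\<Sum>i\<in>Basis. (w x \<bullet> i) *\<^sub>R frechet_derivative f (at x) i) = frechet_derivative f (at x) (w x)"
      by (subst (2) euclidean_representation[symmetric, of "w x"]) (simp add: linear_sum linear_scale)
  qed
qed

lemma smooth_continuous_on: "smooth U f \<Longrightarrow> continuous_on U f"
  unfolding smooth_def using Ck_on_continuous_on[of 0] by blast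

lemma smooth_on_iff:
  "smooth_on S f \<longleftrightarrow> (\<forall>x\<in>S. \<exists>U F. open U \<and> x \<in> U \<and> smooth U F \<and> (\<forall>y\<in>S \<inter> U. F y = f y))"
  unfolding smooth_on_def smooth_def ..

lemma smooth_onE:
  assumes "smooth_on S f" "x \<in> S"
  obtains U F where "open U" "x \<in> U" "smooth U F" "\<forall>y\<in>S \<inter> U. F y = f y"
  using bspec[OF assms[unfolded smooth_on_iff]] by (elim exE conjE) (rule that)

lemma smooth_imp_smooth_on:
  assumes "open U" "smooth U f" "S \<subseteq> U" shows "smooth_on S f"
  unfolding smooth_on_iff
proof
  fix x assume "x \<in> S"
  then show "\<exists>U F. open U \<and> x \<in> U \<and> smooth U F \<and> (\<forall>y\<in>S \<inter> U. F y = f y)"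
    using assms by (intro exI[of _ U] exI[of _ f]) auto
qed

lemma smooth_on_subset:
  assumes "smooth_on S f" "T \<subseteq> S" shows "smooth_on T f"
  unfolding smooth_on_iff
proof
  fix x assume "x \<in> T"
  then have xS: "x \<in> S" using assms by auto
  obtain U F where UF: "open U" "x \<in> U" "smooth U F" "\<forall>y\<in>S \<inter> U. F y = f y"
    by (rule smooth_onE[OF assms(1) xS])
  then show "\<exists>U F. open U \<and> x \<in> U \<and> smooth U F \<and> (\<forall>y\<in>T \<inter> U. F y = f y)"
    using assms(2) by (intro exI[of _ U] exI[of _ F]) auto
qed

text \<open>Bridge between the definitions: \<open>smooth_on\<close> asks for local extensions,
  while the calculus is done with \<open>smooth\<close> on open sets.\<close>

lemma smooth_on_open: 
  assumes "open S" shows "smooth_on S f \<longleftrightarrow> smooth S f"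
proof
  assume *: "smooth_on S f"
  show "smooth S f"
  proof (rule smooth_local)
    fix x assume "x \<in> S"
    obtain U F where UF: "open U" "x \<in> U" "smooth U F" "\<forall>y\<in>S \<inter> U. F y = f y"
      by (rule smooth_onE[OF * \<open>x \<in> S\<close>])
    have "smooth (S \<inter> U) f"
      by (rule smooth_cong[OF _ _ smooth_subset[OF UF(3), of "S \<inter> U"]]) (use UF assms in auto)
    then show "\<exists>N. open N \<and> x \<in> N \<and> smooth N f" using UF \<open>x \<in> S\<close> assms by (intro exI[of _ "S \<inter> U"]) auto
  qed
qed (auto intro: smooth_imp_smooth_on assms)


section \<open>Curves, mixed partial derivatives and the implicit function theorem\<close>

lemma has_vector_derivative_chain:
  assumes "(f has_vector_derivative f') (at x within S)" "(g has_derivative g') (at (f x) within T)"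
    and "f ` S \<subseteq> T"
  shows "((\<lambda>x. g (f x)) has_vector_derivative g' f') (at x within S)"
  using vector_derivative_diff_chain_within[OF assms(1) has_derivative_subset[OF assms(2,3)]]
  by (simp add: o_def)

lemma smooth_curve_derivative:
  assumes "smooth U f" "g 0 \<in> U" "(g has_vector_derivative v) (at (0::real))"
  shows "((\<lambda>t. f (g t)) has_vector_derivative frechet_derivative f (at (g 0)) v) (at 0)"
  by (rule has_vector_derivative_chain[OF assms(3) smooth_has_derivative[OF assms(1,2)]]) simp

lemma smooth_has_partial_derivative:
  assumes "smooth U f" "(s, u) \<in> U"
  shows "((\<lambda>s. f (s, u)) has_vector_derivative frechet_derivative f (at (s, u)) (1, 0)) (at (s::real))"
    and "((\<lambda>u. f (s, u)) has_vector_derivative frechet_derivative f (at (s, u)) (0, 1)) (at (u::real))"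
proof -
  have D: "(f has_derivative frechet_derivative f (at (s, u))) (at (s, u))"
    by (rule smooth_has_derivative[OF assms])
  have 1: "((\<lambda>s. (s, u)) has_vector_derivative (1, 0)) (at s)"
    and 2: "((\<lambda>u. (s, u)) has_vector_derivative (0, 1)) (at u)"
    by (auto intro!: derivative_eq_intros simp: has_vector_derivative_def)
  show "((\<lambda>s. f (s, u)) has_vector_derivative frechet_derivative f (at (s, u)) (1, 0)) (at s)"
    by (rule has_vector_derivative_chain[OF 1 D]) simp
  show "((\<lambda>u. f (s, u)) has_vector_derivative frechet_derivative f (at (s, u)) (0, 1)) (at u)"
    by (rule has_vector_derivative_chain[OF 2 D]) simp
qed

text \<open>Write f(s,v) = f(s,u) plus the integral of f_u from u to v. Differentiating in s under
  the integral gives f_s as an integral of the mixed derivative, and the fundamental theorem of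
  calculus differentiates this in v.\<close>

lemma smooth_partial_derivatives_commute:
  fixes f :: "real \<times> real \<Rightarrow> 'b::euclidean_space"
  assumes U: "open U" and f: "smooth U f" and x: "x \<in> U"
  shows "frechet_derivative (\<lambda>x. frechet_derivative f (at x) (0, 1)) (at x) (1, 0) =
    frechet_derivative (\<lambda>x. frechet_derivative f (at x) (1, 0)) (at x) (0, 1)"
proof -
  obtain s u where [simp]: "x = (s, u)" by fastforce
  obtain A B where AB: "open A" "open B" "s \<in> A" "u \<in> B" "A \<times> B \<subseteq> U"
    by (rule open_prod_elim[OF U x]) auto
  obtain d where d: "0 < d" "cball s d \<subseteq> A" using AB open_contains_cball by blast
  obtain e where e: "0 < e" "cball u e \<subseteq> B" using AB open_contains_cball by blast
  \<comment> \<open>\<open>S\<close> is two-sided, for the derivative in \<open>s\<close>.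
    \<open>T\<close> starts at \<open>u\<close>, the base point of the integral; a one-sided
    derivative at \<open>u\<close> already identifies the two mixed derivatives.\<close>
  define S where "S = {s - d .. s + d}"
  define T where "T = {u .. u + e}"
  have ST: "S \<times> T \<subseteq> U" and sS: "s \<in> S" "convex S" and uT: "u \<in> T"
    using d e AB(5) by (auto simp: S_def T_def cball_eq_atLeastAtMost subset_eq)
  let ?fs = "\<lambda>x. frechet_derivative f (at x) (1, 0)"
  let ?fu = "\<lambda>x. frechet_derivative f (at x) (0, 1)"
  let ?fus = "\<lambda>x. frechet_derivative ?fu (at x) (1, 0)"
  have sm: "smooth U ?fs" "smooth U ?fu" "smooth U ?fus"
    by (rule smooth_frechet[OF f], rule smooth_frechet[OF f], rule smooth_frechet[OF smooth_frechet[OF f]])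
  have cont: "continuous_on (S \<times> T) ?fus" "continuous_on (S \<times> T) ?fu"
    by (rule continuous_on_subset[OF smooth_continuous_on[OF sm(3)] ST], rule continuous_on_subset[OF smooth_continuous_on[OF sm(2)] ST])
  have contT: "continuous_on T (\<lambda>v. ?fu (s', v))" "continuous_on T (\<lambda>v. ?fus (s', v))" if "s' \<in> S" for s'
  proof -
    have P: "continuous_on T (Pair s')" "Pair s' ` T \<subseteq> S \<times> T"
      using that by (auto intro: continuous_intros)
    show "continuous_on T (\<lambda>v. ?fu (s', v))" "continuous_on T (\<lambda>v. ?fus (s', v))"
      by (rule continuous_on_compose2[OF cont(2) P], rule continuous_on_compose2[OF cont(1) P])
  qed
  have I: "f (s', v) = f (s', u) + integral (cbox u v) (\<lambda>v. ?fu (s', v))" if "s' \<in> S" "v \<in> T" for s' v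
  proof -
    have "((\<lambda>v. ?fu (s', v)) has_integral f (s', v) - f (s', u)) {u..v}"
    proof (rule fundamental_theorem_of_calculus)
      show "u \<le> v" using that by (simp add: T_def)
      fix w assume "w \<in> {u..v}"
      then have "(s', w) \<in> U" using that ST by (auto simp: T_def)
      then show "((\<lambda>v. f (s', v)) has_vector_derivative ?fu (s', w)) (at w within {u..v})"
        by (rule has_vector_derivative_at_within[OF smooth_has_partial_derivative(2)[OF f]])
    qed
    then show ?thesis by (simp add: integral_unique cbox_interval)
  qed
  have fs: "?fs (s, v) = ?fs (s, u) + integral {u..v} (\<lambda>v. ?fus (s, v))" if v: "v \<in> T" for v
  proof -
    have sub: "{u..v} \<subseteq> T" using v by (auto simp: T_def)
    have 1: "((\<lambda>s. integral (cbox u v) (\<lambda>v. ?fu (s, v))) has_vector_derivative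
        integral (cbox u v) (\<lambda>v. ?fus (s, v))) (at s within S)"
    proof (rule leibniz_rule_vector_derivative[OF _ _ _ sS])
      show "((\<lambda>s. ?fu (s, t)) has_vector_derivative ?fus (s', t)) (at s' within S)"
        if "s' \<in> S" "t \<in> cbox u v" for s' t
        by (rule has_vector_derivative_at_within[OF smooth_has_partial_derivative(1)[OF sm(2)]])
          (use that ST sub in \<open>auto simp: cbox_interval\<close>)
      show "(\<lambda>v. ?fu (s', v)) integrable_on cbox u v" if "s' \<in> S" for s'
        using continuous_on_subset[OF contT(1)[OF that] sub] by (intro integrable_continuous) (simp add: cbox_interval)
      show "continuous_on (S \<times> cbox u v) (\<lambda>(x, t). ?fus (x, t))"
        unfolding case_prod_unfold prod.collapse
        by (rule continuous_on_subset[OF cont(1)]) (use sub in \<open>auto simp: cbox_interval\<close>)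
    qed
    have 2: "((\<lambda>s. f (s, u) + integral (cbox u v) (\<lambda>v. ?fu (s, v))) has_vector_derivative
       ?fs (s, u) + integral (cbox u v) (\<lambda>v. ?fus (s, v))) (at s within S)"
      by (rule has_vector_derivative_add[OF has_vector_derivative_at_within[OF smooth_has_partial_derivative(1)[OF f]] 1])
        (use x in simp)
    have 3: "((\<lambda>s. f (s, v)) has_vector_derivative ?fs (s, u) + integral (cbox u v) (\<lambda>v. ?fus (s, v))) (at s within S)"
      by (rule has_vector_derivative_transform[OF _ _ 2]) (use sS I v in auto)
    have 4: "((\<lambda>s. f (s, v)) has_vector_derivative ?fs (s, v)) (at s within S)"
      by (rule has_vector_derivative_at_within[OF smooth_has_partial_derivative(1)[OF f]]) (use v ST sS in auto)
    show ?thesis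
      using vector_derivative_unique_within[OF _ 3 4] d
      by (simp add: S_def cbox_interval at_within_Icc_at trivial_limit_within)
  qed
  have "((\<lambda>v. integral {u..v} (\<lambda>v. ?fus (s, v))) has_vector_derivative ?fus (s, u)) (at u within T)"
    unfolding T_def using e contT(2)[OF sS(1)] by (intro integral_has_vector_derivative) (auto simp: T_def)
  then have 5: "((\<lambda>v. ?fs (s, u) + integral {u..v} (\<lambda>v. ?fus (s, v))) has_vector_derivative 0 + ?fus (s, u)) (at u within T)"
    by (rule has_vector_derivative_add[OF has_vector_derivative_const])
  have 6: "((\<lambda>v. ?fs (s, v)) has_vector_derivative ?fus (s, u)) (at u within T)"
    using has_vector_derivative_transform[OF uT _ 5, of "\<lambda>v. ?fs (s, v)"] fs by simp
  have 7: "((\<lambda>v. ?fs (s, v)) has_vector_derivative frechet_derivative ?fs (at (s, u)) (0, 1)) (at u within T)"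
    by (rule has_vector_derivative_at_within[OF smooth_has_partial_derivative(2)[OF sm(1)]]) (use x in simp)
  show ?thesis
    using vector_derivative_unique_within[OF _ 6 7] e
    by (simp add: T_def trivial_limit_within)
qed

text \<open>The inverse function theorem, applied to (t,u) -> (t, f(t,u)), straightens the zero set:
  \<psi> t is the second component of the inverse at (t,0). It yields differentiability; smoothness
  of \<psi> is bootstrapped from its differential equation.\<close>

lemma smooth_implicit:
  fixes f :: "real \<times> real \<Rightarrow> real"
  assumes U: "open U" "(0, 0) \<in> U" and f: "smooth U f" "f (0, 0) = 0"
    and ne: "frechet_derivative f (at (0, 0)) (0, 1) \<noteq> 0"
  obtains d \<psi> where "0 < d" "smooth {-d<..<d} \<psi>" "\<psi> 0 = 0"
    "\<And>t. t \<in> {-d<..<d} \<Longrightarrow> (t, \<psi> t) \<in> U \<and> f (t, \<psi> t) = 0"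
proof -
  let ?ft = "\<lambda>x. frechet_derivative f (at x) (1, 0)"
  let ?fs = "\<lambda>x. frechet_derivative f (at x) (0, 1)"
  \<comment> \<open>Restricting to nonzero u-derivative keeps the quotient -f_t/f_u, the right-hand
    side for \<psi>', smooth on the whole domain.\<close>
  define U' where "U' = {x \<in> U. ?fs x \<noteq> 0}"
  have oU': "open U'"
  proof -
    have "open (?fs -` (-{0}) \<inter> U)"
      using continuous_on_open_vimage[OF U(1), of ?fs] smooth_continuous_on[OF smooth_frechet[OF f(1)]]
      by (simp add: open_Compl)
    moreover have "U' = ?fs -` (-{0}) \<inter> U" by (auto simp: U'_def)
    ultimately show ?thesis by simp
  qed
  have U'U: "U' \<subseteq> U" by (auto simp: U'_def)
  have f': "smooth U' f" by (rule smooth_subset[OF f(1) U'U])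
  define \<Phi> where "\<Phi> = (\<lambda>x::real \<times> real. (fst x, f x))"
  define D where "D = (\<lambda>x. Blinfun (\<lambda>v::real \<times> real. (fst v, frechet_derivative f (at x) v)))"
  have D: "blinfun_apply (D x) = (\<lambda>v. (fst v, frechet_derivative f (at x) v))" if "x \<in> U'" for x
    unfolding D_def
    by (rule bounded_linear_Blinfun_apply)
      (rule bounded_linear_Pair[OF bounded_linear_fst has_derivative_bounded_linear[OF smooth_has_derivative[OF f' that]]])
  have lin: "frechet_derivative f (at x) (a, b) = a * ?ft x + b * ?fs x" if "x \<in> U'" for x a b
  proof -
    have L: "linear (frechet_derivative f (at x))"
      using smooth_has_derivative[OF f' that] by (rule has_derivative_linear)
    have "(a, b) = a *\<^sub>R (1, 0) + b *\<^sub>R (0, 1::real)" by simp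
    then show ?thesis by (simp only: linear_add[OF L] linear_scale[OF L] real_scaleR_def)
  qed
  have x0: "(0, 0) \<in> U'" using U ne by (simp add: U'_def)
  \<comment> \<open>The derivative of \<Phi> at the origin is triangular; this is its inverse
    written out.\<close>
  define I where "I = Blinfun (\<lambda>v::real \<times> real. (fst v, (snd v - fst v * ?ft (0,0)) / ?fs (0,0)))"
  have I: "blinfun_apply I = (\<lambda>v. (fst v, (snd v - fst v * ?ft (0,0)) / ?fs (0,0)))"
  proof -
    have "bounded_linear (\<lambda>v::real \<times> real. (fst v, (snd v - fst v * A) / B))" for A B
      unfolding divide_inverse
      by (rule linear_conv_bounded_linear[THEN iffD1], rule linearI) (simp_all add: algebra_simps)
    then show ?thesis unfolding I_def by (rule bounded_linear_Blinfun_apply)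
  qed
  have inv: "I o\<^sub>L D (0,0) = id_blinfun"
  proof (rule blinfun_eqI)
    fix v :: "real \<times> real"
    have "frechet_derivative f (at (0, 0)) v = fst v * ?ft (0, 0) + snd v * ?fs (0, 0)"
      using lin[OF x0, of "fst v" "snd v"] by simp
    then show "blinfun_apply (I o\<^sub>L D (0, 0)) v = blinfun_apply id_blinfun v"
      using ne by (simp add: I D[OF x0])
  qed
  obtain N T g g' where g: "open N" "N \<subseteq> U'" "(0,0) \<in> N" "open T" "\<Phi> (0,0) \<in> T" "homeomorphism N T \<Phi> g"
    "\<And>y. y \<in> T \<Longrightarrow> (g has_derivative g' y) (at y)"
  proof (rule inverse_function_theorem[where f=\<Phi> and f'=D and U=U' and ?x0.0="(0, 0)" and invf=I, OF oU' _ _ x0 inv])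
    show "(\<Phi> has_derivative blinfun_apply (D x)) (at x)" if "x \<in> U'" for x
      unfolding \<Phi>_def D[OF that]
      by (intro has_derivative_Pair smooth_has_derivative[OF f' that] has_derivative_fst has_derivative_ident)
    show "continuous_on U' D"
    proof (rule continuous_on_blinfun_componentwise)
      fix i :: "real \<times> real"
      have "continuous_on U' (\<lambda>x. (fst i, frechet_derivative f (at x) i))"
        by (intro continuous_intros smooth_continuous_on[OF smooth_frechet[OF f']])
      then show "continuous_on U' (\<lambda>x. blinfun_apply (D x) i)"
        by (rule continuous_on_eq) (simp add: D)
    qed
  qed (rule that)
  obtain d where d: "0 < d" "\<And>t. t \<in> {-d<..<d} \<Longrightarrow> (t, 0) \<in> T"
  proof -
    have "(0, 0) \<in> T" using g(5) f by (simp add: \<Phi>_def)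
    then obtain A B where "open A" "open B" "0 \<in> A" "0 \<in> B" "A \<times> B \<subseteq> T"
      by (rule open_prod_elim[OF g(4)]) auto
    moreover then obtain d where "0 < d" "ball 0 d \<subseteq> A" using open_contains_ball by blast
    ultimately show ?thesis by (intro that[of d]) (auto simp: ball_eq_greaterThanLessThan subset_eq)
  qed
  define \<psi> where "\<psi> t = snd (g (t, 0))" for t
  have g1: "g (t, 0) = (t, \<psi> t)" "f (t, \<psi> t) = 0" "(t, \<psi> t) \<in> U'" if "t \<in> {-d<..<d}" for t
  proof -
    have "\<Phi> (g (t, 0)) = (t, 0)" "g (t, 0) \<in> N"
      using d(2)[OF that] g(6) by (auto simp: homeomorphism_def)
    moreover from this(1) have "g (t, 0) = (t, \<psi> t)" by (simp add: \<Phi>_def \<psi>_def prod_eq_iff)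
    ultimately show "g (t, 0) = (t, \<psi> t)" "f (t, \<psi> t) = 0" "(t, \<psi> t) \<in> U'"
      using g(2) by (auto simp: \<Phi>_def)
  qed
  have "g (0, 0) = (0, 0)" using g(3,6) f(2) by (auto simp: homeomorphism_def \<Phi>_def)
  then have \<psi>0: "\<psi> 0 = 0" by (simp add: \<psi>_def)
  have diff: "\<psi> differentiable (at t)" if "t \<in> {-d<..<d}" for t
  proof -
    have 1: "((\<lambda>t. (t, 0::real)) has_derivative (\<lambda>v. (v, 0))) (at t)"
      by (auto intro!: derivative_eq_intros)
    show ?thesis unfolding \<psi>_def
      using has_derivative_snd[OF has_derivative_compose[OF 1 g(7)[OF d(2)[OF that]]]]
      by (auto simp: differentiable_def)
  qed
  have D\<psi>: "(\<psi> has_derivative (\<lambda>v. v * (- ?ft (t, \<psi> t) / ?fs (t, \<psi> t)))) (at t)" if t: "t \<in> {-d<..<d}" for t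
  proof -
    obtain p where p: "(\<psi> has_vector_derivative p) (at t)"
      using diff[OF t] by (auto simp: vector_derivative_works)
    have 1: "((\<lambda>t. (t, \<psi> t)) has_vector_derivative (1, p)) (at t)"
      using p unfolding has_vector_derivative_def by (auto intro!: derivative_eq_intros)
    have "((\<lambda>t. f (t, \<psi> t)) has_vector_derivative frechet_derivative f (at (t, \<psi> t)) (1, p)) (at t)"
      by (rule has_vector_derivative_chain[OF 1 smooth_has_derivative[OF f' g1(3)[OF t]]]) simp
    moreover have "((\<lambda>t. f (t, \<psi> t)) has_vector_derivative 0) (at t)"
      by (rule has_vector_derivative_transform_within_open[of "\<lambda>_. 0" _ _ "{-d<..<d}"]) (use t g1 in auto)
    ultimately have "frechet_derivative f (at (t, \<psi> t)) (1, p) = 0"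
      by (rule vector_derivative_unique_at)
    then have "?ft (t, \<psi> t) + p * ?fs (t, \<psi> t) = 0"
      using lin[OF g1(3)[OF t], of 1 p] by linarith
    moreover have "?fs (t, \<psi> t) \<noteq> 0" using g1(3)[OF t] by (simp add: U'_def)
    ultimately have "p = - ?ft (t, \<psi> t) / ?fs (t, \<psi> t)" by (simp add: field_simps)
    then show ?thesis using p by (simp add: has_vector_derivative_def)
  qed
  \<comment> \<open>Bootstrapping: \<psi>' is a smooth function of (t, \<psi> t), so each order of
    differentiability of \<psi> yields the next.\<close>
  have "Ck_on k {-d<..<d} \<psi>" for k
  proof (induction k)
    case 0
    show ?case using diff by (auto intro!: continuous_at_imp_continuous_on differentiable_imp_continuous_within)
  next
    case (Suc k)
    have sm: "smooth U' (\<lambda>x. - ?ft x / ?fs x)"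
      by (intro smooth_intros smooth_frechet f' oU') (simp add: U'_def)
    have "Ck_on k {-d<..<d} (\<lambda>t. - ?ft (t, \<psi> t) / ?fs (t, \<psi> t))"
    proof (intro Ck_on_compose[OF _ oU', where f="\<lambda>x. - ?ft x / ?fs x" and g="\<lambda>t. (t, \<psi> t)"])
      show "Ck_on k U' (\<lambda>x. - ?ft x / ?fs x)" using sm unfolding smooth_def by blast
      show "Ck_on k {-d<..<d} (\<lambda>t. (t, \<psi> t))"
        by (rule Ck_on_Pair[OF _ Ck_on_linear Suc]) (simp_all add: bounded_linear_ident)
    qed (use g1 in auto)
    then have "Ck_on k {-d<..<d} (\<lambda>t. v * (- ?ft (t, \<psi> t) / ?fs (t, \<psi> t)))" for v
      by (intro Ck_on_bilinear[OF _ bounded_bilinear_mult] Ck_on_const) simp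
    then show ?case by (intro Ck_on_SucI[OF _ D\<psi>]) simp_all
  qed
  then have "smooth {-d<..<d} \<psi>" by (simp add: smooth_def)
  then show thesis using d(1) \<psi>0 g1 U'U by (intro that[of d \<psi>]) auto
qed

section \<open>Tangent spaces\<close>

lemma tangent_spaceI:
  assumes "open Q" "(0::real) \<in> Q" "smooth Q \<gamma>" "\<gamma> ` Q \<subseteq> Z" "\<gamma> 0 = z" "(\<gamma> has_vector_derivative v) (at 0)"
  shows "v \<in> tangent_space Z z"
proof -
  obtain d where d: "0 < d" "ball 0 d \<subseteq> Q" using assms(1,2) open_contains_ball by blast
  then have "{-d<..<d} \<subseteq> Q" by (simp add: ball_eq_greaterThanLessThan)
  moreover then have "smooth_on {-d<..<d} \<gamma>"
    by (intro smooth_imp_smooth_on[OF assms(1,3)])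
  ultimately show ?thesis unfolding tangent_space_def
    using d(1) assms(4,5,6) by (intro CollectI exI[of _ \<gamma>] exI[of _ d]) auto
qed

lemma tangent_space_smooth_map:
  assumes "open Q" "smooth Q h" "h ` Q \<subseteq> Z" "x \<in> Q"
  shows "frechet_derivative h (at x) e \<in> tangent_space Z (h x)"
proof (rule tangent_spaceI)
  let ?c = "\<lambda>t::real. x + t *\<^sub>R e"
  show oO: "open (?c -` Q)"
    by (intro open_vimage assms continuous_intros)
  show "0 \<in> ?c -` Q" using assms by simp
  show "smooth (?c -` Q) (\<lambda>t. h (?c t))"
    by (rule smooth_compose[OF oO assms(1) _ _ assms(2)]) (auto intro!: smooth_intros oO)
  show "(\<lambda>t. h (?c t)) ` (?c -` Q) \<subseteq> Z" using assms by auto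
  show "h (x + 0 *\<^sub>R e) = h x" by simp
  have "(?c has_vector_derivative e) (at 0)"
    by (auto intro!: derivative_eq_intros simp: has_vector_derivative_def)
  from smooth_curve_derivative[OF assms(2) _ this]
  show "((\<lambda>t. h (?c t)) has_vector_derivative frechet_derivative h (at x) e) (at 0)"
    using assms by simp
qed

lemma tangent_space_open: "open Z \<Longrightarrow> z \<in> Z \<Longrightarrow> tangent_space Z z = UNIV"
  using tangent_space_smooth_map[of Z "\<lambda>x. x" Z z] by (auto simp: smooth_intros frechet_derivative_ident)

lemma tangent_space_chain:
  assumes "v \<in> tangent_space Z z" "(K has_derivative D) (at z within Z)"
  obtains \<gamma> d where "0 < d" "\<gamma> ` {-d<..<d} \<subseteq> Z" "\<gamma> 0 = z" "(\<gamma> has_vector_derivative v) (at 0)"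
    "((\<lambda>t. K (\<gamma> t)) has_vector_derivative D v) (at (0::real))"
proof -
  from assms(1) obtain \<gamma> d where g: "0 < d" "\<gamma> ` {-d<..<d} \<subseteq> Z" "\<gamma> 0 = z"
      "(\<gamma> has_vector_derivative v) (at (0::real))"
    unfolding tangent_space_def by blast
  have "((\<lambda>t. K (\<gamma> t)) has_vector_derivative D v) (at 0 within {-d<..<d})"
    by (rule has_vector_derivative_chain[OF has_vector_derivative_at_within[OF g(4)], of K D Z])
      (use g assms(2) in auto)
  then have "((\<lambda>t. K (\<gamma> t)) has_vector_derivative D v) (at 0)"
    using g(1) at_within_open[of 0 "{-d<..<d}"] by simp
  with g show thesis using that by blast
qed

text \<open>A derivative within a thin set \<open>Z\<close> is not unique as a linear map, but
  composing with a curve in \<open>Z\<close> of velocity \<open>v\<close> pins down its value at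
  \<open>v\<close>.\<close>

lemma tangent_space_derivative_unique:
  assumes "v \<in> tangent_space Z z" "(K has_derivative D) (at z within Z)" "(K' has_derivative D') (at z within Z)"
    and "\<And>x. x \<in> Z \<Longrightarrow> K x = K' x"
  shows "D v = D' v"
proof -
  obtain \<gamma> d where g: "0 < d" "\<gamma> ` {-d<..<d} \<subseteq> Z" "\<gamma> 0 = z" "(\<gamma> has_vector_derivative v) (at 0)"
    "((\<lambda>t. K (\<gamma> t)) has_vector_derivative D v) (at (0::real))"
    by (rule tangent_space_chain[OF assms(1,2)])
  have "((\<lambda>t. K' (\<gamma> t)) has_vector_derivative D' v) (at 0 within {-d<..<d})"
    by (rule has_vector_derivative_chain[OF has_vector_derivative_at_within[OF g(4)], of K' D' Z])
      (use g assms(3) in auto)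
  then have "((\<lambda>t. K (\<gamma> t)) has_vector_derivative D' v) (at 0 within {-d<..<d})"
    by (rule has_vector_derivative_transform[rotated 2]) (use g assms(4) in \<open>auto simp: image_subset_iff\<close>)
  then have "((\<lambda>t. K (\<gamma> t)) has_vector_derivative D' v) (at 0)"
    using g(1) at_within_open[of 0 "{-d<..<d}"] by simp
  with g(5) show ?thesis by (rule vector_derivative_unique_at)
qed

text \<open>\<open>frechet_derivative f (at z within Z)\<close> is an arbitrary choice among the
  derivatives within \<open>Z\<close>. On tangent vectors it can be computed from any smooth local
  extension \<open>F\<close>.\<close>

lemma smooth_frechet_within:
  assumes "smooth U F" "z \<in> U" "open U" "z \<in> Z" "\<forall>y\<in>Z \<inter> U. F y = f y" 
  shows "(f has_derivative frechet_derivative F (at z)) (at z within Z)"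
    "v \<in> tangent_space Z z \<Longrightarrow> frechet_derivative f (at z within Z) v = frechet_derivative F (at z) v"
proof -
  have "(F has_derivative frechet_derivative F (at z)) (at z within Z)"
    using smooth_has_derivative[OF assms(1,2)] by (rule has_derivative_at_withinI)
  moreover have "\<forall>\<^sub>F x in at z within Z. F x = f x"
    unfolding eventually_at_topological using assms by blast
  ultimately show D: "(f has_derivative frechet_derivative F (at z)) (at z within Z)"
    by (rule has_derivative_transform_eventually) (use assms in auto)
  then have "(f has_derivative frechet_derivative f (at z within Z)) (at z within Z)"
    using frechet_derivative_works differentiable_def by blast
  then show "v \<in> tangent_space Z z \<Longrightarrow> frechet_derivative f (at z within Z) v = frechet_derivative F (at z) v"
    using D tangent_space_derivative_unique by blast
qed

text \<open>The zero set of \<open>f\<close> in the parameter plane is a graph over the first axis,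
  tangent to that axis because the first partial derivative vanishes. Its image under
  \<open>k\<close> is a curve in \<open>S\<close> with the wanted velocity.\<close>

lemma tangent_space_level_set:
  assumes Q: "open Q" "(0, 0) \<in> Q" and k: "smooth Q k" "k (0, 0) = z"
    and f: "smooth Q f" "f (0, 0) = 0" "\<And>x. x \<in> Q \<Longrightarrow> f x = 0 \<Longrightarrow> k x \<in> S"
    and ft: "frechet_derivative f (at (0, 0)) (1, 0) = 0"
    and fs: "frechet_derivative f (at (0, 0)) (0, 1) \<noteq> (0::real)"
  shows "frechet_derivative k (at (0, 0)) (1::real, 0::real) \<in> tangent_space S z"
proof -
  obtain d \<psi> where d: "0 < d" "smooth {-d<..<d} \<psi>" "\<psi> 0 = 0"
    and \<psi>: "\<And>t. t \<in> {-d<..<d} \<Longrightarrow> (t, \<psi> t) \<in> Q \<and> f (t, \<psi> t) = 0"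
    using smooth_implicit[OF Q f(1,2) fs] by blast
  define p where "p = frechet_derivative \<psi> (at 0) 1"
  have "(\<psi> has_derivative frechet_derivative \<psi> (at 0)) (at 0)"
    using smooth_has_derivative[OF d(2), of 0] d(1) by simp
  from has_vector_derivative_chain[OF has_vector_derivative_id this]
  have p: "(\<psi> has_vector_derivative p) (at 0)"
    by (simp add: p_def)
  have c: "((\<lambda>t. (t, \<psi> t)) has_vector_derivative (1, p)) (at 0)"
    using p unfolding has_vector_derivative_def by (auto intro!: derivative_eq_intros)
  have "((\<lambda>t. f (t, \<psi> t)) has_vector_derivative frechet_derivative f (at (0, 0)) (1, p)) (at 0)"
    using smooth_curve_derivative[OF f(1) _ c] Q d by simp
  moreover have "((\<lambda>t. f (t, \<psi> t)) has_vector_derivative 0) (at 0)"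
    by (rule has_vector_derivative_transform_within_open[of "\<lambda>_. 0" _ _ "{-d<..<d}"]) (use d \<psi> in auto)
  ultimately have "frechet_derivative f (at (0, 0)) (1, p) = 0"
    by (rule vector_derivative_unique_at)
  moreover have "linear (frechet_derivative f (at (0, 0)))"
    using smooth_has_derivative[OF f(1) Q(2)] by (rule has_derivative_linear)
  then have "frechet_derivative f (at (0, 0)) ((1, 0) + p *\<^sub>R (0, 1)) =
     frechet_derivative f (at (0, 0)) (1, 0) + p * frechet_derivative f (at (0, 0)) (0, 1)"
    by (simp only: linear_add linear_scale real_scaleR_def)
  \<comment> \<open>\<open>p\<close> is the slope of the graph at the origin; with it gone, the
    velocity of the curve is the first partial derivative of \<open>k\<close>.\<close>
  ultimately have [simp]: "p = 0" using ft fs by simp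
  show ?thesis
  proof (rule tangent_spaceI[of "{-d<..<d}" "\<lambda>t. k (t, \<psi> t)"])
    show "smooth {-d<..<d} (\<lambda>t. k (t, \<psi> t))"
      by (rule smooth_compose[OF _ Q(1) _ _ k(1)]) (use \<psi> d in \<open>auto intro!: smooth_intros\<close>)
    show "((\<lambda>t. k (t, \<psi> t)) has_vector_derivative frechet_derivative k (at (0, 0)) (1, 0)) (at 0)"
      using smooth_curve_derivative[OF k(1) _ c] Q d by simp
  qed (use d \<psi> k f in auto)
qed


section \<open>The variation of the action\<close>

lemma bounded_bilinear_symp: "bounded_bilinear (symp :: 'v::euclidean_space \<times> 'v \<Rightarrow> 'v \<times> 'v \<Rightarrow> real)"
proof -
  show ?thesis
  proof
    fix a a' b b' :: "'v \<times> 'v" and r :: real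
    show "symp (a + a') b = symp a b + symp a' b" "symp a (b + b') = symp a b + symp a b'"
      "symp (r *\<^sub>R a) b = r *\<^sub>R symp a b" "symp a (r *\<^sub>R b) = r *\<^sub>R symp a b"
      by (auto simp: symp_def algebra_simps)
    show "\<exists>K. \<forall>a b :: 'v \<times> 'v. norm (symp a b) \<le> norm a * norm b * K"
    proof (intro exI[of _ 2] allI)
      fix a b :: "'v \<times> 'v"
      have n: "norm (fst x) \<le> norm x" "norm (snd x) \<le> norm x" for x :: "'v \<times> 'v"
        by (cases x; simp add: norm_fst_le norm_snd_le)+
      have "\<bar>snd a \<bullet> fst b\<bar> \<le> norm a * norm b" "\<bar>fst a \<bullet> snd b\<bar> \<le> norm a * norm b"
        by (rule order_trans[OF Cauchy_Schwarz_ineq2 mult_mono[OF n(2) n(1)]]; simp)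
          (rule order_trans[OF Cauchy_Schwarz_ineq2 mult_mono[OF n(1) n(2)]]; simp)
      then show "norm (symp a b) \<le> norm a * norm b * 2"
        by (simp add: symp_def)
    qed
  qed
qed

lemmas smooth_symp [smooth_intros] = smooth_bilinear[OF _ bounded_bilinear_symp]

text \<open>Infinitesimal form of Stokes' theorem for the one-form omega(X, .), whose exterior
  derivative is omega when X is Liouville. Pulling back to the plane replaces the exterior
  derivative by a difference of two partial derivatives, in which the second derivatives of
  \<open>h\<close> cancel by symmetry.\<close>

lemma liouville_strip:
  fixes h :: "real \<times> real \<Rightarrow> 'v::euclidean_space \<times> 'v"
  assumes Q: "open Q" and h: "smooth Q h" "h ` Q \<subseteq> Z" and X: "smooth_on Z X" "liouville_on Z X"
  shows "smooth Q (\<lambda>x. symp (X (h x)) (frechet_derivative h (at x) v))"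
    and "x \<in> Q \<Longrightarrow>
      frechet_derivative (\<lambda>x. symp (X (h x)) (frechet_derivative h (at x) (0, 1))) (at x) (1, 0) -
      frechet_derivative (\<lambda>x. symp (X (h x)) (frechet_derivative h (at x) (1, 0))) (at x) (0, 1)
      = symp (frechet_derivative h (at x) (1, 0)) (frechet_derivative h (at x) (0, 1))"
proof -
  let ?a = "\<lambda>v x. symp (X (h x)) (frechet_derivative h (at x) v)"
  have loc: "\<exists>N. open N \<and> x \<in> N \<and> N \<subseteq> Q \<and> smooth N (\<lambda>x. X (h x)) \<and>
      (\<forall>v. frechet_derivative (\<lambda>x. X (h x)) (at x) v =
         frechet_derivative X (at (h x) within Z) (frechet_derivative h (at x) v))" if x: "x \<in> Q" for x
  proof -
    have "h x \<in> Z" using h x by auto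
    from smooth_onE[OF X(1) this] obtain U F where U: "open U" "h x \<in> U" "smooth U F"
      "\<forall>y\<in>Z \<inter> U. F y = X y" .
    define N where "N = h -` U \<inter> Q"
    have N: "open N" unfolding N_def
      using continuous_on_open_vimage[OF Q] smooth_continuous_on[OF h(1)] U(1) by blast
    have NQ: "N \<subseteq> Q" and xN: "x \<in> N" using x U by (auto simp: N_def)
    have hN: "smooth N h" by (rule smooth_subset[OF h(1) NQ])
    have "smooth N (\<lambda>x. F (h x))"
      by (rule smooth_compose[OF N U(1) _ hN U(3)]) (auto simp: N_def)
    then have sX: "smooth N (\<lambda>x. X (h x))"
      by (rule smooth_cong[OF N, rotated]) (use U h N_def in auto)
    have "frechet_derivative (\<lambda>x. X (h x)) (at x) v =
         frechet_derivative X (at (h x) within Z) (frechet_derivative h (at x) v)" for v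
    proof -
      have 1: "((\<lambda>x. F (h x)) has_derivative (\<lambda>v. frechet_derivative F (at (h x)) (frechet_derivative h (at x) v))) (at x)"
        using diff_chain_at[OF smooth_has_derivative[OF hN xN] smooth_has_derivative[OF U(3,2)]]
        by (simp add: o_def)
      have "((\<lambda>x. X (h x)) has_derivative (\<lambda>v. frechet_derivative F (at (h x)) (frechet_derivative h (at x) v))) (at x)"
        by (rule has_derivative_transform_within_open[OF 1 N xN]) (use U h N_def in auto)
      then have "frechet_derivative (\<lambda>x. X (h x)) (at x) v = frechet_derivative F (at (h x)) (frechet_derivative h (at x) v)"
        using frechet_derivative_at by metis
      then show ?thesis
        using smooth_frechet_within(2)[OF U(3,2,1) \<open>h x \<in> Z\<close> U(4) tangent_space_smooth_map[OF Q h x]] by simp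
    qed
    with N xN NQ sX show ?thesis by (intro exI[of _ N] conjI allI)
  qed
  have sm: "smooth Q (\<lambda>x. X (h x))"
  proof (rule smooth_local)
    fix x assume "x \<in> Q"
    from loc[OF this] show "\<exists>N. open N \<and> x \<in> N \<and> smooth N (\<lambda>x. X (h x))"
      by (elim exE conjE) (intro exI conjI)
  qed
  show a: "smooth Q (?a v)" for v
    by (rule smooth_symp[OF Q sm smooth_frechet[OF h(1)]])
  assume x: "x \<in> Q"
  have D: "frechet_derivative (?a v) (at x) w =
      symp (X (h x)) (frechet_derivative (\<lambda>x. frechet_derivative h (at x) v) (at x) w)
    + symp (frechet_derivative X (at (h x) within Z) (frechet_derivative h (at x) w)) (frechet_derivative h (at x) v)" for v w
  proof -
    have "(?a v has_derivative (\<lambda>w. symp (X (h x)) (frechet_derivative (\<lambda>x. frechet_derivative h (at x) v) (at x) w)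
        + symp (frechet_derivative (\<lambda>x. X (h x)) (at x) w) (frechet_derivative h (at x) v))) (at x)"
      by (rule bounded_bilinear.FDERIV[OF bounded_bilinear_symp smooth_has_derivative[OF sm x]
            smooth_has_derivative[OF smooth_frechet[OF h(1)] x]])
    from fun_cong[OF frechet_derivative_at[OF this], symmetric] loc[OF x]
    show ?thesis by (elim exE conjE) simp
  qed
  let ?s = "frechet_derivative h (at x) (1, 0)" and ?u = "frechet_derivative h (at x) (0, 1)"
  let ?D = "frechet_derivative X (at (h x) within Z)"
  have "symp (?D ?s) ?u + symp ?s (?D ?u) = symp ?s ?u"
    using X(2) tangent_space_smooth_map[OF Q h x] h x
    unfolding liouville_on_def lie_symp_def Let_def by (simp add: image_subset_iff)
  moreover have "symp (?D ?u) ?s = - symp ?s (?D ?u)"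
    by (simp add: symp_def inner_commute)
  ultimately show "frechet_derivative (?a (0, 1)) (at x) (1, 0) - frechet_derivative (?a (1, 0)) (at x) (0, 1) = symp ?s ?u"
    by (simp add: D smooth_partial_derivatives_commute[OF Q h(1) x])
qed

text \<open>A Gronwall argument. \<open>a\<close> and \<open>b\<close> stand for omega(X, .) on the
  u- and s-derivatives of the family; the action A is the integral of |a| over a period. Then
  \<open>\<delta> * \<tau>\<close> is at most A, while |A'| is at most C times \<tau>, hence at most
  (|C|/\<delta>) A, so A grows at most exponentially.\<close>

lemma periods_bounded:
  fixes a b :: "real \<times> real \<Rightarrow> real" and \<tau> :: "real \<Rightarrow> real"
  assumes s1: "s1 < 1"
    and a: "smooth ({s1<..<1} \<times> UNIV) a" and b: "smooth ({s1<..<1} \<times> UNIV) b"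
    and per: "\<And>s. s \<in> {s1<..<1} \<Longrightarrow> b (s, 1) = b (s, 0)"
    and var: "\<And>s u. s \<in> {s1<..<1} \<Longrightarrow>
      \<bar>frechet_derivative a (at (s, u)) (1, 0) - frechet_derivative b (at (s, u)) (0, 1)\<bar> \<le> C * \<tau> s"
    and low: "\<And>s u. s \<in> {s1<..<1} \<Longrightarrow> \<delta> * \<tau> s \<le> \<bar>a (s, u)\<bar>"
    and pos: "0 < \<delta>" "\<And>s. s \<in> {s1<..<1} \<Longrightarrow> 0 < \<tau> s"
  shows "\<not> filterlim \<tau> at_top (at_left 1)"
proof
  assume lim: "filterlim \<tau> at_top (at_left 1)"
  let ?S = "{s1<..<1}"
  have oS: "open (?S \<times> (UNIV :: real set))" by (intro open_Times) auto
  have ne: "a x \<noteq> 0" if "x \<in> ?S \<times> UNIV" for x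
  proof -
    have "0 < \<delta> * \<tau> (fst x)" using that pos by (intro mult_pos_pos) auto
    then show ?thesis using low[of "fst x" "snd x"] that by (auto simp: mem_Times_iff)
  qed
  \<comment> \<open>\<open>a\<close> has no zero on the connected strip, hence one sign
    \<open>g\<close> there; so |a| = g a is smooth and can be differentiated under the
    integral.\<close>
  obtain g :: real where g: "g = 1 \<or> g = -1" and ga: "\<And>x. x \<in> ?S \<times> UNIV \<Longrightarrow> g * a x = \<bar>a x\<bar>"
  proof -
    have "connected (a ` (?S \<times> UNIV))"
      by (intro connected_continuous_image smooth_continuous_on[OF a] connected_Times) auto
    moreover have "0 \<notin> a ` (?S \<times> UNIV)" using ne by force
    ultimately have *: "\<not> (a x < 0 \<and> 0 < a y)" if "x \<in> ?S \<times> UNIV" "y \<in> ?S \<times> UNIV" for x y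
      using that connectedD_interval[of "a ` (?S \<times> UNIV)" "a x" "a y" 0] by auto
    show thesis
    proof (cases "\<exists>x\<in>?S \<times> UNIV. a x < 0")
      case True
      then have "a x < 0" if "x \<in> ?S \<times> UNIV" for x using * ne[OF that] that by (meson linorder_neqE)
      then show thesis by (intro that[of "-1"]) (simp_all add: abs_of_neg)
    next
      case False
      then have "\<bar>a x\<bar> = a x" if "x \<in> ?S \<times> UNIV" for x using that by (meson abs_of_nonneg not_le)
      then show thesis by (intro that[of 1]) simp_all
    qed
  qed
  define A where "A s = g * integral (cbox 0 1) (\<lambda>u. a (s, u))" for s
  define w where "w s u = frechet_derivative a (at (s, u)) (1, 0) - frechet_derivative b (at (s, u)) (0, 1)" for s u
  have ca: "continuous_on (cbox 0 1) (\<lambda>u. f (s, u))" if "smooth (?S \<times> UNIV) f" "s \<in> ?S"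
    for s and f :: "real \<times> real \<Rightarrow> real"
    by (rule continuous_on_compose2[OF smooth_continuous_on[OF that(1)]]) (use that in \<open>auto intro!: continuous_intros\<close>)
  have A': "(A has_field_derivative g * integral (cbox 0 1) (w s)) (at s)" if s: "s \<in> ?S" for s
  proof -
    have "((\<lambda>s. integral (cbox 0 1) (\<lambda>u. a (s, u))) has_field_derivative
        integral (cbox 0 1) (\<lambda>u. frechet_derivative a (at (s, u)) (1, 0))) (at s within ?S)"
    proof (rule leibniz_rule_field_derivative[OF _ _ _ s])
      show "((\<lambda>s. a (s, t)) has_field_derivative frechet_derivative a (at (s', t)) (1, 0)) (at s' within ?S)"
        if "s' \<in> ?S" for s' t
        using has_vector_derivative_at_within[OF smooth_has_partial_derivative(1)[OF a]] that
        by (simp add: has_real_derivative_iff_has_vector_derivative)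
      show "(\<lambda>u. a (s', u)) integrable_on cbox 0 1" if "s' \<in> ?S" for s'
        by (intro integrable_continuous ca[OF a that])
      show "continuous_on (?S \<times> cbox 0 1) (\<lambda>(x, t). frechet_derivative a (at (x, t)) (1, 0))"
        unfolding case_prod_unfold prod.collapse
        by (rule continuous_on_subset[OF smooth_continuous_on[OF smooth_frechet[OF a]]]) auto
    qed simp
    \<comment> \<open>The \<open>b\<close>-term is a total derivative in \<open>u\<close> and
      integrates to zero over a period, so A' is g times the integral of the controlled difference
      \<open>w\<close>.\<close>
    moreover have "((\<lambda>u. frechet_derivative b (at (s, u)) (0, 1)) has_integral b (s, 1) - b (s, 0)) {0..1}"
    proof (rule fundamental_theorem_of_calculus)
      show "((\<lambda>u. b (s, u)) has_vector_derivative frechet_derivative b (at (s, u)) (0, 1)) (at u within {0..1})" for u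
        by (rule has_vector_derivative_at_within[OF smooth_has_partial_derivative(2)[OF b]]) (use s in simp)
    qed simp
    then have "integral (cbox 0 1) (\<lambda>u. frechet_derivative b (at (s, u)) (0, 1)) = 0"
      using per[OF s] by (simp add: cbox_interval integral_unique)
    moreover have "integral (cbox 0 1) (w s) = integral (cbox 0 1) (\<lambda>u. frechet_derivative a (at (s, u)) (1, 0))
        - integral (cbox 0 1) (\<lambda>u. frechet_derivative b (at (s, u)) (0, 1))"
      unfolding w_def
      by (rule integral_diff[OF integrable_continuous[OF ca[OF smooth_frechet[OF a] s]]
            integrable_continuous[OF ca[OF smooth_frechet[OF b] s]]])
    ultimately have "((\<lambda>s. integral (cbox 0 1) (\<lambda>u. a (s, u))) has_field_derivative integral (cbox 0 1) (w s)) (at s)"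
      using at_within_open[OF s] by simp
    then show ?thesis unfolding A_def[abs_def] by (rule DERIV_cmult)
  qed
  have Alow: "\<delta> * \<tau> s \<le> A s" if s: "s \<in> ?S" for s
  proof -
    have "integral (cbox 0 1) (\<lambda>u::real. \<delta> * \<tau> s) \<le> integral (cbox 0 1) (\<lambda>u. g * a (s, u))"
    proof (rule integral_le)
      show "(\<lambda>u. g * a (s, u)) integrable_on cbox 0 1"
        by (intro integrable_continuous continuous_intros ca[OF a s])
    qed (use low[OF s] ga s in \<open>auto intro: integrable_continuous\<close>)
    then show ?thesis by (simp add: A_def cbox_interval)
  qed
  have w: "\<bar>integral (cbox 0 1) (w s)\<bar> \<le> C * \<tau> s" if s: "s \<in> ?S" for s
  proof -
    have "norm (integral (cbox 0 1) (w s)) \<le> C * \<tau> s * measure lborel (cbox 0 (1::real))"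
    proof (rule integrable_bound)
      show "0 \<le> C * \<tau> s" using var[OF s, of 0] by linarith
      show "w s integrable_on cbox 0 1" unfolding w_def
        by (intro integrable_continuous continuous_intros ca[OF smooth_frechet[OF a] s] ca[OF smooth_frechet[OF b] s])
      show "norm (w s u) \<le> C * \<tau> s" for u using var[OF s] by (simp add: w_def)
    qed
    then show ?thesis by simp
  qed
  define M where "M = \<bar>C\<bar> / \<delta>"
  have A'le: "g * integral (cbox 0 1) (w s) \<le> M * A s" if s: "s \<in> ?S" for s
  proof -
    have "g * integral (cbox 0 1) (w s) \<le> C * \<tau> s" using w[OF s] g by auto
    also have "\<dots> \<le> \<bar>C\<bar> * \<tau> s" using pos(2)[OF s] by (simp add: mult_right_mono)
    also have "\<dots> = M * (\<delta> * \<tau> s)" using pos(1) by (simp add: M_def)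
    also have "\<dots> \<le> M * A s" using Alow[OF s] pos(1) by (intro mult_left_mono) (simp_all add: M_def)
    finally show ?thesis .
  qed
  \<comment> \<open>\<open>s1\<close> may be very negative; starting at a nonnegative time makes the
    interval at most 1 long, so that \<open>exp M\<close> bounds the growth.\<close>
  define s2 where "s2 = max 0 ((s1 + 1) / 2)"
  have s2: "s1 < s2" "s2 < 1" using s1 by (auto simp: s2_def less_max_iff_disj)
  have "A s \<le> \<bar>A s2\<bar> * exp M" if s: "s2 \<le> s" "s < 1" for s
  proof -
    have "exp (- M * s) * A s \<le> exp (- M * s2) * A s2"
    proof (rule DERIV_nonpos_imp_nonincreasing[OF s(1)])
      fix x assume x: "s2 \<le> x" "x \<le> s"
      then have xS: "x \<in> ?S" using s s2 by auto
      have "((\<lambda>s. exp (- M * s) * A s) has_field_derivative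
          exp (- M * x) * (g * integral (cbox 0 1) (w x)) + exp (- M * x) * (- M) * A x) (at x)"
      proof -
        have "((\<lambda>s. exp (- M * s)) has_field_derivative exp (- M * x) * (- M)) (at x)"
          by (auto intro!: derivative_eq_intros)
        from DERIV_mult[OF this A'[OF xS]] show ?thesis by (simp add: algebra_simps)
      qed
      moreover have "exp (- M * x) * (g * integral (cbox 0 1) (w x)) + exp (- M * x) * (- M) * A x
          = exp (- M * x) * (g * integral (cbox 0 1) (w x) - M * A x)" by (simp add: algebra_simps)
      moreover have "\<dots> \<le> 0" using A'le[OF xS] by (simp add: mult_nonneg_nonpos)
      ultimately show "\<exists>y. ((\<lambda>s. exp (- M * s) * A s) has_real_derivative y) (at x) \<and> y \<le> 0"
        by (intro exI conjI) simp_all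
    qed
    then have "exp (M * s) * (exp (- M * s) * A s) \<le> exp (M * s) * (exp (- M * s2) * A s2)"
      by (rule mult_left_mono) simp
    moreover have "exp (M * s) * exp (- M * s) = 1" "exp (M * s) * exp (- M * s2) = exp (M * (s - s2))"
      by (simp_all add: right_diff_distrib flip: exp_add)
    ultimately have "A s \<le> exp (M * (s - s2)) * A s2"
      by (simp only: mult.assoc[symmetric] mult_1_left)
    also have "\<dots> \<le> exp (M * (s - s2)) * \<bar>A s2\<bar>" by (simp add: mult_left_mono)
    also have "\<dots> \<le> exp M * \<bar>A s2\<bar>"
    proof (rule mult_right_mono)
      have "s - s2 \<le> 1" using s by (simp add: s2_def)
      then have "M * (s - s2) \<le> M * 1" using pos(1) by (intro mult_left_mono) (auto simp: M_def)
      then show "exp (M * (s - s2)) \<le> exp M" by simp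
    qed simp
    finally show ?thesis by (simp add: mult.commute)
  qed
  note bA = this
  have bound: "\<tau> s \<le> \<bar>A s2\<bar> * exp M / \<delta>" if "s2 \<le> s" "s < 1" for s
  proof -
    have "\<tau> s * \<delta> \<le> \<bar>A s2\<bar> * exp M" using Alow[of s] bA[OF that] that s2 by (simp add: mult.commute)
    then show ?thesis using pos(1) by (simp only: pos_le_divide_eq)
  qed
  have "\<forall>\<^sub>F s in at_left 1. \<bar>A s2\<bar> * exp M / \<delta> + 1 \<le> \<tau> s"
    using lim by (simp add: filterlim_at_top)
  moreover have "\<forall>\<^sub>F s in at_left 1. s \<in> {s2<..<1}"
    using eventually_at_left_real[OF s2(2)] by simp
  ultimately have "\<forall>\<^sub>F s in at_left (1::real). False"
  proof eventually_elim
    case (elim s)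
    then show False using bound[of s] by simp
  qed
  then show False by simp
qed


section \<open>Moser's chart\<close>

lemma moser_alt:
  "moser \<mu> P z = (pos \<mu> P + (1 - fst (fst z)) *\<^sub>R snd (snd z) + fst (snd z) *\<^sub>R snd (fst z),
    - (inverse (1 - fst (fst z)) *\<^sub>R snd (fst z)))"
  by (simp add: moser_def case_prod_unfold)

text \<open>Neither \<mu> nor the primary is an argument: they enter \<open>moser\<close> only
  through a translation.\<close>

definition dmoser :: "R4 \<times> R4 \<Rightarrow> R4 \<times> R4 \<Rightarrow> phase" where
  "dmoser z u = (let r = inverse (1 - fst (fst z)) in
     ((1 - fst (fst z)) *\<^sub>R snd (snd u) - fst (fst u) *\<^sub>R snd (snd z) + fst (snd u) *\<^sub>R snd (fst z)
        + fst (snd z) *\<^sub>R snd (fst u),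
      - (r *\<^sub>R snd (fst u) + (r * fst (fst u) * r) *\<^sub>R snd (fst z))))"

lemma moser_has_derivative:
  assumes "fst (fst z) \<noteq> 1"
  shows "(moser \<mu> P has_derivative dmoser z) (at z)"
proof -
  have a: "((\<lambda>z. fst (fst z)) has_derivative (\<lambda>u. fst (fst u))) (at z)"
    and b: "((\<lambda>z. snd (fst z)) has_derivative (\<lambda>u. snd (fst u))) (at z)"
    and c: "((\<lambda>z. fst (snd z)) has_derivative (\<lambda>u. fst (snd u))) (at z)"
    and d: "((\<lambda>z. snd (snd z)) has_derivative (\<lambda>u. snd (snd u))) (at z)"
    by (intro has_derivative_fst has_derivative_snd has_derivative_ident)+
  note e = has_derivative_diff[OF has_derivative_const[of 1] a]
  have i: "((\<lambda>z. inverse (1 - fst (fst z))) has_derivative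
      (\<lambda>u. - (inverse (1 - fst (fst z)) * (0 - fst (fst u)) * inverse (1 - fst (fst z))))) (at z)"
    using Deriv.has_derivative_inverse[OF _ e] assms by simp
  show ?thesis
    unfolding moser_alt[abs_def] dmoser_def Let_def
    by (rule has_derivative_eq_rhs[OF has_derivative_Pair[OF has_derivative_add[OF has_derivative_add[OF
          has_derivative_const has_derivative_scaleR[OF e d]] has_derivative_scaleR[OF c b]]
          has_derivative_minus[OF has_derivative_scaleR[OF i b]]]])
      (auto simp: fun_eq_iff algebra_simps)
qed

lemma smooth_moser: "smooth {z. fst (fst z) \<noteq> 1} (moser \<mu> P)"
proof -
  have "open {z :: R4 \<times> R4. fst (fst z) \<noteq> 1}"
    by (intro open_Collect_neq continuous_intros)
  then show ?thesis unfolding moser_alt[abs_def]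
    by (intro smooth_intros) auto
qed

lemma V_iff:
  "((x0, x), (y0, y)) \<in> V \<longleftrightarrow> x0\<^sup>2 + x \<bullet> x = 1 \<and> x0 * y0 + x \<bullet> y = 0 \<and> \<not> (y0 = 0 \<and> y = 0) \<and>
     norm (y0, y) * (1 - x0) < 1/2"
  by (simp add: V_def norm_eq_1 power2_eq_square zero_prod_def)

lemma V_fst_less:
  assumes "z \<in> V" "fst z \<noteq> north" shows "fst (fst z) < 1"
proof -
  obtain x0 x y0 y where z: "z = ((x0, x), (y0, y))" by (metis prod.collapse)
  have e: "x0\<^sup>2 + x \<bullet> x = 1" using assms z V_iff by simp
  then have "x0\<^sup>2 \<le> 1" using inner_ge_zero[of x] by linarith
  then have "x0 \<le> 1" using abs_square_le_1[of x0] by auto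
  moreover have "x0 \<noteq> 1" using e assms z by auto
  ultimately show ?thesis using z by simp
qed

lemma V_fst_le: "z \<in> V \<Longrightarrow> fst (fst z) \<le> 1"
  using V_fst_less[of z] by (cases "fst z = north") auto

text \<open>Inverse stereographic projection of the momentum (up to sign), together with the induced
  fibre map on the position x = q - P. The denominators |p|^2 + 1 never vanish, so the formula is
  smooth on the whole phase space.\<close>

definition moser_inv :: "real \<Rightarrow> primary \<Rightarrow> phase \<Rightarrow> R4 \<times> R4" where
  "moser_inv \<mu> P w = (let x = fst w - pos \<mu> P; p = snd w; r = inverse (p \<bullet> p + 1) in
     ((r * (p \<bullet> p - 1), (- 2 * r) *\<^sub>R p), (- (x \<bullet> p), ((p \<bullet> p + 1) / 2) *\<^sub>R x - (x \<bullet> p) *\<^sub>R p)))"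

lemma inner_plus_1_neq: "p \<bullet> p + 1 \<noteq> (0::real)" 
  using inner_ge_zero[of p] by linarith

lemma smooth_moser_inv: "smooth UNIV (moser_inv \<mu> P)"
  unfolding moser_inv_def[abs_def] Let_def
  by (intro smooth_intros) (auto simp: inner_plus_1_neq)

lemma moser_moser_inv: "moser \<mu> P (moser_inv \<mu> P w) = w"
proof -
  define x where "x = fst w - pos \<mu> P"
  define p where "p = snd w"
  define k where "k = p \<bullet> p + 1"
  define r where "r = inverse k"
  have r: "r * k = 1" "k \<noteq> 0" by (auto simp: r_def k_def inner_plus_1_neq)
  have e: "moser_inv \<mu> P w = ((r * (k - 2), (- 2 * r) *\<^sub>R p), (- (x \<bullet> p), (k / 2) *\<^sub>R x - (x \<bullet> p) *\<^sub>R p))"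
    by (simp add: moser_inv_def Let_def x_def p_def r_def k_def)
  have k2: "1 - r * (k - 2) = 2 * r" using r by algebra
  have "(2 * r) *\<^sub>R ((k / 2) *\<^sub>R x - (x \<bullet> p) *\<^sub>R p) + (- (x \<bullet> p)) *\<^sub>R (- 2 * r) *\<^sub>R p = (r * k) *\<^sub>R x"
    by (simp add: scaleR_right_diff_distrib mult.commute)
  moreover have "- (inverse (2 * r) *\<^sub>R (- 2 * r) *\<^sub>R p) = p"
    using r(2) by (simp add: r_def)
  ultimately show ?thesis
    unfolding moser_alt e fst_conv snd_conv k2 r(1) by (simp add: x_def p_def add.assoc)
qed

lemma moser_inv_moser:
  assumes "z \<in> V" "fst z \<noteq> north"
  shows "moser_inv \<mu> P (moser \<mu> P z) = z"
proof -
  obtain x0 x y0 y where z: "z = ((x0, x), (y0, y))" by (metis prod.collapse)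
  have c: "x \<bullet> x = 1 - x0\<^sup>2" "x \<bullet> y = - (x0 * y0)" using assms z V_iff[of x0 x y0 y] by auto
  have k: "1 - x0 > 0" using V_fst_less[OF assms] z by simp
  define r where "r = inverse (1 - x0)"
  have r: "r * (1 - x0) = 1" "r \<noteq> 0" using k by (auto simp: r_def)
  define q' where "q' = (1 - x0) *\<^sub>R y + y0 *\<^sub>R x"
  define p where "p = - (r *\<^sub>R x)"
  have m: "moser \<mu> P z = (pos \<mu> P + q', p)"
    by (simp add: moser_alt z q'_def p_def r_def)
  have pp: "p \<bullet> p = r * (1 + x0)"
    using c r by (simp add: p_def) (simp add: power2_eq_square; algebra)
  have pp1: "p \<bullet> p + 1 = 2 * r"
    using pp r by algebra
  have qp: "q' \<bullet> p = - y0"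
    using c r by (simp add: p_def q'_def inner_simps inner_commute) (simp add: power2_eq_square; algebra)
  have i: "inverse (p \<bullet> p + 1) = (1 - x0) / 2"
    unfolding pp1 r_def using k by simp
  have f1: "(1 - x0) / 2 * (p \<bullet> p - 1) = x0"
  proof -
    have "(1 - x0) * (p \<bullet> p - 1) = 2 * x0" unfolding pp using r by algebra
    then show ?thesis by simp
  qed
  have f2: "(- 2 * ((1 - x0) / 2)) *\<^sub>R p = x"
  proof -
    have "(- 2 * ((1 - x0) / 2)) *\<^sub>R p = (- (- 2 * ((1 - x0) / 2)) * r) *\<^sub>R x" by (simp add: p_def)
    moreover have "- (- 2 * ((1 - x0) / 2)) * r = 1" using r by (simp add: field_simps)
    ultimately show ?thesis by (simp only: scaleR_one)
  qed
  have f3: "((p \<bullet> p + 1) / 2) *\<^sub>R q' - (- y0) *\<^sub>R p = y"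
  proof -
    have "(2 * r / 2) *\<^sub>R q' - (- y0) *\<^sub>R p = (r * (1 - x0)) *\<^sub>R y + (r * y0 - y0 * r) *\<^sub>R x"
      by (simp add: q'_def p_def scaleR_add_right scaleR_left_diff_distrib scaleR_right_diff_distrib right_diff_distrib mult.commute)
    then show ?thesis unfolding pp1 using r by simp
  qed
  show ?thesis
    unfolding moser_inv_def Let_def m fst_conv snd_conv add_diff_cancel_left' i qp
    by (simp only: f1 f2 f3 z minus_minus)
qed

text \<open>By the constraints of \<open>V\<close>, the cross term -2 (1 - \<xi>0) \<xi>0 \<eta>0^2
  and the term (1 - \<xi>0^2) \<eta>0^2 add up to (1 - \<xi>0)^2 \<eta>0^2, so |q - P|^2 is (1 -
  \<xi>0)^2 |\<eta>|^2.\<close>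

lemma moser_dist:
  assumes "z \<in> V"
  shows "norm (fst (moser \<mu> P z) - pos \<mu> P) = norm (snd z) * (1 - fst (fst z))"
proof -
  obtain x0 x y0 y where z: "z = ((x0, x), (y0, y))" by (metis prod.collapse)
  have c: "x \<bullet> x = 1 - x0\<^sup>2" "x \<bullet> y = - (x0 * y0)" using assms z V_iff[of x0 x y0 y] by auto
  have "((1 - x0) *\<^sub>R y + y0 *\<^sub>R x) \<bullet> ((1 - x0) *\<^sub>R y + y0 *\<^sub>R x) = (1 - x0)\<^sup>2 * (y0\<^sup>2 + y \<bullet> y)"
    using c by (simp add: inner_simps inner_commute) (simp add: power2_eq_square algebra_simps)
  then have "norm ((1 - x0) *\<^sub>R y + y0 *\<^sub>R x) = \<bar>1 - x0\<bar> * norm (y0, y)"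
    by (simp add: norm_eq_sqrt_inner real_sqrt_mult power2_eq_square)
  then show ?thesis using V_fst_le[OF assms] by (simp add: moser_alt z)
qed

text \<open>The two equations of T*S^3 hold for the image of every (q,p). The hypotheses on q serve
  the open conditions: |\<eta>| is |q - P| (|p|^2 + 1)/2, and |\<eta>| (1 - \<xi>0) is |q -
  P|.\<close>

lemma moser_inv_in_V:
  assumes "fst w \<noteq> pos \<mu> P" "norm (fst w - pos \<mu> P) < 1/2"
  shows "moser_inv \<mu> P w \<in> V" "fst (moser_inv \<mu> P w) \<noteq> north"
    "norm (snd (moser_inv \<mu> P w)) = norm (fst w - pos \<mu> P) * (snd w \<bullet> snd w + 1) / 2"
proof -
  obtain q p where w: "w = (q, p)" by (cases w)
  define x where "x = q - pos \<mu> P"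
  define k where "k = p \<bullet> p + 1"
  have k: "k > 0" unfolding k_def using inner_ge_zero[of p] by linarith
  have pp: "p \<bullet> p = k - 1" by (simp add: k_def)
  define r where "r = inverse k"
  have r: "r * k = 1" "r > 0" using k by (auto simp: r_def)
  have e: "moser_inv \<mu> P w = ((r * (k - 2), (- 2 * r) *\<^sub>R p), (- (x \<bullet> p), (k / 2) *\<^sub>R x - (x \<bullet> p) *\<^sub>R p))"
    by (simp add: moser_inv_def Let_def w x_def pp r_def)
  have "(x \<bullet> p)\<^sup>2 + ((k / 2) *\<^sub>R x - (x \<bullet> p) *\<^sub>R p) \<bullet> ((k / 2) *\<^sub>R x - (x \<bullet> p) *\<^sub>R p) = (k / 2)\<^sup>2 * (x \<bullet> x)"
    using pp by (simp add: inner_simps inner_commute power2_eq_square) (simp add: field_simps)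
  then have n: "norm (- (x \<bullet> p), (k / 2) *\<^sub>R x - (x \<bullet> p) *\<^sub>R p) = norm x * k / 2"
  proof -
    assume *: "(x \<bullet> p)\<^sup>2 + ((k / 2) *\<^sub>R x - (x \<bullet> p) *\<^sub>R p) \<bullet> ((k / 2) *\<^sub>R x - (x \<bullet> p) *\<^sub>R p) = (k / 2)\<^sup>2 * (x \<bullet> x)"
    have "norm (- (x \<bullet> p), (k / 2) *\<^sub>R x - (x \<bullet> p) *\<^sub>R p) =
        sqrt ((x \<bullet> p)\<^sup>2 + ((k / 2) *\<^sub>R x - (x \<bullet> p) *\<^sub>R p) \<bullet> ((k / 2) *\<^sub>R x - (x \<bullet> p) *\<^sub>R p))"
      by (simp add: norm_eq_sqrt_inner power2_eq_square)
    also have "\<dots> = norm x * k / 2"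
      unfolding * using k by (simp add: real_sqrt_mult norm_eq_sqrt_inner)
    finally show ?thesis .
  qed
  then show "norm (snd (moser_inv \<mu> P w)) = norm (fst w - pos \<mu> P) * (snd w \<bullet> snd w + 1) / 2"
    unfolding e snd_conv n by (simp add: w x_def k_def)
  have x: "x \<noteq> 0" "norm x < 1/2" using assms w by (auto simp: x_def)
  have ne: "norm x * k / 2 \<noteq> 0" using x k by simp
  have r1: "1 - r * (k - 2) = 2 * r" using r by algebra
  show "moser_inv \<mu> P w \<in> V"
    unfolding e V_iff
  proof (intro conjI)
    show "(r * (k - 2))\<^sup>2 + (- 2 * r) *\<^sub>R p \<bullet> (- 2 * r) *\<^sub>R p = 1"
      using r pp by (simp add: power2_eq_square) algebra
    show "r * (k - 2) * - (x \<bullet> p) + (- 2 * r) *\<^sub>R p \<bullet> ((k / 2) *\<^sub>R x - (x \<bullet> p) *\<^sub>R p) = 0"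
      by (simp add: inner_diff_right inner_commute[of p x] pp) (simp add: algebra_simps)
    show "\<not> (- (x \<bullet> p) = 0 \<and> (k / 2) *\<^sub>R x - (x \<bullet> p) *\<^sub>R p = 0)"
      using ne n by (metis norm_zero zero_prod_def)
    have "norm x * k / 2 * (2 * r) = norm x" using r(1) by (simp add: mult.commute)
    then show "norm (- (x \<bullet> p), (k / 2) *\<^sub>R x - (x \<bullet> p) *\<^sub>R p) * (1 - r * (k - 2)) < 1/2"
      unfolding n r1 using x by simp
  qed
  show "fst (moser_inv \<mu> P w) \<noteq> north" unfolding e using r r1 by auto
qed

text \<open>Kernel of the differentials of the two equations |\<xi>| = 1 and <\<xi>,\<eta>> = 0;
  \<open>tangent_space_V\<close> identifies it with the tangent space.\<close>

definition TV :: "R4 \<times> R4 \<Rightarrow> (R4 \<times> R4) set" where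
  "TV z = {u. fst z \<bullet> fst u = 0 \<and> fst u \<bullet> snd z + fst z \<bullet> snd u = 0}"

text \<open>Moser's map is symplectic on T*S^3 though not on the ambient space: the linearized
  constraints of \<open>TV\<close> eliminate the inner products with \<xi>, and what remains is an
  identity of polynomials.\<close>

lemma symp_dmoser:
  assumes "z \<in> V" "fst z \<noteq> north" "u \<in> TV z" "v \<in> TV z"
  shows "symp (dmoser z u) (dmoser z v) = symp u v"
proof -
  obtain x0 x y0 y where z: "z = ((x0, x), (y0, y))" by (metis prod.collapse)
  obtain a0 a b0 b where u: "u = ((a0, a), (b0, b))" by (metis prod.collapse)
  obtain c0 c d0 d where v: "v = ((c0, c), (d0, d))" by (metis prod.collapse)
  have e: "x \<bullet> x = 1 - x0 * x0" "x \<bullet> y = - (x0 * y0)"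
    using assms z V_iff[of x0 x y0 y] by (auto simp: power2_eq_square)
  have f: "x \<bullet> a = - (x0 * a0)" "x \<bullet> c = - (x0 * c0)"
    "x \<bullet> b = - (a0 * y0 + a \<bullet> y + x0 * b0)" "x \<bullet> d = - (c0 * y0 + c \<bullet> y + x0 * d0)"
    using assms(3,4) by (auto simp: TV_def z u v)
  define r where "r = inverse (1 - x0)"
  have r: "r * (1 - x0) = 1" using V_fst_less[OF assms(1,2)] z by (auto simp: r_def)
  have "symp (dmoser z u) (dmoser z v) =
    - ((r *\<^sub>R a + (r * a0 * r) *\<^sub>R x) \<bullet> ((1 - x0) *\<^sub>R d - c0 *\<^sub>R y + d0 *\<^sub>R x + y0 *\<^sub>R c))
    + ((1 - x0) *\<^sub>R b - a0 *\<^sub>R y + b0 *\<^sub>R x + y0 *\<^sub>R a) \<bullet> (r *\<^sub>R c + (r * c0 * r) *\<^sub>R x)"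
    by (simp add: symp_def dmoser_def Let_def z u v r_def[symmetric] del: minus_add_distrib)
  also have "\<dots> = b0 * c0 + b \<bullet> c - (a0 * d0 + a \<bullet> d)"
    using r e f
    by (simp add: inner_add_left inner_add_right inner_diff_left inner_diff_right
       inner_commute[of a x] inner_commute[of b x] inner_commute[of c x] inner_commute[of d x] inner_commute[of y x]
       inner_commute[of y a] inner_commute[of y c] inner_commute[of c a]) algebra
  finally show ?thesis by (simp add: symp_def u v)
qed

text \<open>A smooth retraction of a neighbourhood onto \<open>T\<^sup>*S\<^sup>3\<close>; it yields curves in \<^const>\<open>V\<close> with
  prescribed velocity.\<close>

definition sphere_ret :: "R4 \<times> R4 \<Rightarrow> R4 \<times> R4" where
  "sphere_ret z = (let r = inverse (norm (fst z)) in
     (r *\<^sub>R fst z, snd z - (fst z \<bullet> snd z * (r * r)) *\<^sub>R fst z))"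

lemma smooth_sphere_ret: "smooth {z. fst z \<noteq> 0} sphere_ret"
proof -
  have "open {z :: R4 \<times> R4. fst z \<noteq> 0}" by (intro open_Collect_neq continuous_intros)
  then show ?thesis unfolding sphere_ret_def[abs_def] Let_def by (intro smooth_intros) auto
qed

lemma sphere_ret_constraint:
  assumes "fst z \<noteq> 0"
  shows "norm (fst (sphere_ret z)) = 1" "fst (sphere_ret z) \<bullet> snd (sphere_ret z) = 0"
proof -
  have r: "inverse (norm (fst z)) * norm (fst z) = 1" using assms by simp
  have n: "norm (fst z) \<noteq> 0" using assms by simp
  show "norm (fst (sphere_ret z)) = 1" using assms by (simp add: sphere_ret_def Let_def)
  have "fst z \<bullet> fst z = norm (fst z) * norm (fst z)" by (simp add: dot_square_norm power2_eq_square)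
  then show "fst (sphere_ret z) \<bullet> snd (sphere_ret z) = 0" using n
    by (simp add: sphere_ret_def Let_def inner_diff_right field_simps del: norm_eq_zero)
qed

lemma sphere_ret_id: "z \<in> V \<Longrightarrow> sphere_ret z = z"
  by (auto simp: V_def sphere_ret_def Let_def prod_eq_iff)

lemma V_fst_nonzero: "z \<in> V \<Longrightarrow> fst z \<noteq> 0"
  by (auto simp: V_def)

text \<open>\<open>sphere_ret\<close> always lands in T*S^3, so only the open conditions of
  \<open>V\<close> have to be pulled back.\<close>

lemma V_retract_nbhd: "open {z. fst z \<noteq> 0 \<and> sphere_ret z \<in> V}"
proof -
  let ?N = "{z :: R4 \<times> R4. fst z \<noteq> 0}"
  have "open {z :: R4 \<times> R4. snd z \<noteq> 0 \<and> norm (snd z) * (1 - fst (fst z)) < 1/2}" (is "open ?B")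
    by (intro open_Collect_conj open_Collect_neq open_Collect_less continuous_intros)
  moreover have "open ?N" by (intro open_Collect_neq continuous_intros)
  ultimately have "open (sphere_ret -` ?B \<inter> ?N)"
    using continuous_on_open_vimage smooth_continuous_on[OF smooth_sphere_ret] by blast
  moreover have "sphere_ret -` ?B \<inter> ?N = {z. fst z \<noteq> 0 \<and> sphere_ret z \<in> V}"
    using sphere_ret_constraint by (auto simp: V_def case_prod_unfold)
  ultimately show ?thesis by simp
qed

lemma sphere_ret_derivative:
  assumes "z \<in> V" "u \<in> TV z"
  shows "frechet_derivative sphere_ret (at z) u = u"
proof -
  have z: "fst z \<bullet> fst z = 1" "norm (fst z) = 1" "fst z \<bullet> snd z = 0" "fst z \<noteq> 0"
    using assms V_fst_nonzero by (auto simp: V_def norm_eq_1)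
  have u: "fst z \<bullet> fst u = 0" "fst u \<bullet> snd z + fst z \<bullet> snd u = 0"
    using assms(2) by (auto simp: TV_def)
  let ?D = "frechet_derivative (\<lambda>x. inverse (norm (fst x))) (at z) :: R4 \<times> R4 \<Rightarrow> real"
  have sm: "smooth {z :: R4 \<times> R4. fst z \<noteq> 0} (\<lambda>x. inverse (norm (fst x)))"
    by (intro smooth_intros) (auto intro!: open_Collect_neq continuous_intros)
  have n: "((\<lambda>x. norm (fst x)) has_derivative (\<lambda>v. fst z \<bullet> fst v)) (at z)"
    using has_derivative_compose[OF has_derivative_fst[OF has_derivative_ident] has_derivative_norm[OF z(4)]] z
    by (simp add: sgn_div_norm inner_commute)
  have r: "((\<lambda>x. inverse (norm (fst x))) has_derivative (\<lambda>v. - (fst z \<bullet> fst v))) (at z)"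
    using Deriv.has_derivative_inverse[OF _ n] z by simp
  have "(sphere_ret has_derivative (\<lambda>v. (fst v - (fst z \<bullet> fst v) *\<^sub>R fst z,
      snd v - (fst v \<bullet> snd z + fst z \<bullet> snd v) *\<^sub>R fst z))) (at z)"
    unfolding sphere_ret_def[abs_def] Let_def
    by (rule has_derivative_eq_rhs, (rule derivative_intros r)+)
       (auto simp: fun_eq_iff z algebra_simps inner_commute)
  from fun_cong[OF frechet_derivative_at[OF this], of u] show ?thesis
    using u by (simp add: prod_eq_iff)
qed

text \<open>Curves in \<open>V\<close> satisfy the differentiated constraints; conversely
  \<open>sphere_ret\<close> fixes the vectors of \<open>TV\<close> to first order and so turns
  straight lines into curves in \<open>V\<close> with these velocities.\<close>

lemma tangent_space_V:
  assumes z: "z \<in> V" shows "tangent_space V z = TV z"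
proof
  show "TV z \<subseteq> tangent_space V z"
  proof
    fix u assume u: "u \<in> TV z"
    have "frechet_derivative sphere_ret (at z) u \<in> tangent_space V (sphere_ret z)"
      by (rule tangent_space_smooth_map[OF V_retract_nbhd smooth_subset[OF smooth_sphere_ret]])
        (use z V_fst_nonzero in \<open>auto simp: sphere_ret_id\<close>)
    then show "u \<in> tangent_space V z" by (simp add: sphere_ret_derivative[OF z u] sphere_ret_id[OF z])
  qed
  show "tangent_space V z \<subseteq> TV z"
  proof
    fix u assume u: "u \<in> tangent_space V z"
    have "((\<lambda>x. fst x \<bullet> fst x) has_derivative (\<lambda>v. fst z \<bullet> fst v + fst v \<bullet> fst z)) (at z within V)"
      by (auto intro!: derivative_eq_intros)
    from tangent_space_derivative_unique[OF u this has_derivative_const[of 1]]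
    have 1: "fst z \<bullet> fst u + fst u \<bullet> fst z = 0" by (auto simp: V_def norm_eq_1)
    have "((\<lambda>x. fst x \<bullet> snd x) has_derivative (\<lambda>v. fst z \<bullet> snd v + fst v \<bullet> snd z)) (at z within V)"
      by (auto intro!: derivative_eq_intros)
    from tangent_space_derivative_unique[OF u this has_derivative_const[of 0]]
    have "fst z \<bullet> snd u + fst u \<bullet> snd z = 0" by (auto simp: V_def)
    with 1 show "u \<in> TV z" by (simp add: TV_def inner_commute)
  qed
qed

section \<open>Hamiltonian vector fields\<close>

text \<open>The description by \<open>THE\<close> is meaningful once the form is nondegenerate on
  the tangent space; \<open>ex\<close> and \<open>nd\<close> are the surjectivity and injectivity
  halves of that. Afterwards any derivative \<open>D\<close> within \<open>Z\<close> may replace the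
  chosen one.\<close>

lemma ham_vf_characterization:
  assumes ex: "\<And>D. linear D \<Longrightarrow> \<exists>x\<in>tangent_space Z z. \<forall>u\<in>tangent_space Z z. D u = symp u x"
    and nd: "\<And>x y. x \<in> tangent_space Z z \<Longrightarrow> y \<in> tangent_space Z z \<Longrightarrow>
      (\<forall>u\<in>tangent_space Z z. symp u x = symp u y) \<Longrightarrow> x = y"
    and D: "(K has_derivative D) (at z within Z)"
  shows "x = ham_vf Z K z \<longleftrightarrow> x \<in> tangent_space Z z \<and> (\<forall>u\<in>tangent_space Z z. D u = symp u x)"
proof -
  have "(K has_derivative frechet_derivative K (at z within Z)) (at z within Z)"
    using D frechet_derivative_works differentiable_def by blast
  then have e: "frechet_derivative K (at z within Z) u = D u" if "u \<in> tangent_space Z z" for u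
    using tangent_space_derivative_unique[OF that _ D] by simp
  obtain x0 where x0: "x0 \<in> tangent_space Z z" "\<forall>u\<in>tangent_space Z z. D u = symp u x0"
    using ex has_derivative_linear[OF D] by blast
  have "ham_vf Z K z = x0"
    unfolding ham_vf_def by (rule the_equality) (use x0 e nd in auto)
  then show ?thesis using x0 nd[of x x0] by (metis)
qed

lemma linear_functional_pair:
  fixes D :: "'v::euclidean_space \<times> 'v \<Rightarrow> real"
  assumes "linear D"
  obtains a b where "\<And>u. D u = fst u \<bullet> a + snd u \<bullet> b"
proof -
  have "D u = u \<bullet> adjoint D 1" for u
    using adjoint_works[OF assms, of u 1] by simp
  then show thesis using that by (metis inner_prod_def)
qed

lemma ham_vf_open:
  assumes "open Z" "z \<in> Z" "(K has_derivative D) (at z)"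
  shows "x = ham_vf Z K z \<longleftrightarrow> (\<forall>u. D u = symp u x)"
proof -
  note T = tangent_space_open[OF assms(1,2)]
  have "x = ham_vf Z K z \<longleftrightarrow> x \<in> tangent_space Z z \<and> (\<forall>u\<in>tangent_space Z z. D u = symp u x)"
  proof (rule ham_vf_characterization)
    show "\<exists>x\<in>tangent_space Z z. \<forall>u\<in>tangent_space Z z. D u = symp u x" if D: "linear D" for D
    proof -
      obtain a b where "\<And>u. D u = fst u \<bullet> a + snd u \<bullet> b" using linear_functional_pair[OF D] by blast
      then show ?thesis unfolding T by (intro bexI[of _ "(b, - a)"]) (auto simp: symp_def)
    qed
    fix x y assume eq: "\<forall>u\<in>tangent_space Z z. symp u x = symp u y"
    have "symp (0, fst x - fst y) x = symp (0, fst x - fst y) y"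
      "symp (snd x - snd y, 0) x = symp (snd x - snd y, 0) y" using eq T by auto
    then have "(fst x - fst y) \<bullet> (fst x - fst y) = 0" "(snd x - snd y) \<bullet> (snd x - snd y) = 0"
      by (auto simp: symp_def inner_diff_right)
    then show "x = y" by (simp add: prod_eq_iff)
  qed (use assms(3) in \<open>rule has_derivative_at_withinI\<close>)
  then show ?thesis using T by simp
qed

lemma ham_vf_V:
  assumes z: "z \<in> V" and K: "(K has_derivative D) (at z within V)"
  shows "x = ham_vf V K z \<longleftrightarrow> x \<in> TV z \<and> (\<forall>u\<in>TV z. D u = symp u x)"
proof -
  obtain \<xi> \<eta> where zz: "z = (\<xi>, \<eta>)" by (cases z)
  have c: "\<xi> \<bullet> \<xi> = 1" "\<xi> \<bullet> \<eta> = 0" using z zz by (auto simp: V_def norm_eq_1)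
  note T = tangent_space_V[OF z]
  have "x = ham_vf V K z \<longleftrightarrow> x \<in> tangent_space V z \<and> (\<forall>u\<in>tangent_space V z. D u = symp u x)"
  proof (rule ham_vf_characterization[OF _ _ K])
    show "\<exists>x\<in>tangent_space V z. \<forall>u\<in>tangent_space V z. D u = symp u x" if D: "linear D" for D
    proof -
      obtain a b where D: "\<And>u. D u = fst u \<bullet> a + snd u \<bullet> b" using linear_functional_pair[OF D] by blast
      \<comment> \<open>Lagrange multipliers: the ambient solution is (b, -a); the corrections by
        \<open>t\<close> and \<open>s\<close> make it tangent and pair to zero with
        \<open>TV\<close>.\<close>
      define t where "t = - (\<xi> \<bullet> b)"
      define s where "s = b \<bullet> \<eta> - \<xi> \<bullet> a"
      let ?x = "(b + t *\<^sub>R \<xi>, - (a + s *\<^sub>R \<xi> + t *\<^sub>R \<eta>))"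
      have "?x \<in> TV z"
        using c by (simp add: TV_def zz inner_simps t_def s_def inner_commute)
      moreover have "D u = symp u ?x" if "u \<in> TV z" for u
      proof -
        have "symp u ?x = D u + t * (fst u \<bullet> \<eta> + \<xi> \<bullet> snd u) + s * (\<xi> \<bullet> fst u)"
          by (simp add: symp_def D inner_simps algebra_simps inner_commute)
        then show ?thesis using that by (simp add: TV_def zz)
      qed
      ultimately show ?thesis unfolding T by (intro bexI[of _ ?x]) auto
    qed
    fix x y assume x: "x \<in> tangent_space V z" and y: "y \<in> tangent_space V z"
      and eq: "\<forall>u\<in>tangent_space V z. symp u x = symp u y"
    define d where "d = x - y"
    have d: "d \<in> TV z" using x y unfolding T d_def by (auto simp: TV_def inner_diff_left inner_diff_right)
    have 0: "symp u d = 0" if "u \<in> TV z" for u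
      using eq that unfolding T d_def by (auto simp: symp_def inner_diff_right)
    \<comment> \<open>Test vectors for nondegeneracy: the vertical one detects the base part of
      \<open>d\<close>; the next has base part \<open>snd d\<close> and a vertical part that
      restores tangency.\<close>
    have "(0, fst d) \<in> TV z" using d by (simp add: TV_def)
    from 0[OF this] have d1: "fst d = 0" by (simp add: symp_def)
    have "(snd d, (- (snd d \<bullet> \<eta>)) *\<^sub>R \<xi>) \<in> TV z" using d d1 c by (simp add: TV_def zz)
    from 0[OF this] have "snd d = 0" using d1 by (simp add: symp_def)
    with d1 show "x = y" by (simp add: d_def prod_eq_iff)
  qed
  then show ?thesis using T by simp
qed

text \<open>Symplectic maps carry Hamiltonian fields to Hamiltonian fields. Every direction at the
  image point is \<open>dmoser\<close> of a tangent vector of \<open>V\<close>, namely of its image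
  under the derivative of \<open>moser_inv\<close>, so the identity on \<open>TV\<close> determines
  the field in phase space.\<close>

lemma dmoser_ham_vf:
  assumes z: "z \<in> V" "fst z \<noteq> north" and Z: "open Z" "moser \<mu> P z \<in> Z"
    and k: "(k has_derivative D) (at (moser \<mu> P z))"
    and kv: "\<And>x. x \<in> V \<Longrightarrow> fst x \<noteq> north \<Longrightarrow> kv x = k (moser \<mu> P x)"
  shows "dmoser z (ham_vf V kv z) = ham_vf Z k (moser \<mu> P z)"
    and "(kv has_derivative (\<lambda>u. D (dmoser z u))) (at z within V)"
proof -
  let ?w = "moser \<mu> P z"
  have z1: "fst (fst z) \<noteq> 1" using V_fst_less[OF z] by simp
  have "((\<lambda>x. k (moser \<mu> P x)) has_derivative (\<lambda>u. D (dmoser z u))) (at z within V)"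
    using diff_chain_at[OF moser_has_derivative[OF z1] k] by (simp add: o_def has_derivative_at_withinI)
  moreover have "open {x :: R4 \<times> R4. fst x \<noteq> north}" by (intro open_Collect_neq continuous_intros)
  then have "\<forall>\<^sub>F x in at z within V. k (moser \<mu> P x) = kv x"
    unfolding eventually_at_topological using z kv by (intro exI[of _ "{x. fst x \<noteq> north}"]) auto
  ultimately show dkv: "(kv has_derivative (\<lambda>u. D (dmoser z u))) (at z within V)"
    by (rule has_derivative_transform_eventually) (use z kv in auto)
  define x where "x = ham_vf V kv z"
  have x: "x \<in> TV z" "\<And>u. u \<in> TV z \<Longrightarrow> D (dmoser z u) = symp u x"
    using ham_vf_V[OF z(1) dkv, of x] x_def by auto
  let ?N = "{w :: phase. fst w \<noteq> pos \<mu> P \<and> norm (fst w - pos \<mu> P) < 1/2}"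
  have oN: "open ?N" by (intro open_Collect_conj open_Collect_neq open_Collect_less continuous_intros)
  have "norm (snd z) * (1 - fst (fst z)) < 1/2" "snd z \<noteq> 0"
    using z(1) by (auto simp: V_def)
  then have wN: "?w \<in> ?N" using moser_dist[OF z(1), of \<mu> P] V_fst_less[OF z] by auto
  have iw: "moser_inv \<mu> P ?w = z" by (rule moser_inv_moser[OF z])
  have "D U = symp U (dmoser z x)" for U
  proof -
    define u where "u = frechet_derivative (moser_inv \<mu> P) (at ?w) U"
    have "u \<in> tangent_space V z"
      unfolding u_def using tangent_space_smooth_map[OF oN smooth_subset[OF smooth_moser_inv subset_UNIV] _ wN, of \<mu> P V U]
      moser_inv_in_V(1) iw by (auto simp: image_subset_iff)
    then have u: "u \<in> TV z" using tangent_space_V[OF z(1)] by simp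
    have "((\<lambda>w. moser \<mu> P (moser_inv \<mu> P w)) has_derivative
        (\<lambda>U. dmoser z (frechet_derivative (moser_inv \<mu> P) (at ?w) U))) (at ?w)"
      using diff_chain_at[OF smooth_has_derivative[OF smooth_moser_inv UNIV_I, of \<mu> P ?w], of "moser \<mu> P" "dmoser z"]
        moser_has_derivative[OF z1] iw by (simp add: o_def)
    then have "((\<lambda>w. w) has_derivative (\<lambda>U. dmoser z (frechet_derivative (moser_inv \<mu> P) (at ?w) U))) (at ?w)"
      by (simp add: moser_moser_inv)
    from has_derivative_unique[OF this has_derivative_ident] have "dmoser z u = U"
      unfolding u_def by metis
    then show ?thesis using x(2)[OF u] symp_dmoser[OF z u x(1)] by simp
  qed
  then show "dmoser z (ham_vf V kv z) = ham_vf Z k ?w"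
    using ham_vf_open[OF Z k] unfolding x_def by blast
qed


section \<open>The regularized Hamiltonian\<close>

fun other :: "primary \<Rightarrow> primary" where
  "other Earth = Moon" | "other Moon = Earth"

lemma pos_component:
  "pos \<mu> P $ 1 = (case P of Earth \<Rightarrow> \<mu> | Moon \<Rightarrow> \<mu> - 1)" "pos \<mu> P $ 2 = 0" "pos \<mu> P $ 3 = 0"
  by (cases P; simp)+

declare pos.simps [simp del]

lemma norm_pos_other: "norm (pos \<mu> (other P) - pos \<mu> P) = 1"
  by (cases P; simp add: norm_vec_def L2_set_def sum_3 pos_component)

lemma pos_other_neq: "pos \<mu> (other P) \<noteq> pos \<mu> P"
  using norm_pos_other[of \<mu> P] by auto

lemma primaries: "{pos \<mu> Earth, pos \<mu> Moon} = {pos \<mu> P, pos \<mu> (other P)}"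
  by (cases P) auto

lemma phase_space_iff: "z \<in> phase_space \<mu> \<longleftrightarrow> fst z \<noteq> pos \<mu> P \<and> fst z \<noteq> pos \<mu> (other P)"
  by (cases P) (auto simp: phase_space_def mem_Times_iff)

lemma open_phase_space: "open (phase_space \<mu>)"
  unfolding phase_space_def by (intro open_Times open_Diff) auto

lemma H_alt: "H \<mu> z = (snd z \<bullet> snd z) / 2 - mass \<mu> P / norm (fst z - pos \<mu> P)
    - mass \<mu> (other P) / norm (fst z - pos \<mu> (other P)) + snd z $ 1 * fst z $ 2 - snd z $ 2 * fst z $ 1"
  by (cases P) (simp_all add: H_def case_prod_unfold power2_norm_eq_inner)

lemma smooth_H: "smooth (phase_space \<mu>) (H \<mu>)"
  unfolding H_alt[where P=Earth, abs_def]
  by (intro smooth_intros open_phase_space) (auto simp: phase_space_iff[where P=Earth])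

lemma V_pos_norm: "z \<in> V \<Longrightarrow> norm (fst (moser \<mu> P z) - pos \<mu> P) < 1/2"
  by (simp only: moser_dist) (auto simp: V_def)

lemma V_away_other:
  assumes "z \<in> V" shows "fst (moser \<mu> P z) \<noteq> pos \<mu> (other P)"
  using V_pos_norm[OF assms, of \<mu> P] norm_pos_other[of \<mu> P] by auto

lemma V_moser_neq:
  assumes "z \<in> V" "fst z \<noteq> north" shows "fst (moser \<mu> P z) \<noteq> pos \<mu> P"
proof -
  have "norm (fst (moser \<mu> P z) - pos \<mu> P) > 0"
    unfolding moser_dist[OF assms(1)] using V_fst_less[OF assms] assms(1) by (auto simp: V_def)
  then show ?thesis by auto
qed

lemma moser_phase_space: "z \<in> V \<Longrightarrow> fst z \<noteq> north \<Longrightarrow> moser \<mu> P z \<in> phase_space \<mu>"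
  using V_moser_neq V_away_other phase_space_iff by metis

text \<open>This is |q - P| (H - c) in Moser's coordinates with the pole at \<xi>0 = 1 cancelled:
  |p|^2 = (1 + \<xi>0)/(1 - \<xi>0), while the factor |q - P| is |\<eta>| (1 - \<xi>0).\<close>

definition coll_ham :: "real \<Rightarrow> primary \<Rightarrow> real \<Rightarrow> R4 \<times> R4 \<Rightarrow> real" where
  "coll_ham \<mu> P c z = (let x0 = fst (fst z); x = snd (fst z); y = snd (snd z) in
     norm (snd z) * ((1 + x0) / 2 + pos \<mu> P $ 1 * x $ 2 - (1 - x0) * (x $ 1 * y $ 2 - x $ 2 * y $ 1
       + mass \<mu> (other P) * inverse (norm (pos \<mu> P + (1 - x0) *\<^sub>R y + fst (snd z) *\<^sub>R x - pos \<mu> (other P))) + c))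
     - mass \<mu> P)"

lemma coll_ham_north: "coll_ham \<mu> P c (north, \<eta>) = norm \<eta> - mass \<mu> P"
  by (simp add: coll_ham_def Let_def)

lemma coll_ham_shift: "coll_ham \<mu> P c z = coll_ham \<mu> P 0 z - c * (norm (snd z) * (1 - fst (fst z)))"
  by (simp add: coll_ham_def Let_def algebra_simps)

text \<open>An open set of the ambient R^8 containing \<open>V\<close>, so that
  \<open>coll_ham\<close> can be differentiated without reference to the constraints.\<close>

definition coll_dom :: "real \<Rightarrow> primary \<Rightarrow> (R4 \<times> R4) set" where
  "coll_dom \<mu> P = {z. snd z \<noteq> 0 \<and> pos \<mu> P + (1 - fst (fst z)) *\<^sub>R snd (snd z) + fst (snd z) *\<^sub>R snd (fst z) \<noteq> pos \<mu> (other P)}"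

lemma open_coll_dom: "open (coll_dom \<mu> P)"
  unfolding coll_dom_def by (intro open_Collect_conj open_Collect_neq continuous_intros)

lemma V_coll_dom: "V \<subseteq> coll_dom \<mu> P"
proof
  fix z assume z: "z \<in> V"
  then show "z \<in> coll_dom \<mu> P"
    using V_away_other[OF z, of \<mu> P] by (auto simp: coll_dom_def moser_alt V_def)
qed

lemma smooth_coll_ham: "smooth (coll_dom \<mu> P) (coll_ham \<mu> P c)"
  unfolding coll_ham_def[abs_def] Let_def
  by (intro smooth_intros open_coll_dom) (auto simp: coll_dom_def)

lemma coll_ham_moser:
  assumes z: "z \<in> V" "fst z \<noteq> north"
  shows "norm (fst (moser \<mu> P z) - pos \<mu> P) * (H \<mu> (moser \<mu> P z) - c) = coll_ham \<mu> P c z"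
proof -
  obtain x0 x y0 y where zz: "z = ((x0, x), (y0, y))" by (metis prod.collapse)
  have c: "x \<bullet> x = 1 - x0 * x0"
    using z zz V_iff[of x0 x y0 y] by (auto simp: power2_eq_square)
  have k: "1 - x0 > 0" using V_fst_less[OF z] zz by simp
  define r where "r = inverse (1 - x0)"
  have r: "r * (1 - x0) = 1" using k by (simp add: r_def)
  define n where "n = norm (y0, y)"
  have n: "n > 0" using z zz by (auto simp: n_def V_def)
  define a where "a = pos \<mu> P $ 1"
  define q where "q = pos \<mu> P + (1 - x0) *\<^sub>R y + y0 *\<^sub>R x"
  have m: "moser \<mu> P z = (q, - (r *\<^sub>R x))" by (simp add: moser_alt zz q_def r_def)
  have d: "norm (q - pos \<mu> P) = n * (1 - x0)"
    using moser_dist[OF z(1), of \<mu> P] m by (simp add: zz n_def)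
  have qc: "q $ 1 = a + (1 - x0) * y $ 1 + y0 * x $ 1" "q $ 2 = (1 - x0) * y $ 2 + y0 * x $ 2"
    by (simp_all add: q_def a_def pos_component(2))
  define M where "M = mass \<mu> (other P) * inverse (norm (q - pos \<mu> (other P)))"
  have kin: "(- (r *\<^sub>R x)) \<bullet> (- (r *\<^sub>R x)) = r * (1 + x0)"
  proof -
    have "(- (r *\<^sub>R x)) \<bullet> (- (r *\<^sub>R x)) = r * r * (x \<bullet> x)" by simp
    then show ?thesis using c r by algebra
  qed
  have H: "H \<mu> (moser \<mu> P z) = r * (1 + x0) / 2 - mass \<mu> P / (n * (1 - x0)) - M
      + (- (r * x $ 1)) * q $ 2 - (- (r * x $ 2)) * q $ 1"
  proof -
    have "mass \<mu> (other P) / norm (q - pos \<mu> (other P)) = M" by (simp add: M_def divide_inverse)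
    then show ?thesis
      unfolding m H_alt[of \<mu> "(q, - (r *\<^sub>R x))" P] fst_conv snd_conv kin d
      by (simp only: vector_uminus_component vector_scaleR_component real_scaleR_def)
  qed
  have mm: "n * (1 - x0) * (mass \<mu> P / (n * (1 - x0))) = mass \<mu> P" using n k by simp
  have "n * (1 - x0) * (H \<mu> (moser \<mu> P z) - c) = n * (1 - x0) * (r * (1 + x0) / 2 - M
      + (- (r * x $ 1)) * q $ 2 - (- (r * x $ 2)) * q $ 1 - c) - n * (1 - x0) * (mass \<mu> P / (n * (1 - x0)))"
    unfolding H by (simp add: algebra_simps)
  also have "\<dots> = n * ((1 + x0) / 2 + a * x $ 2 - (1 - x0) * (x $ 1 * y $ 2 - x $ 2 * y $ 1 + M + c)) - mass \<mu> P"
  proof -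
    have "(1 - x0) * (r * (1 + x0) / 2 - M + (- (r * x $ 1)) * q $ 2 - (- (r * x $ 2)) * q $ 1 - c)
        = (1 + x0) / 2 + a * x $ 2 - (1 - x0) * (x $ 1 * y $ 2 - x $ 2 * y $ 1 + M + c)"
    proof -
      have "(1 - x0) * (r * (1 + x0) / 2 - M + (- (r * x $ 1)) * q $ 2 - (- (r * x $ 2)) * q $ 1 - c)
          = (r * (1 - x0)) * ((1 + x0) / 2 - x $ 1 * q $ 2 + x $ 2 * q $ 1) - (1 - x0) * (M + c)"
        by (simp add: algebra_simps)
      also have "\<dots> = (1 + x0) / 2 - x $ 1 * q $ 2 + x $ 2 * q $ 1 - (1 - x0) * (M + c)"
        unfolding r by simp
      also have "\<dots> = (1 + x0) / 2 + a * x $ 2 - (1 - x0) * (x $ 1 * y $ 2 - x $ 2 * y $ 1 + M + c)"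
        unfolding qc by (simp add: algebra_simps)
      finally show ?thesis .
    qed
    then show ?thesis unfolding mm by (simp add: mult.assoc)
  qed
  also have "\<dots> = coll_ham \<mu> P c z"
    by (simp add: coll_ham_def Let_def zz n_def a_def M_def q_def)
  finally show ?thesis using m d by simp
qed

section \<open>The extension of the regularized Hamiltonian over the collisions\<close>

fun wproj :: "real \<Rightarrow> wpoint \<Rightarrow> real^3" where
  "wproj \<mu> (Reg z) = fst z" | "wproj \<mu> (Coll P \<eta>) = pos \<mu> P"

text \<open>The value 0 at the primaries makes the function continuous, as \<open>g\<close> is the
  distance to the primary nearby. It is the factor by which the Hamiltonian changes with the
  energy.\<close>

definition gext :: "real \<Rightarrow> (real^3 \<Rightarrow> real) \<Rightarrow> real^3 \<Rightarrow> real" where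
  "gext \<mu> g q = (if q \<in> {pos \<mu> Earth, pos \<mu> Moon} then 0 else g q)"

text \<open>An explicit candidate for the function that \<open>reg_ham\<close> selects by
  \<open>SOME\<close>; its values on collision points are those of \<open>coll_ham\<close> at the
  north pole.\<close>

fun regK :: "real \<Rightarrow> (real^3 \<Rightarrow> real) \<Rightarrow> real \<Rightarrow> wpoint \<Rightarrow> real" where
  "regK \<mu> g c (Reg z) = g (fst z) * (H \<mu> z - c)"
| "regK \<mu> g c (Coll P \<eta>) = norm \<eta> - mass \<mu> P"

lemma wproj_glue: "wproj \<mu> (glue \<mu> P z) = fst (moser \<mu> P z)"
  by (cases "fst z = north") (simp_all add: glue_def moser_alt[of \<mu> P z])

lemma glue_W: "z \<in> V \<Longrightarrow> glue \<mu> P z \<in> W \<mu>" and Reg_W: "w \<in> phase_space \<mu> \<Longrightarrow> Reg w \<in> W \<mu>"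
  by (auto simp: W_def)

text \<open>Two energies give Hamiltonians that differ by a multiple of a function bounded on
  compact sets; the variation of the action along the family is controlled through this.\<close>

lemma regK_shift:
  assumes "w \<in> W \<mu>" shows "regK \<mu> g c w = regK \<mu> g c' w + (c' - c) * gext \<mu> g (wproj \<mu> w)"
proof (cases w)
  case (Reg z)
  then have "z \<in> phase_space \<mu>" using assms moser_phase_space by (auto simp: W_def glue_def split: if_splits)
  then show ?thesis using Reg phase_space_iff[of z \<mu> Earth] by (auto simp: gext_def algebra_simps)
next
  case (Coll P \<eta>)
  then show ?thesis by (cases P) (auto simp: gext_def)
qed

lemma regularizing_near:
  assumes "regularizing \<mu> g"
  obtains N where "open N" "pos \<mu> P \<in> N" "\<forall>q\<in>N. q \<noteq> pos \<mu> P \<longrightarrow> g q = norm (q - pos \<mu> P)"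
    "pos \<mu> (other P) \<notin> N"
proof -
  have "eventually (\<lambda>q. g q = norm (q - pos \<mu> P)) (at (pos \<mu> P))"
    using assms by (auto simp: regularizing_def)
  then obtain N where "open N" "pos \<mu> P \<in> N" "\<forall>q\<in>N. q \<noteq> pos \<mu> P \<longrightarrow> g q = norm (q - pos \<mu> P)"
    unfolding eventually_at_topological by auto
  then show thesis using pos_other_neq[of \<mu> P]
    by (intro that[of "N - {pos \<mu> (other P)}"]) auto
qed

lemma smooth_g:
  assumes "regularizing \<mu> g" shows "smooth (UNIV - {pos \<mu> Earth, pos \<mu> Moon}) g"
  using assms smooth_on_open[of "UNIV - {pos \<mu> Earth, pos \<mu> Moon}" g] by (auto simp: regularizing_def open_Diff)

lemma continuous_gext:
  assumes "regularizing \<mu> g" shows "continuous_on UNIV (gext \<mu> g)"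
proof (rule continuous_at_imp_continuous_on, rule ballI)
  fix q :: "real^3"
  show "isCont (gext \<mu> g) q"
  proof (cases "q \<in> {pos \<mu> Earth, pos \<mu> Moon}")
    case True
    then obtain P where P: "q = pos \<mu> P" by blast
    obtain N where N: "open N" "pos \<mu> P \<in> N" "\<forall>q\<in>N. q \<noteq> pos \<mu> P \<longrightarrow> g q = norm (q - pos \<mu> P)"
      "pos \<mu> (other P) \<notin> N" by (rule regularizing_near[OF assms, of P])
    have "continuous_on N (\<lambda>q. norm (q - pos \<mu> P))" by (intro continuous_intros)
    moreover have "gext \<mu> g x = norm (x - pos \<mu> P)" if "x \<in> N" for x
      using N(3,4) that primaries[of \<mu> P] by (auto simp: gext_def)
    ultimately have "continuous_on N (gext \<mu> g)" by (simp cong: continuous_on_cong)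
    then show ?thesis using N P by (simp add: continuous_on_eq_continuous_at)
  next
    case False
    let ?U = "UNIV - {pos \<mu> Earth, pos \<mu> Moon}"
    have "continuous_on ?U (gext \<mu> g)"
      using smooth_continuous_on[OF smooth_g[OF assms]] by (rule continuous_on_eq) (auto simp: gext_def)
    then show ?thesis using False by (simp add: continuous_on_eq_continuous_at open_Diff)
  qed
qed

lemma smooth_regK_Reg:
  assumes "regularizing \<mu> g" shows "smooth (phase_space \<mu>) (regK \<mu> g c \<circ> Reg)"
proof -
  have "smooth (phase_space \<mu>) (\<lambda>z. g (fst z))"
    by (rule smooth_compose[OF open_phase_space _ _ _ smooth_g[OF assms]])
      (auto intro!: smooth_intros open_phase_space open_Diff simp: phase_space_iff[of _ \<mu> Earth])
  then have "smooth (phase_space \<mu>) (\<lambda>z. g (fst z) * (H \<mu> z - c))"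
    by (intro smooth_mult smooth_diff smooth_H smooth_const open_phase_space)
  then show ?thesis by (simp add: comp_def)
qed

lemma regK_glue_near_collision:
  assumes "regularizing \<mu> g"
  obtains N where "open N" "pos \<mu> P \<in> N"
    "\<forall>z\<in>V. \<forall>c. fst (moser \<mu> P z) \<in> N \<longrightarrow> regK \<mu> g c (glue \<mu> P z) = coll_ham \<mu> P c z"
proof -
  obtain N where N: "open N" "pos \<mu> P \<in> N" "\<forall>q\<in>N. q \<noteq> pos \<mu> P \<longrightarrow> g q = norm (q - pos \<mu> P)"
    "pos \<mu> (other P) \<notin> N" by (rule regularizing_near[OF assms, of P])
  have "regK \<mu> g c (glue \<mu> P z) = coll_ham \<mu> P c z" if z: "z \<in> V" "fst (moser \<mu> P z) \<in> N" for z c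
  proof (cases "fst z = north")
    case True
    then have "fst (snd z) = 0" using z(1) by (auto simp: V_def)
    with True have zz: "z = (north, (0, snd (snd z)))" by (simp add: prod_eq_iff)
    have "norm (0::real, snd (snd z)) = norm (snd (snd z))" by (simp add: norm_Pair)
    then show ?thesis
      by (subst (1 2) zz) (simp only: glue_def coll_ham_north fst_conv snd_conv if_True refl regK.simps)
  next
    case False
    then show ?thesis using coll_ham_moser[OF z(1) False, of \<mu> P c] N(3)[rule_format, OF z(2) V_moser_neq[OF z(1) False]]
      by (simp add: glue_def)
  qed
  then show thesis using N(1,2) by (intro that[of N] ballI allI impI)
qed

lemma continuous_moser_fst: "continuous_on UNIV (\<lambda>z. fst (moser \<mu> P z))"
  unfolding moser_alt fst_conv by (intro continuous_intros)

lemma moser_north: "fst z = north \<Longrightarrow> fst (moser \<mu> P z) = pos \<mu> P"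
  by (simp add: moser_alt)

text \<open>Near the collision fibre the extension is \<open>coll_ham\<close>; elsewhere it is the
  pullback by \<open>moser\<close> of the function on phase space.\<close>

lemma smooth_on_regK_glue:
  assumes "regularizing \<mu> g" shows "smooth_on V (regK \<mu> g c \<circ> glue \<mu> P)"
  unfolding smooth_on_iff
proof
  fix z assume z: "z \<in> V"
  show "\<exists>U F. open U \<and> z \<in> U \<and> smooth U F \<and> (\<forall>y\<in>V \<inter> U. F y = (regK \<mu> g c \<circ> glue \<mu> P) y)"
  proof (cases "fst z = north")
    case True
    obtain N where N: "open N" "pos \<mu> P \<in> N"
      "\<forall>z\<in>V. \<forall>c. fst (moser \<mu> P z) \<in> N \<longrightarrow> regK \<mu> g c (glue \<mu> P z) = coll_ham \<mu> P c z"
      by (rule regK_glue_near_collision[OF assms, of P])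
    let ?U = "coll_dom \<mu> P \<inter> (\<lambda>z. fst (moser \<mu> P z)) -` N"
    have "open ?U" using open_vimage[OF N(1) continuous_moser_fst] open_coll_dom by blast
    moreover have "z \<in> ?U" using V_coll_dom[of \<mu> P] z N(2) moser_north[OF True] by auto
    moreover have "smooth ?U (coll_ham \<mu> P c)" by (rule smooth_subset[OF smooth_coll_ham]) auto
    ultimately show ?thesis using N(3) by (intro exI[of _ ?U] exI[of _ "coll_ham \<mu> P c"]) auto
  next
    case False
    let ?B = "{z :: R4 \<times> R4. fst (fst z) \<noteq> 1}"
    have oB: "open ?B" by (intro open_Collect_neq continuous_intros)
    let ?U = "moser \<mu> P -` phase_space \<mu> \<inter> ?B"
    have oU: "open ?U"
      using continuous_on_open_vimage[OF oB] smooth_continuous_on[OF smooth_moser] open_phase_space by blast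
    have "smooth ?U (\<lambda>z. (regK \<mu> g c \<circ> Reg) (moser \<mu> P z))"
      by (rule smooth_compose[OF oU open_phase_space _ smooth_subset[OF smooth_moser] smooth_regK_Reg[OF assms]]) auto
    moreover have "z \<in> ?U" using moser_phase_space[OF z False] V_fst_less[OF z False] by auto
    moreover have "glue \<mu> P y = Reg (moser \<mu> P y)" if "y \<in> ?U" for y using that by (auto simp: glue_def)
    ultimately show ?thesis using oU
      by (intro exI[of _ ?U] exI[of _ "\<lambda>z. (regK \<mu> g c \<circ> Reg) (moser \<mu> P z)"]) auto
  qed
qed

lemma smooth_on_continuous: "smooth_on S f \<Longrightarrow> continuous_on S f"
  unfolding continuous_on_eq_continuous_within
proof
  fix x assume f: "smooth_on S f" and x: "x \<in> S"
  obtain U F where U: "open U" "x \<in> U" "smooth U F" "\<forall>y\<in>S \<inter> U. F y = f y" by (rule smooth_onE[OF f x])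
  have "continuous (at x within S) F"
    using smooth_continuous_on[OF U(3)] U(1,2) by (simp add: continuous_on_eq_continuous_at continuous_at_imp_continuous_at_within)
  moreover obtain d where "0 < d" "ball x d \<subseteq> U" using U open_contains_ball by blast
  ultimately show "continuous (at x within S) f"
    using U(4) x by (intro continuous_transform_within[of x S F d f]) (auto simp: dist_commute subset_eq)
qed

text \<open>Density of the phase space in \<open>W\<close>, in the form in which
  \<open>reg_ham_eq\<close> consumes it.\<close>

lemma collision_limit:
  assumes z: "z \<in> V" "fst z = north"
  obtains c where "continuous (at 0) c" "c 0 = z" "\<forall>\<^sub>F t in at (0::real). c t \<in> V \<and> fst (c t) \<noteq> north"
proof -
  define y where "y = snd (snd z)"
  have zz: "z = ((1, 0), (0, y))" using z by (auto simp: V_def y_def prod_eq_iff)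
  have y: "y \<noteq> 0" using z zz by (auto simp: V_def zero_prod_def)
  \<comment> \<open>The curve tilts \<xi> away from the north pole in the direction of \<eta>. It
    leaves T*S^3, and \<open>sphere_ret\<close> brings it back without making the tilt
    vanish.\<close>
  define k :: "real \<Rightarrow> R4 \<times> R4" where "k t = ((1, t *\<^sub>R y), (0, y))" for t
  define c where "c t = sphere_ret (k t)" for t
  let ?N = "{z. fst z \<noteq> 0 \<and> sphere_ret z \<in> V}"
  have k: "isCont k 0" unfolding k_def by (intro continuous_intros)
  have k0: "k 0 = z" by (simp add: k_def zz)
  have zN: "z \<in> ?N" using z(1) V_fst_nonzero[OF z(1)] by (simp add: sphere_ret_id)
  have "isCont sphere_ret (k 0)"
  proof -
    have "continuous_on ?N sphere_ret"
      by (rule smooth_continuous_on[OF smooth_subset[OF smooth_sphere_ret]]) auto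
    then show ?thesis unfolding k0 continuous_on_eq_continuous_at[OF V_retract_nbhd] using zN by (rule bspec)
  qed
  then have "isCont c 0" unfolding c_def using isCont_o2[OF k] by blast
  moreover have "c 0 = z" using k0 z by (simp add: c_def sphere_ret_id)
  moreover have "\<forall>\<^sub>F t in at 0. k t \<in> ?N"
    using topological_tendstoD[OF k[unfolded isCont_def] V_retract_nbhd] zN k0 by simp
  then have "\<forall>\<^sub>F t in at 0. c t \<in> V \<and> fst (c t) \<noteq> north"
    using eventually_neq_at_within[of 0 0 UNIV]
  proof eventually_elim
    case (elim t)
    have "snd (fst (c t)) \<noteq> 0" using y elim(2) by (simp add: c_def sphere_ret_def k_def Let_def zero_prod_def)
    then show ?case using elim by (auto simp: c_def)
  qed
  ultimately show thesis by (rule that)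
qed

text \<open>Both functions are continuous on the charts and agree on the dense phase space, so the
  choice made by \<open>SOME\<close> has no influence on \<open>W\<close>.\<close>

lemma reg_ham_eq:
  assumes g: "regularizing \<mu> g" and w: "w \<in> W \<mu>"
  shows "reg_ham \<mu> g c w = regK \<mu> g c w"
proof -
  let ?Q = "\<lambda>K. smooth_fun_W \<mu> K \<and> (\<forall>z\<in>phase_space \<mu>. K (Reg z) = g (fst z) * (H \<mu> z - c))"
  have "?Q (regK \<mu> g c)"
    using smooth_imp_smooth_on[OF open_phase_space smooth_regK_Reg[OF g] subset_refl] smooth_on_regK_glue[OF g]
    by (simp add: smooth_fun_W_def)
  then have Q: "?Q (reg_ham \<mu> g c)" unfolding reg_ham_def by (rule someI[of ?Q])
  let ?K = "reg_ham \<mu> g c"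
  have R: "?K (Reg z) = regK \<mu> g c (Reg z)" if "z \<in> phase_space \<mu>" for z using Q that by simp
  have "?K (glue \<mu> P z) = regK \<mu> g c (glue \<mu> P z)" if z: "z \<in> V" for z P
  proof (cases "fst z = north")
    case False
    then show ?thesis using R[OF moser_phase_space[OF z False, of \<mu> P]] by (simp add: glue_def)
  next
    case True
    obtain k where k: "continuous (at 0) k" "k 0 = z" "\<forall>\<^sub>F t in at (0::real). k t \<in> V \<and> fst (k t) \<noteq> north"
      by (rule collision_limit[OF z True])
    have lim: "((\<lambda>t. f (k t)) \<longlongrightarrow> f z) (at 0)" if "continuous_on V f" for f :: "_ \<Rightarrow> real"
    proof -
      have 1: "(k \<longlongrightarrow> z) (at 0)" using k(1,2) by (simp add: isCont_def)
      have 2: "(f \<longlongrightarrow> f z) (at z within V)" using that z by (simp add: continuous_on_def)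
      have "filterlim k (at z within V) (at 0)"
        unfolding filterlim_at using 1 k(3) True by (auto elim: eventually_mono)
      from filterlim_compose[OF 2 this] show ?thesis .
    qed
    have "((\<lambda>t. (?K \<circ> glue \<mu> P) (k t)) \<longlongrightarrow> (?K \<circ> glue \<mu> P) z) (at 0)"
    proof (intro lim smooth_on_continuous)
      show "smooth_on V (?K \<circ> glue \<mu> P)" using Q unfolding smooth_fun_W_def by blast
    qed
    moreover have "\<forall>\<^sub>F t in at 0. (?K \<circ> glue \<mu> P) (k t) = (regK \<mu> g c \<circ> glue \<mu> P) (k t)"
      using k(3)
    proof eventually_elim
      case (elim t)
      then show ?case using R[OF moser_phase_space[of "k t" \<mu> P]] by (simp add: glue_def)
    qed
    ultimately have "((\<lambda>t. (regK \<mu> g c \<circ> glue \<mu> P) (k t)) \<longlongrightarrow> (?K \<circ> glue \<mu> P) z) (at 0)"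
      by (rule Lim_transform_eventually)
    moreover have "((\<lambda>t. (regK \<mu> g c \<circ> glue \<mu> P) (k t)) \<longlongrightarrow> (regK \<mu> g c \<circ> glue \<mu> P) z) (at 0)"
      by (intro lim smooth_on_continuous smooth_on_regK_glue[OF g])
    ultimately show ?thesis using tendsto_unique[OF at_neq_bot] by force
  qed
  with R w show ?thesis by (auto simp: W_def)
qed


section \<open>Smooth families of loops in the regularized phase space\<close>

fun un_Reg :: "wpoint \<Rightarrow> phase" where
  "un_Reg (Reg z) = z" | "un_Reg (Coll P \<eta>) = 0"

text \<open>Together with \<open>un_Reg\<close> a canonical left inverse of the inclusion into
  \<open>W\<close>. Any local lift of a map into a piece must coincide with it, so derivatives of
  lifts can be written down without choosing one. Off the image of the piece the values are
  arbitrary.\<close>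

fun un_glue :: "real \<Rightarrow> primary \<Rightarrow> wpoint \<Rightarrow> R4 \<times> R4" where
  "un_glue \<mu> P (Reg z) = moser_inv \<mu> P z" | "un_glue \<mu> P (Coll Q \<eta>) = (north, (0, \<eta>))"

lemma un_glue_glue: "z \<in> V \<Longrightarrow> un_glue \<mu> P (glue \<mu> P z) = z"
  by (auto simp: glue_def moser_inv_moser V_def prod_eq_iff)

lemma glue_Reg_iff: "glue \<mu> P z = Reg w \<longleftrightarrow> fst z \<noteq> north \<and> w = moser \<mu> P z"
  and glue_Coll_iff: "glue \<mu> P z = Coll P' \<eta> \<longleftrightarrow> fst z = north \<and> P' = P \<and> \<eta> = snd (snd z)"
  by (auto simp: glue_def)

definition reg_lift :: "real \<Rightarrow> ('a::euclidean_space \<Rightarrow> wpoint) \<Rightarrow> 'a set \<Rightarrow> bool" where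
  "reg_lift \<mu> \<Gamma> N \<longleftrightarrow> open N \<and> smooth N (\<lambda>y. un_Reg (\<Gamma> y)) \<and>
     (\<forall>y\<in>N. un_Reg (\<Gamma> y) \<in> phase_space \<mu> \<and> \<Gamma> y = Reg (un_Reg (\<Gamma> y)))"

definition coll_lift :: "real \<Rightarrow> primary \<Rightarrow> ('a::euclidean_space \<Rightarrow> wpoint) \<Rightarrow> 'a set \<Rightarrow> bool" where
  "coll_lift \<mu> P \<Gamma> N \<longleftrightarrow> open N \<and> smooth N (\<lambda>y. un_glue \<mu> P (\<Gamma> y)) \<and>
     (\<forall>y\<in>N. un_glue \<mu> P (\<Gamma> y) \<in> V \<and> \<Gamma> y = glue \<mu> P (un_glue \<mu> P (\<Gamma> y)))"

definition liftable :: "real \<Rightarrow> ('a::euclidean_space \<Rightarrow> wpoint) \<Rightarrow> 'a \<Rightarrow> bool" where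
  "liftable \<mu> \<Gamma> x \<longleftrightarrow> (\<exists>N. x \<in> N \<and> reg_lift \<mu> \<Gamma> N) \<or> (\<exists>P N. x \<in> N \<and> coll_lift \<mu> P \<Gamma> N)"

lemma reg_liftI:
  assumes "open N" "smooth N h" "\<And>y. y \<in> N \<Longrightarrow> h y \<in> phase_space \<mu> \<and> \<Gamma> y = Reg (h y)"
  shows "reg_lift \<mu> \<Gamma> N"
proof -
  have "smooth N (\<lambda>y. un_Reg (\<Gamma> y))"
    by (rule smooth_cong[OF assms(1) _ assms(2)]) (use assms(3) in simp)
  then show ?thesis using assms unfolding reg_lift_def by simp
qed

lemma coll_liftI:
  assumes "open N" "smooth N h" "\<And>y. y \<in> N \<Longrightarrow> h y \<in> V \<and> \<Gamma> y = glue \<mu> P (h y)"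
  shows "coll_lift \<mu> P \<Gamma> N"
proof -
  have "smooth N (\<lambda>y. un_glue \<mu> P (\<Gamma> y))"
    by (rule smooth_cong[OF assms(1) _ assms(2)]) (use assms(3) un_glue_glue in simp)
  then show ?thesis using assms un_glue_glue unfolding coll_lift_def by simp
qed

text \<open>The domain \<open>D\<close> of a family, a half-open strip, is not open. Reparametrizing
  into an open \<open>D'\<close> inside it turns relative smoothness into
  \<open>smooth\<close>.\<close>

lemma smooth_lift_at_compose:
  assumes L: "smooth_lift_at \<iota> Z D f (\<phi> x)" and Q: "open Q" "x \<in> Q" and \<phi>: "smooth Q \<phi>" "\<phi> ` Q \<subseteq> D"
    and D: "open D'" "\<phi> ` Q \<subseteq> D'" "D' \<subseteq> D"
  obtains N h where "open N" "x \<in> N" "smooth N h" "\<forall>y\<in>N. h y \<in> Z \<and> f (\<phi> y) = \<iota> (h y)"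
proof -
  from L obtain U h where U: "open U" "\<phi> x \<in> U" "smooth_on (D \<inter> U) h" "\<forall>y\<in>D \<inter> U. h y \<in> Z \<and> f y = \<iota> (h y)"
    unfolding smooth_lift_at_def by (elim exE conjE)
  have oDU: "open (D' \<inter> U)" using D(1) U(1) by blast
  have "smooth_on (D' \<inter> U) h" by (rule smooth_on_subset[OF U(3)]) (use D(3) in blast)
  then have sh: "smooth (D' \<inter> U) h" by (rule iffD1[OF smooth_on_open[OF oDU]])
  have oN: "open (\<phi> -` U \<inter> Q)"
    using continuous_on_open_vimage[OF Q(1)] smooth_continuous_on[OF \<phi>(1)] U(1) by blast
  show thesis
  proof (rule that[of "\<phi> -` U \<inter> Q" "\<lambda>y. h (\<phi> y)"])
    show "smooth (\<phi> -` U \<inter> Q) (\<lambda>y. h (\<phi> y))"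
      by (rule smooth_compose[OF oN oDU _ smooth_subset[OF \<phi>(1)] sh]) (use D(2) in auto)
  qed (use oN Q U D in auto)
qed

lemma smooth_map_W_liftable:
  assumes f: "smooth_map_W \<mu> D f" and Q: "open Q" "x \<in> Q" and \<phi>: "smooth Q \<phi>"
    and D: "open D'" "\<phi> ` Q \<subseteq> D'" "D' \<subseteq> D"
  shows "liftable \<mu> (\<lambda>y. f (\<phi> y)) x"
proof -
  have \<phi>D: "\<phi> ` Q \<subseteq> D" using D by blast
  have "\<phi> x \<in> D" using Q \<phi>D by blast
  with f consider "smooth_lift_at Reg (phase_space \<mu>) D f (\<phi> x)"
    | P where "smooth_lift_at (glue \<mu> P) V D f (\<phi> x)"
    unfolding smooth_map_W_def by auto
  then show ?thesis
  proof cases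
    case 1
    obtain N h where N: "open N" "x \<in> N" "smooth N h" "\<forall>y\<in>N. h y \<in> phase_space \<mu> \<and> f (\<phi> y) = Reg (h y)"
      by (rule smooth_lift_at_compose[OF 1 Q \<phi> \<phi>D D])
    have "reg_lift \<mu> (\<lambda>y. f (\<phi> y)) N" by (rule reg_liftI[OF N(1,3)]) (use N(4) in simp)
    then show ?thesis unfolding liftable_def using N(2) by (intro disjI1 exI[of _ N]) simp
  next
    case 2
    obtain N h where N: "open N" "x \<in> N" "smooth N h" "\<forall>y\<in>N. h y \<in> V \<and> f (\<phi> y) = glue \<mu> P (h y)"
      by (rule smooth_lift_at_compose[OF 2 Q \<phi> \<phi>D D])
    have "coll_lift \<mu> P (\<lambda>y. f (\<phi> y)) N" by (rule coll_liftI[OF N(1,3)]) (use N(4) in simp)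
    then show ?thesis unfolding liftable_def using N(2) by (intro disjI2 exI[of _ P] exI[of _ N]) simp
  qed
qed

lemma coll_lift_imp_reg_lift:
  assumes "coll_lift \<mu> P \<Gamma> N"
  shows "reg_lift \<mu> \<Gamma> {y \<in> N. fst (un_glue \<mu> P (\<Gamma> y)) \<noteq> north}"
proof -
  let ?h = "\<lambda>y. un_glue \<mu> P (\<Gamma> y)"
  let ?M = "{y \<in> N. fst (?h y) \<noteq> north}"
  have N: "open N" "smooth N ?h" "\<forall>y\<in>N. ?h y \<in> V \<and> \<Gamma> y = glue \<mu> P (?h y)"
    using assms unfolding coll_lift_def by auto
  have "open ((\<lambda>y. fst (?h y)) -` (-{north}) \<inter> N)"
    using continuous_on_open_vimage[OF N(1), of "\<lambda>y. fst (?h y)"] smooth_continuous_on[OF N(2)]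
    by (auto intro!: continuous_on_fst)
  moreover have "(\<lambda>y. fst (?h y)) -` (-{north}) \<inter> N = ?M" by auto
  ultimately have oM: "open ?M" by simp
  have sm: "smooth ?M (\<lambda>y. moser \<mu> P (?h y))"
  proof (rule smooth_compose[OF oM _ _ smooth_subset[OF N(2)] smooth_moser])
    show "open {z :: R4 \<times> R4. fst (fst z) \<noteq> 1}" by (intro open_Collect_neq continuous_intros)
    show "?h ` ?M \<subseteq> {z. fst (fst z) \<noteq> 1}" using V_fst_less N(3) by fastforce
  qed auto
  show ?thesis
  proof (rule reg_liftI[OF oM sm])
    fix y assume "y \<in> ?M"
    then have y: "y \<in> N" "?h y \<in> V" "fst (?h y) \<noteq> north" "\<Gamma> y = glue \<mu> P (?h y)" using N(3) by auto
    have "\<Gamma> y = Reg (moser \<mu> P (?h y))" by (subst y(4)) (simp add: glue_def y(3))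
    then show "moser \<mu> P (?h y) \<in> phase_space \<mu> \<and> \<Gamma> y = Reg (moser \<mu> P (?h y))"
      using moser_phase_space[OF y(2,3)] by simp
  qed
qed

text \<open>A lift into a copy of \<open>V\<close> at a noncollision point can be pushed down by
  \<open>moser\<close> after shrinking the neighbourhood; so one may always work in the piece
  suggested by the normal form of the point.\<close>

lemma liftable_Reg:
  assumes "liftable \<mu> \<Gamma> x" "\<Gamma> x = Reg w"
  obtains N where "x \<in> N" "reg_lift \<mu> \<Gamma> N"
proof -
  from assms(1) consider N where "x \<in> N" "reg_lift \<mu> \<Gamma> N" | P N where "x \<in> N" "coll_lift \<mu> P \<Gamma> N"
    unfolding liftable_def by auto
  then show thesis
  proof cases
    case 2
    then have "\<Gamma> x = glue \<mu> P (un_glue \<mu> P (\<Gamma> x))" by (simp add: coll_lift_def)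
    then have "fst (un_glue \<mu> P (\<Gamma> x)) \<noteq> north" using assms(2) glue_Reg_iff by metis
    then show thesis
      by (intro that[of "{y \<in> N. fst (un_glue \<mu> P (\<Gamma> y)) \<noteq> north}"] coll_lift_imp_reg_lift 2(2)) (simp add: 2(1))
  qed (rule that)
qed

lemma liftable_Coll:
  assumes "liftable \<mu> \<Gamma> x" "\<Gamma> x = Coll P \<eta>"
  obtains N where "x \<in> N" "coll_lift \<mu> P \<Gamma> N"
proof -
  from assms(1) consider N where "x \<in> N" "reg_lift \<mu> \<Gamma> N" | P' N where "x \<in> N" "coll_lift \<mu> P' \<Gamma> N"
    unfolding liftable_def by auto
  then show thesis
  proof cases
    case 1
    then have "\<Gamma> x = Reg (un_Reg (\<Gamma> x))" by (simp add: reg_lift_def)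
    then show thesis using assms(2) by simp
  next
    case 2
    then have "\<Gamma> x = glue \<mu> P' (un_glue \<mu> P' (\<Gamma> x))" by (simp add: coll_lift_def)
    then have "P' = P" using assms(2) glue_Coll_iff by metis
    with 2 that show thesis by simp
  qed
qed

text \<open>The pullback of the one-form \<open>\<omega>(X, \<cdot>)\<close> along \<open>\<Gamma>\<close>, evaluated at \<open>v\<close>.\<close>

definition pull :: "real \<Rightarrow> (phase \<Rightarrow> phase) \<Rightarrow> (primary \<Rightarrow> R4 \<times> R4 \<Rightarrow> R4 \<times> R4) \<Rightarrow>
    ('a::euclidean_space \<Rightarrow> wpoint) \<Rightarrow> 'a \<Rightarrow> 'a \<Rightarrow> real" where
  "pull \<mu> XA XV \<Gamma> v x = (case \<Gamma> x of
     Reg w \<Rightarrow> symp (XA w) (frechet_derivative (\<lambda>y. un_Reg (\<Gamma> y)) (at x) v)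
   | Coll P \<eta> \<Rightarrow> symp (XV P (north, (0, \<eta>))) (frechet_derivative (\<lambda>y. un_glue \<mu> P (\<Gamma> y)) (at x) v))"

text \<open>Common format for the field from the contact hypothesis and for the radial field:
  domains as plain sets in the charts, with \<open>TV\<close> and \<open>dmoser\<close> in place of
  abstract tangent spaces and derivatives.\<close>

definition liouville_field ::
  "real \<Rightarrow> phase set \<Rightarrow> (primary \<Rightarrow> (R4 \<times> R4) set) \<Rightarrow> (phase \<Rightarrow> phase) \<Rightarrow> (primary \<Rightarrow> R4 \<times> R4 \<Rightarrow> R4 \<times> R4) \<Rightarrow> bool"
  where
  "liouville_field \<mu> A B XA XV \<longleftrightarrow> open A \<and> A \<subseteq> phase_space \<mu> \<and> smooth_on A XA \<and> liouville_on A XA \<and>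
     (\<forall>P. openin (top_of_set V) (B P) \<and> smooth_on (B P) (XV P) \<and> liouville_on (B P) (XV P) \<and>
        (\<forall>z\<in>B P. XV P z \<in> TV z \<and>
           (fst z \<noteq> north \<longrightarrow> moser \<mu> P z \<in> A \<and> dmoser z (XV P z) = XA (moser \<mu> P z))))"

lemma frechet_derivative_cong:
  assumes "open N" "x \<in> N" "\<And>y. y \<in> N \<Longrightarrow> f y = g y"
  shows "frechet_derivative f (at x) = frechet_derivative g (at x)"
proof -
  have "(f has_derivative D) (at x) \<longleftrightarrow> (g has_derivative D) (at x)" for D
    using assms has_derivative_transform_within_open[of f D x UNIV N g]
      has_derivative_transform_within_open[of g D x UNIV N f] by auto
  then show ?thesis unfolding frechet_derivative_def by simp
qed

text \<open>\<open>liouville_strip\<close> transferred to \<open>W\<close>. The delicate point is a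
  collision: \<open>pull\<close> is evaluated there in Moser's chart but in phase space at
  neighbouring points, and the two expressions agree because \<open>dmoser\<close> is symplectic and
  relates the fields.\<close>

lemma pull_variation:
  fixes \<Gamma> :: "real \<times> real \<Rightarrow> wpoint"
  assumes L: "liouville_field \<mu> A B XA XV" and lift: "liftable \<mu> \<Gamma> x"
    and A: "\<And>w. \<Gamma> x = Reg w \<Longrightarrow> w \<in> A" and B: "\<And>P \<eta>. \<Gamma> x = Coll P \<eta> \<Longrightarrow> (north, (0, \<eta>)) \<in> B P"
  obtains N where "open N" "x \<in> N" "\<forall>v. smooth N (pull \<mu> XA XV \<Gamma> v)"
    "frechet_derivative (pull \<mu> XA XV \<Gamma> (0, 1)) (at x) (1, 0) -
     frechet_derivative (pull \<mu> XA XV \<Gamma> (1, 0)) (at x) (0, 1) =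
     (case \<Gamma> x of
       Reg w \<Rightarrow> symp (frechet_derivative (\<lambda>y. un_Reg (\<Gamma> y)) (at x) (1, 0))
                 (frechet_derivative (\<lambda>y. un_Reg (\<Gamma> y)) (at x) (0, 1))
     | Coll P \<eta> \<Rightarrow> symp (frechet_derivative (\<lambda>y. un_glue \<mu> P (\<Gamma> y)) (at x) (1, 0))
                 (frechet_derivative (\<lambda>y. un_glue \<mu> P (\<Gamma> y)) (at x) (0, 1)))"
proof -
  note outer = that
  have main: thesis if M: "open M" "x \<in> M" "smooth M h" "h ` M \<subseteq> Z" and X: "smooth_on Z X" "liouville_on Z X"
    and eq: "\<And>y v. y \<in> M \<Longrightarrow> pull \<mu> XA XV \<Gamma> v y = symp (X (h y)) (frechet_derivative h (at y) v)"
    and case_eq: "symp (frechet_derivative h (at x) (1, 0)) (frechet_derivative h (at x) (0, 1)) =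
      (case \<Gamma> x of
       Reg w \<Rightarrow> symp (frechet_derivative (\<lambda>y. un_Reg (\<Gamma> y)) (at x) (1, 0))
                 (frechet_derivative (\<lambda>y. un_Reg (\<Gamma> y)) (at x) (0, 1))
     | Coll P \<eta> \<Rightarrow> symp (frechet_derivative (\<lambda>y. un_glue \<mu> P (\<Gamma> y)) (at x) (1, 0))
                 (frechet_derivative (\<lambda>y. un_glue \<mu> P (\<Gamma> y)) (at x) (0, 1)))"
    for M h Z and X :: "'v::euclidean_space \<times> 'v \<Rightarrow> 'v \<times> 'v"
  proof -
    have sm: "smooth M (pull \<mu> XA XV \<Gamma> v)" for v
      by (rule smooth_cong[OF M(1) _ liouville_strip(1)[OF M(1,3,4) X]]) (simp add: eq)
    have fd: "frechet_derivative (pull \<mu> XA XV \<Gamma> v) (at x) =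
        frechet_derivative (\<lambda>y. symp (X (h y)) (frechet_derivative h (at y) v)) (at x)" for v
      by (rule frechet_derivative_cong[OF M(1,2)]) (rule eq)
    show thesis
      by (rule outer[OF M(1,2)]) (simp add: sm, unfold fd liouville_strip(2)[OF M(1,3,4) X M(2)] case_eq, rule refl)
  qed
  have LA: "open A" "A \<subseteq> phase_space \<mu>" "smooth_on A XA" "liouville_on A XA"
    and LB: "\<And>P. openin (top_of_set V) (B P)" "\<And>P. smooth_on (B P) (XV P)" "\<And>P. liouville_on (B P) (XV P)"
      "\<And>P z. z \<in> B P \<Longrightarrow> XV P z \<in> TV z"
      "\<And>P z. z \<in> B P \<Longrightarrow> fst z \<noteq> north \<Longrightarrow> moser \<mu> P z \<in> A \<and> dmoser z (XV P z) = XA (moser \<mu> P z)"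
    using L unfolding liouville_field_def by auto
  show thesis
  proof (cases "\<Gamma> x")
    case (Reg w)
    obtain N where N: "x \<in> N" "reg_lift \<mu> \<Gamma> N" by (rule liftable_Reg[OF lift Reg])
    let ?h = "\<lambda>y. un_Reg (\<Gamma> y)"
    have oN: "open N" and sh: "smooth N ?h" and hN: "\<And>y. y \<in> N \<Longrightarrow> \<Gamma> y = Reg (?h y)"
      using N(2) unfolding reg_lift_def by auto
    let ?M = "?h -` A \<inter> N"
    have oM: "open ?M"
      using continuous_on_open_vimage[OF oN] smooth_continuous_on[OF sh] LA(1) by blast
    show thesis
    proof (rule main[OF oM _ smooth_subset[OF sh] _ LA(3,4)])
      show "x \<in> ?M" using N(1) A[OF Reg] Reg by simp
      fix y v assume "y \<in> ?M"
      then have G: "\<Gamma> y = Reg (?h y)" using hN by blast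
      show "pull \<mu> XA XV \<Gamma> v y = symp (XA (?h y)) (frechet_derivative ?h (at y) v)"
        unfolding pull_def by (subst G) simp
    qed (use Reg in auto)
  next
    case (Coll P \<eta>)
    obtain N where N: "x \<in> N" "coll_lift \<mu> P \<Gamma> N" by (rule liftable_Coll[OF lift Coll])
    let ?h = "\<lambda>y. un_glue \<mu> P (\<Gamma> y)"
    have oN: "open N" and sh: "smooth N ?h" and hV: "\<And>y. y \<in> N \<Longrightarrow> ?h y \<in> V"
      and hN: "\<And>y. y \<in> N \<Longrightarrow> \<Gamma> y = glue \<mu> P (?h y)"
      using N(2) unfolding coll_lift_def by auto
    obtain B' where B': "open B'" "B P = V \<inter> B'" using LB(1)[of P] unfolding openin_open by auto
    let ?M = "?h -` B' \<inter> N"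
    have oM: "open ?M"
      using continuous_on_open_vimage[OF oN] smooth_continuous_on[OF sh] B'(1) by blast
    have MB: "?h ` ?M \<subseteq> B P" unfolding B'(2) using hV by blast
    show thesis
    proof (rule main[OF oM _ smooth_subset[OF sh] MB LB(2,3)])
      show "x \<in> ?M" using N(1) B[OF Coll] B'(2) Coll by simp
      fix y v assume y: "y \<in> ?M"
      then have yN: "y \<in> N" and yB: "?h y \<in> B P" using MB by auto
      show "pull \<mu> XA XV \<Gamma> v y = symp (XV P (?h y)) (frechet_derivative ?h (at y) v)"
      proof (cases "fst (?h y) = north")
        case True
        then have G: "\<Gamma> y = Coll P (snd (snd (?h y)))" using hN[OF yN] glue_Coll_iff by metis
        have "?h y = (north, (0, snd (snd (?h y))))" by (subst (1) G) simp
        then show ?thesis unfolding pull_def by (subst G) simp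
      next
        case False
        \<comment> \<open>The neighbour of a collision that is itself regular: its phase space lift
          is \<open>moser\<close> of the lift to \<open>V\<close>, and the chain rule plus
          \<open>symp_dmoser\<close> give the chart expression.\<close>
        let ?M' = "{y \<in> N. fst (?h y) \<noteq> north}"
        have R: "reg_lift \<mu> \<Gamma> ?M'" by (rule coll_lift_imp_reg_lift[OF N(2)])
        have G: "\<Gamma> y' = Reg (moser \<mu> P (?h y'))" if "y' \<in> ?M'" for y'
          using hN[of y'] that glue_Reg_iff[of \<mu> P "?h y'"] by auto
        have yM': "y \<in> ?M'" using yN False by simp
        have "frechet_derivative (\<lambda>y. un_Reg (\<Gamma> y)) (at y) = frechet_derivative (\<lambda>y. moser \<mu> P (?h y)) (at y)"
        proof (rule frechet_derivative_cong[of ?M' y])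
          show "open ?M'" using R unfolding reg_lift_def by blast
          show "un_Reg (\<Gamma> y') = moser \<mu> P (?h y')" if "y' \<in> ?M'" for y' by (subst G[OF that]) simp
        qed (rule yM')
        moreover have "fst (fst (?h y)) \<noteq> 1" using V_fst_less[OF hV[OF yN] False] by simp
        then have "((\<lambda>y. moser \<mu> P (?h y)) has_derivative (\<lambda>v. dmoser (?h y) (frechet_derivative ?h (at y) v))) (at y)"
          using diff_chain_at[OF smooth_has_derivative[OF sh yN] moser_has_derivative[of "?h y" \<mu> P]] by (simp add: o_def)
        ultimately have fd: "frechet_derivative (\<lambda>y. un_Reg (\<Gamma> y)) (at y) v = dmoser (?h y) (frechet_derivative ?h (at y) v)"
          using frechet_derivative_at by metis
        have "frechet_derivative ?h (at y) v \<in> TV (?h y)"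
        proof -
          have "?h ` N \<subseteq> V" using hV by blast
          from tangent_space_smooth_map[OF oN sh this yN, of v] show ?thesis
            by (simp only: tangent_space_V[OF hV[OF yN]])
        qed
        then have "symp (XA (moser \<mu> P (?h y))) (dmoser (?h y) (frechet_derivative ?h (at y) v)) =
            symp (XV P (?h y)) (frechet_derivative ?h (at y) v)"
          using symp_dmoser[OF hV[OF yN] False LB(4)[OF yB]] LB(5)[OF yB False] by metis
        moreover have "pull \<mu> XA XV \<Gamma> v y = symp (XA (moser \<mu> P (?h y))) (frechet_derivative (\<lambda>y. un_Reg (\<Gamma> y)) (at y) v)"
          unfolding pull_def by (subst G[OF yM']) simp
        ultimately show ?thesis by (simp only: fd)
      qed
    qed (use Coll in auto)
  qed
qed

section \<open>Periods along families of periodic orbits\<close>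

text \<open>Product rule at a zero of the first factor, where continuity of the second suffices. Its
  use is with \<open>gext\<close>, a norm at the collisions and thus not differentiable.\<close>

lemma has_derivative_shift_product:
  fixes c \<phi> :: "real \<Rightarrow> real"
  assumes "(c has_field_derivative c') (at s)" "isCont \<phi> s"
  shows "((\<lambda>t. (c t - c s) * \<phi> t) has_field_derivative c' * \<phi> s) (at s)"
proof -
  obtain k where k: "\<And>z. c z - c s = k z * (z - s)" "isCont k s" "k s = c'"
    using assms(1) unfolding CARAT_DERIV by blast
  show ?thesis unfolding CARAT_DERIV
    using k assms(2) by (intro exI[of _ "\<lambda>t. k t * \<phi> t"]) (auto intro: continuous_mult)
qed

text \<open>The energy identity \<open>K\<^sub>s(\<Gamma>(s', u)) = (c(s') - c(s)) G\<close>, valid since \<open>\<Gamma>(s', \<cdot>)\<close> lies in the zero level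
  of \<open>K\<^sub>s\<^sub>'\<close>, differentiated at \<open>s' = s\<close>.\<close>

lemma energy_variation:
  fixes h :: "real \<times> real \<Rightarrow> 'v::euclidean_space \<times> 'v"
  assumes N: "open N" "(s, u) \<in> N" and h: "smooth N h" "h ` N \<subseteq> Z" and K: "(K has_derivative D) (at (h (s, u)) within Z)"
    and eq: "\<And>s'. (s', u) \<in> N \<Longrightarrow> K (h (s', u)) = (c s' - c s) * \<phi> s'"
    and c: "(c has_field_derivative c') (at s)" and \<phi>: "isCont \<phi> s"
  shows "D (frechet_derivative h (at (s, u)) (1, 0)) = c' * \<phi> s"
proof -
  obtain A B where AB: "open A" "open B" "(s, u) \<in> A \<times> B" "A \<times> B \<subseteq> N" by (rule open_prod_elim[OF N])
  have hd: "((\<lambda>s. h (s, u)) has_vector_derivative frechet_derivative h (at (s, u)) (1, 0)) (at s within A)"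
    by (rule has_vector_derivative_at_within[OF smooth_has_partial_derivative(1)[OF h(1) N(2)]])
  have "((\<lambda>s'. K (h (s', u))) has_vector_derivative D (frechet_derivative h (at (s, u)) (1, 0))) (at s within A)"
    by (rule has_vector_derivative_chain[OF hd K]) (use AB h in auto)
  then have 1: "((\<lambda>s'. K (h (s', u))) has_vector_derivative D (frechet_derivative h (at (s, u)) (1, 0))) (at s)"
    using at_within_open[of s A] AB by simp
  have "((\<lambda>s'. (c s' - c s) * \<phi> s') has_vector_derivative c' * \<phi> s) (at s)"
    using has_derivative_shift_product[OF c \<phi>] by (simp add: has_real_derivative_iff_has_vector_derivative)
  then have "((\<lambda>s'. K (h (s', u))) has_vector_derivative c' * \<phi> s) (at s)"
    by (rule has_vector_derivative_transform_within_open[of _ _ _ A]) (use AB eq in auto)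
  with 1 show ?thesis by (rule vector_derivative_unique_at)
qed

lemma ham_vf_cong:
  assumes "\<And>x. x \<in> Z \<Longrightarrow> K x = K' x" "z \<in> Z"
  shows "ham_vf Z K z = ham_vf Z K' z"
proof -
  have "(K has_derivative D) (at z within Z) \<longleftrightarrow> (K' has_derivative D) (at z within Z)" for D
    using assms has_derivative_transform[of z Z K K' D] has_derivative_transform[of z Z K' K D] by auto
  then have "frechet_derivative K (at z within Z) = frechet_derivative K' (at z within Z)"
    unfolding frechet_derivative_def by simp
  then show ?thesis unfolding ham_vf_def by simp
qed

section \<open>The equation of motion in the two kinds of charts\<close>

lemma has_derivative_regK_Reg:
  assumes "regularizing \<mu> g" "w \<in> phase_space \<mu>"
  shows "((regK \<mu> g c \<circ> Reg) has_derivative frechet_derivative (regK \<mu> g c \<circ> Reg) (at w)) (at w)"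
  by (rule smooth_has_derivative[OF smooth_regK_Reg[OF assms(1)] assms(2)])

lemma has_derivative_regK_glue:
  assumes "regularizing \<mu> g" "z \<in> V"
  obtains D where "((regK \<mu> g c \<circ> glue \<mu> P) has_derivative D) (at z within V)"
proof -
  obtain U F where U: "open U" "z \<in> U" "smooth U F" "\<forall>y\<in>V \<inter> U. F y = (regK \<mu> g c \<circ> glue \<mu> P) y"
    by (rule smooth_onE[OF smooth_on_regK_glue[OF assms(1)] assms(2)])
  show thesis by (rule that[OF smooth_frechet_within(1)[OF U(3,2,1) assms(2) U(4)]])
qed

text \<open>\<open>integral_curve\<close> lets the equation be witnessed in any piece; at a regular
  point a witness in \<open>V\<close> is pushed down by \<open>moser\<close>, which maps the
  Hamiltonian field to the Hamiltonian field.\<close>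

lemma solves_at_Reg:
  assumes g: "regularizing \<mu> g" and G: "\<gamma> t = Reg w"
    and sol: "solves_at Reg (phase_space \<mu>) (reg_ham \<mu> g c) \<gamma> t \<or> (\<exists>P. solves_at (glue \<mu> P) V (reg_ham \<mu> g c) \<gamma> t)"
  shows "((\<lambda>t. un_Reg (\<gamma> t)) has_vector_derivative ham_vf (phase_space \<mu>) (regK \<mu> g c \<circ> Reg) w) (at t)"
  using sol
proof
  assume "solves_at Reg (phase_space \<mu>) (reg_ham \<mu> g c) \<gamma> t"
  then obtain h where h: "\<forall>\<^sub>F r in nhds t. h r \<in> phase_space \<mu> \<and> \<gamma> r = Reg (h r)"
    "(h has_vector_derivative ham_vf (phase_space \<mu>) (reg_ham \<mu> g c \<circ> Reg) (h t)) (at t)"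
    unfolding solves_at_def by (elim exE conjE)
  from h(1) have ht: "h t \<in> phase_space \<mu>" "h t = w" using G eventually_nhds_x_imp_x by fastforce+
  have "ham_vf (phase_space \<mu>) (reg_ham \<mu> g c \<circ> Reg) w = ham_vf (phase_space \<mu>) (regK \<mu> g c \<circ> Reg) w"
    by (rule ham_vf_cong) (use ht reg_ham_eq[OF g Reg_W] in auto)
  moreover obtain S where S: "open S" "t \<in> S" "\<forall>r\<in>S. h r \<in> phase_space \<mu> \<and> \<gamma> r = Reg (h r)"
    using h(1) unfolding eventually_nhds by auto
  ultimately show ?thesis
    using has_vector_derivative_transform_within_open[OF h(2) S(1,2), of "\<lambda>t. un_Reg (\<gamma> t)"] ht by simp
next
  assume "\<exists>P. solves_at (glue \<mu> P) V (reg_ham \<mu> g c) \<gamma> t"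
  then obtain P h where h: "\<forall>\<^sub>F r in nhds t. h r \<in> V \<and> \<gamma> r = glue \<mu> P (h r)"
    "(h has_vector_derivative ham_vf V (reg_ham \<mu> g c \<circ> glue \<mu> P) (h t)) (at t)"
    unfolding solves_at_def by (elim exE conjE)
  obtain S where S: "open S" "t \<in> S" "\<forall>r\<in>S. h r \<in> V \<and> \<gamma> r = glue \<mu> P (h r)"
    using h(1) unfolding eventually_nhds by auto
  have ht: "h t \<in> V" "fst (h t) \<noteq> north" "w = moser \<mu> P (h t)"
    using S G glue_Reg_iff[of \<mu> P "h t" w] by auto
  have 1: "ham_vf V (reg_ham \<mu> g c \<circ> glue \<mu> P) (h t) = ham_vf V (regK \<mu> g c \<circ> glue \<mu> P) (h t)"
    by (rule ham_vf_cong) (use ht reg_ham_eq[OF g glue_W] in auto)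
  have wp: "moser \<mu> P (h t) \<in> phase_space \<mu>" by (rule moser_phase_space[OF ht(1,2)])
  have 2: "dmoser (h t) (ham_vf V (regK \<mu> g c \<circ> glue \<mu> P) (h t)) = ham_vf (phase_space \<mu>) (regK \<mu> g c \<circ> Reg) w"
    unfolding ht(3)
    by (rule dmoser_ham_vf(1)[OF ht(1,2) open_phase_space wp has_derivative_regK_Reg[OF g wp]]) (simp add: glue_def)
  have "fst (fst (h t)) \<noteq> 1" using V_fst_less[OF ht(1,2)] by simp
  from has_vector_derivative_chain[OF h(2) moser_has_derivative[OF this, of \<mu> P]]
  have d: "((\<lambda>r. moser \<mu> P (h r)) has_vector_derivative ham_vf (phase_space \<mu>) (regK \<mu> g c \<circ> Reg) w) (at t)"
    by (simp add: 1 2)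
  \<comment> \<open>The witness is differentiable at the single time \<open>t\<close>; continuity
    there keeps it off the collision fibre for nearby times.\<close>
  have "isCont h t" using h(2) by (rule has_vector_derivative_continuous)
  then have "((\<lambda>r. fst (h r)) \<longlongrightarrow> fst (h t)) (at t)" by (intro tendsto_fst) (simp add: isCont_def)
  then have "\<forall>\<^sub>F r in at t. fst (h r) \<noteq> north" using ht(2) by (rule tendsto_imp_eventually_ne)
  then obtain S' where S': "open S'" "t \<in> S'" "\<forall>r\<in>S'. r \<noteq> t \<longrightarrow> fst (h r) \<noteq> north"
    unfolding eventually_at_topological by auto
  show ?thesis
  proof (rule has_vector_derivative_transform_within_open[OF d])
    show "open (S \<inter> S')" "t \<in> S \<inter> S'" using S S' by auto
    fix r assume r: "r \<in> S \<inter> S'"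
    then have "fst (h r) \<noteq> north" using S' ht(2) by (cases "r = t") auto
    then show "moser \<mu> P (h r) = un_Reg (\<gamma> r)" using S(3) r by (simp add: glue_def)
  qed
qed

lemma solves_at_Coll:
  assumes g: "regularizing \<mu> g" and G: "\<gamma> t = Coll P \<eta>"
    and sol: "solves_at Reg (phase_space \<mu>) (reg_ham \<mu> g c) \<gamma> t \<or> (\<exists>P. solves_at (glue \<mu> P) V (reg_ham \<mu> g c) \<gamma> t)"
  shows "((\<lambda>t. un_glue \<mu> P (\<gamma> t)) has_vector_derivative ham_vf V (regK \<mu> g c \<circ> glue \<mu> P) (north, (0, \<eta>))) (at t)"
  using sol
proof
  assume "solves_at Reg (phase_space \<mu>) (reg_ham \<mu> g c) \<gamma> t"
  then have "\<exists>h. \<gamma> t = Reg (h t)" unfolding solves_at_def using eventually_nhds_x_imp_x by fastforce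
  then show ?thesis using G by simp
next
  assume "\<exists>P. solves_at (glue \<mu> P) V (reg_ham \<mu> g c) \<gamma> t"
  then obtain P' h where h: "\<forall>\<^sub>F r in nhds t. h r \<in> V \<and> \<gamma> r = glue \<mu> P' (h r)"
    "(h has_vector_derivative ham_vf V (reg_ham \<mu> g c \<circ> glue \<mu> P') (h t)) (at t)"
    unfolding solves_at_def by (elim exE conjE)
  obtain S where S: "open S" "t \<in> S" "\<forall>r\<in>S. h r \<in> V \<and> \<gamma> r = glue \<mu> P' (h r)"
    using h(1) unfolding eventually_nhds by auto
  have P: "P' = P" using S(2,3) G glue_Coll_iff[of \<mu> P' "h t" P \<eta>] by simp
  have un: "un_glue \<mu> P (\<gamma> r) = h r" if "r \<in> S" for r using S(3) that un_glue_glue P by simp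
  have ht: "h t = (north, (0, \<eta>))" using un[OF S(2)] G by simp
  have "ham_vf V (reg_ham \<mu> g c \<circ> glue \<mu> P) (h t) = ham_vf V (regK \<mu> g c \<circ> glue \<mu> P) (h t)"
    by (rule ham_vf_cong) (use S reg_ham_eq[OF g glue_W] in auto)
  then show ?thesis
    using has_vector_derivative_transform_within_open[OF h(2) S(1,2), of "\<lambda>t. un_glue \<mu> P (\<gamma> t)"] un ht P by simp
qed


text \<open>The Frechet derivative is unchanged under translation of the argument by (0,1).
  Periodicity is assumed on the whole plane so that translation gives an equality of
  functions.\<close>

lemma pull_periodic:
  fixes \<Gamma> :: "real \<times> real \<Rightarrow> wpoint"
  assumes "\<And>s u. \<Gamma> (s, u + 1) = \<Gamma> (s, u)"
  shows "pull \<mu> XA XV \<Gamma> v (s, u + 1) = pull \<mu> XA XV \<Gamma> v (s, u :: real)"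
proof -
  have fd: "frechet_derivative (\<lambda>y. f (\<Gamma> y)) (at (s, u + 1)) = frechet_derivative (\<lambda>y. f (\<Gamma> y)) (at (s, u))"
    for f :: "wpoint \<Rightarrow> 'c::real_normed_vector"
  proof -
    have sh: "(\<lambda>y. f (\<Gamma> (y + (0, 1)))) = (\<lambda>y. f (\<Gamma> y))"
    proof
      fix y show "f (\<Gamma> (y + (0, 1))) = f (\<Gamma> y)" using assms[of "fst y" "snd y"] by (cases y) simp
    qed
    have sh': "(\<lambda>y. f (\<Gamma> (y + (0, -1)))) = (\<lambda>y. f (\<Gamma> y))"
    proof
      fix y show "f (\<Gamma> (y + (0, -1))) = f (\<Gamma> y)" using assms[of "fst y" "snd y - 1"] by (cases y) simp
    qed
    have t: "((\<lambda>y. y + k) has_derivative (\<lambda>v. v)) (at x)" for k x :: "real \<times> real"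
      by (auto intro!: derivative_eq_intros)
    have "((\<lambda>y. f (\<Gamma> y)) has_derivative D) (at (s, u + 1)) \<longleftrightarrow> ((\<lambda>y. f (\<Gamma> y)) has_derivative D) (at (s, u))" for D
      using has_derivative_compose[OF t[of "(0, 1)" "(s, u)"], of "\<lambda>y. f (\<Gamma> y)" D]
        has_derivative_compose[OF t[of "(0, -1)" "(s, u + 1)"], of "\<lambda>y. f (\<Gamma> y)" D]
      by (auto simp: sh sh')
    then show ?thesis unfolding frechet_derivative_def by simp
  qed
  show ?thesis unfolding pull_def assms fd ..
qed

text \<open>With Gamma rescaled to period 1, a = omega(Y, tau X_K) = tau dK(Y) is at least \<delta>
  tau in modulus, and the curl of the pulled-back form is omega(d_s Gamma, tau X_K) = tau c' g, at
  most C G tau in modulus. These are the inputs of \<open>periods_bounded\<close>.\<close>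

lemma no_catastrophe:
  assumes g: "regularizing \<mu> g" and c: "smooth_on {0..1} c" and L: "liouville_field \<mu> A B XA XV"
    and s1: "s1 < 1" and \<delta>: "0 < \<delta>"
    and S: "\<And>s w. s1 < s \<Longrightarrow> s < 1 \<Longrightarrow> w \<in> S (c s) \<Longrightarrow> w \<in> W \<mu> \<and> regK \<mu> g (c s) w = 0 \<and> \<bar>gext \<mu> g (wproj \<mu> w)\<bar> \<le> G"
    and low_Reg: "\<And>s w D. s1 < s \<Longrightarrow> s < 1 \<Longrightarrow> Reg w \<in> S (c s) \<Longrightarrow>
      w \<in> A \<and> (((regK \<mu> g (c s) \<circ> Reg) has_derivative D) (at w) \<longrightarrow> \<delta> \<le> \<bar>D (XA w)\<bar>)"
    and low_Coll: "\<And>s P \<eta> D. s1 < s \<Longrightarrow> s < 1 \<Longrightarrow> Coll P \<eta> \<in> S (c s) \<Longrightarrow> (north, (0, \<eta>)) \<in> B P \<and>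
      (((regK \<mu> g (c s) \<circ> glue \<mu> P) has_derivative D) (at (north, (0, \<eta>)) within V) \<longrightarrow>
         \<delta> \<le> \<bar>D (XV P (north, (0, \<eta>)))\<bar>)"
  shows "\<not> blue_sky_catastrophe \<mu> g S c"
proof
  assume "blue_sky_catastrophe \<mu> g S c"
  then obtain \<gamma> \<tau> where fam: "periodic_orbit_family \<mu> g S c \<gamma> \<tau>" and lim: "filterlim \<tau> at_top (at_left 1)"
    unfolding blue_sky_catastrophe_def by (elim exE conjE)
  have sm: "smooth_map_W \<mu> ({0..<1} \<times> UNIV) (\<lambda>(s, t). \<gamma> s t)" and \<tau>sm: "smooth_on {0..<1} \<tau>"
    and orb: "\<And>s. 0 \<le> s \<Longrightarrow> s < 1 \<Longrightarrow> 0 < \<tau> s \<and> range (\<gamma> s) \<subseteq> S (c s) \<and>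
        integral_curve \<mu> (reg_ham \<mu> g (c s)) (\<gamma> s) \<and> (\<forall>t. \<gamma> s (t + \<tau> s) = \<gamma> s t)"
    using fam unfolding periodic_orbit_family_def by auto
  have one_in: "(1::real) \<in> {0..1}" by simp
  \<comment> \<open>\<open>c\<close> is smooth up to and including s = 1; the local extension
    \<open>F\<close> there bounds c' on a closed interval ending at 1.\<close>
  obtain U F where U: "open U" "1 \<in> U" "smooth U F" "\<forall>y\<in>{0..1} \<inter> U. F y = c y"
    by (rule smooth_onE[OF c one_in]) 
  obtain e where e: "0 < e" "cball 1 e \<subseteq> U" using U open_contains_cball by blast
  define r where "r = max (max s1 0) (1 - e)"
  have r: "r < 1" "s1 \<le> r" "0 \<le> r" using s1 e by (auto simp: r_def)
  have rU: "{r..1} \<subseteq> U" using e by (auto simp: r_def cball_def dist_real_def subset_eq)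
  have cF: "c s = F s" if "r < s" "s < 1" for s
  proof -
    have "s \<in> {r..1}" using that by simp
    then have "s \<in> {0..1} \<inter> U" using rU r by auto
    then show ?thesis using U(4) by simp
  qed
  have cd: "(c has_field_derivative frechet_derivative F (at s) 1) (at s)" if s: "s \<in> {r<..<1}" for s
  proof -
    have "s \<in> U" using s rU by auto
    from has_vector_derivative_chain[OF has_vector_derivative_id smooth_has_derivative[OF U(3) this]]
    have "(F has_vector_derivative frechet_derivative F (at s) 1) (at s)" by simp
    then have "(c has_vector_derivative frechet_derivative F (at s) 1) (at s)"
      by (rule has_vector_derivative_transform_within_open[of _ _ _ "{r<..<1}"]) (use s cF in auto)
    then show ?thesis by (simp add: has_real_derivative_iff_has_vector_derivative)
  qed
  obtain C where C: "\<And>s. s \<in> {r..1} \<Longrightarrow> \<bar>frechet_derivative F (at s) 1\<bar> \<le> C"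
  proof -
    have "continuous_on {r..1} (\<lambda>s. frechet_derivative F (at s) (1::real))"
      by (rule continuous_on_subset[OF smooth_continuous_on[OF smooth_frechet[OF U(3)]] rU])
    then have "bounded ((\<lambda>s. frechet_derivative F (at s) (1::real)) ` {r..1})"
      by (intro compact_imp_bounded compact_continuous_image) auto
    then obtain C where "\<forall>x\<in>(\<lambda>s. frechet_derivative F (at s) (1::real)) ` {r..1}. norm x \<le> C"
      unfolding bounded_iff by auto
    then show thesis by (intro that[of C]) auto
  qed
  let ?Q = "{r<..<1} \<times> (UNIV :: real set)"
  have oQ: "open ?Q" by (intro open_Times) auto
  \<comment> \<open>Time is rescaled so that every orbit has period 1. The composed form matches the
    pattern f(\<phi> y) of \<open>smooth_map_W_liftable\<close>.\<close>
  define \<Gamma> where "\<Gamma> y = (case (\<lambda>y. (fst y, \<tau> (fst y) * snd y)) y of (s, t) \<Rightarrow> \<gamma> s t)" for y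
  have \<Gamma>: "\<Gamma> (s, u) = \<gamma> s (\<tau> s * u)" for s u by (simp add: \<Gamma>_def)
  have "smooth {0<..<1} \<tau>"
    by (rule iffD1[OF smooth_on_open smooth_on_subset[OF \<tau>sm]]) auto
  then have sm\<tau>: "smooth {r<..<1} \<tau>" by (rule smooth_subset) (use r in auto)
  have "smooth ?Q (\<lambda>y. \<tau> (fst y))"
    by (rule smooth_compose[OF oQ _ _ smooth_fst[OF oQ smooth_id[OF oQ]] sm\<tau>]) auto
  then have \<phi>: "smooth ?Q (\<lambda>y. (fst y, \<tau> (fst y) * snd y))"
    by (intro smooth_Pair smooth_fst smooth_mult smooth_snd smooth_id oQ)
  have lift: "liftable \<mu> \<Gamma> x" if "x \<in> ?Q" for x
    unfolding \<Gamma>_def[abs_def]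
    by (rule smooth_map_W_liftable[OF sm oQ that \<phi> oQ]) (use r in auto)
  have in_S: "\<Gamma> (s, u) \<in> S (c s)" if "s \<in> {r<..<1}" for s u
    using orb[of s] that r unfolding \<Gamma> by (auto simp: image_subset_iff)
  have per: "\<Gamma> (s, u + 1) = \<Gamma> (s, u)" if "s \<in> {r<..<1}" for s u
    using orb[of s] that r unfolding \<Gamma> by (auto simp: distrib_left)
  \<comment> \<open>outside the strip the family is irrelevant; it is cut off to make periodicity unconditional\<close>
  define \<Gamma>' where "\<Gamma>' y = (if fst y \<in> {r<..<1} then \<Gamma> y else Coll Earth 0)" for y
  have eqG: "\<Gamma>' y = \<Gamma> y" if "y \<in> ?Q" for y using that by (auto simp: \<Gamma>'_def)
  have per': "\<Gamma>' (s, u + 1) = \<Gamma>' (s, u)" for s u using per by (simp add: \<Gamma>'_def)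
  have lift': "liftable \<mu> \<Gamma>' x" if x: "x \<in> ?Q" for x
    using lift[OF x] unfolding liftable_def
  proof (elim disjE exE conjE)
    fix N assume N: "x \<in> N" "reg_lift \<mu> \<Gamma> N"
    have "reg_lift \<mu> \<Gamma>' (N \<inter> ?Q)"
      by (rule reg_liftI[where h="\<lambda>y. un_Reg (\<Gamma> y)"])
        (use N oQ eqG smooth_subset[of N "\<lambda>y. un_Reg (\<Gamma> y)" "N \<inter> ?Q"] in \<open>auto simp: reg_lift_def\<close>)
    then show "(\<exists>N. x \<in> N \<and> reg_lift \<mu> \<Gamma>' N) \<or> (\<exists>P N. x \<in> N \<and> coll_lift \<mu> P \<Gamma>' N)"
      using N x by (intro disjI1 exI[of _ "N \<inter> ?Q"]) auto
  next
    fix P N assume N: "x \<in> N" "coll_lift \<mu> P \<Gamma> N"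
    have "coll_lift \<mu> P \<Gamma>' (N \<inter> ?Q)"
      by (rule coll_liftI[where h="\<lambda>y. un_glue \<mu> P (\<Gamma> y)"])
        (use N oQ eqG smooth_subset[of N "\<lambda>y. un_glue \<mu> P (\<Gamma> y)" "N \<inter> ?Q"] in \<open>auto simp: coll_lift_def\<close>)
    then show "(\<exists>N. x \<in> N \<and> reg_lift \<mu> \<Gamma>' N) \<or> (\<exists>P N. x \<in> N \<and> coll_lift \<mu> P \<Gamma>' N)"
      using N x by (intro disjI2 exI[of _ P] exI[of _ "N \<inter> ?Q"]) auto
  qed
  let ?p = "pull \<mu> XA XV \<Gamma>'"
  have inA: "w \<in> A" if "x \<in> ?Q" "\<Gamma>' x = Reg w" for x w
    using low_Reg[of "fst x" w] in_S[of "fst x" "snd x"] that eqG[OF that(1)] r by (auto simp: mem_Times_iff)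
  have inB: "(north, (0, \<eta>)) \<in> B P" if "x \<in> ?Q" "\<Gamma>' x = Coll P \<eta>" for x P \<eta>
    using low_Coll[of "fst x" P \<eta>] in_S[of "fst x" "snd x"] that eqG[OF that(1)] r by (auto simp: mem_Times_iff)
  have psm: "smooth ?Q (?p v)" for v
  proof (rule smooth_local)
    fix x assume x: "x \<in> ?Q"
    obtain N where N: "open N" "x \<in> N" "\<forall>v. smooth N (?p v)"
      by (rule pull_variation[OF L lift'[OF x] inA[OF x] inB[OF x]])
    then show "\<exists>N. open N \<and> x \<in> N \<and> smooth N (?p v)" 
      using N(1,2) spec[OF N(3), of v] by (intro exI[of _ N] conjI)
  qed
  have pt: "\<bar>frechet_derivative (?p (0, 1)) (at (s, u)) (1, 0) - frechet_derivative (?p (1, 0)) (at (s, u)) (0, 1)\<bar> \<le> (C * G) * \<tau> s \<and>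
      \<delta> * \<tau> s \<le> \<bar>?p (0, 1) (s, u)\<bar>" if s: "s \<in> {r<..<1}" for s u
  proof -
    have x: "(s, u) \<in> ?Q" using s by simp
    have s01: "0 \<le> s" "s < 1" "s1 < s" using s r by auto
    have \<tau>: "0 < \<tau> s" using orb s01 by simp
    have sol: "solves_at Reg (phase_space \<mu>) (reg_ham \<mu> g (c s)) (\<gamma> s) t \<or>
        (\<exists>P. solves_at (glue \<mu> P) V (reg_ham \<mu> g (c s)) (\<gamma> s) t)" for t
      using orb[OF s01(1,2)] unfolding integral_curve_def by blast
    obtain N0 where N0: "open N0" "(s, u) \<in> N0" 
      and var: "frechet_derivative (?p (0, 1)) (at (s, u)) (1, 0) -
       frechet_derivative (?p (1, 0)) (at (s, u)) (0, 1) =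
       (case \<Gamma>' (s, u) of
         Reg w \<Rightarrow> symp (frechet_derivative (\<lambda>y. un_Reg (\<Gamma>' y)) (at (s, u)) (1, 0))
                   (frechet_derivative (\<lambda>y. un_Reg (\<Gamma>' y)) (at (s, u)) (0, 1))
       | Coll P \<eta> \<Rightarrow> symp (frechet_derivative (\<lambda>y. un_glue \<mu> P (\<Gamma>' y)) (at (s, u)) (1, 0))
                   (frechet_derivative (\<lambda>y. un_glue \<mu> P (\<Gamma>' y)) (at (s, u)) (0, 1)))"
      by (rule pull_variation[OF L lift'[OF x] inA[OF x] inB[OF x]])
    have Gb: "\<bar>gext \<mu> g (wproj \<mu> (\<Gamma>' (s, u)))\<bar> \<le> G" "\<Gamma>' (s, u) \<in> S (c s)"
      using S[OF s01(3,2) in_S[OF s, of u]] eqG[OF x] in_S[OF s] by auto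
    \<comment> \<open>The two estimates for a lift \<open>h\<close> into an arbitrary piece
      \<open>Z\<close>; the cases of a regular and of a collision point then only supply the data of
      their chart.\<close>
    have final: ?thesis
      if N: "open N" "(s, u) \<in> N" "N \<subseteq> ?Q" "smooth N h" "h ` N \<subseteq> Z" "\<And>y. y \<in> N \<Longrightarrow> \<Gamma>' y = \<iota> (h y)"
        and K: "((regK \<mu> g (c s) \<circ> \<iota>) has_derivative D) (at (h (s, u)) within Z)"
        and sol: "((\<lambda>t. l (\<gamma> s t)) has_vector_derivative X) (at (\<tau> s * u))"
        and hl: "\<And>y. y \<in> N \<Longrightarrow> h y = l (\<Gamma>' y)"
        and ham: "\<And>U. U \<in> tangent_space Z (h (s, u)) \<Longrightarrow> D U = symp U X"
        and YX: "Y \<in> tangent_space Z (h (s, u))" "\<delta> \<le> \<bar>D Y\<bar>"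
        and pl: "?p (0, 1) (s, u) = symp Y (frechet_derivative h (at (s, u)) (0, 1))"
        and vr: "frechet_derivative (?p (0, 1)) (at (s, u)) (1, 0) - frechet_derivative (?p (1, 0)) (at (s, u)) (0, 1) =
          symp (frechet_derivative h (at (s, u)) (1, 0)) (frechet_derivative h (at (s, u)) (0, 1))"
        and cw: "continuous_on N (\<lambda>y. wproj \<mu> (\<Gamma>' y))"
      for h N D X Y and Z :: "('v::euclidean_space \<times> 'v) set" and \<iota> l
    proof -
      have du: "frechet_derivative h (at (s, u)) (0, 1) = \<tau> s *\<^sub>R X"
      proof -
        have "((\<lambda>u. \<tau> s * u) has_vector_derivative \<tau> s) (at u)"
          by (auto intro!: derivative_eq_intros simp: has_vector_derivative_def)
        from has_vector_derivative_chain[OF this sol[unfolded has_vector_derivative_def]]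
        have 1: "((\<lambda>u. l (\<gamma> s (\<tau> s * u))) has_vector_derivative \<tau> s *\<^sub>R X) (at u)" by simp
        obtain A B where AB: "open A" "open B" "(s, u) \<in> A \<times> B" "A \<times> B \<subseteq> N" by (rule open_prod_elim[OF N(1,2)])
        have "((\<lambda>u. h (s, u)) has_vector_derivative \<tau> s *\<^sub>R X) (at u)"
        proof (rule has_vector_derivative_transform_within_open[OF 1 AB(2)])
          show "u \<in> B" using AB by simp
          fix v assume "v \<in> B"
          then have "(s, v) \<in> N" using AB by auto
          then show "l (\<gamma> s (\<tau> s * v)) = h (s, v)" using hl[of "(s, v)"] eqG[of "(s, v)"] N(3) by (auto simp: \<Gamma>)
        qed
        with smooth_has_partial_derivative(2)[OF N(4,2)] show ?thesis by (rule vector_derivative_unique_at)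
      qed
      have ds: "frechet_derivative h (at (s, u)) (1, 0) \<in> tangent_space Z (h (s, u))"
        by (rule tangent_space_smooth_map[OF N(1,4,5,2)])
      let ?\<phi> = "\<lambda>s'. gext \<mu> g (wproj \<mu> (\<Gamma>' (s', u)))"
      have "D (frechet_derivative h (at (s, u)) (1, 0)) = frechet_derivative F (at s) 1 * ?\<phi> s"
      proof (rule energy_variation[OF N(1,2,4,5) K _ cd[OF s]])
        fix s' assume "(s', u) \<in> N"
        then have s': "(s', u) \<in> ?Q" "\<Gamma>' (s', u) = \<iota> (h (s', u))" using N by auto
        then have "s1 < s'" "s' < 1" using r by auto
        from S[OF this in_S[of s' u]] s'(1) eqG[OF s'(1)]
        have "\<Gamma>' (s', u) \<in> W \<mu>" "regK \<mu> g (c s') (\<Gamma>' (s', u)) = 0" by auto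
        then show "(regK \<mu> g (c s) \<circ> \<iota>) (h (s', u)) = (c s' - c s) * ?\<phi> s'"
          using regK_shift[of "\<Gamma>' (s', u)" \<mu> g "c s" "c s'"] s'(2) by simp
      next
        have "continuous_on N (\<lambda>y. gext \<mu> g (wproj \<mu> (\<Gamma>' y)))"
          by (rule continuous_on_compose2[OF continuous_gext[OF g] cw]) simp
        then have "isCont (\<lambda>y. gext \<mu> g (wproj \<mu> (\<Gamma>' y))) (s, u)"
          using N(1,2) by (simp add: continuous_on_eq_continuous_at)
        moreover have "isCont (\<lambda>s. (s, u)) s" by (intro continuous_intros)
        ultimately show "isCont ?\<phi> s"
          using isCont_o2[where f="\<lambda>s. (s, u)" and g="\<lambda>y. gext \<mu> g (wproj \<mu> (\<Gamma>' y))" and a=s] by simp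
      qed
      then have 1: "symp (frechet_derivative h (at (s, u)) (1, 0)) X = frechet_derivative F (at s) 1 * ?\<phi> s"
        using ham[OF ds] by simp
      have sc: "symp a (\<tau> s *\<^sub>R X) = \<tau> s * symp a X" for a by (simp add: symp_def right_diff_distrib)
      have "\<bar>frechet_derivative F (at s) 1\<bar> * \<bar>?\<phi> s\<bar> \<le> C * G"
        using C[of s] Gb(1) s by (intro mult_mono) (auto intro: order_trans[OF abs_ge_zero])
      then have "\<bar>symp (frechet_derivative h (at (s, u)) (1, 0)) X\<bar> \<le> C * G" by (simp add: 1 abs_mult)
      then have a: "\<bar>\<tau> s * symp (frechet_derivative h (at (s, u)) (1, 0)) X\<bar> \<le> (C * G) * \<tau> s"
        using \<tau> by (simp add: abs_mult mult.commute mult_right_mono)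
      have "\<bar>symp Y X\<bar> \<ge> \<delta>" using ham[OF YX(1)] YX(2) by simp
      then have b: "\<delta> * \<tau> s \<le> \<bar>\<tau> s * symp Y X\<bar>" using \<tau> by (simp add: abs_mult mult.commute mult_right_mono)
      show ?thesis unfolding vr pl du sc using a b by simp
    qed
    show ?thesis
    proof (cases "\<Gamma>' (s, u)")
      case (Reg w)
      obtain N where N: "(s, u) \<in> N" "reg_lift \<mu> \<Gamma>' N" by (rule liftable_Reg[OF lift'[OF x] Reg])
      let ?h = "\<lambda>y. un_Reg (\<Gamma>' y)"
      let ?M = "N \<inter> ?Q"
      have M: "open ?M" "(s, u) \<in> ?M" "smooth ?M ?h" "?h ` ?M \<subseteq> phase_space \<mu>" "\<And>y. y \<in> ?M \<Longrightarrow> \<Gamma>' y = Reg (?h y)"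
        using N x oQ smooth_subset[of N ?h ?M] by (auto simp: reg_lift_def)
      have hw: "?h (s, u) = w" using Reg by simp
      have w: "w \<in> phase_space \<mu>" using M(2,4) hw by auto
      let ?K = "regK \<mu> g (c s) \<circ> Reg"
      let ?D = "frechet_derivative ?K (at w)"
      let ?X = "ham_vf (phase_space \<mu>) ?K w"
      have K: "(?K has_derivative ?D) (at w)" by (rule has_derivative_regK_Reg[OF g w])
      show ?thesis
      proof (rule final[of ?M ?h "phase_space \<mu>" Reg ?D un_Reg ?X "XA w"])
        show "(?K has_derivative ?D) (at (?h (s, u)) within phase_space \<mu>)"
          unfolding hw using K by (rule has_derivative_at_withinI)
        show "((\<lambda>t. un_Reg (\<gamma> s t)) has_vector_derivative ?X) (at (\<tau> s * u))"
          by (rule solves_at_Reg[OF g _ sol]) (use Reg eqG[OF x] \<Gamma> in simp)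
        show "?D U = symp U ?X" for U 
          using iffD1[OF ham_vf_open[OF open_phase_space w K] refl] by (rule spec)
        show "XA w \<in> tangent_space (phase_space \<mu>) (?h (s, u))"
          unfolding hw tangent_space_open[OF open_phase_space w] by simp
        show "\<delta> \<le> \<bar>?D (XA w)\<bar>" using low_Reg[OF s01(3,2), of w ?D] Gb(2) Reg K by simp
        show "?p (0, 1) (s, u) = symp (XA w) (frechet_derivative ?h (at (s, u)) (0, 1))"
          by (simp add: pull_def Reg)
        show "frechet_derivative (?p (0, 1)) (at (s, u)) (1, 0) - frechet_derivative (?p (1, 0)) (at (s, u)) (0, 1) =
          symp (frechet_derivative ?h (at (s, u)) (1, 0)) (frechet_derivative ?h (at (s, u)) (0, 1))"
          unfolding var by (simp add: Reg)
        have "continuous_on ?M (\<lambda>y. fst (?h y))" by (intro continuous_on_fst smooth_continuous_on M(3))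
        then show "continuous_on ?M (\<lambda>y. wproj \<mu> (\<Gamma>' y))"
          by (rule continuous_on_eq) (use M(5) in \<open>metis wproj.simps(1)\<close>)
      qed (use M in auto)
    next
      case (Coll P \<eta>)
      obtain N where N: "(s, u) \<in> N" "coll_lift \<mu> P \<Gamma>' N" by (rule liftable_Coll[OF lift'[OF x] Coll])
      let ?h = "\<lambda>y. un_glue \<mu> P (\<Gamma>' y)"
      let ?M = "N \<inter> ?Q"
      have M: "open ?M" "(s, u) \<in> ?M" "smooth ?M ?h" "?h ` ?M \<subseteq> V" "\<And>y. y \<in> ?M \<Longrightarrow> \<Gamma>' y = glue \<mu> P (?h y)"
        using N x oQ smooth_subset[of N ?h ?M] by (auto simp: coll_lift_def)
      let ?w = "(north, (0, \<eta>)) :: R4 \<times> R4"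
      have hw: "?h (s, u) = ?w" using Coll by simp
      have w: "?w \<in> V" using M(2,4) hw by (metis image_subset_iff)
      let ?K = "regK \<mu> g (c s) \<circ> glue \<mu> P"
      obtain D where K: "(?K has_derivative D) (at ?w within V)" by (rule has_derivative_regK_glue[OF g w])
      let ?X = "ham_vf V ?K ?w"
      have B: "?w \<in> B P" "\<delta> \<le> \<bar>D (XV P ?w)\<bar>" using low_Coll[OF s01(3,2), of P \<eta> D] Gb(2) Coll K by auto
      show ?thesis
      proof (rule final[of ?M ?h V "glue \<mu> P" D "un_glue \<mu> P" ?X "XV P ?w"])
        show "(?K has_derivative D) (at (?h (s, u)) within V)" unfolding hw by (rule K)
        show "((\<lambda>t. un_glue \<mu> P (\<gamma> s t)) has_vector_derivative ?X) (at (\<tau> s * u))"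
          by (rule solves_at_Coll[OF g _ sol]) (use Coll eqG[OF x] \<Gamma> in simp)
        show "D U = symp U ?X" if "U \<in> tangent_space V (?h (s, u))" for U
          using ham_vf_V[OF w K, of ?X] that unfolding hw tangent_space_V[OF w] by simp
        show "XV P ?w \<in> tangent_space V (?h (s, u))"
          unfolding hw tangent_space_V[OF w] using L B(1) by (simp add: liouville_field_def)
        show "\<delta> \<le> \<bar>D (XV P ?w)\<bar>" by (rule B(2))
        show "?p (0, 1) (s, u) = symp (XV P ?w) (frechet_derivative ?h (at (s, u)) (0, 1))"
          by (simp add: pull_def Coll)
        show "frechet_derivative (?p (0, 1)) (at (s, u)) (1, 0) - frechet_derivative (?p (1, 0)) (at (s, u)) (0, 1) =
          symp (frechet_derivative ?h (at (s, u)) (1, 0)) (frechet_derivative ?h (at (s, u)) (0, 1))"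
          unfolding var by (simp add: Coll)
        have "continuous_on ?M (\<lambda>y. fst (moser \<mu> P (?h y)))"
          by (rule continuous_on_compose2[OF continuous_moser_fst smooth_continuous_on[OF M(3)]]) simp
        then show "continuous_on ?M (\<lambda>y. wproj \<mu> (\<Gamma>' y))"
          by (rule continuous_on_eq) (use M(5) wproj_glue in metis)
      qed (use M in auto)
    qed
  qed
  have "\<not> filterlim \<tau> at_top (at_left 1)"
  proof (rule periods_bounded[OF r(1) psm[of "(0, 1)"] psm[of "(1, 0)"]])
    show "?p (1, 0) (s, 1) = ?p (1, 0) (s, 0)" for s
      using pull_periodic[of \<Gamma>' \<mu> XA XV "(1, 0)" s 0] per' by simp
    show "0 < \<tau> s" if "s \<in> {r<..<1}" for s using orb[of s] that r by simp
  qed (use pt \<delta> in auto)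
  then show False using lim by simp
qed


section \<open>The effective potential\<close>

definition effpot :: "real \<Rightarrow> real^3 \<Rightarrow> real" where
  "effpot \<mu> q = - mass \<mu> Earth / norm (q - pos \<mu> Earth) - mass \<mu> Moon / norm (q - pos \<mu> Moon)
     - ((q $ 1)\<^sup>2 + (q $ 2)\<^sup>2) / 2"

text \<open>The velocity in the rotating frame.\<close>

definition vel :: "phase \<Rightarrow> real^3" where
  "vel z = vector [snd z $ 1 + fst z $ 2, snd z $ 2 - fst z $ 1, snd z $ 3]"

lemma inner_3: "x \<bullet> y = x $ 1 * y $ 1 + x $ 2 * y $ 2 + x $ 3 * (y :: real^3) $ 3"
  by (simp add: inner_vec_def sum_3)

text \<open>Completing the square in the momentum absorbs the rotation term and leaves the
  centrifugal term in the potential.\<close>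

lemma H_effpot: "H \<mu> z = (vel z \<bullet> vel z) / 2 + effpot \<mu> (fst z)"
  unfolding H_alt[of \<mu> z Earth] effpot_def vel_def inner_3
  by (simp add: power2_eq_square field_simps del: mass.simps)

lemma effpot_alt: "effpot \<mu> q = - mass \<mu> P / norm (q - pos \<mu> P) - mass \<mu> (other P) / norm (q - pos \<mu> (other P))
     - ((q $ 1)\<^sup>2 + (q $ 2)\<^sup>2) / 2"
  by (cases P) (simp_all add: effpot_def del: mass.simps)

lemma mass_other: "mass \<mu> (other P) = 1 - mass \<mu> P"
  by (cases P) auto

text \<open>Contribution of one primary per unit of mass, with the sign reversed: attraction plus
  its share of the centrifugal term.\<close>

definition hfun :: "real \<Rightarrow> real" where "hfun r = 1 / r + r\<^sup>2 / 2"

text \<open>In bipolar coordinates the effective potential is, up to \<open>q\<^sub>3\<close>, minus a convex function: since the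
  origin is the centre of mass, \<open>|q|\<^sup>2\<close> is an affine function of the squared distances.\<close>

lemma effpot_bipolar:
  "effpot \<mu> q = - (mass \<mu> P * hfun (norm (q - pos \<mu> P)) + mass \<mu> (other P) * hfun (norm (q - pos \<mu> (other P))))
     + (q $ 3)\<^sup>2 / 2 + \<mu> * (1 - \<mu>) / 2"
proof -
  have n: "(norm (q - pos \<mu> Q))\<^sup>2 = (q $ 1 - pos \<mu> Q $ 1)\<^sup>2 + (q $ 2)\<^sup>2 + (q $ 3)\<^sup>2" for Q
    unfolding power2_norm_eq_inner inner_3 by (simp add: pos_component power2_eq_square)
  have "mass \<mu> Earth * (norm (q - pos \<mu> Earth))\<^sup>2 + mass \<mu> Moon * (norm (q - pos \<mu> Moon))\<^sup>2
     = (q $ 1)\<^sup>2 + (q $ 2)\<^sup>2 + (q $ 3)\<^sup>2 + \<mu> * (1 - \<mu>)"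
    unfolding n by (simp add: pos_component power2_eq_square algebra_simps)
  then have E: "effpot \<mu> q = - (mass \<mu> Earth * hfun (norm (q - pos \<mu> Earth)) + mass \<mu> Moon * hfun (norm (q - pos \<mu> Moon)))
     + (q $ 3)\<^sup>2 / 2 + \<mu> * (1 - \<mu>) / 2"
    unfolding effpot_def hfun_def by (simp add: field_simps del: mass.simps)
  show ?thesis by (cases P) (simp_all add: E)
qed

lemma hfun_deriv: "r \<noteq> 0 \<Longrightarrow> (hfun has_field_derivative (r - 1 / r\<^sup>2)) (at r)"
  unfolding hfun_def by (auto intro!: derivative_eq_intros simp: power2_eq_square field_simps)

lemma hfun_convex: "convex_on {0<..} hfun"
proof (rule f''_ge0_imp_convex[where f' = "\<lambda>r. r - 1 / r\<^sup>2" and f'' = "\<lambda>r. 1 + 2 / r^3"])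
  show "((\<lambda>r. r - 1 / r\<^sup>2) has_real_derivative 1 + 2 / x ^ 3) (at x)" if "x \<in> {0<..}" for x :: real
    using that by (auto intro!: derivative_eq_intros simp: field_simps power2_eq_square power3_eq_cube)
qed (auto intro!: hfun_deriv)

text \<open>The minimum lies at unit distance, which is why the potential is largest in the plane at
  the equilateral points.\<close>

lemma hfun_ge: 
  assumes "0 < r" shows "3 / 2 \<le> hfun r"
proof -
  have "hfun r - 3 / 2 = (r - 1)\<^sup>2 * (r + 2) / (2 * r)"
    using assms by (simp add: hfun_def field_simps power2_eq_square)
  also have "\<dots> \<ge> 0" using assms by simp
  finally show ?thesis by simp
qed

lemma hfun_gt:
  assumes "0 < r" "r \<noteq> 1" shows "3 / 2 < hfun r"
proof -
  have "hfun r - 3 / 2 = (r - 1)\<^sup>2 * (r + 2) / (2 * r)"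
    using assms by (simp add: hfun_def field_simps power2_eq_square)
  also have "\<dots> > 0" using assms by simp
  finally show ?thesis by simp
qed

lemma hfun_max:
  assumes "0 < a" "a \<le> r" "r \<le> b" shows "hfun r \<le> max (hfun a) (hfun b)"
proof -
  have "{a..b} \<subseteq> {0<..}" using assms by auto
  from convex_on_le_max[OF convex_on_subset[OF hfun_convex this], of r] show ?thesis using assms by simp
qed

text \<open>The difference of the two values is 2 r^3/(1 - r^2) > 0. On the interval [1 - r, 1 + r]
  the maximum of the convex \<open>hfun\<close> is therefore at the near end.\<close>

lemma hfun_reflect:
  assumes "0 < r" "r < 1" shows "hfun (1 + r) < hfun (1 - r)"
proof -
  have "(1 - r\<^sup>2) * (hfun (1 - r) - hfun (1 + r)) = 2 * r ^ 3"
  proof -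
    have "hfun (1 - r) - hfun (1 + r) = 2 * r / (1 - r\<^sup>2) - 2 * r"
    proof -
      have "(1 - r\<^sup>2) = (1 - r) * (1 + r)" by (simp add: power2_eq_square algebra_simps)
      then show ?thesis using assms by (simp add: hfun_def power2_eq_square divide_simps) (simp add: algebra_simps)
    qed
    moreover have "1 - r\<^sup>2 \<noteq> 0" using assms power_strict_mono[of r 1 2] by simp
    ultimately show ?thesis by (simp add: right_diff_distrib power2_eq_square power3_eq_cube) (simp add: algebra_simps)
  qed
  moreover have "0 < 1 - r\<^sup>2" using assms power_strict_mono[of r 1 2] by simp
  ultimately show ?thesis using assms by (smt (verit) zero_less_mult_iff zero_less_power)
qed

lemma dist_triangle_primaries:
  "1 \<le> norm (q - pos \<mu> P) + norm (q - pos \<mu> (other P))"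
  "norm (q - pos \<mu> P) \<le> 1 + norm (q - pos \<mu> (other P))"
  "norm (q - pos \<mu> (other P)) \<le> 1 + norm (q - pos \<mu> P)"
  using norm_triangle_ineq4[of "q - pos \<mu> P" "q - pos \<mu> (other P)"] norm_pos_other[of \<mu> P]
    norm_triangle_ineq[of "q - pos \<mu> (other P)" "pos \<mu> (other P) - pos \<mu> P"]
    norm_triangle_ineq4[of "q - pos \<mu> P" "pos \<mu> (other P) - pos \<mu> P"]
  by (simp_all add: norm_minus_commute)

subsection \<open>The inner Lagrange point\<close>

definition axis_dir :: "real \<Rightarrow> primary \<Rightarrow> real^3" where
  "axis_dir \<mu> P = pos \<mu> (other P) - pos \<mu> P"

lemma axis_dir_component: "axis_dir \<mu> P $ 1 = (case P of Earth \<Rightarrow> -1 | Moon \<Rightarrow> 1)" "axis_dir \<mu> P $ 2 = 0" "axis_dir \<mu> P $ 3 = 0"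
  by (cases P; simp add: axis_dir_def pos_component)+

lemma norm_axis_dir: "norm (axis_dir \<mu> P) = 1"
  by (simp add: axis_dir_def norm_pos_other)

lemma pos_axis: "pos \<mu> P = - (mass \<mu> (other P)) *\<^sub>R axis_dir \<mu> P"
  unfolding vec_eq_iff forall_3 by (cases P; simp add: pos_component axis_dir_component)

lemma pos_other_axis: "pos \<mu> (other P) = pos \<mu> P + axis_dir \<mu> P"
  by (simp add: axis_dir_def)

lemma axis_point_dist:
  "norm (pos \<mu> P + r *\<^sub>R axis_dir \<mu> P - pos \<mu> P) = \<bar>r\<bar>"
  "norm (pos \<mu> P + r *\<^sub>R axis_dir \<mu> P - pos \<mu> (other P)) = \<bar>r - 1\<bar>"
proof -
  show "norm (pos \<mu> P + r *\<^sub>R axis_dir \<mu> P - pos \<mu> P) = \<bar>r\<bar>" by (simp add: norm_axis_dir)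
  have "pos \<mu> P + r *\<^sub>R axis_dir \<mu> P - pos \<mu> (other P) = (r - 1) *\<^sub>R axis_dir \<mu> P"
    by (simp add: pos_other_axis algebra_simps)
  then show "norm (pos \<mu> P + r *\<^sub>R axis_dir \<mu> P - pos \<mu> (other P)) = \<bar>r - 1\<bar>" by (simp add: norm_axis_dir)
qed

definition grad_effpot :: "real \<Rightarrow> real^3 \<Rightarrow> real^3" where
  "grad_effpot \<mu> q = (mass \<mu> Earth / (norm (q - pos \<mu> Earth))^3) *\<^sub>R (q - pos \<mu> Earth)
     + (mass \<mu> Moon / (norm (q - pos \<mu> Moon))^3) *\<^sub>R (q - pos \<mu> Moon) - vector [q $ 1, q $ 2, 0]"

lemma effpot_has_derivative:
  assumes "q \<notin> {pos \<mu> Earth, pos \<mu> Moon}"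
  shows "(effpot \<mu> has_derivative (\<lambda>v. grad_effpot \<mu> q \<bullet> v)) (at q)"
proof -
  have i: "((\<lambda>q. m / norm (q - a)) has_derivative (\<lambda>v. - (m / (norm (q - a))^3 * ((q - a) \<bullet> v)))) (at q)"
    if "q \<noteq> a" for a :: "real^3" and m
  proof -
    have n: "((\<lambda>q. norm (q - a)) has_derivative (\<lambda>v. sgn (q - a) \<bullet> v)) (at q)"
    proof -
      have "((\<lambda>q. q - a) has_derivative (\<lambda>v. v)) (at q)" by (auto intro!: derivative_eq_intros)
      from has_derivative_compose[OF this has_derivative_norm, of ] that show ?thesis
        by (simp add: inner_commute)
    qed
    have nz: "norm (q - a) \<noteq> 0" using that by simp
    have "((\<lambda>q. m * inverse (norm (q - a))) has_derivative
        (\<lambda>v. m * - (inverse (norm (q - a)) * (sgn (q - a) \<bullet> v) * inverse (norm (q - a))))) (at q)"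
      by (rule has_derivative_mult_right[OF Deriv.has_derivative_inverse[OF nz n]])
    then show ?thesis
      unfolding divide_inverse
      by (rule has_derivative_eq_rhs) (simp add: fun_eq_iff sgn_div_norm power3_eq_cube mult_ac)
  qed
  have c: "((\<lambda>q. q $ k) has_derivative (\<lambda>v. v $ k)) (at q)" for k :: 3
    by (rule bounded_linear_imp_has_derivative[OF bounded_linear_vec_nth])
  have s: "((\<lambda>q. ((q $ 1)\<^sup>2 + (q $ 2)\<^sup>2) / 2) has_derivative (\<lambda>v. q $ 1 * v $ 1 + q $ 2 * v $ 2)) (at q)"
    by (rule has_derivative_eq_rhs, (rule derivative_intros c)+) (auto simp: fun_eq_iff)
  have "(effpot \<mu> has_derivative (\<lambda>v. - (- (mass \<mu> Earth / (norm (q - pos \<mu> Earth))^3 * ((q - pos \<mu> Earth) \<bullet> v)))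
     - (- (mass \<mu> Moon / (norm (q - pos \<mu> Moon))^3 * ((q - pos \<mu> Moon) \<bullet> v))) - (q $ 1 * v $ 1 + q $ 2 * v $ 2))) (at q)"
    unfolding effpot_def[abs_def] minus_divide_left[symmetric]
    using assms by (intro has_derivative_diff has_derivative_minus i s) auto
  then show ?thesis
    by (rule has_derivative_eq_rhs)
      (simp add: fun_eq_iff grad_effpot_def inner_add_left inner_diff_left inner_3[of "vector [q $ 1, q $ 2, 0]"])
qed

lemma H_has_derivative:
  assumes "z \<in> phase_space \<mu>"
  shows "(H \<mu> has_derivative (\<lambda>u. vel z \<bullet> vel u + grad_effpot \<mu> (fst z) \<bullet> fst u)) (at z)"
proof -
  have "linear vel"
    by (rule linearI) (simp_all add: vel_def vec_eq_iff forall_3 algebra_simps)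
  then have v: "(vel has_derivative vel) (at z)"
    by (simp add: bounded_linear_imp_has_derivative linear_conv_bounded_linear)
  have k: "((\<lambda>z. (vel z \<bullet> vel z) / 2) has_derivative (\<lambda>u. vel z \<bullet> vel u)) (at z)"
    by (rule has_derivative_eq_rhs[OF has_derivative_divide[OF has_derivative_inner[OF v v] has_derivative_const]])
      (auto simp: fun_eq_iff inner_commute)
  have "fst z \<notin> {pos \<mu> Earth, pos \<mu> Moon}" using assms phase_space_iff[of z \<mu> Earth] by simp
  from has_derivative_compose[OF has_derivative_fst[OF has_derivative_ident] effpot_has_derivative[OF this]]
  have "((\<lambda>z. effpot \<mu> (fst z)) has_derivative (\<lambda>u. grad_effpot \<mu> (fst z) \<bullet> fst u)) (at z)" .
  from has_derivative_add[OF k this] show ?thesis unfolding H_effpot[abs_def] .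
qed

lemma critical_point_iff:
  "z \<in> critical_points \<mu> \<longleftrightarrow> z \<in> phase_space \<mu> \<and> vel z = 0 \<and> grad_effpot \<mu> (fst z) = 0"
proof -
  have "(H \<mu> has_derivative (\<lambda>_. 0)) (at z) \<longleftrightarrow> vel z = 0 \<and> grad_effpot \<mu> (fst z) = 0" if z: "z \<in> phase_space \<mu>"
  proof
    assume "(H \<mu> has_derivative (\<lambda>_. 0)) (at z)"
    from has_derivative_unique[OF H_has_derivative[OF z] this]
    have D: "vel z \<bullet> vel u + grad_effpot \<mu> (fst z) \<bullet> fst u = 0" for u by metis
    have "vel (0, vel z) = vel z" by (simp add: vel_def vec_eq_iff forall_3)
    with D[of "(0, vel z)"] have "vel z = 0" by simp
    with D[of "(grad_effpot \<mu> (fst z), 0)"] show "vel z = 0 \<and> grad_effpot \<mu> (fst z) = 0" by simp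
  next
    assume "vel z = 0 \<and> grad_effpot \<mu> (fst z) = 0"
    with H_has_derivative[OF z] show "(H \<mu> has_derivative (\<lambda>_. 0)) (at z)" by simp
  qed
  then show ?thesis unfolding critical_points_def by auto
qed

text \<open>The phase point over \<open>q\<close> that is at rest in the rotating frame; all
  critical points have this form.\<close>

definition rest :: "real^3 \<Rightarrow> phase" where "rest q = (q, vector [- (q $ 2), q $ 1, 0])"

lemma vel_rest: "vel z = 0 \<longleftrightarrow> z = rest (fst z)"
  by (cases z) (auto simp: vel_def rest_def vec_eq_iff forall_3)

lemma fst_rest: "fst (rest q) = q"
  by (simp add: rest_def)

lemma vel_rest_0: "vel (rest q) = 0"
  using vel_rest[of "rest q"] by (simp add: fst_rest)

lemma H_rest: "H \<mu> (rest q) = effpot \<mu> q"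
  by (simp add: H_effpot vel_rest_0 fst_rest)

text \<open>The signs cover the three intervals of the axis at once.\<close>

lemma grad_effpot_axis:
  assumes "r \<noteq> 0" "r \<noteq> 1"
  shows "grad_effpot \<mu> (pos \<mu> P + r *\<^sub>R axis_dir \<mu> P) =
    (mass \<mu> P * (sgn r / r\<^sup>2 - r) + mass \<mu> (other P) * (sgn (r - 1) / (r - 1)\<^sup>2 - (r - 1))) *\<^sub>R axis_dir \<mu> P"
proof -
  let ?q = "pos \<mu> P + r *\<^sub>R axis_dir \<mu> P"
  have 1: "?q - pos \<mu> P = r *\<^sub>R axis_dir \<mu> P" by simp
  have 2: "?q - pos \<mu> (other P) = (r - 1) *\<^sub>R axis_dir \<mu> P" by (simp add: pos_other_axis algebra_simps)
  have c: "t / \<bar>t\<bar> ^ 3 = sgn t / t\<^sup>2" if "t \<noteq> 0" for t :: real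
    using that by (simp add: power3_eq_cube power2_eq_square sgn_if field_simps abs_if)
  have g: "grad_effpot \<mu> ?q = (mass \<mu> P / (norm (?q - pos \<mu> P))^3) *\<^sub>R (?q - pos \<mu> P)
     + (mass \<mu> (other P) / (norm (?q - pos \<mu> (other P)))^3) *\<^sub>R (?q - pos \<mu> (other P)) - vector [?q $ 1, ?q $ 2, 0]"
    by (cases P) (simp_all add: grad_effpot_def)
  have v: "vector [?q $ 1, ?q $ 2, 0] = (r - mass \<mu> (other P)) *\<^sub>R axis_dir \<mu> P"
    unfolding vec_eq_iff forall_3 by (cases P; simp add: pos_component axis_dir_component algebra_simps)
  have "grad_effpot \<mu> ?q = (mass \<mu> P * (r / \<bar>r\<bar> ^ 3) + mass \<mu> (other P) * ((r - 1) / \<bar>r - 1\<bar> ^ 3) - (r - mass \<mu> (other P))) *\<^sub>R axis_dir \<mu> P"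
    unfolding g axis_point_dist unfolding v 1 2
    by (simp only: scaleR_scaleR scaleR_left_distrib[symmetric] scaleR_left_diff_distrib[symmetric]
        times_divide_eq_left times_divide_eq_right)
  also have "mass \<mu> P * (r / \<bar>r\<bar> ^ 3) + mass \<mu> (other P) * ((r - 1) / \<bar>r - 1\<bar> ^ 3) - (r - mass \<mu> (other P))
     = mass \<mu> P * (sgn r / r\<^sup>2 - r) + mass \<mu> (other P) * (sgn (r - 1) / (r - 1)\<^sup>2 - (r - 1))"
    using assms by (simp add: c mass_other algebra_simps)
  finally show ?thesis .
qed

lemma axis_point_phase:
  assumes "r \<noteq> 0" "r \<noteq> 1"
  shows "rest (pos \<mu> P + r *\<^sub>R axis_dir \<mu> P) \<in> phase_space \<mu>"
  using axis_point_dist[of \<mu> P r] assms phase_space_iff[of _ \<mu> P]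
  by (auto simp: fst_rest)

text \<open>Slope of the effective potential on the segment between the primaries, at distance
  \<open>s\<close> from the primary of mass \<open>m\<close>. Its root is the distance of
  L1.\<close>

definition lagr_eq :: "real \<Rightarrow> real \<Rightarrow> real" where
  "lagr_eq m s = m * (1 / s\<^sup>2 - s) - (1 - m) * (1 / (1 - s)\<^sup>2 - (1 - s))"

lemma lagr_eq_decreasing:
  assumes "0 < m" "m < 1" "0 < s" "s < t" "t < 1"
  shows "lagr_eq m t < lagr_eq m s"
proof -
  have *: "1 / b\<^sup>2 - b < 1 / a\<^sup>2 - a" if "0 < a" "a < b" for a b :: real
    using that by (smt (verit) frac_le power2_less_imp_less power_strict_mono zero_less_power pos2)
  have "m * (1 / t\<^sup>2 - t) < m * (1 / s\<^sup>2 - s)" using *[of s t] assms by simp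
  moreover have "(1 - m) * (1 / (1 - s)\<^sup>2 - (1 - s)) < (1 - m) * (1 / (1 - t)\<^sup>2 - (1 - t))"
    using *[of "1 - t" "1 - s"] assms by simp
  ultimately show ?thesis unfolding lagr_eq_def by linarith
qed

text \<open>Clearing denominators gives a polynomial \<open>p\<close> that is continuous on the
  closed interval, with end values m and -(1 - m).\<close>

lemma lagr_eq_root:
  assumes m: "0 < m" "m < 1"
  obtains s where "0 < s" "s < 1" "lagr_eq m s = 0"
proof -
  define p where "p s = m * (1 - s ^ 3) * (1 - s)\<^sup>2 - (1 - m) * (1 - (1 - s) ^ 3) * s\<^sup>2" for s
  have "continuous_on {0..1} p" unfolding p_def by (intro continuous_intros)
  from IVT2'[OF _ _ _ this, of 0] obtain s where s: "0 \<le> s" "s \<le> 1" "p s = 0"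
    using m by (auto simp: p_def)
  have "s \<noteq> 0" "s \<noteq> 1" using s(3) m by (auto simp: p_def)
  with s have s01: "0 < s" "s < 1" by auto
  define X where "X = 1 / s\<^sup>2 - s"
  define Y where "Y = 1 / (1 - s)\<^sup>2 - (1 - s)"
  have "s\<^sup>2 * X = 1 - s ^ 3" "(1 - s)\<^sup>2 * Y = 1 - (1 - s) ^ 3"
    using s01 by (simp_all add: X_def Y_def right_diff_distrib power2_eq_square power3_eq_cube)
  then have "s\<^sup>2 * (1 - s)\<^sup>2 * (m * X - (1 - m) * Y) = p s"
    unfolding p_def by algebra
  then have "s\<^sup>2 * (1 - s)\<^sup>2 * lagr_eq m s = p s" by (simp only: lagr_eq_def X_def Y_def)
  then have "lagr_eq m s = 0" using s01 s(3) by simp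
  then show thesis using that[of s] s01 by auto
qed


text \<open>Strong convexity: \<open>hfun\<close> minus r^2/2 is the convex function 1/r, so the
  quadratic term survives. It provides strict inequalities later.\<close>

lemma hfun_tangent:
  assumes "0 < x" "0 < y"
  shows "hfun x + (x - 1 / x\<^sup>2) * (y - x) + (y - x)\<^sup>2 / 2 \<le> hfun y"
proof -
  have "hfun y - (hfun x + (x - 1 / x\<^sup>2) * (y - x) + (y - x)\<^sup>2 / 2) = (y - x)\<^sup>2 / (x\<^sup>2 * y)"
    using assms by (simp add: hfun_def power2_eq_square divide_simps) (simp add: algebra_simps)
  also have "\<dots> \<ge> 0" using assms by simp
  finally show ?thesis by simp
qed

section \<open>Hill's regions and their bounded components below the first critical value\<close>

lemma hill_region_iff:
  "q \<in> hill_region \<mu> c \<longleftrightarrow> q \<notin> {pos \<mu> Earth, pos \<mu> Moon} \<and> effpot \<mu> q \<le> c"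
proof
  assume "q \<in> hill_region \<mu> c"
  then obtain z where z: "z \<in> phase_space \<mu>" "H \<mu> z = c" "q = fst z"
    unfolding hill_region_def level_set_def by auto
  have "effpot \<mu> (fst z) \<le> c" using z(2) H_effpot[of \<mu> z] inner_ge_zero[of "vel z"] by linarith
  then show "q \<notin> {pos \<mu> Earth, pos \<mu> Moon} \<and> effpot \<mu> q \<le> c" using z phase_space_iff[of z \<mu> Earth] by simp
next
  assume q: "q \<notin> {pos \<mu> Earth, pos \<mu> Moon} \<and> effpot \<mu> q \<le> c"
  \<comment> \<open>The kinetic energy still missing is put into the first component of the rotating
    velocity.\<close>
  define z :: phase where "z = (q, vector [sqrt (2 * (c - effpot \<mu> q)) - q $ 2, q $ 1, 0 :: real])"
  have v: "vel z = vector [sqrt (2 * (c - effpot \<mu> q)), 0, 0]" by (simp add: z_def vel_def)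
  have "H \<mu> z = c" unfolding H_effpot v inner_3 using q by (simp add: z_def diff_divide_distrib)
  moreover have "z \<in> phase_space \<mu>" using q phase_space_iff[of z \<mu> Earth] by (simp add: z_def)
  ultimately show "q \<in> hill_region \<mu> c" unfolding hill_region_def level_set_def
    by (intro image_eqI[of _ _ z]) (auto simp: z_def)
qed

lemma level_set_vel:
  assumes "z \<in> level_set \<mu> c" shows "vel z \<bullet> vel z = 2 * (c - effpot \<mu> (fst z))"
  using assms H_effpot[of \<mu> z] by (simp add: level_set_def)

context
  fixes \<mu> :: real
  assumes \<mu>: "0 < \<mu>" "\<mu> < 1"
begin

lemma mass_bounds: "0 < mass \<mu> P" "mass \<mu> P < 1"
  using \<mu> by (cases P; simp)+

lemma open_segment_axis:
  assumes "q \<in> open_segment (pos \<mu> Earth) (pos \<mu> Moon)"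
  obtains r where "0 < r" "r < 1" "q = pos \<mu> P + r *\<^sub>R axis_dir \<mu> P"
proof -
  obtain t where t: "0 < t" "t < 1" "q = (1 - t) *\<^sub>R pos \<mu> Earth + t *\<^sub>R pos \<mu> Moon"
    using assms unfolding in_segment by auto
  show thesis
  proof (cases P)
    case Earth
    then show ?thesis using t by (intro that[of t]) (auto simp: axis_dir_def algebra_simps)
  next
    case Moon
    then show ?thesis using t by (intro that[of "1 - t"]) (auto simp: axis_dir_def algebra_simps)
  qed
qed

lemma axis_open_segment:
  assumes "0 < r" "r < 1"
  shows "pos \<mu> P + r *\<^sub>R axis_dir \<mu> P \<in> open_segment (pos \<mu> Earth) (pos \<mu> Moon)"
proof -
  have ne: "pos \<mu> Earth \<noteq> pos \<mu> Moon" using pos_other_neq[of \<mu> Earth] by simp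
  show ?thesis
  proof (cases P)
    case Earth
    then show ?thesis using assms ne unfolding in_segment
      by (intro conjI exI[of _ r]) (auto simp: axis_dir_def algebra_simps)
  next
    case Moon
    then show ?thesis using assms ne unfolding in_segment
      by (intro conjI exI[of _ "1 - r"]) (auto simp: axis_dir_def algebra_simps)
  qed
qed

lemma grad_inner_axis:
  assumes "0 < r" "r < 1"
  shows "grad_effpot \<mu> (pos \<mu> P + r *\<^sub>R axis_dir \<mu> P) = lagr_eq (mass \<mu> P) r *\<^sub>R axis_dir \<mu> P"
proof -
  have "(r - 1)\<^sup>2 = (1 - r)\<^sup>2" by (simp add: power2_commute)
  then show ?thesis
    using grad_effpot_axis[of r \<mu> P] assms by (simp add: lagr_eq_def mass_other sgn_if algebra_simps)
qed

lemma axis_dir_nonzero: "axis_dir \<mu> P \<noteq> 0"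
  using norm_axis_dir[of \<mu> P] by auto

lemma critical_fst: "z \<in> critical_points \<mu> \<Longrightarrow> z = rest (fst z)"
  using critical_point_iff vel_rest by blast

text \<open>Stated from the point of view of either primary \<open>P\<close>, since the ball around
  each of them is needed. Monotonicity of \<open>lagr_eq\<close> makes the root unique, so the
  \<open>THE\<close> in \<open>L1\<close> denotes it.\<close>

lemma L1_point:
  obtains s where "0 < s" "s < 1" "lagr_eq (mass \<mu> P) s = 0"
    "H \<mu> (L1 \<mu>) = - (mass \<mu> P * hfun s + mass \<mu> (other P) * hfun (1 - s)) + \<mu> * (1 - \<mu>) / 2"
proof -
  obtain s where s: "0 < s" "s < 1" "lagr_eq (mass \<mu> P) s = 0"
    using lagr_eq_root[OF mass_bounds[of P]] by blast
  let ?q = "pos \<mu> P + s *\<^sub>R axis_dir \<mu> P"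
  have "L1 \<mu> = rest ?q"
    unfolding L1_def
  proof (rule the_equality)
    have "rest ?q \<in> phase_space \<mu>" using s by (intro axis_point_phase) auto
    then have "rest ?q \<in> critical_points \<mu>"
      unfolding critical_point_iff fst_rest grad_inner_axis[OF s(1,2)] using s vel_rest_0 by simp
    then show "rest ?q \<in> critical_points \<mu> \<and> fst (rest ?q) \<in> open_segment (pos \<mu> Earth) (pos \<mu> Moon)"
      using axis_open_segment s by (simp add: fst_rest)
    fix z assume z: "z \<in> critical_points \<mu> \<and> fst z \<in> open_segment (pos \<mu> Earth) (pos \<mu> Moon)"
    then obtain r where r: "0 < r" "r < 1" "fst z = pos \<mu> P + r *\<^sub>R axis_dir \<mu> P"
      using open_segment_axis[of "fst z" P] by blast
    have "lagr_eq (mass \<mu> P) r = 0"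
      using z critical_point_iff[of z \<mu>] grad_inner_axis[OF r(1,2), of P] r(3) axis_dir_nonzero by auto
    then have "r = s"
      using lagr_eq_decreasing[OF mass_bounds[of P], of r s] lagr_eq_decreasing[OF mass_bounds[of P], of s r] r s
      by (cases r s rule: linorder_cases) auto
    then show "z = rest ?q" using z critical_fst[of z] r(3) by simp
  qed
  then have "H \<mu> (L1 \<mu>) = - (mass \<mu> P * hfun s + mass \<mu> (other P) * hfun (1 - s)) + \<mu> * (1 - \<mu>) / 2"
    using axis_point_dist[of \<mu> P s] s
    by (simp add: H_rest effpot_bipolar[of \<mu> _ P] pos_component axis_dir_component)
  with s show thesis by (rule that)
qed

lemma effpot_inner_axis:
  assumes "0 < r" "r < 1"
  shows "effpot \<mu> (pos \<mu> P + r *\<^sub>R axis_dir \<mu> P) =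
    - (mass \<mu> P * hfun r + mass \<mu> (other P) * hfun (1 - r)) + \<mu> * (1 - \<mu>) / 2"
  using axis_point_dist[of \<mu> P r] assms
  by (simp add: effpot_bipolar[of \<mu> _ P] pos_component axis_dir_component)

text \<open>On the sphere the distance to the other primary ranges over [1 - r, 1 + r], where
  \<open>hfun\<close> is largest at 1 - r; so the axis point facing the other primary has the least
  potential. For the sphere through L1 this value is \<open>H \<mu> (L1 \<mu>)\<close>, which makes
  it a barrier at lower energies.\<close>

lemma effpot_sphere:
  assumes r: "norm (q - pos \<mu> P) = r" "0 < r" "r < 1"
  shows "- (mass \<mu> P * hfun r + mass \<mu> (other P) * hfun (1 - r)) + \<mu> * (1 - \<mu>) / 2 \<le> effpot \<mu> q"
proof -
  let ?r' = "norm (q - pos \<mu> (other P))"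
  have "1 - r \<le> ?r'" "?r' \<le> 1 + r" using dist_triangle_primaries[of q \<mu> P] r by auto
  then have "hfun ?r' \<le> hfun (1 - r)"
    using hfun_max[of "1 - r" ?r' "1 + r"] hfun_reflect[OF r(2,3)] r by auto
  then have "mass \<mu> (other P) * hfun ?r' \<le> mass \<mu> (other P) * hfun (1 - r)"
    using mass_bounds[of "other P"] by (simp add: mult_left_mono)
  then show ?thesis unfolding effpot_bipolar[of \<mu> q P] r(1) using zero_le_power2[of "q $ 3"] by linarith
qed

lemma hill_punctured_ball:
  obtains \<delta> where "0 < \<delta>" "ball (pos \<mu> P) \<delta> - {pos \<mu> P} \<subseteq> hill_region \<mu> c"
proof -
  \<comment> \<open>The bound 1 keeps the ball off the other primary; inside the second radius the
    attraction -m/r alone is below -(|c| + 1).\<close>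
  define \<delta> where "\<delta> = min 1 (mass \<mu> P / (\<bar>c\<bar> + 1))"
  have d: "0 < \<delta>" using mass_bounds[of P] by (simp add: \<delta>_def)
  have "q \<in> hill_region \<mu> c" if q: "q \<in> ball (pos \<mu> P) \<delta> - {pos \<mu> P}" for q
  proof -
    let ?r = "norm (q - pos \<mu> P)"
    have r: "0 < ?r" "?r < 1" "?r < mass \<mu> P / (\<bar>c\<bar> + 1)"
      using q by (auto simp: \<delta>_def dist_norm norm_minus_commute)
    then have "q \<noteq> pos \<mu> (other P)" using norm_pos_other[of \<mu> P] by auto
    moreover have "?r * (\<bar>c\<bar> + 1) < mass \<mu> P" using r(3) by (simp add: pos_less_divide_eq)
    then have "\<bar>c\<bar> + 1 < mass \<mu> P / ?r" using r(1) by (simp add: pos_less_divide_eq mult.commute)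
    moreover have "0 \<le> mass \<mu> (other P) / norm (q - pos \<mu> (other P))" using mass_bounds[of "other P"] by simp
    moreover have "0 \<le> ((q $ 1)\<^sup>2 + (q $ 2)\<^sup>2) / 2" by simp
    ultimately have "effpot \<mu> q \<le> c" unfolding effpot_alt[of \<mu> q P] minus_divide_left[symmetric] by linarith
    then show ?thesis using \<open>q \<noteq> pos \<mu> (other P)\<close> q primaries[of \<mu> P] by (simp add: hill_region_iff)
  qed
  then have "ball (pos \<mu> P) \<delta> - {pos \<mu> P} \<subseteq> hill_region \<mu> c" by (rule subsetI)
  with d show thesis by (rule that)
qed

text \<open>A small punctured ball lies in the region and is connected, so it lies in one component,
  and no other component accumulates at the primary. This evaluates the \<open>THE\<close> in the
  definitions of the components.\<close>

lemma hill_component_at: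
  obtains C where "C \<in> components (hill_region \<mu> c)" "pos \<mu> P \<in> closure C"
    "\<forall>C'\<in>components (hill_region \<mu> c). pos \<mu> P \<in> closure C' \<longrightarrow> C' = C"
    "\<forall>e>0. C \<inter> ball (pos \<mu> P) e \<noteq> {}"
proof -
  obtain \<delta> where d: "0 < \<delta>" "ball (pos \<mu> P) \<delta> - {pos \<mu> P} \<subseteq> hill_region \<mu> c" by (rule hill_punctured_ball)
  let ?B = "ball (pos \<mu> P) \<delta> - {pos \<mu> P}"
  have conn: "connected ?B" by (rule connected_punctured_ball) simp
  have nonempty: "\<exists>q. q \<in> ball (pos \<mu> P) e - {pos \<mu> P}" if "0 < e" for e
  proof
    show "pos \<mu> P + (e / 2) *\<^sub>R axis_dir \<mu> P \<in> ball (pos \<mu> P) e - {pos \<mu> P}"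
      using that axis_dir_nonzero by (simp add: dist_norm norm_axis_dir)
  qed
  obtain q0 where q0: "q0 \<in> ?B" using nonempty[OF d(1)] by blast
  have "hill_region \<mu> c \<noteq> {}" using q0 d(2) by blast
  from exists_component_superset[OF d(2) this conn]
  obtain C where C: "C \<in> components (hill_region \<mu> c)" "?B \<subseteq> C" by (elim exE conjE)
  have meets: "\<exists>q\<in>C. dist q (pos \<mu> P) < e" if "0 < e" for e
  proof -
    have "0 < min e \<delta>" using that d(1) by simp
    then obtain q where q: "q \<in> ball (pos \<mu> P) (min e \<delta>) - {pos \<mu> P}" using nonempty by blast
    then have "q \<in> C" by (intro subsetD[OF C(2)]) simp
    then show ?thesis using q by (intro bexI[of _ q]) (simp add: dist_commute)
  qed
  then have cl: "pos \<mu> P \<in> closure C" unfolding closure_approachable by blast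
  have uniq: "C' = C" if C': "C' \<in> components (hill_region \<mu> c)" "pos \<mu> P \<in> closure C'" for C'
  proof -
    obtain q where q: "q \<in> C'" "dist q (pos \<mu> P) < \<delta>" using C'(2) d(1) unfolding closure_approachable by blast
    have "q \<in> hill_region \<mu> c" using q(1) in_components_subset[OF C'(1)] by blast
    then have "q \<notin> {pos \<mu> P, pos \<mu> (other P)}" unfolding primaries[symmetric] using hill_region_iff by blast
    then have "q \<noteq> pos \<mu> P" by simp
    then have "q \<in> ?B" using q(2) by (simp add: dist_commute)
    then have "q \<in> C" using C(2) by (rule subsetD[rotated])
    then show ?thesis using components_nonoverlap[OF C'(1) C(1)] q(1) by blast
  qed
  have meets': "\<forall>e>0. C \<inter> ball (pos \<mu> P) e \<noteq> {}"
  proof (intro allI impI)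
    fix e :: real assume "0 < e"
    from meets[OF this] obtain q where "q \<in> C" "dist q (pos \<mu> P) < e" by blast
    then have "q \<in> C" "q \<in> ball (pos \<mu> P) e" by (simp_all add: dist_commute)
    then show "C \<inter> ball (pos \<mu> P) e \<noteq> {}" by blast
  qed
  show thesis by (rule that[OF C(1) cl _ meets']) (intro ballI impI uniq)
qed

text \<open>A connected set that starts near the primary and leaves the ball would meet the sphere
  through L1, where the potential exceeds \<open>c\<close>.\<close>

lemma hill_component_subset_ball:
  assumes c: "c < H \<mu> (L1 \<mu>)" and s: "0 < s" "s < 1"
    and Hs: "H \<mu> (L1 \<mu>) = - (mass \<mu> P * hfun s + mass \<mu> (other P) * hfun (1 - s)) + \<mu> * (1 - \<mu>) / 2"
  shows "hill_component \<mu> P c \<subseteq> hill_region \<mu> c \<inter> ball (pos \<mu> P) s"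
proof -
  obtain C where C: "C \<in> components (hill_region \<mu> c)" "pos \<mu> P \<in> closure C"
    "\<forall>C'\<in>components (hill_region \<mu> c). pos \<mu> P \<in> closure C' \<longrightarrow> C' = C"
    "\<forall>e>0. C \<inter> ball (pos \<mu> P) e \<noteq> {}" by (rule hill_component_at)
  have sub: "C \<subseteq> hill_region \<mu> c" by (rule in_components_subset[OF C(1)])
  have CB: "C \<subseteq> ball (pos \<mu> P) s"
  proof (rule ccontr)
    assume "\<not> C \<subseteq> ball (pos \<mu> P) s"
    then have "C - ball (pos \<mu> P) s \<noteq> {}" by blast
    moreover have "C \<inter> ball (pos \<mu> P) s \<noteq> {}" using C(4) s(1) by simp
    ultimately have "C \<inter> frontier (ball (pos \<mu> P) s) \<noteq> {}"
      using connected_Int_frontier[OF in_components_connected[OF C(1)], of "ball (pos \<mu> P) s"] by simp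
    then obtain q where q0: "q \<in> C" "q \<in> frontier (ball (pos \<mu> P) s)" by blast
    moreover have "frontier (ball (pos \<mu> P) s) = sphere (pos \<mu> P) s" using s by (simp add: frontier_ball)
    ultimately have q: "q \<in> C" "q \<in> sphere (pos \<mu> P) s" by simp_all
    then have qs: "norm (q - pos \<mu> P) = s" by (simp add: dist_norm norm_minus_commute)
    have "q \<in> hill_region \<mu> c" using sub q(1) by (rule subsetD)
    then have "effpot \<mu> q \<le> c" unfolding hill_region_iff by (rule conjunct2)
    then show False using effpot_sphere[OF qs s] c unfolding Hs by linarith
  qed
  have bC: "bounded C" by (rule bounded_subset[OF bounded_ball CB])
  have "hill_component \<mu> P c = C"
    unfolding hill_component_def
  proof (rule the_equality)
    show "C \<in> components (hill_region \<mu> c) \<and> bounded C \<and> pos \<mu> P \<in> closure C"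
      using C(1,2) bC by (intro conjI)
    fix C' assume "C' \<in> components (hill_region \<mu> c) \<and> bounded C' \<and> pos \<mu> P \<in> closure C'"
    then show "C' = C" using bspec[OF C(3), of C'] by simp
  qed
  then show ?thesis using sub CB by (simp only: Int_subset_iff simp_thms)
qed

end

text \<open>One-dimensional estimates along a ray from a primary, in the direction at cosine \<open>t\<close> to the axis and with
  \<open>w\<close> the squared sine of its angle to the rotation axis.\<close>

definition ray_R :: "real \<Rightarrow> real \<Rightarrow> real" where "ray_R t r = sqrt (1 - 2 * r * t + r\<^sup>2)"

text \<open>Effective potential at distance \<open>r\<close> on the ray, where \<open>ray_R\<close>
  is the distance to the other primary by the law of cosines; \<open>ray_u1\<close> and
  \<open>ray_u2\<close> are its first and second derivatives in \<open>r\<close>.\<close>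

definition ray_u :: "real \<Rightarrow> real \<Rightarrow> real \<Rightarrow> real \<Rightarrow> real" where
  "ray_u m t w r = - m / r - (1 - m) / ray_R t r - (1 - m)\<^sup>2 / 2 + (1 - m) * r * t - r\<^sup>2 * w / 2"

definition ray_u1 :: "real \<Rightarrow> real \<Rightarrow> real \<Rightarrow> real \<Rightarrow> real" where
  "ray_u1 m t w r = m / r\<^sup>2 + (1 - m) * (r - t) / ray_R t r ^ 3 + (1 - m) * t - r * w"

definition ray_u2 :: "real \<Rightarrow> real \<Rightarrow> real \<Rightarrow> real \<Rightarrow> real" where
  "ray_u2 m t w r = - 2 * m / r ^ 3 + (1 - m) * (1 / ray_R t r ^ 3 - 3 * (r - t)\<^sup>2 / ray_R t r ^ 5) - w"

context
  fixes m t w s :: real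
  assumes m: "0 < m" "m < 1" and t: "-1 \<le> t" "t \<le> 1" and w: "0 \<le> w" "w \<le> 1"
    and s: "0 < s" "s < 1" "lagr_eq m s = 0"
begin

lemma ray_R_bounds:
  assumes "0 < r" "r < 1"
  shows "1 - r \<le> ray_R t r" "ray_R t r \<le> 1 + r" "0 < ray_R t r" "(ray_R t r)\<^sup>2 = 1 - 2 * r * t + r\<^sup>2"
proof -
  have "r * t \<le> r * 1" "r * (-1) \<le> r * t" using assms t by (intro mult_left_mono; simp)+
  then have 1: "(1 - r)\<^sup>2 \<le> 1 - 2 * r * t + r\<^sup>2" "1 - 2 * r * t + r\<^sup>2 \<le> (1 + r)\<^sup>2"
    by (simp_all add: power2_eq_square algebra_simps)
  show "1 - r \<le> ray_R t r" unfolding ray_R_def using 1(1) by (rule real_le_rsqrt)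
  then show "0 < ray_R t r" using assms by linarith
  show "ray_R t r \<le> 1 + r" unfolding ray_R_def using 1(2) assms by (intro real_le_lsqrt) auto
  show "(ray_R t r)\<^sup>2 = 1 - 2 * r * t + r\<^sup>2"
    unfolding ray_R_def using order_trans[OF zero_le_power2 1(1)] by (rule real_sqrt_pow2)
qed

lemma ray_R_deriv:
  assumes "0 < r" "r < 1"
  shows "(ray_R t has_field_derivative (r - t) / ray_R t r) (at r)"
proof -
  have "0 < (ray_R t r)\<^sup>2" by (rule zero_less_power[OF ray_R_bounds(3)[OF assms]])
  then have p: "0 < 1 - 2 * r * t + r\<^sup>2" by (simp only: ray_R_bounds(4)[OF assms])
  have "((\<lambda>r. 1 - 2 * r * t + r\<^sup>2) has_field_derivative 2 * (r - t)) (at r)"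
    by (auto intro!: derivative_eq_intros)
  from DERIV_chain2[where f=sqrt and g="\<lambda>r. 1 - 2 * r * t + r\<^sup>2" and x=r, OF DERIV_real_sqrt[OF p] this]
  show ?thesis unfolding ray_R_def[abs_def]
  proof (rule DERIV_cong)
    have "inverse S / 2 * (2 * x) = x / S" for S x :: real by (cases "S = 0") (simp_all add: field_simps)
    then show "inverse (sqrt (1 - 2 * r * t + r\<^sup>2)) / 2 * (2 * (r - t)) = (r - t) / sqrt (1 - 2 * r * t + r\<^sup>2)" .
  qed
qed

lemma ray_u_deriv:
  assumes "0 < r" "r < 1"
  shows "(ray_u m t w has_field_derivative ray_u1 m t w r) (at r)"
  unfolding ray_u_def[abs_def] ray_u1_def using ray_R_bounds(3)[OF assms] assms
  by (auto intro!: derivative_eq_intros ray_R_deriv simp: power2_eq_square power3_eq_cube field_simps)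

lemma ray_u1_deriv:
  assumes "0 < r" "r < 1"
  shows "(ray_u1 m t w has_field_derivative ray_u2 m t w r) (at r)"
proof -
  have R: "ray_R t r \<noteq> 0" "r \<noteq> 0" using ray_R_bounds(3)[OF assms] assms by auto
  have 1: "((\<lambda>r. m / r\<^sup>2) has_field_derivative - 2 * m / r ^ 3) (at r)"
    using R by (auto intro!: derivative_eq_intros simp: power2_eq_square power3_eq_cube field_simps)
  have "((\<lambda>r. inverse (ray_R t r ^ 3)) has_field_derivative - (3 * (r - t) / ray_R t r ^ 5)) (at r)"
    using R by (auto intro!: derivative_eq_intros ray_R_deriv[OF assms] simp: eval_nat_numeral field_simps)
  note i = this
  have d: "((\<lambda>r. r - t) has_field_derivative 1) (at r)" by (auto intro!: derivative_eq_intros)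
  from DERIV_mult[OF d i] have 2: "((\<lambda>r. (r - t) / ray_R t r ^ 3) has_field_derivative (1 / ray_R t r ^ 3 - 3 * (r - t)\<^sup>2 / ray_R t r ^ 5)) (at r)"
    by (simp add: divide_inverse power2_eq_square algebra_simps)
  from DERIV_diff[OF DERIV_add[OF DERIV_add[OF 1 DERIV_cmult[OF 2, of "1 - m"]] DERIV_const[of "(1 - m) * t"]]
      DERIV_cmult_right[OF DERIV_ident, of w]]
  show ?thesis unfolding ray_u1_def[abs_def] ray_u2_def by (simp add: algebra_simps)
qed

lemma inverse_square_tangent: "0 < x \<Longrightarrow> 3 - 2 * x \<le> 1 / x\<^sup>2" for x :: real
proof -
  assume x: "0 < x"
  have "1 / x\<^sup>2 - (3 - 2 * x) = (1 - x)\<^sup>2 * (1 + 2 * x) / x\<^sup>2"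
    using x by (simp add: power2_eq_square field_simps)
  also have "\<dots> \<ge> 0" using x by simp
  finally show ?thesis by simp
qed

text \<open>Among all rays the slope is least towards the other primary (t = 1, w = 1), where it
  equals \<open>lagr_eq m r\<close>. After subtracting the harmonic part this is a bound for the
  tidal term.\<close>

lemma ray_u1_ge:
  assumes r: "0 < r" "r < 1" shows "lagr_eq m r \<le> ray_u1 m t w r"
proof -
  let ?R = "ray_R t r"
  note R = ray_R_bounds[OF r]
  have cube: "(1 / k ^ 3 - 1) * k = 1 / k\<^sup>2 - k" if "k \<noteq> 0" for k :: real
    using that by (simp add: power2_eq_square power3_eq_cube field_simps)
  \<comment> \<open>The right side is the left side at t = 1, where R = 1 - r. The signs of t - r
    and 1 - R give four cases, and in the two mixed ones the left side is nonpositive.\<close>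
  have key: "(1 / ?R ^ 3 - 1) * (t - r) \<le> 1 / (1 - r)\<^sup>2 - (1 - r)"
  proof -
    have sq: "(1 - r)\<^sup>2 \<le> 1" using r by (simp add: power_le_one)
    have nn: "0 \<le> 1 / (1 - r)\<^sup>2 - (1 - r)"
    proof -
      have "1 \<le> 1 / (1 - r)\<^sup>2" using sq r by (simp add: pos_le_divide_eq)
      then show ?thesis using r by linarith
    qed
    consider "r \<le> t" "?R \<le> 1" | "r \<le> t" "1 < ?R" | "t < r" "?R \<le> 1" | "t < r" "1 < ?R" by linarith
    then show ?thesis
    proof cases
      case 1
      have "1 / ?R ^ 3 \<le> 1 / (1 - r) ^ 3" using R r by (intro divide_left_mono power_mono) auto
      then have "(1 / ?R ^ 3 - 1) * (t - r) \<le> (1 / (1 - r) ^ 3 - 1) * (t - r)" using 1 by (intro mult_right_mono) auto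
      also have "\<dots> \<le> (1 / (1 - r) ^ 3 - 1) * (1 - r)"
      proof (rule mult_left_mono)
        have "(1 - r) ^ 3 \<le> 1" using r by (simp add: power_le_one)
        then show "0 \<le> 1 / (1 - r) ^ 3 - 1" using r by (simp add: pos_le_divide_eq)
      qed (use t in simp)
      also have "\<dots> = 1 / (1 - r)\<^sup>2 - (1 - r)" using r by (intro cube) simp
      finally show ?thesis .
    next
      case 2
      then have "1 / ?R ^ 3 \<le> 1" using one_le_power[of ?R 3] by simp
      then have "(1 / ?R ^ 3 - 1) * (t - r) \<le> 0" using 2 by (intro mult_nonpos_nonneg) auto
      then show ?thesis using nn by linarith
    next
      case 3
      then have "1 \<le> 1 / ?R ^ 3" using R power_le_one[of ?R 3] by (simp add: pos_le_divide_eq)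
      then have "(1 / ?R ^ 3 - 1) * (t - r) \<le> 0" using 3 by (intro mult_nonneg_nonpos) auto
      then show ?thesis using nn by linarith
    next
      \<comment> \<open>Here the extreme direction is t = -1 with R = 1 + r. It is compared with t =
        1 by adding the tangent line of 1/x^2 at 1, evaluated at 1 + r and 1 - r.\<close>
      case 4
      have a: "1 - 1 / ?R ^ 3 \<le> 1 - 1 / (1 + r) ^ 3" using R by (simp add: divide_left_mono power_mono)
      have "(x - 1) * (t - r) = (1 - x) * (r - t)" for x by (simp add: algebra_simps)
      then have "(1 / ?R ^ 3 - 1) * (t - r) = (1 - 1 / ?R ^ 3) * (r - t)" .
      also have "\<dots> \<le> (1 - 1 / (1 + r) ^ 3) * (1 + r)"
      proof (rule mult_mono[OF a])
        show "r - t \<le> 1 + r" using t by simp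
        have "1 \<le> (1 + r) ^ 3" using r by (intro one_le_power) simp
        then show "0 \<le> 1 - 1 / (1 + r) ^ 3" using r by (simp add: divide_le_eq_1)
      qed (use 4 in simp)
      also have "\<dots> = (1 + r) - 1 / (1 + r)\<^sup>2" using cube[of "1 + r"] r by (simp add: algebra_simps)
      also have "\<dots> \<le> 1 / (1 - r)\<^sup>2 - (1 - r)"
        using inverse_square_tangent[of "1 + r"] inverse_square_tangent[of "1 - r"] r by simp
      finally show ?thesis .
    qed
  qed
  have "ray_u1 m t w r = m * (1 / r\<^sup>2 - r) - (1 - m) * ((1 / ?R ^ 3 - 1) * (t - r)) + r * (1 - w)"
  proof -
    define A where "A = inverse (?R ^ 3)"
    have "ray_u1 m t w r = m * (1 / r\<^sup>2) + (1 - m) * ((r - t) * A) + (1 - m) * t - r * w" "1 / ?R ^ 3 = A"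
      by (simp_all add: ray_u1_def A_def divide_inverse)
    then show ?thesis by (simp add: algebra_simps)
  qed
  moreover have "(1 - m) * ((1 / ?R ^ 3 - 1) * (t - r)) \<le> (1 - m) * (1 / (1 - r)\<^sup>2 - (1 - r))"
    using key m by (intro mult_left_mono) auto
  moreover have "0 \<le> r * (1 - w)" using r w by simp
  ultimately show ?thesis unfolding lagr_eq_def by linarith
qed

lemma lagr_eq_nonneg:
  assumes "0 < r" "r \<le> s" shows "0 \<le> lagr_eq m r" "r < s \<Longrightarrow> 0 < lagr_eq m r"
  using lagr_eq_decreasing[OF m assms(1), of s] s assms by (cases "r = s"; force)+

text \<open>The radial second derivative of the Newtonian potential is nonpositive in the ball: up to the angular
  factor, the tidal term of the other primary is dominated because \<open>r\<close> does not exceed the distance of the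
  Lagrange point.\<close>

lemma ray_u2_le:
  assumes r: "0 < r" "r \<le> s" shows "ray_u2 m t w r + w \<le> 0"
proof -
  have r1: "r < 1" using r s by simp
  let ?R = "ray_R t r"
  note R = ray_R_bounds[OF r(1) r1]
  define k where "k = 1 - r"
  have k: "0 < k" "k < 1" "r = 1 - k" using r r1 by (auto simp: k_def)
  \<comment> \<open>Numerator of the radial second derivative of the other primary's attraction;
    where it is nonpositive the claim is immediate.\<close>
  define E where "E = ?R\<^sup>2 - 3 * (r - t)\<^sup>2"
  have u2: "ray_u2 m t w r + w = - 2 * m / r ^ 3 + (1 - m) * (E / ?R ^ 5)"
  proof -
    have "1 / ?R ^ 3 = ?R\<^sup>2 / ?R ^ 5" using R(3) by (simp add: eval_nat_numeral)
    then show ?thesis unfolding ray_u2_def E_def by (simp add: diff_divide_distrib)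
  qed
  show ?thesis
  proof (cases "E \<le> 0")
    case True
    then have "(1 - m) * (E / ?R ^ 5) \<le> 0" using m R(3) by (intro mult_nonneg_nonpos divide_nonpos_pos) auto
    moreover have "0 \<le> 2 * m / r ^ 3" using m r by simp
    ultimately show ?thesis unfolding u2 by simp
  next
    case False
    \<comment> \<open>\<open>lagr_eq m r\<close> is nonnegative for r up to s; multiply it by r^2
      k^2 and factor 1 - r^3 and 1 - k^3.\<close>
    have lag: "(1 - m) * r ^ 3 * (1 + k + k\<^sup>2) \<le> m * k ^ 3 * (3 - 3 * k + k\<^sup>2)"
    proof -
      have "0 \<le> lagr_eq m r * (r\<^sup>2 * k\<^sup>2)" using lagr_eq_nonneg(1)[OF r] by simp
      also have "lagr_eq m r * (r\<^sup>2 * k\<^sup>2) = (m * (1 - r ^ 3) * k\<^sup>2 - (1 - m) * (1 - k ^ 3) * r\<^sup>2)"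
      proof -
        define X where "X = 1 / r\<^sup>2 - r"
        define Y where "Y = 1 / k\<^sup>2 - k"
        have "r\<^sup>2 * X = 1 - r ^ 3" "k\<^sup>2 * Y = 1 - k ^ 3"
          using r k(1) by (simp_all add: X_def Y_def right_diff_distrib power2_eq_square power3_eq_cube)
        then have "(m * X - (1 - m) * Y) * (r\<^sup>2 * k\<^sup>2) = m * (1 - r ^ 3) * k\<^sup>2 - (1 - m) * (1 - k ^ 3) * r\<^sup>2"
          by algebra
        then show ?thesis by (simp add: lagr_eq_def X_def Y_def k_def)
      qed
      also have "\<dots> = m * k ^ 3 * (3 - 3 * k + k\<^sup>2) - (1 - m) * r ^ 3 * (1 + k + k\<^sup>2)"
        unfolding k(3) by algebra
      finally show ?thesis by simp
    qed
    have "3 * (t - r)\<^sup>2 < ?R\<^sup>2" using False by (simp add: E_def power2_commute)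
    \<comment> \<open>29/50 lies just above 1/sqrt 3, so E > 0 confines t - r to that multiple of
      R.\<close>
    moreover have "((29/50) * ?R)\<^sup>2 = (841/2500) * ?R\<^sup>2" by (simp add: power2_eq_square)
    ultimately have "(t - r)\<^sup>2 \<le> ((29/50) * ?R)\<^sup>2" using zero_le_power2[of ?R] by linarith
    then have tr: "t - r \<le> (29/50) * ?R" by (rule power2_le_imp_le) (use R(3) in simp)
    have geo: "k * (2 - k) \<le> ?R\<^sup>2 + (29/25) * (1 - k) * ?R"
    proof -
      have "k * (2 - k) = ?R\<^sup>2 + 2 * r * (t - r)"
        unfolding R(4) k_def by (simp add: power2_eq_square algebra_simps)
      moreover have "2 * r * (t - r) \<le> 2 * r * ((29/50) * ?R)" using r tr by (intro mult_left_mono) auto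
      moreover have "2 * r * ((29/50) * ?R) = (29/25) * (1 - k) * ?R" by (simp add: k_def)
      ultimately show ?thesis by linarith
    qed
    have Rk: "k \<le> ?R" using R(1) by (simp add: k_def)
    have poly: "k ^ 3 * (3 - 3 * k + k\<^sup>2) \<le> 2 * ?R ^ 3 * (1 + k + k\<^sup>2)"
    \<comment> \<open>The cube of 23/20 exceeds 3/2, which settles large R by itself. For smaller R,
      \<open>geo\<close> forces k \<ge> 3/5, and then R \<ge> k is enough.\<close>
    proof (cases "(23/20) * k \<le> ?R")
      case True
      have "((23/20) * k) ^ 3 \<le> ?R ^ 3" using True k by (intro power_mono) auto
      then have "(3/2) * k ^ 3 \<le> ?R ^ 3" using zero_less_power[OF k(1), of 3] by (simp add: power_mult_distrib eval_nat_numeral)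
      moreover have "3 - 3 * k + k\<^sup>2 \<le> 3 * (1 + k + k\<^sup>2)" using k by simp
      ultimately have "(2/3 * ((3/2) * k ^ 3)) * (3 - 3 * k + k\<^sup>2) \<le> (2/3 * ?R ^ 3) * (3 * (1 + k + k\<^sup>2))"
        using k(1,2) R(3) by (intro mult_mono) auto
      moreover have "(2/3 * u) * (3 * v) = 2 * u * v" "2/3 * (3/2 * u) = u" for u v :: real by simp_all
      ultimately show ?thesis by (simp only:)
    next
      case False
      then have l: "?R \<le> (23/20) * k" by simp
      have "?R\<^sup>2 \<le> ((23/20) * k)\<^sup>2" using l R(3) by (intro power_mono) auto
      moreover have "(29/25) * (1 - k) * ?R \<le> (29/25) * (1 - k) * ((23/20) * k)" using l k by (intro mult_left_mono) auto
      ultimately have "k * (2 - k) \<le> ((23/20) * k)\<^sup>2 + (29/25) * (1 - k) * ((23/20) * k)" using geo by linarith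
      then have "k * (2 - k) \<le> k * ((529/400) * k + (667/500) * (1 - k))" by (simp add: power2_eq_square algebra_simps)
      then have "2 - k \<le> (529/400) * k + (667/500) * (1 - k)" using k(1) by simp
      moreover have "667/500 * (1 - k) = 667/500 - 667/500 * k" unfolding right_diff_distrib by simp
      ultimately have k6: "3/5 \<le> k" by linarith
      have "2 * (1 + k + k\<^sup>2) - (3 - 3 * k + k\<^sup>2) = k\<^sup>2 + (5 * k - 1)" by simp
      moreover have "0 \<le> k\<^sup>2 + (5 * k - 1)" using k6 by (intro add_nonneg_nonneg) auto
      ultimately have "3 - 3 * k + k\<^sup>2 \<le> 2 * (1 + k + k\<^sup>2)" by simp
      moreover have "k ^ 3 \<le> ?R ^ 3" using Rk k by (intro power_mono) auto
      ultimately have "k ^ 3 * (3 - 3 * k + k\<^sup>2) \<le> ?R ^ 3 * (2 * (1 + k + k\<^sup>2))"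
        using k(1,2) R(3) by (intro mult_mono) auto
      also have "\<dots> = 2 * ?R ^ 3 * (1 + k + k\<^sup>2)" by (simp only: mult_ac)
      finally show ?thesis .
    qed
    have pos: "0 < 1 + k + k\<^sup>2" by (rule add_pos_nonneg) (use k(1) in auto)
    have "(1 - m) * r ^ 3 * (1 + k + k\<^sup>2) \<le> m * (2 * ?R ^ 3 * (1 + k + k\<^sup>2))"
    proof (rule order_trans[OF lag])
      show "m * k ^ 3 * (3 - 3 * k + k\<^sup>2) \<le> m * (2 * ?R ^ 3 * (1 + k + k\<^sup>2))"
        unfolding mult.assoc[of m "k ^ 3"] by (rule mult_left_mono[OF poly]) (use m in simp)
    qed
    also have "m * (2 * ?R ^ 3 * (1 + k + k\<^sup>2)) = (2 * m * ?R ^ 3) * (1 + k + k\<^sup>2)" by simp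
    finally have A: "(1 - m) * r ^ 3 \<le> 2 * m * ?R ^ 3" using pos by (rule mult_right_le_imp_le)
    have "E \<le> ?R\<^sup>2" by (simp add: E_def)
    then have "(1 - m) * r ^ 3 * E \<le> 2 * m * ?R ^ 3 * ?R\<^sup>2"
      by (rule mult_mono[OF A]) (use False m R(3) in simp_all)
    then have "(1 - m) * r ^ 3 * E \<le> 2 * m * ?R ^ 5" by (simp add: eval_nat_numeral mult.assoc)
    then have "(1 - m) * (E / ?R ^ 5) \<le> 2 * m / r ^ 3"
      using r R(3) by (simp add: pos_le_divide_eq pos_divide_le_eq mult_ac)
    then show ?thesis unfolding u2 by simp
  qed
qed

text \<open>The function f = u'^2/2 - w (c - u) has derivative u' (u'' + w), nonpositive on the way
  to s, so f(r) is at least f(s), and c < u(s) makes f(s) positive when w > 0.\<close>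

lemma ray_transverse:
  assumes r: "0 < r" "r < s" and c: "c < ray_u m t w s"
  shows "0 < ray_u1 m t w r" "2 * w * (c - ray_u m t w r) < (ray_u1 m t w r)\<^sup>2"
proof -
  show u1: "0 < ray_u1 m t w r"
    using ray_u1_ge[OF r(1)] lagr_eq_nonneg(2)[OF r(1) less_imp_le[OF r(2)] r(2)] r s by simp
  define f where "f r = (ray_u1 m t w r)\<^sup>2 / 2 - w * (c - ray_u m t w r)" for r
  have "f s \<le> f r"
  proof (rule DERIV_nonpos_imp_nonincreasing[OF less_imp_le[OF r(2)]])
    fix x assume x: "r \<le> x" "x \<le> s"
    then have x1: "0 < x" "x < 1" using r s by auto
    have "(f has_field_derivative (ray_u1 m t w) x * ((ray_u2 m t w) x + w)) (at x)"
      unfolding f_def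
      by (auto intro!: derivative_eq_intros ray_u1_deriv[OF x1] ray_u_deriv[OF x1] simp: algebra_simps)
    moreover have "(ray_u1 m t w) x * ((ray_u2 m t w) x + w) \<le> 0"
      using ray_u1_ge[OF x1] lagr_eq_nonneg(1)[OF x1(1) x(2)] ray_u2_le[OF x1(1) x(2)]
      by (intro mult_nonneg_nonpos) auto
    ultimately show "\<exists>y. (f has_real_derivative y) (at x) \<and> y \<le> 0" by (intro exI conjI)
  qed
  \<comment> \<open>For w = 0, a ray along the rotation axis, the claim reads 0 < u'^2 and follows
    from the sign of u'.\<close>
  moreover have "0 < f s \<or> w = 0"
  proof (cases "w = 0")
    case False
    then have "0 < w * (ray_u m t w s - c)" using w c by simp
    moreover have "f s = ((ray_u1 m t w) s)\<^sup>2 / 2 + w * (ray_u m t w s - c)" by (simp add: f_def algebra_simps)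
    ultimately have "0 < f s" using zero_le_power2[of "(ray_u1 m t w) s"] by linarith
    then show ?thesis ..
  qed simp
  ultimately show "2 * w * (c - ray_u m t w r) < (ray_u1 m t w r)\<^sup>2"
    using u1 by (auto simp: f_def)
qed

end


lemma continuous_effpot: "continuous_on (UNIV - {pos \<mu> Earth, pos \<mu> Moon}) (effpot \<mu>)"
  unfolding effpot_def[abs_def] by (intro continuous_intros) auto

context
  fixes \<mu> :: real
  assumes \<mu>: "0 < \<mu>" "\<mu> < 1"
begin

subsection \<open>Transversality of the radial field\<close>

text \<open>The derivative of H along the radial field is <vel z, vel (x,0)> + r u'(r). The two
  velocities have squared lengths 2 (c - u) and r^2 w, so by Cauchy-Schwarz the second summand
  dominates exactly when \<open>ray_transverse\<close> holds.\<close>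

lemma radial_transverse:
  assumes c: "c < H \<mu> (L1 \<mu>)" and s: "0 < s" "s < 1" "lagr_eq (mass \<mu> P) s = 0"
    and Hs: "H \<mu> (L1 \<mu>) = - (mass \<mu> P * hfun s + mass \<mu> (other P) * hfun (1 - s)) + \<mu> * (1 - \<mu>) / 2"
    and z: "z \<in> level_set \<mu> c" and x: "x = fst z - pos \<mu> P" "x \<noteq> 0" "norm x < s"
  shows "0 < vel z \<bullet> vel (x, 0) + grad_effpot \<mu> (fst z) \<bullet> x"
proof -
  define m where "m = mass \<mu> P"
  have m: "0 < m" "m < 1" "mass \<mu> (other P) = 1 - m" using mass_bounds[OF \<mu>] mass_other by (auto simp: m_def)
  define r where "r = norm x"
  have r: "0 < r" "r < s" "r < 1" using x s by (auto simp: r_def)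
  define a where "a = axis_dir \<mu> P"
  define \<omega> where "\<omega> = inverse r *\<^sub>R x"
  have xo: "x = r *\<^sub>R \<omega>" using r by (simp add: \<omega>_def)
  have o1: "\<omega> \<bullet> \<omega> = 1" using r by (simp add: \<omega>_def r_def dot_square_norm power2_eq_square)
  have a1: "a \<bullet> a = 1" using norm_axis_dir[of \<mu> P] by (simp add: a_def norm_eq_1)
  have a23: "a $ 2 = 0" "a $ 3 = 0" by (simp_all add: a_def axis_dir_component)
  define t where "t = \<omega> \<bullet> a"
  have t': "t = \<omega> $ 1 * a $ 1" by (simp add: t_def inner_3 a23)
  define w where "w = (\<omega> $ 1)\<^sup>2 + (\<omega> $ 2)\<^sup>2"
  have aa: "a $ 1 * a $ 1 = 1" using a1 by (simp add: inner_3 a23)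
  have "\<bar>t\<bar> \<le> 1" using Cauchy_Schwarz_ineq2[of \<omega> a] o1 a1 by (simp add: t_def norm_eq_1[symmetric])
  then have t: "-1 \<le> t" "t \<le> 1" by auto
  have w3: "w = 1 - (\<omega> $ 3)\<^sup>2" using o1 by (simp add: w_def inner_3 power2_eq_square)
  have "0 \<le> w" by (simp add: w_def)
  moreover have "w \<le> 1" unfolding w3 by simp
  ultimately have w: "0 \<le> w" "w \<le> 1" by auto
  have s': "lagr_eq m s = 0" using s by (simp add: m_def)
  have P: "pos \<mu> P = - (1 - m) *\<^sub>R a" using pos_axis[of \<mu> P] m by (simp add: a_def)
  have pot: "effpot \<mu> (pos \<mu> P + r' *\<^sub>R \<omega>) = ray_u m t w r'" if r': "0 < r'" "r' < 1" for r'
  proof -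
    let ?q = "pos \<mu> P + r' *\<^sub>R \<omega>"
    have 1: "norm (?q - pos \<mu> P) = r'" using r' o1 by (simp add: norm_eq_1)
    have "?q - pos \<mu> (other P) = r' *\<^sub>R \<omega> - a" by (simp add: pos_other_axis a_def)
    moreover have "(r' *\<^sub>R \<omega> - a) \<bullet> (r' *\<^sub>R \<omega> - a) = 1 - 2 * r' * t + r'\<^sup>2"
      using o1 a1 by (simp add: inner_diff_left inner_diff_right t_def inner_commute power2_eq_square)
    ultimately have 2: "norm (?q - pos \<mu> (other P)) = ray_R t r'"
      by (simp only: norm_eq_sqrt_inner ray_R_def)
    have q1: "?q $ 1 = - (1 - m) * a $ 1 + r' * \<omega> $ 1" "?q $ 2 = r' * \<omega> $ 2" by (simp_all add: P a23)
    have "(?q $ 1)\<^sup>2 + (?q $ 2)\<^sup>2 = (1 - m)\<^sup>2 * (a $ 1 * a $ 1) - 2 * (1 - m) * r' * (\<omega> $ 1 * a $ 1) + r'\<^sup>2 * w"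
      unfolding q1 w_def by (simp add: power2_eq_square algebra_simps)
    then have Q: "(?q $ 1)\<^sup>2 + (?q $ 2)\<^sup>2 = (1 - m)\<^sup>2 - 2 * (1 - m) * r' * t + r'\<^sup>2 * w"
      unfolding aa t'[symmetric] by simp
    have "effpot \<mu> ?q = - m / r' - (1 - m) / ray_R t r' - ((?q $ 1)\<^sup>2 + (?q $ 2)\<^sup>2) / 2"
      unfolding effpot_alt[of \<mu> ?q P] 1 2 m(3) m_def by (rule refl)
    then show ?thesis unfolding Q ray_u_def by (simp add: diff_divide_distrib add_divide_distrib)
  qed
  have q: "fst z = pos \<mu> P + r *\<^sub>R \<omega>" using x(1) xo by simp
  have "effpot \<mu> (pos \<mu> P + s *\<^sub>R \<omega>) \<ge> H \<mu> (L1 \<mu>)"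
    unfolding Hs by (rule effpot_sphere[OF \<mu>]) (use s o1 in \<open>auto simp: norm_eq_1\<close>)
  then have cs: "c < ray_u m t w s" using pot[OF s(1,2)] c by simp
  note ray = ray_transverse[OF m(1,2) t w s(1,2) s' r(1,2) cs]
  have grad: "grad_effpot \<mu> (fst z) \<bullet> x = r * ray_u1 m t w r"
  proof -
    let ?q = "fst z"
    have 1: "?q - pos \<mu> P = x" using x(1) by simp
    have 2: "?q - pos \<mu> (other P) = x - a" using x(1) by (simp add: pos_other_axis a_def)
    have xx: "x \<bullet> x = r * r" "x \<bullet> a = r * t" using o1 by (simp_all add: xo t_def)
    have n2: "norm (x - a) = ray_R t r"
      using xx a1 by (simp add: norm_eq_sqrt_inner ray_R_def inner_diff_left inner_diff_right inner_commute power2_eq_square)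
    have g: "grad_effpot \<mu> ?q = (mass \<mu> P / (norm (?q - pos \<mu> P))^3) *\<^sub>R (?q - pos \<mu> P)
     + (mass \<mu> (other P) / (norm (?q - pos \<mu> (other P)))^3) *\<^sub>R (?q - pos \<mu> (other P)) - vector [?q $ 1, ?q $ 2, 0]"
      by (cases P) (simp_all add: grad_effpot_def)
    have v: "vector [?q $ 1, ?q $ 2, 0] \<bullet> x = - (1 - m) * r * t + r * r * w"
      unfolding inner_3 q xo by (simp add: P a23 t' w_def power2_eq_square algebra_simps)
    have "grad_effpot \<mu> ?q \<bullet> x = m / r ^ 3 * (r * r) + (1 - m) / ray_R t r ^ 3 * (r * r - r * t) - (- (1 - m) * r * t + r * r * w)"
      unfolding g 1 2 n2 m(3) m_def[symmetric] r_def[symmetric] inner_diff_left inner_add_left inner_scaleR_left v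
      using xx by (simp add: inner_commute[of a x])
    also have "\<dots> = r * ray_u1 m t w r"
    proof -
      define A where "A = inverse (ray_R t r ^ 3)"
      define B where "B = m / r\<^sup>2"
      have f1: "m / r ^ 3 * (r * r) = r * B" using r by (simp add: B_def power2_eq_square power3_eq_cube)
      have f2: "ray_u1 m t w r = B + (1 - m) * ((r - t) * A) + (1 - m) * t - r * w"
        by (simp add: ray_u1_def A_def B_def divide_inverse)
      have f3: "(1 - m) / ray_R t r ^ 3 * (r * r - r * t) = (1 - m) * A * (r * r - r * t)"
        by (simp add: A_def divide_inverse)
      show ?thesis unfolding f1 f2 f3 by (simp add: algebra_simps)
    qed
    finally show ?thesis .
  qed
  have v2: "vel z \<bullet> vel z = 2 * (c - ray_u m t w r)"
    using level_set_vel[OF z] pot[OF r(1,3)] q by simp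
  have vx: "vel (x, 0) \<bullet> vel (x, 0) = r * r * w"
    unfolding inner_3 by (simp add: vel_def xo w_def power2_eq_square algebra_simps)
  have "(vel z \<bullet> vel (x, 0))\<^sup>2 \<le> (vel z \<bullet> vel z) * (vel (x, 0) \<bullet> vel (x, 0))" by (rule Cauchy_Schwarz_ineq)
  also have "\<dots> = r\<^sup>2 * (2 * w * (c - ray_u m t w r))" unfolding v2 vx by (simp add: power2_eq_square)
  also have "\<dots> < r\<^sup>2 * (ray_u1 m t w r)\<^sup>2" using ray(2) r by simp
  finally have "(vel z \<bullet> vel (x, 0))\<^sup>2 < (r * ray_u1 m t w r)\<^sup>2" by (simp add: power_mult_distrib)
  then have "\<bar>vel z \<bullet> vel (x, 0)\<bar> < r * ray_u1 m t w r"
    using ray(1) r by (metis abs_le_square_iff abs_of_pos mult_pos_pos not_le power2_abs)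
  then show ?thesis unfolding grad by linarith
qed

subsection \<open>The outer Lagrange points and the second critical value\<close>

text \<open>The equilibrium condition on the axis behind \<open>P\<close>, away from the other
  primary; again by the intermediate value theorem after clearing denominators.\<close>

lemma outer_root:
  obtains \<rho> where "0 < \<rho>" "\<rho> < 1"
    "mass \<mu> P * (\<rho> - 1 / \<rho>\<^sup>2) + mass \<mu> (other P) * ((1 + \<rho>) - 1 / (1 + \<rho>)\<^sup>2) = 0"
proof -
  define m where "m = mass \<mu> P"
  have m: "0 < m" "m < 1" "mass \<mu> (other P) = 1 - m" using mass_bounds[OF \<mu>] mass_other by (auto simp: m_def)
  define p where "p \<rho> = m * (\<rho> ^ 3 - 1) * (1 + \<rho>)\<^sup>2 + (1 - m) * ((1 + \<rho>) ^ 3 - 1) * \<rho>\<^sup>2" for \<rho> :: real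
  have "continuous_on {0..1} p" unfolding p_def by (intro continuous_intros)
  from IVT'[OF _ _ _ this, of 0] obtain \<rho> where \<rho>: "0 \<le> \<rho>" "\<rho> \<le> 1" "p \<rho> = 0"
    using m by (auto simp: p_def)
  have "\<rho> \<noteq> 0" "\<rho> \<noteq> 1" using \<rho>(3) m by (auto simp: p_def)
  with \<rho> have r: "0 < \<rho>" "\<rho> < 1" by auto
  define X where "X = \<rho> - 1 / \<rho>\<^sup>2"
  define Y where "Y = (1 + \<rho>) - 1 / (1 + \<rho>)\<^sup>2"
  have "\<rho>\<^sup>2 * X = \<rho> ^ 3 - 1" "(1 + \<rho>)\<^sup>2 * Y = (1 + \<rho>) ^ 3 - 1"
    using r by (simp_all add: X_def Y_def right_diff_distrib power2_eq_square power3_eq_cube)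
  then have "\<rho>\<^sup>2 * (1 + \<rho>)\<^sup>2 * (m * X + (1 - m) * Y) = p \<rho>" unfolding p_def by algebra
  then have "m * X + (1 - m) * Y = 0" using r \<rho>(3) by simp
  then show thesis using that[of \<rho>] r m by (simp add: X_def Y_def m_def)
qed

lemma outer_axis_dist:
  assumes "0 < \<rho>"
  shows "norm (pos \<mu> P + (- \<rho>) *\<^sub>R axis_dir \<mu> P - pos \<mu> P) = \<rho>"
    "norm (pos \<mu> P + (- \<rho>) *\<^sub>R axis_dir \<mu> P - pos \<mu> (other P)) = 1 + \<rho>"
  using axis_point_dist[of \<mu> P "- \<rho>"] assms by auto

lemma effpot_outer_axis:
  assumes "0 < \<rho>"
  shows "effpot \<mu> (pos \<mu> P + (- \<rho>) *\<^sub>R axis_dir \<mu> P) =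
    - (mass \<mu> P * hfun \<rho> + mass \<mu> (other P) * hfun (1 + \<rho>)) + \<mu> * (1 - \<mu>) / 2"
  unfolding effpot_bipolar[of \<mu> _ P] outer_axis_dist[OF assms] by (simp add: pos_component axis_dir_component)

lemma grad_outer_axis:
  assumes "0 < \<rho>"
  shows "grad_effpot \<mu> (pos \<mu> P + (- \<rho>) *\<^sub>R axis_dir \<mu> P) =
    (mass \<mu> P * (\<rho> - 1 / \<rho>\<^sup>2) + mass \<mu> (other P) * ((1 + \<rho>) - 1 / (1 + \<rho>)\<^sup>2)) *\<^sub>R axis_dir \<mu> P"
proof -
  have "(- \<rho> - 1)\<^sup>2 = (1 + \<rho>)\<^sup>2" "(- \<rho>)\<^sup>2 = \<rho>\<^sup>2" by (simp_all add: power2_eq_square algebra_simps)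
  then show ?thesis
    using grad_effpot_axis[of "- \<rho>" \<mu> P] assms by (simp add: sgn_if algebra_simps)
qed

text \<open>On each of the three intervals of the axis the potential is strictly concave, so a critical point is
  the maximum.\<close>

lemma concave_max:
  assumes xy: "0 < x" "0 < y" "0 < x'" "0 < y'" "x' - x = d" "y' - y = e * d" "\<bar>e\<bar> = 1"
    and crit: "mass \<mu> P * (x - 1 / x\<^sup>2) + e * (mass \<mu> (other P) * (y - 1 / y\<^sup>2)) = 0"
  shows "mass \<mu> P * hfun x + mass \<mu> (other P) * hfun y + d\<^sup>2 / 2 \<le> mass \<mu> P * hfun x' + mass \<mu> (other P) * hfun y'"
proof -
  define m where "m = mass \<mu> P"
  have m: "0 < m" "m < 1" "mass \<mu> (other P) = 1 - m" using mass_bounds[OF \<mu>] mass_other by (auto simp: m_def)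
  have ee: "e * e = 1" using xy(7) by (metis abs_mult_self_eq mult_1_left)
  have a: "m * (hfun x + (x - 1 / x\<^sup>2) * d + d\<^sup>2 / 2) \<le> m * hfun x'"
    using hfun_tangent[OF xy(1,3)] xy(5) m by (intro mult_left_mono) auto
  have "(e * d)\<^sup>2 = d\<^sup>2" using ee by (simp add: power2_eq_square algebra_simps)
  then have b: "(1 - m) * (hfun y + (y - 1 / y\<^sup>2) * (e * d) + d\<^sup>2 / 2) \<le> (1 - m) * hfun y'"
    using hfun_tangent[OF xy(2,4)] xy(6) m by (intro mult_left_mono) auto
  define X where "X = x - 1 / x\<^sup>2"
  define Y where "Y = y - 1 / y\<^sup>2"
  have c: "m * X + e * ((1 - m) * Y) = 0" using crit m by (simp add: X_def Y_def m_def)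
  have "m * (hfun x + X * d + d\<^sup>2 / 2) + (1 - m) * (hfun y + Y * (e * d) + d\<^sup>2 / 2)
     = m * hfun x + (1 - m) * hfun y + d\<^sup>2 / 2 + (m * X + e * ((1 - m) * Y)) * d"
    by (simp add: algebra_simps add_divide_distrib diff_divide_distrib)
  then show ?thesis using a b unfolding c m(3) m_def[symmetric] X_def[symmetric] Y_def[symmetric] by simp
qed

text \<open>With A and B the masses over the cubed distances, the third component forces q into the
  plane. Off the axis the second one gives A + B = 1, and then the first gives A = 1 - \<mu> and B =
  \<mu>, that is, unit distances.\<close>

lemma critical_classification:
  assumes q: "q \<notin> {pos \<mu> Earth, pos \<mu> Moon}" "grad_effpot \<mu> q = 0"
  shows "(\<exists>r. r \<noteq> 0 \<and> r \<noteq> 1 \<and> q = pos \<mu> Moon + r *\<^sub>R axis_dir \<mu> Moon) \<or>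
    (norm (q - pos \<mu> Earth) = 1 \<and> norm (q - pos \<mu> Moon) = 1 \<and> q $ 3 = 0)"
proof -
  define A where "A = (1 - \<mu>) / norm (q - pos \<mu> Earth) ^ 3"
  define B where "B = \<mu> / norm (q - pos \<mu> Moon) ^ 3"
  have AB: "0 < A" "0 < B" using q \<mu> by (auto simp: A_def B_def)
  have g: "grad_effpot \<mu> q = A *\<^sub>R (q - pos \<mu> Earth) + B *\<^sub>R (q - pos \<mu> Moon) - vector [q $ 1, q $ 2, 0]"
    by (simp add: grad_effpot_def A_def B_def)
  have "grad_effpot \<mu> q $ 3 = 0" "grad_effpot \<mu> q $ 2 = 0" "grad_effpot \<mu> q $ 1 = 0" using q(2) by simp_all
  then have c: "(A + B) * q $ 3 = 0" "(A + B - 1) * q $ 2 = 0" "(A + B - 1) * q $ 1 = A * \<mu> - B * (1 - \<mu>)"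
    unfolding g by (simp_all add: pos_component algebra_simps)
  have q3: "q $ 3 = 0" using c(1) AB by simp
  show ?thesis
  proof (cases "q $ 2 = 0")
    case True
    define r where "r = q $ 1 + (1 - \<mu>)"
    have qr: "q = pos \<mu> Moon + r *\<^sub>R axis_dir \<mu> Moon"
      unfolding vec_eq_iff forall_3 using True q3 by (simp add: r_def pos_component axis_dir_component)
    have "r \<noteq> 0" "r \<noteq> 1" using q(1) qr by (auto simp: axis_dir_def)
    then show ?thesis using qr by blast
  next
    case False
    then have S: "A + B = 1" using c(2) by simp
    then have "A * \<mu> = B * (1 - \<mu>)" using c(3) by simp
    then have "A * \<mu> = (1 - A) * (1 - \<mu>)" using S by (simp add: eq_diff_eq)
    then have "A = 1 - \<mu>" by (simp add: algebra_simps)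
    then have A: "A = 1 - \<mu>" "B = \<mu>" using S by auto
    have cancel: "N = 1" if "m / N = m" "m \<noteq> 0" for m N :: real
      using that by (cases "N = 0") (auto simp: divide_eq_eq)
    have "norm (q - pos \<mu> Earth) ^ 3 = 1" by (rule cancel[of "1 - \<mu>"]) (use A \<mu> in \<open>auto simp: A_def\<close>)
    moreover have "norm (q - pos \<mu> Moon) ^ 3 = 1" by (rule cancel[of \<mu>]) (use A \<mu> in \<open>auto simp: B_def\<close>)
    moreover have "x = 1" if "x ^ 3 = 1" "0 \<le> x" for x :: real
      using power_inject_base[of x 2 1] that by (simp add: eval_nat_numeral)
    ultimately have "norm (q - pos \<mu> Earth) = 1" "norm (q - pos \<mu> Moon) = 1" by simp_all
    then show ?thesis using q3 by simp
  qed
qed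

text \<open>The sign conditions say that \<open>r\<close> and \<open>r'\<close> lie in the same of
  the three intervals cut out by the primaries, where \<open>concave_max\<close> applies.\<close>

lemma axis_branch:
  assumes r: "r \<noteq> 0" "r \<noteq> 1" and g: "grad_effpot \<mu> (pos \<mu> Moon + r *\<^sub>R axis_dir \<mu> Moon) = 0"
    and r': "sgn r' = sgn r" "sgn (r' - 1) = sgn (r - 1)"
  shows "effpot \<mu> (pos \<mu> Moon + r' *\<^sub>R axis_dir \<mu> Moon) + (r' - r)\<^sup>2 / 2 \<le> effpot \<mu> (pos \<mu> Moon + r *\<^sub>R axis_dir \<mu> Moon)"
proof -
  have nz: "r' \<noteq> 0" "r' \<noteq> 1" using r r' by (auto simp: sgn_if split: if_splits)
  have U: "effpot \<mu> (pos \<mu> Moon + r *\<^sub>R axis_dir \<mu> Moon) =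
      - (mass \<mu> Moon * hfun \<bar>r\<bar> + mass \<mu> (other Moon) * hfun \<bar>r - 1\<bar>) + \<mu> * (1 - \<mu>) / 2" for r
    unfolding effpot_bipolar[of \<mu> _ Moon] axis_point_dist by (simp add: pos_component axis_dir_component)
  have "mass \<mu> Moon * (sgn r / r\<^sup>2 - r) + mass \<mu> (other Moon) * (sgn (r - 1) / (r - 1)\<^sup>2 - (r - 1)) = 0"
    using g grad_effpot_axis[OF r, of \<mu> Moon] axis_dir_nonzero[OF \<mu>, of Moon] by simp
  then have crit: "sgn r * (mass \<mu> Moon * (\<bar>r\<bar> - 1 / \<bar>r\<bar>\<^sup>2)) + sgn (r - 1) * (mass \<mu> (other Moon) * (\<bar>r - 1\<bar> - 1 / \<bar>r - 1\<bar>\<^sup>2)) = 0"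
    using r by (auto simp: sgn_if abs_if algebra_simps power2_commute[of 1 r] split: if_splits)
  \<comment> \<open>e = -1 between the primaries, where one distance grows as the other shrinks, and
    e = 1 outside.\<close>
  define e where "e = sgn r * sgn (r - 1)"
  have s: "sgn r * sgn r = 1" "sgn (r - 1) * sgn (r - 1) = 1" "\<bar>e\<bar> = 1" using r by (auto simp: e_def sgn_if)
  have "mass \<mu> Moon * (\<bar>r\<bar> - 1 / \<bar>r\<bar>\<^sup>2) + e * (mass \<mu> (other Moon) * (\<bar>r - 1\<bar> - 1 / \<bar>r - 1\<bar>\<^sup>2)) =
    sgn r * (sgn r * (mass \<mu> Moon * (\<bar>r\<bar> - 1 / \<bar>r\<bar>\<^sup>2)) + sgn (r - 1) * (mass \<mu> (other Moon) * (\<bar>r - 1\<bar> - 1 / \<bar>r - 1\<bar>\<^sup>2)))"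
    unfolding e_def distrib_left mult.assoc[symmetric] s(1) by simp
  then have crit': "mass \<mu> Moon * (\<bar>r\<bar> - 1 / \<bar>r\<bar>\<^sup>2) + e * (mass \<mu> (other Moon) * (\<bar>r - 1\<bar> - 1 / \<bar>r - 1\<bar>\<^sup>2)) = 0"
    unfolding crit by simp
  have d: "\<bar>r'\<bar> - \<bar>r\<bar> = sgn r * (r' - r)" "\<bar>r' - 1\<bar> - \<bar>r - 1\<bar> = e * (sgn r * (r' - r))"
    using r r' nz by (auto simp: e_def sgn_if abs_if split: if_splits)
  have "(sgn r * (r' - r))\<^sup>2 = (r' - r)\<^sup>2" using s(1) by (simp add: power_mult_distrib power2_eq_square)
  then show ?thesis
    using concave_max[OF _ _ _ _ d s(3) crit'] r nz unfolding U by simp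
qed

text \<open>A local minimum would be critical; yet every collinear critical point is a strict
  maximum along the axis, and from an equilateral point the potential drops along the ray away from
  the Moon.\<close>

lemma no_local_min:
  assumes q: "q \<notin> {pos \<mu> Earth, pos \<mu> Moon}" and S: "open S" "q \<in> S"
  shows "\<exists>q'\<in>S. q' \<notin> {pos \<mu> Earth, pos \<mu> Moon} \<and> effpot \<mu> q' < effpot \<mu> q"
proof (rule ccontr)
  let ?S = "S - {pos \<mu> Earth, pos \<mu> Moon}"
  assume "\<not> ?thesis"
  then have min: "\<forall>q'\<in>?S. effpot \<mu> q \<le> effpot \<mu> q'" by force
  have oS: "open ?S" "q \<in> ?S" using S q by (auto intro: open_Diff)
  have "(\<lambda>v. grad_effpot \<mu> q \<bullet> v) = (\<lambda>v. 0)"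
    by (rule differential_zero_maxmin[OF oS(2,1) effpot_has_derivative[OF q] disjI2[OF min]])
  then have g: "grad_effpot \<mu> q = 0" by (metis inner_eq_zero_iff)
  from critical_classification[OF q g] show False
  proof (elim disjE exE conjE)
    fix r assume r: "r \<noteq> 0" "r \<noteq> 1" and qr: "q = pos \<mu> Moon + r *\<^sub>R axis_dir \<mu> Moon"
    let ?f = "\<lambda>r. pos \<mu> Moon + r *\<^sub>R axis_dir \<mu> Moon"
    have "open (?f -` ?S \<inter> {r'. sgn r' = sgn r \<and> sgn (r' - 1) = sgn (r - 1)})" (is "open ?T")
    proof (rule open_Int)
      show "open (?f -` ?S)" by (intro open_vimage oS continuous_intros)
      consider "r < 0" | "0 < r" "r < 1" | "1 < r" using r by linarith
      then show "open {r'. sgn r' = sgn r \<and> sgn (r' - 1) = sgn (r - 1)}"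
      proof cases
        case 1
        then have "{r'. sgn r' = sgn r \<and> sgn (r' - 1) = sgn (r - 1)} = {..<0}" by (auto simp: sgn_if split: if_splits)
        then show ?thesis by simp
      next
        case 2
        then have "{r'. sgn r' = sgn r \<and> sgn (r' - 1) = sgn (r - 1)} = {0<..<1}" by (auto simp: sgn_if split: if_splits)
        then show ?thesis by simp
      next
        case 3
        then have "{r'. sgn r' = sgn r \<and> sgn (r' - 1) = sgn (r - 1)} = {1<..}" by (auto simp: sgn_if split: if_splits)
        then show ?thesis by simp
      qed
    qed
    moreover have "r \<in> ?T" using oS(2) qr by simp
    ultimately obtain d where d: "0 < d" "ball r d \<subseteq> ?T" using open_contains_ball by blast
    have "r + d / 2 \<in> ?T" using d by (intro subsetD[OF d(2)]) (simp add: dist_norm)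
    then have "effpot \<mu> q \<le> effpot \<mu> (?f (r + d / 2))" "sgn (r + d / 2) = sgn r" "sgn (r + d / 2 - 1) = sgn (r - 1)"
      using min by auto
    moreover have "0 < (r + d / 2 - r)\<^sup>2 / 2" using d by simp
    ultimately show False using axis_branch[OF r g[unfolded qr], of "r + d / 2"] unfolding qr by linarith
  next
    assume q1: "norm (q - pos \<mu> Earth) = 1" "norm (q - pos \<mu> Moon) = 1" "q $ 3 = 0"
    \<comment> \<open>Moving away from the Moon raises its \<open>hfun\<close> above the minimum
      3/2, while the Earth's term, already at the minimum, cannot fall.\<close>
    let ?f = "\<lambda>t. q + t *\<^sub>R (q - pos \<mu> Moon)"
    have "open (?f -` ?S)" by (intro open_vimage oS continuous_intros)
    moreover have "0 \<in> ?f -` ?S" using oS by simp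
    ultimately obtain d where d: "0 < d" "ball 0 d \<subseteq> ?f -` ?S" using open_contains_ball by blast
    have "d / 2 \<in> ?f -` ?S" using d(1) by (intro subsetD[OF d(2)]) simp
    then have fS: "?f (d / 2) \<in> ?S" by simp
    have "?f (d / 2) - pos \<mu> Moon = (1 + d / 2) *\<^sub>R (q - pos \<mu> Moon)" by (simp add: algebra_simps)
    then have n: "norm (?f (d / 2) - pos \<mu> Moon) = 1 + d / 2" using q1 d by simp
    have n2: "0 < norm (?f (d / 2) - pos \<mu> Earth)" using fS by simp
    have f3: "?f (d / 2) $ 3 = 0" using q1(3) by (simp add: pos_component)
    have "3 / 2 < hfun (1 + d / 2)" using d by (intro hfun_gt) auto
    then have "\<mu> * (3 / 2) < \<mu> * hfun (1 + d / 2)" using \<mu> by simp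
    moreover have "(1 - \<mu>) * (3 / 2) \<le> (1 - \<mu>) * hfun (norm (?f (d / 2) - pos \<mu> Earth))"
      using hfun_ge[OF n2] \<mu> by (intro mult_left_mono) auto
    moreover have "effpot \<mu> (?f (d / 2)) = - (\<mu> * hfun (1 + d / 2) + (1 - \<mu>) * hfun (norm (?f (d / 2) - pos \<mu> Earth))) + \<mu> * (1 - \<mu>) / 2"
      unfolding effpot_bipolar[of \<mu> _ Moon] n f3 by simp
    moreover have "effpot \<mu> q = - (\<mu> * (3 / 2) + (1 - \<mu>) * (3 / 2)) + \<mu> * (1 - \<mu>) / 2"
      unfolding effpot_bipolar[of \<mu> q Moon] using q1 by (simp add: hfun_def)
    ultimately have "effpot \<mu> (?f (d / 2)) < effpot \<mu> q" by linarith
    then show False using min fS by force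
  qed
qed

text \<open>Makes the \<open>Inf\<close> in \<open>second_critical_value\<close> meaningful. A
  collinear critical value is a maximum on its interval, hence at least the value at a sample point:
  -1, 1/2 and 2 are one in each interval. Equilateral values are at least -3/2.\<close>

lemma bdd_below_critical_values: "bdd_below (H \<mu> ` critical_points \<mu>)"
proof -
  let ?f = "\<lambda>r. effpot \<mu> (pos \<mu> Moon + r *\<^sub>R axis_dir \<mu> Moon)"
  let ?b = "min (min (?f (-1)) (?f (1/2))) (min (?f 2) (-3/2))"
  have "?b \<le> H \<mu> z" if z: "z \<in> critical_points \<mu>" for z
  proof -
    let ?q = "fst z"
    have z': "z \<in> phase_space \<mu>" "grad_effpot \<mu> ?q = 0" "vel z = 0" using z critical_point_iff by auto
    have q: "?q \<notin> {pos \<mu> Earth, pos \<mu> Moon}" using z'(1) phase_space_iff[of z \<mu> Earth] by simp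
    have H: "H \<mu> z = effpot \<mu> ?q" using z'(3) by (simp add: H_effpot)
    from critical_classification[OF q z'(2)] show ?thesis
    proof (elim disjE exE conjE)
      fix r assume r: "r \<noteq> 0" "r \<noteq> 1" and qr: "?q = pos \<mu> Moon + r *\<^sub>R axis_dir \<mu> Moon"
      consider "r < 0" | "0 < r" "r < 1" | "1 < r" using r by linarith
      then obtain r' where r': "r' \<in> {-1, 1/2, 2::real}" "sgn r' = sgn r" "sgn (r' - 1) = sgn (r - 1)"
      proof cases
        case 1
        then show thesis by (intro that[of "-1"]) (auto simp: sgn_if)
      next
        case 2
        then show thesis by (intro that[of "1/2"]) (auto simp: sgn_if)
      next
        case 3
        then show thesis by (intro that[of 2]) (auto simp: sgn_if)
      qed
      have "?f r' \<le> effpot \<mu> ?q"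
        using axis_branch[OF r z'(2)[unfolded qr] r'(2,3)] zero_le_power2[of "r' - r"] unfolding qr by linarith
      moreover have "?b \<le> ?f r'"
      proof -
        have b: "?b \<le> ?f (-1)" "?b \<le> ?f (1/2)" "?b \<le> ?f 2" by (simp_all add: min_le_iff_disj)
        from r'(1) consider "r' = -1" | "r' = 1/2" | "r' = 2" by blast
        then show ?thesis
        proof cases
          case 1
          show ?thesis unfolding 1 by (rule b(1))
        next
          case 2
          show ?thesis unfolding 2 by (rule b(2))
        next
          case 3
          show ?thesis unfolding 3 by (rule b(3))
        qed
      qed
      ultimately show ?thesis unfolding H by linarith
    next
      assume n: "norm (?q - pos \<mu> Earth) = 1" "norm (?q - pos \<mu> Moon) = 1" "?q $ 3 = 0"
      have "effpot \<mu> ?q = - (3 / 2) + \<mu> * (1 - \<mu>) / 2"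
        unfolding effpot_bipolar[of \<mu> _ Moon] using n by (simp add: hfun_def field_simps)
      moreover have "0 \<le> \<mu> * (1 - \<mu>) / 2" using \<mu> by simp
      ultimately show ?thesis unfolding H by (simp add: min_le_iff_disj)
    qed
  qed
  then show ?thesis unfolding bdd_below_def by blast
qed

lemma critical_value_ge:
  assumes "z \<in> critical_points \<mu>" "H \<mu> z \<noteq> H \<mu> (L1 \<mu>)"
  shows "second_critical_value \<mu> \<le> H \<mu> z"
  unfolding second_critical_value_def
  by (rule cInf_lower) (use assms bdd_below_critical_values in \<open>auto intro: bdd_below_mono\<close>)

text \<open>The outer point is the maximum on its branch, hence not below the point at distance s
  behind P, with s the distance of L1; that point in turn lies strictly above L1 by
  \<open>hfun_reflect\<close>. Its critical value thus differs from the one at L1.\<close>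

lemma outer_point:
  obtains \<rho> where "0 < \<rho>" "\<rho> < 1"
    "second_critical_value \<mu> \<le> - (mass \<mu> P * hfun \<rho> + mass \<mu> (other P) * hfun (1 + \<rho>)) + \<mu> * (1 - \<mu>) / 2"
proof -
  obtain \<rho> where \<rho>: "0 < \<rho>" "\<rho> < 1"
    "mass \<mu> P * (\<rho> - 1 / \<rho>\<^sup>2) + mass \<mu> (other P) * ((1 + \<rho>) - 1 / (1 + \<rho>)\<^sup>2) = 0" by (rule outer_root)
  let ?z = "rest (pos \<mu> P + (- \<rho>) *\<^sub>R axis_dir \<mu> P)"
  have "?z \<in> phase_space \<mu>" using \<rho> by (intro axis_point_phase) auto
  then have z: "?z \<in> critical_points \<mu>"
    unfolding critical_point_iff fst_rest grad_outer_axis[OF \<rho>(1)] using \<rho> vel_rest_0 by simp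
  have Hz: "H \<mu> ?z = - (mass \<mu> P * hfun \<rho> + mass \<mu> (other P) * hfun (1 + \<rho>)) + \<mu> * (1 - \<mu>) / 2"
    by (simp only: H_rest effpot_outer_axis[OF \<rho>(1)])
  obtain s where s: "0 < s" "s < 1" "lagr_eq (mass \<mu> P) s = 0"
    "H \<mu> (L1 \<mu>) = - (mass \<mu> P * hfun s + mass \<mu> (other P) * hfun (1 - s)) + \<mu> * (1 - \<mu>) / 2" by (rule L1_point[OF \<mu>])
  have "mass \<mu> P * hfun \<rho> + mass \<mu> (other P) * hfun (1 + \<rho>) + (s - \<rho>)\<^sup>2 / 2
     \<le> mass \<mu> P * hfun s + mass \<mu> (other P) * hfun (1 + s)"
    using \<rho> s by (intro concave_max[of _ _ _ _ "s - \<rho>" 1]) auto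
  moreover have "mass \<mu> (other P) * hfun (1 + s) < mass \<mu> (other P) * hfun (1 - s)"
    using hfun_reflect[OF s(1,2)] mass_bounds[OF \<mu>, of "other P"] by simp
  ultimately have "H \<mu> (L1 \<mu>) < H \<mu> ?z" unfolding s(4) Hz using zero_le_power2[of "s - \<rho>"] by linarith
  then show thesis using critical_value_ge[OF z] \<rho> unfolding Hz by (intro that[of \<rho>]) auto
qed

subsection \<open>The bounded component above the first critical value\<close>

text \<open>The oval through the two outer Lagrange points: a straight line in bipolar coordinates. Along it the
  potential is at least the second critical value by convexity of \<^const>\<open>hfun\<close>.\<close>

lemma separating_oval:
  obtains D where "open D" "bounded D" "pos \<mu> Earth \<in> D" "pos \<mu> Moon \<in> D"
    "\<forall>q\<in>closure D - D. second_critical_value \<mu> \<le> effpot \<mu> q"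
proof -
  obtain \<rho> where \<rho>: "0 < \<rho>" "\<rho> < 1"
    "second_critical_value \<mu> \<le> - (mass \<mu> Moon * hfun \<rho> + mass \<mu> (other Moon) * hfun (1 + \<rho>)) + \<mu> * (1 - \<mu>) / 2"
    by (rule outer_point)
  obtain \<kappa> where \<kappa>: "0 < \<kappa>" "\<kappa> < 1"
    "second_critical_value \<mu> \<le> - (mass \<mu> Earth * hfun \<kappa> + mass \<mu> (other Earth) * hfun (1 + \<kappa>)) + \<mu> * (1 - \<mu>) / 2"
    by (rule outer_point)
  \<comment> \<open>In the plane of the distances to Moon and Earth the outer points are (\<rho>, 1
    + \<rho>) and (1 + \<kappa>, \<kappa>); (a, b) is normal to the chord joining them, and
    \<open>d\<close> is its level.\<close>
  define a where "a = 1 + \<rho> - \<kappa>"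
  define b where "b = 1 + \<kappa> - \<rho>"
  define d where "d = a * \<rho> + b * (1 + \<rho>)"
  have ab: "0 < a" "0 < b" "a + b = 2" using \<rho>(1,2) \<kappa>(1,2) by (auto simp: a_def b_def)
  define f where "f q = a * norm (q - pos \<mu> Moon) + b * norm (q - pos \<mu> Earth)" for q
  define D where "D = {q. f q < d}"
  have cf: "continuous_on UNIV f" unfolding f_def by (intro continuous_intros)
  have oD: "open D" unfolding D_def by (intro open_Collect_less cf continuous_intros)
  have cD: "closure D \<subseteq> {q. f q \<le> d}"
    by (rule closure_minimal) (auto simp: D_def intro!: closed_Collect_le cf continuous_intros)
  have "D \<subseteq> ball (pos \<mu> Earth) (d / b)"
  proof
    fix q assume "q \<in> D"
    moreover have "0 \<le> a * norm (q - pos \<mu> Moon)" using ab by simp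
    ultimately have "b * norm (q - pos \<mu> Earth) < d" unfolding D_def f_def by simp
    then show "q \<in> ball (pos \<mu> Earth) (d / b)"
      using ab by (simp add: dist_norm norm_minus_commute pos_less_divide_eq mult.commute)
  qed
  then have "bounded D" using bounded_subset bounded_ball by blast
  have n1: "norm (pos \<mu> Moon - pos \<mu> Earth) = 1" "norm (pos \<mu> Earth - pos \<mu> Moon) = 1"
    using norm_pos_other[of \<mu> Earth] norm_pos_other[of \<mu> Moon] by simp_all
  have d2: "d = a * (1 + \<kappa>) + b * \<kappa>" unfolding d_def a_def b_def by (simp add: algebra_simps)
  have E: "pos \<mu> Earth \<in> D" unfolding D_def f_def using n1 ab \<kappa> by (simp add: d2 distrib_left add_pos_pos)
  have M: "pos \<mu> Moon \<in> D" unfolding D_def f_def using n1 ab \<rho> by (simp add: d_def distrib_left add_pos_pos)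
  have "second_critical_value \<mu> \<le> effpot \<mu> q" if "q \<in> closure D - D" for q
  proof -
    define x where "x = norm (q - pos \<mu> Moon)"
    define y where "y = norm (q - pos \<mu> Earth)"
    have fq: "a * x + b * y = d" using that cD by (force simp: D_def f_def x_def y_def)
    \<comment> \<open>Position on the chord. The triangle inequality |y - x| \<le> 1 says precisely
      that the point lies between the two ends.\<close>
    define l where "l = (1 - (y - x)) / 2"
    have l: "0 \<le> l" "l \<le> 1"
      using dist_triangle_primaries(2,3)[of q \<mu> Earth] by (auto simp: l_def x_def y_def)
    have yx: "y = x + 1 - 2 * l" by (simp add: l_def field_simps)
    have "2 * x = 2 * \<rho> + 2 * (l * b)"
    proof -
      have "(a + b) * x + b * (1 - 2 * l) = d" using fq unfolding yx by (simp add: algebra_simps)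
      then have "2 * x + b * (1 - 2 * l) = 2 * \<rho> + b" unfolding ab(3) d_def using ab(3) by (simp add: algebra_simps) (metis add.commute distrib_left mult.commute ab(3))
      then show ?thesis by (simp add: algebra_simps)
    qed
    then have x': "x = (1 - l) * \<rho> + l * (1 + \<kappa>)" by (simp add: b_def algebra_simps)
    then have y': "y = (1 - l) * (1 + \<rho>) + l * \<kappa>" unfolding yx by (simp add: algebra_simps)
    have hx: "hfun x \<le> (1 - l) * hfun \<rho> + l * hfun (1 + \<kappa>)"
      using convex_onD[OF hfun_convex l, of \<rho> "1 + \<kappa>"] \<rho> \<kappa> unfolding x' by simp
    have hy: "hfun y \<le> (1 - l) * hfun (1 + \<rho>) + l * hfun \<kappa>"
      using convex_onD[OF hfun_convex l, of "1 + \<rho>" \<kappa>] \<rho> \<kappa> unfolding y' by simp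
    define F1 where "F1 = \<mu> * hfun \<rho> + (1 - \<mu>) * hfun (1 + \<rho>)"
    define F2 where "F2 = (1 - \<mu>) * hfun \<kappa> + \<mu> * hfun (1 + \<kappa>)"
    have "\<mu> * hfun x + (1 - \<mu>) * hfun y \<le> \<mu> * ((1 - l) * hfun \<rho> + l * hfun (1 + \<kappa>)) + (1 - \<mu>) * ((1 - l) * hfun (1 + \<rho>) + l * hfun \<kappa>)"
      using hx hy \<mu> by (intro add_mono mult_left_mono) auto
    also have "\<dots> = (1 - l) * F1 + l * F2" by (simp add: F1_def F2_def algebra_simps)
    also have "\<dots> \<le> (1 - l) * (\<mu> * (1 - \<mu>) / 2 - second_critical_value \<mu>) + l * (\<mu> * (1 - \<mu>) / 2 - second_critical_value \<mu>)"
      using \<rho>(3) \<kappa>(3) l by (intro add_mono mult_left_mono) (auto simp: F1_def F2_def)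
    also have "(1 - l) * X + l * X = X" for X by (simp add: algebra_simps)
    finally have "\<mu> * hfun x + (1 - \<mu>) * hfun y \<le> \<mu> * (1 - \<mu>) / 2 - second_critical_value \<mu>" .
    then show ?thesis unfolding effpot_bipolar[of \<mu> q Moon] x_def[symmetric] y_def[symmetric]
      using zero_le_power2[of "q $ 3"]
      by (simp only: mass.simps other.simps y_def[symmetric])
  qed
  then show thesis using oD \<open>bounded D\<close> E M by (intro that[of D]) auto
qed

text \<open>A bounded component away from the primaries would be compact, and minimizing the
  potential over a suitable compact set around it would contradict
  \<open>no_local_min\<close>.\<close>

lemma bounded_component_meets_primary:
  assumes C: "C \<in> components (hill_region \<mu> c)" "bounded C"
  shows "pos \<mu> Earth \<in> closure C \<or> pos \<mu> Moon \<in> closure C"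
proof (rule ccontr)
  assume no: "\<not> ?thesis"
  let ?A = "UNIV - {pos \<mu> Earth, pos \<mu> Moon}"
  have oA: "open ?A" by (simp add: open_Diff)
  have hill: "hill_region \<mu> c = ?A \<inter> effpot \<mu> -` {..c}" using hill_region_iff by auto
  have cl: "closedin (top_of_set ?A) (hill_region \<mu> c)"
    unfolding hill by (rule continuous_closedin_preimage[OF continuous_effpot]) simp
  have lc: "locally compact (hill_region \<mu> c)"
    by (rule locally_compact_closedin[OF cl open_imp_locally_compact[OF oA]])
  obtain T where T: "closed T" "hill_region \<mu> c = ?A \<inter> T" using cl unfolding closedin_closed by auto
  have "closure C \<subseteq> T" using in_components_subset[OF C(1)] T by (intro closure_minimal) auto
  then have ch: "closure C \<subseteq> hill_region \<mu> c" using no T(2) by auto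
  have "closedin (top_of_set (hill_region \<mu> c)) C" by (rule closedin_component[OF C(1)])
  then obtain T' where T': "closed T'" "C = hill_region \<mu> c \<inter> T'" unfolding closedin_closed by auto
  have "closure C \<subseteq> T'" using T' by (intro closure_minimal) auto
  then have "closure C \<subseteq> C" using ch T'(2) by blast
  then have "closed C" using closure_subset_eq by blast
  then have "compact C" using C(2) compact_eq_bounded_closed by blast
  \<comment> \<open>The component itself need not be relatively open. Sura-Bura encloses it in a
    compact, relatively open \<open>K\<close>; points of lower potential near the minimizer stay in
    the Hill region and hence in \<open>K\<close>.\<close>
  obtain K where K: "openin (top_of_set (hill_region \<mu> c)) K" "compact K" "C \<subseteq> K" "K \<subseteq> UNIV"
    by (rule Sura_Bura_clopen_subset[OF lc C(1) \<open>compact C\<close> open_UNIV subset_UNIV])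
  obtain O' where O': "open O'" "K = hill_region \<mu> c \<inter> O'" using K(1) unfolding openin_open by auto
  have "K \<noteq> {}" using in_components_nonempty[OF C(1)] K(3) by auto
  have KA: "K \<subseteq> ?A" using O'(2) hill by auto
  obtain q where q: "q \<in> K" "\<forall>q'\<in>K. effpot \<mu> q \<le> effpot \<mu> q'"
    using continuous_attains_inf[OF K(2) \<open>K \<noteq> {}\<close> continuous_on_subset[OF continuous_effpot KA]] by blast
  have qh: "effpot \<mu> q \<le> c" using q(1) O'(2) hill by auto
  obtain q' where q': "q' \<in> O'" "q' \<notin> {pos \<mu> Earth, pos \<mu> Moon}" "effpot \<mu> q' < effpot \<mu> q"
    using no_local_min[of q O'] q(1) KA O' by blast
  then have "q' \<in> K" unfolding O'(2) hill using qh by auto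
  then show False using q(2) q'(3) by force
qed

text \<open>The oval \<open>D\<close> is fixed before the energy: the last conclusion quantifies
  over all admissible energies, so one compact set serves the whole family.\<close>

lemma hill_component_EM_eq:
  assumes c: "H \<mu> (L1 \<mu>) < c" "c < second_critical_value \<mu>"
  obtains D where "open D" "bounded D" "pos \<mu> Earth \<in> D" "pos \<mu> Moon \<in> D"
    "\<forall>q\<in>closure D - D. second_critical_value \<mu> \<le> effpot \<mu> q"
    "\<And>c. H \<mu> (L1 \<mu>) < c \<Longrightarrow> c < second_critical_value \<mu> \<Longrightarrow> hill_component_EM \<mu> c = hill_region \<mu> c \<inter> D"
proof -
  obtain D where D: "open D" "bounded D" "pos \<mu> Earth \<in> D" "pos \<mu> Moon \<in> D"
    "\<forall>q\<in>closure D - D. second_critical_value \<mu> \<le> effpot \<mu> q" by (rule separating_oval)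
  have "hill_component_EM \<mu> c = hill_region \<mu> c \<inter> D" if c: "H \<mu> (L1 \<mu>) < c" "c < second_critical_value \<mu>" for c
  proof -
    have inD: "C \<subseteq> D" if C: "C \<in> components (hill_region \<mu> c)" "C \<inter> D \<noteq> {}" for C
    proof (rule ccontr)
      assume "\<not> C \<subseteq> D"
      then have "C \<inter> frontier D \<noteq> {}"
        using connected_Int_frontier[OF in_components_connected[OF C(1)] C(2)] by blast
      then obtain q where "q \<in> C" "q \<in> closure D - D" using D(1) by (auto simp: frontier_def interior_open)
      then show False using D(5) c in_components_subset[OF C(1)] hill_region_iff[of q \<mu> c] by force
    qed
    obtain C where C: "C \<in> components (hill_region \<mu> c)" "pos \<mu> Moon \<in> closure C"
      "\<forall>C'\<in>components (hill_region \<mu> c). pos \<mu> Moon \<in> closure C' \<longrightarrow> C' = C"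
      "\<forall>e>0. C \<inter> ball (pos \<mu> Moon) e \<noteq> {}" by (rule hill_component_at[OF \<mu>])
    obtain C2 where C2: "C2 \<in> components (hill_region \<mu> c)" "pos \<mu> Earth \<in> closure C2"
      "\<forall>C'\<in>components (hill_region \<mu> c). pos \<mu> Earth \<in> closure C' \<longrightarrow> C' = C2"
      "\<forall>e>0. C2 \<inter> ball (pos \<mu> Earth) e \<noteq> {}" by (rule hill_component_at[OF \<mu>])
    \<comment> \<open>L1 is the maximum of the potential on the segment, so above its value the
      segment lies in the Hill region and joins the components at the two primaries.\<close>
    let ?g = "open_segment (pos \<mu> Earth) (pos \<mu> Moon)"
    have ne: "pos \<mu> Earth \<noteq> pos \<mu> Moon" using pos_other_neq[of \<mu> Earth] by simp
    obtain s where s: "0 < s" "s < 1" "lagr_eq (mass \<mu> Moon) s = 0"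
      "H \<mu> (L1 \<mu>) = - (mass \<mu> Moon * hfun s + mass \<mu> (other Moon) * hfun (1 - s)) + \<mu> * (1 - \<mu>) / 2" by (rule L1_point[OF \<mu>])
    have gh: "?g \<subseteq> hill_region \<mu> c"
    proof
      fix q assume q: "q \<in> ?g"
      obtain r where r: "0 < r" "r < 1" "q = pos \<mu> Moon + r *\<^sub>R axis_dir \<mu> Moon"
        by (rule open_segment_axis[OF \<mu> q])
      have "mass \<mu> Moon * hfun s + mass \<mu> (other Moon) * hfun (1 - s) + (r - s)\<^sup>2 / 2
        \<le> mass \<mu> Moon * hfun r + mass \<mu> (other Moon) * hfun (1 - r)"
      proof (rule concave_max[of _ _ _ _ "r - s" "- 1"])
        show "mass \<mu> Moon * (s - 1 / s\<^sup>2) + - 1 * (mass \<mu> (other Moon) * (1 - s - 1 / (1 - s)\<^sup>2)) = 0"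
        proof -
          have "m * (y - u) - (1 - m) * (x - t) = 0 \<Longrightarrow> m * (u - y) + - 1 * ((1 - m) * (t - x)) = 0" for m x y u t :: real
            by (simp add: algebra_simps)
          from this[OF s(3)[unfolded lagr_eq_def]] show ?thesis unfolding mass_other .
        qed
      qed (use r s in auto)
      then have "effpot \<mu> q \<le> c"
        unfolding r(3) effpot_inner_axis[OF \<mu> r(1,2)] using s(4) c zero_le_power2[of "r - s"] by linarith
      moreover have "q \<notin> {pos \<mu> Earth, pos \<mu> Moon}" using q by (auto simp: open_segment_def)
      ultimately show "q \<in> hill_region \<mu> c" by (simp add: hill_region_iff)
    qed
    obtain C3 where C3: "C3 \<in> components (hill_region \<mu> c)" "?g \<subseteq> C3"
      using exists_component_superset[OF gh _ convex_connected[OF convex_open_segment]] ne gh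
      by (metis empty_iff open_segment_eq_empty subset_empty)
    have "closure ?g \<subseteq> closure C3" using C3(2) by (rule closure_mono)
    then have E3: "pos \<mu> Earth \<in> closure C3" and M3: "pos \<mu> Moon \<in> closure C3"
      using ne by (auto simp: closure_open_segment)
    have eq: "C3 = C" "C3 = C2"
      using bspec[OF C(3) C3(1)] bspec[OF C2(3) C3(1)] E3 M3 by simp_all
    obtain e where "0 < e" "ball (pos \<mu> Moon) e \<subseteq> D" using D(1,4) open_contains_ball by blast
    then have "C \<inter> D \<noteq> {}" using C(4) by blast
    then have CD: "C \<subseteq> D" using inD C(1) by blast
    have bdd: "C' = C" if "C' \<in> components (hill_region \<mu> c)" "bounded C'" for C'
      using bounded_component_meets_primary[OF that] bspec[OF C(3) that(1)] bspec[OF C2(3) that(1)] eq by auto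
    have CB: "bounded C" by (rule bounded_subset[OF D(2) CD])
    have "hill_component_EM \<mu> c = C" unfolding hill_component_EM_def
    proof (rule the_equality)
      show "C \<in> components (hill_region \<mu> c) \<and> bounded C" using C(1) CB by (rule conjI)
      show "C' = C" if "C' \<in> components (hill_region \<mu> c) \<and> bounded C'" for C'
        using that by (elim conjE) (rule bdd)
    qed
    moreover have "C = hill_region \<mu> c \<inter> D"
    proof
      show "C \<subseteq> hill_region \<mu> c \<inter> D" using CD in_components_subset[OF C(1)] by blast
      show "hill_region \<mu> c \<inter> D \<subseteq> C"
      proof
        fix q assume q: "q \<in> hill_region \<mu> c \<inter> D"
        then obtain C' where C': "C' \<in> components (hill_region \<mu> c)" "q \<in> C'"
          using Union_components[of "hill_region \<mu> c"] by blast
        then have "C' \<subseteq> D" using inD q by blast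
        then show "q \<in> C" using bdd[OF C'(1) bounded_subset[OF D(2)]] C'(2) by blast
      qed
    qed
    ultimately show ?thesis by simp
  qed
  with D show thesis by (rule that)
qed

end


section \<open>Uniform transversality near a regular energy\<close>

text \<open>A superset of the surfaces that replaces membership in a component by position in a
  fixed compact \<open>K\<close>; this condition survives limits in the energy.\<close>

definition surf_hull :: "real \<Rightarrow> (real^3) set \<Rightarrow> primary set \<Rightarrow> real \<Rightarrow> wpoint set" where
  "surf_hull \<mu> K Ps e = Reg ` {z \<in> level_set \<mu> e. fst z \<in> K} \<union> (\<Union>P\<in>Ps. collision_set \<mu> P)"

lemma smooth_isCont: "smooth U f \<Longrightarrow> open U \<Longrightarrow> x \<in> U \<Longrightarrow> isCont f x"
  using smooth_continuous_on continuous_on_eq_continuous_at by blast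

lemma collision_set_iff: "Coll P \<eta> \<in> collision_set \<mu> Q \<longleftrightarrow> P = Q \<and> (north, (0, \<eta>)) \<in> V \<and> norm \<eta> = mass \<mu> P"
proof -
  have V: "fst (snd z) = 0" if "z \<in> V" "fst z = north" for z using that by (auto simp: V_def)
  have n: "norm (0 :: real, \<eta>) = norm \<eta>" for \<eta> :: "real^3" by (simp add: norm_Pair)
  show ?thesis
  proof
    assume "Coll P \<eta> \<in> collision_set \<mu> Q"
    then obtain z where z: "z \<in> V" "fst z = north" "norm (snd z) = mass \<mu> Q" "Coll P \<eta> = glue \<mu> Q z"
      unfolding collision_set_def by auto
    have e: "P = Q" "\<eta> = snd (snd z)" using z(2,4) by (auto simp: glue_def)
    have sz: "snd z = (0, \<eta>)" using V[OF z(1,2)] e(2) by (simp add: prod_eq_iff)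
    then have "z = (north, (0, \<eta>))" using z(2) by (simp add: prod_eq_iff)
    moreover have "norm \<eta> = mass \<mu> Q" using z(3) unfolding sz n .
    ultimately show "P = Q \<and> (north, (0, \<eta>)) \<in> V \<and> norm \<eta> = mass \<mu> P" using z(1) e(1) by simp
  next
    assume a: "P = Q \<and> (north, (0, \<eta>)) \<in> V \<and> norm \<eta> = mass \<mu> P"
    then show "Coll P \<eta> \<in> collision_set \<mu> Q"
      unfolding collision_set_def by (intro image_eqI[of _ _ "(north, (0, \<eta>))"]) (auto simp: glue_def n)
  qed
qed

lemma Reg_collision_set: "Reg z \<notin> collision_set \<mu> Q"
  by (auto simp: collision_set_def glue_def)

lemma north_in_V: "(north, (0, \<eta>)) \<in> V \<longleftrightarrow> \<eta> \<noteq> 0"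
  by (auto simp: V_def zero_prod_def)

lemma surf_hull_cases:
  assumes "w \<in> surf_hull \<mu> K Ps e"
  obtains z where "w = Reg z" "z \<in> phase_space \<mu>" "H \<mu> z = e" "fst z \<in> K"
  | P \<eta> where "w = Coll P \<eta>" "P \<in> Ps" "\<eta> \<noteq> 0" "norm \<eta> = mass \<mu> P"
proof (cases w)
  case (Reg z)
  then have "z \<in> level_set \<mu> e \<and> fst z \<in> K" using assms Reg_collision_set by (auto simp: surf_hull_def)
  then show thesis using that(1)[OF Reg] by (simp add: level_set_def)
next
  case (Coll P \<eta>)
  then have "\<exists>Q\<in>Ps. Coll P \<eta> \<in> collision_set \<mu> Q" using assms by (auto simp: surf_hull_def)
  then show thesis using that(2)[OF Coll] by (auto simp: collision_set_iff north_in_V)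
qed

definition transverse_at ::
  "real \<Rightarrow> (real^3 \<Rightarrow> real) \<Rightarrow> phase set \<Rightarrow> (primary \<Rightarrow> (R4 \<times> R4) set) \<Rightarrow> (phase \<Rightarrow> phase) \<Rightarrow>
    (primary \<Rightarrow> R4 \<times> R4 \<Rightarrow> R4 \<times> R4) \<Rightarrow> real \<Rightarrow> real \<Rightarrow> wpoint \<Rightarrow> bool" where
  "transverse_at \<mu> g A B XA XV e \<delta> w \<longleftrightarrow> (case w of
     Reg z \<Rightarrow> z \<in> A \<and> (\<forall>D. ((regK \<mu> g e \<circ> Reg) has_derivative D) (at z) \<longrightarrow> \<delta> \<le> \<bar>D (XA z)\<bar>)
   | Coll P \<eta> \<Rightarrow> (north, (0, \<eta>)) \<in> B P \<and>
       (\<forall>D. ((regK \<mu> g e \<circ> glue \<mu> P) has_derivative D) (at (north, (0, \<eta>)) within V) \<longrightarrow>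
         \<delta> \<le> \<bar>D (XV P (north, (0, \<eta>)))\<bar>))"

text \<open>One radius \<open>r\<close> serves as energy window, position window and lower bound, so
  that a finite subcover of \<open>K\<close> yields a uniform constant as the minimum of the
  radii.\<close>

definition locally_transverse where
  "locally_transverse \<mu> g A B XA XV K Ps c q \<longleftrightarrow> (\<exists>r>0. \<forall>e w. \<bar>e - c\<bar> < r \<longrightarrow> w \<in> surf_hull \<mu> K Ps e \<longrightarrow>
     dist (wproj \<mu> w) q < r \<longrightarrow> transverse_at \<mu> g A B XA XV e r w)"

lemma transverse_at_mono: "transverse_at \<mu> g A B XA XV e \<delta> w \<Longrightarrow> \<delta>' \<le> \<delta> \<Longrightarrow> transverse_at \<mu> g A B XA XV e \<delta>' w"
  unfolding transverse_at_def by (cases w) (auto intro: order_trans)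

lemma not_locally_transverse:
  assumes "\<not> locally_transverse \<mu> g A B XA XV K Ps c q"
  obtains e w where "e \<longlonglongrightarrow> c" "(\<lambda>n. wproj \<mu> (w n)) \<longlonglongrightarrow> q" "\<forall>n::nat. w n \<in> surf_hull \<mu> K Ps (e n)"
    "\<forall>n. \<not> transverse_at \<mu> g A B XA XV (e n) (inverse (Suc n)) (w n)"
proof -
  have "\<forall>n::nat. \<exists>e w. \<bar>e - c\<bar> < inverse (Suc n) \<and> w \<in> surf_hull \<mu> K Ps e \<and> dist (wproj \<mu> w) q < inverse (Suc n) \<and>
      \<not> transverse_at \<mu> g A B XA XV e (inverse (Suc n)) w"
  proof
    fix n :: nat
    have "0 < inverse (real (Suc n))" by simp
    then show "\<exists>e w. \<bar>e - c\<bar> < inverse (Suc n) \<and> w \<in> surf_hull \<mu> K Ps e \<and> dist (wproj \<mu> w) q < inverse (Suc n) \<and>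
      \<not> transverse_at \<mu> g A B XA XV e (inverse (Suc n)) w"
      using assms unfolding locally_transverse_def by blast
  qed
  then obtain e w where ew: "\<And>n::nat. \<bar>e n - c\<bar> < inverse (Suc n)" "\<And>n::nat. w n \<in> surf_hull \<mu> K Ps (e n)"
    "\<And>n::nat. dist (wproj \<mu> (w n)) q < inverse (Suc n)" "\<And>n::nat. \<not> transverse_at \<mu> g A B XA XV (e n) (inverse (Suc n)) (w n)"
    by metis
  have "(\<lambda>n. e n - c) \<longlonglongrightarrow> 0"
    by (rule Lim_null_comparison[OF always_eventually LIMSEQ_inverse_real_of_nat]) (use ew(1) in \<open>auto intro: less_imp_le\<close>)
  then have "e \<longlonglongrightarrow> c" by (simp add: LIM_zero_iff)
  moreover have "(\<lambda>n. dist (wproj \<mu> (w n)) q) \<longlonglongrightarrow> 0"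
    by (rule Lim_null_comparison[OF always_eventually LIMSEQ_inverse_real_of_nat]) (use ew(3) in \<open>auto intro: less_imp_le\<close>)
  then have "(\<lambda>n. wproj \<mu> (w n)) \<longlonglongrightarrow> q" by (rule iffD2[OF tendsto_dist_iff])
  ultimately show thesis using ew(2,4) by (intro that[of e w]) auto
qed

lemma locally_transverse_uniform:
  assumes K: "compact K" and PK: "\<And>P. P \<in> Ps \<Longrightarrow> pos \<mu> P \<in> K"
    and loc: "\<And>q. q \<in> K \<Longrightarrow> locally_transverse \<mu> g A B XA XV K Ps c q"
  obtains \<delta> where "0 < \<delta>"
    "\<forall>e w. \<bar>e - c\<bar> < \<delta> \<longrightarrow> w \<in> surf_hull \<mu> K Ps e \<longrightarrow> transverse_at \<mu> g A B XA XV e \<delta> w"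
proof -
  have "\<forall>q\<in>K. \<exists>r>0. \<forall>e w. \<bar>e - c\<bar> < r \<longrightarrow> w \<in> surf_hull \<mu> K Ps e \<longrightarrow>
     dist (wproj \<mu> w) q < r \<longrightarrow> transverse_at \<mu> g A B XA XV e r w"
    using loc unfolding locally_transverse_def by blast
  then obtain r where r: "\<And>q. q \<in> K \<Longrightarrow> 0 < r q" "\<And>q e w. q \<in> K \<Longrightarrow> \<bar>e - c\<bar> < r q \<Longrightarrow> w \<in> surf_hull \<mu> K Ps e \<Longrightarrow>
     dist (wproj \<mu> w) q < r q \<Longrightarrow> transverse_at \<mu> g A B XA XV e (r q) w" by metis
  have "K \<subseteq> (\<Union>q\<in>K. ball q (r q))" using r(1) by force
  then obtain F where F: "F \<subseteq> K" "finite F" "K \<subseteq> (\<Union>q\<in>F. ball q (r q))"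
    using compactE_image[OF K, of K "\<lambda>q. ball q (r q)"] by auto
  define \<delta> where "\<delta> = Min (insert 1 (r ` F))"
  have \<delta>: "0 < \<delta>" "\<And>q. q \<in> F \<Longrightarrow> \<delta> \<le> r q" using F r(1) by (auto simp: \<delta>_def)
  have "transverse_at \<mu> g A B XA XV e \<delta> w" if "\<bar>e - c\<bar> < \<delta>" "w \<in> surf_hull \<mu> K Ps e" for e w
  proof -
    have "wproj \<mu> w \<in> K" using that(2) by (cases rule: surf_hull_cases) (auto intro: PK)
    then obtain q where q: "q \<in> F" "dist (wproj \<mu> w) q < r q" using F(3) by (auto simp: dist_commute)
    then have "transverse_at \<mu> g A B XA XV e (r q) w" using that \<delta>(2)[of q] F(1) by (intro r(2)) auto
    then show ?thesis using \<delta>(2)[OF q(1)] by (rule transverse_at_mono)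
  qed
  with \<delta>(1) show thesis by (intro that[of \<delta>]) auto
qed

text \<open>If it fails, there are surface points over positions tending to \<open>q\<close> at
  which dK(X) tends to 0. Energy conservation bounds their velocities, so a subsequence converges to
  a point of energy \<open>c\<close> over \<open>q\<close>, where dK(X) \<noteq> 0.\<close>

lemma locally_transverse_Reg:
  assumes g: "regularizing \<mu> g" and L: "liouville_field \<mu> A B XA XV" and K: "closed K"
    and q: "q \<notin> {pos \<mu> Earth, pos \<mu> Moon}"
    and lim: "\<And>z. z \<in> phase_space \<mu> \<Longrightarrow> H \<mu> z = c \<Longrightarrow> fst z = q \<Longrightarrow> q \<in> K \<Longrightarrow>
      z \<in> A \<and> frechet_derivative (regK \<mu> g c \<circ> Reg) (at z) (XA z) \<noteq> 0"
  shows "locally_transverse \<mu> g A B XA XV K Ps c q"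
proof (rule ccontr)
  assume "\<not> ?thesis"
  then obtain e w where ew: "e \<longlonglongrightarrow> c" "(\<lambda>n. wproj \<mu> (w n)) \<longlonglongrightarrow> q" "\<forall>n::nat. w n \<in> surf_hull \<mu> K Ps (e n)"
    "\<forall>n. \<not> transverse_at \<mu> g A B XA XV (e n) (inverse (Suc n)) (w n)" by (rule not_locally_transverse)
  let ?A = "UNIV - {pos \<mu> Earth, pos \<mu> Moon}"
  have oA: "open ?A" by (simp add: open_Diff)
  have "\<forall>\<^sub>F n in sequentially. wproj \<mu> (w n) \<in> ?A"
    using topological_tendstoD[OF ew(2) oA] q by simp
  then obtain n0 where n0: "\<And>n. n \<ge> n0 \<Longrightarrow> wproj \<mu> (w n) \<in> ?A" unfolding eventually_sequentially by blast
  define z where "z n = un_Reg (w (n + n0))" for n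
  define E where "E n = e (n + n0)" for n
  have z: "w (n + n0) = Reg (z n)" "z n \<in> phase_space \<mu>" "H \<mu> (z n) = E n" "fst (z n) \<in> K" for n
  proof -
    have wn: "w (n + n0) \<in> surf_hull \<mu> K Ps (e (n + n0))" "wproj \<mu> (w (n + n0)) \<in> ?A" using ew(3) n0 by auto
    from wn(1) have "\<exists>z. w (n + n0) = Reg z \<and> z \<in> phase_space \<mu> \<and> H \<mu> z = e (n + n0) \<and> fst z \<in> K"
    proof (cases rule: surf_hull_cases)
      case (2 P \<eta>)
      then show ?thesis using wn(2) by (cases P) auto
    qed auto
    then show "w (n + n0) = Reg (z n)" "z n \<in> phase_space \<mu>" "H \<mu> (z n) = E n" "fst (z n) \<in> K"
      by (auto simp: z_def E_def)
  qed
  have Elim: "E \<longlonglongrightarrow> c" unfolding E_def by (rule LIMSEQ_ignore_initial_segment[OF ew(1)])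
  have qlim: "(\<lambda>n. fst (z n)) \<longlonglongrightarrow> q"
    using LIMSEQ_ignore_initial_segment[OF ew(2), of n0] by (simp add: z(1))
  have "isCont (effpot \<mu>) q" using continuous_effpot[of \<mu>] oA q by (simp add: continuous_on_eq_continuous_at)
  then have "(\<lambda>n. effpot \<mu> (fst (z n))) \<longlonglongrightarrow> effpot \<mu> q" using qlim by (rule isCont_tendsto_compose)
  then have "(\<lambda>n. 2 * (E n - effpot \<mu> (fst (z n)))) \<longlonglongrightarrow> 2 * (c - effpot \<mu> q)" using Elim by (intro tendsto_intros)
  moreover have "2 * (E n - effpot \<mu> (fst (z n))) = (norm (vel (z n)))\<^sup>2" for n
    using H_effpot[of \<mu> "z n"] z(3)[of n] by (simp add: power2_norm_eq_inner)
  ultimately have "(\<lambda>n. (norm (vel (z n)))\<^sup>2) \<longlonglongrightarrow> 2 * (c - effpot \<mu> q)" by simp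
  then have "Bseq (\<lambda>n. (norm (vel (z n)))\<^sup>2)" by (rule convergent_imp_Bseq[OF convergentI])
  then obtain M where M: "\<And>n. (norm (vel (z n)))\<^sup>2 \<le> M" by (auto simp: Bseq_def)
  have bv: "norm (vel (z n)) \<le> M + 1" for n
  proof -
    have "2 * norm (vel (z n)) \<le> (norm (vel (z n)))\<^sup>2 + 1" using zero_le_power2[of "norm (vel (z n)) - 1"] by (simp add: power2_eq_square algebra_simps)
    then show ?thesis using M[of n] zero_le_power2[of "norm (vel (z n))"] by linarith
  qed
  have "bounded (range vel')" if "vel' = (\<lambda>n. vel (z n))" for vel' using bv that by (auto simp: bounded_iff)
  then have "bounded (range (\<lambda>n. vel (z n)))" by simp
  then obtain v \<sigma> where \<sigma>: "strict_mono \<sigma>" "((\<lambda>n. vel (z n)) \<circ> \<sigma>) \<longlonglongrightarrow> v"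
    using bounded_imp_convergent_subsequence by blast
  \<comment> \<open>The momentum recovered from the limits of velocity and position.\<close>
  define p where "p = (vector [v $ 1 - q $ 2, v $ 2 + q $ 1, v $ 3] :: real^3)"
  have qs: "(\<lambda>n. fst (z (\<sigma> n))) \<longlonglongrightarrow> q" using LIMSEQ_subseq_LIMSEQ[OF qlim \<sigma>(1)] by (simp add: o_def)
  have Es: "(\<lambda>n. E (\<sigma> n)) \<longlonglongrightarrow> c" using LIMSEQ_subseq_LIMSEQ[OF Elim \<sigma>(1)] by (simp add: o_def)
  have vs: "(\<lambda>n. vel (z (\<sigma> n))) \<longlonglongrightarrow> v" using \<sigma>(2) by (simp add: o_def)
  have "(\<lambda>n. snd (z (\<sigma> n))) \<longlonglongrightarrow> p"
  proof (rule vec_tendstoI)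
    fix i :: 3
    have c: "(\<lambda>n. vel (z (\<sigma> n)) $ j) \<longlonglongrightarrow> v $ j" "(\<lambda>n. fst (z (\<sigma> n)) $ j) \<longlonglongrightarrow> q $ j" for j
      by (intro tendsto_vec_nth vs qs)+
    note tendsto_diff[OF c(1)[of 1] c(2)[of 2]] tendsto_add[OF c(1)[of 2] c(2)[of 1]] c(1)[of 3]
    then have "(\<lambda>n. snd (z (\<sigma> n)) $ 1) \<longlonglongrightarrow> p $ 1" "(\<lambda>n. snd (z (\<sigma> n)) $ 2) \<longlonglongrightarrow> p $ 2" "(\<lambda>n. snd (z (\<sigma> n)) $ 3) \<longlonglongrightarrow> p $ 3"
      by (simp_all add: vel_def p_def)
    then show "(\<lambda>n. snd (z (\<sigma> n)) $ i) \<longlonglongrightarrow> p $ i" using exhaust_3[of i] by auto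
  qed
  from tendsto_Pair[OF qs this] have zs: "(\<lambda>n. z (\<sigma> n)) \<longlonglongrightarrow> (q, p)" by simp
  have qp: "(q, p) \<in> phase_space \<mu>" using q phase_space_iff[of "(q, p)" \<mu> Earth] by simp
  have "isCont (H \<mu>) (q, p)" by (rule smooth_isCont[OF smooth_H open_phase_space qp])
  then have "(\<lambda>n. H \<mu> (z (\<sigma> n))) \<longlonglongrightarrow> H \<mu> (q, p)" using zs by (rule isCont_tendsto_compose)
  then have Hqp: "H \<mu> (q, p) = c" using Es LIMSEQ_unique by (simp add: z(3))
  have "q \<in> K" by (rule Lim_in_closed_set[OF K _ _ qs]) (simp_all add: z(4))
  then have li: "(q, p) \<in> A" "frechet_derivative (regK \<mu> g c \<circ> Reg) (at (q, p)) (XA (q, p)) \<noteq> 0"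
    using lim[OF qp Hqp] by auto
  have LA: "open A" "A \<subseteq> phase_space \<mu>" "smooth_on A XA" using L by (auto simp: liouville_field_def)
  have sX: "smooth A XA" using iffD1[OF smooth_on_open[OF LA(1)] LA(3)] .
  have sK: "smooth A (regK \<mu> g c \<circ> Reg)" by (rule smooth_subset[OF smooth_regK_Reg[OF g] LA(2)])
  have sg: "smooth A (\<lambda>z. g (fst z))"
    by (rule smooth_compose[OF LA(1) oA _ _ smooth_g[OF g]])
      (use LA(2) phase_space_iff[of _ \<mu> Earth] in \<open>auto intro!: smooth_fst smooth_id LA(1)\<close>)
  \<comment> \<open>dK at energy E, applied to X, is \<Phi>1 + (c - E) \<Phi>2; freezing the energy
    at \<open>c\<close> makes both functions independent of the sequence.\<close>
  define \<Phi>1 where "\<Phi>1 z = frechet_derivative (regK \<mu> g c \<circ> Reg) (at z) (XA z)" for z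
  define \<Phi>2 where "\<Phi>2 z = frechet_derivative (\<lambda>z. g (fst z)) (at z) (XA z)" for z
  have "smooth A \<Phi>1" unfolding \<Phi>1_def[abs_def] by (rule smooth_frechet_vary[OF LA(1) sK sX])
  then have cont1: "isCont \<Phi>1 (q, p)" using LA(1) li(1) by (rule smooth_isCont)
  have "smooth A \<Phi>2" unfolding \<Phi>2_def[abs_def] by (rule smooth_frechet_vary[OF LA(1) sg sX])
  then have cont2: "isCont \<Phi>2 (q, p)" using LA(1) li(1) by (rule smooth_isCont)
  have "(\<lambda>n. \<Phi>1 (z (\<sigma> n)) + (c - E (\<sigma> n)) * \<Phi>2 (z (\<sigma> n))) \<longlonglongrightarrow> \<Phi>1 (q, p) + (c - c) * \<Phi>2 (q, p)"
    by (intro tendsto_intros isCont_tendsto_compose[OF cont1 zs] isCont_tendsto_compose[OF cont2 zs] Es)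
  then have lim1: "(\<lambda>n. \<Phi>1 (z (\<sigma> n)) + (c - E (\<sigma> n)) * \<Phi>2 (z (\<sigma> n))) \<longlonglongrightarrow> \<Phi>1 (q, p)" by simp
  have "\<forall>\<^sub>F n in sequentially. z (\<sigma> n) \<in> A" by (rule topological_tendstoD[OF zs LA(1) li(1)])
  then have evb: "\<forall>\<^sub>F n in sequentially. \<bar>\<Phi>1 (z (\<sigma> n)) + (c - E (\<sigma> n)) * \<Phi>2 (z (\<sigma> n))\<bar> \<le> inverse (Suc (\<sigma> n + n0))"
  proof eventually_elim
    case (elim n)
    let ?z = "z (\<sigma> n)"
    have D: "((regK \<mu> g (E (\<sigma> n)) \<circ> Reg) has_derivative
       (\<lambda>v. frechet_derivative (regK \<mu> g c \<circ> Reg) (at ?z) v + (c - E (\<sigma> n)) * frechet_derivative (\<lambda>z. g (fst z)) (at ?z) v)) (at ?z)"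
    proof -
      have "regK \<mu> g (E (\<sigma> n)) \<circ> Reg = (\<lambda>z. (regK \<mu> g c \<circ> Reg) z + (c - E (\<sigma> n)) * g (fst z))"
        by (simp add: fun_eq_iff algebra_simps)
      then show ?thesis
        using has_derivative_add[OF smooth_has_derivative[OF sK elim]
            has_derivative_mult_right[OF smooth_has_derivative[OF sg elim]]] by simp
    qed
    have "\<not> transverse_at \<mu> g A B XA XV (E (\<sigma> n)) (inverse (Suc (\<sigma> n + n0))) (Reg ?z)"
      using ew(4)[rule_format, of "\<sigma> n + n0"] by (simp add: z(1) E_def)
    then obtain D' where D': "((regK \<mu> g (E (\<sigma> n)) \<circ> Reg) has_derivative D') (at ?z)" "\<bar>D' (XA ?z)\<bar> < inverse (Suc (\<sigma> n + n0))"
      using elim unfolding transverse_at_def by (auto simp: not_le)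
    show ?case using D'(2) unfolding has_derivative_unique[OF D'(1) D] \<Phi>1_def \<Phi>2_def by simp
  qed
  have invl: "(\<lambda>n. inverse (real (Suc (\<sigma> n + n0)))) \<longlonglongrightarrow> 0"
    using LIMSEQ_subseq_LIMSEQ[OF LIMSEQ_ignore_initial_segment[OF LIMSEQ_inverse_real_of_nat, of n0] \<sigma>(1)] by (simp add: o_def)
  have "(\<lambda>n. \<Phi>1 (z (\<sigma> n)) + (c - E (\<sigma> n)) * \<Phi>2 (z (\<sigma> n))) \<longlonglongrightarrow> 0"
    by (rule Lim_null_comparison[OF _ invl]) (use evb in \<open>simp only: real_norm_def\<close>)
  then show False using lim1 li(2) LIMSEQ_unique by (auto simp: \<Phi>1_def)
qed

text \<open>Compactness near a collision. On the zero level |\<eta>| equals a bounded quantity plus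
  terms that absorb at most n/2 (rotation) and n/8 (the factor 1/16 times 2 n) of n = |\<eta>|, so a
  positive fraction of n is left on the left-hand side.\<close>

lemma coll_ham_eta_bound:
  assumes \<mu>: "0 < \<mu>" "\<mu> < 1" and z: "z \<in> V" and r: "norm (snd z) * (1 - fst (fst z)) \<le> 1/16"
    and K: "coll_ham \<mu> P e z = 0"
  shows "norm (snd z) \<le> 8 * (2 + \<bar>e\<bar>)"
proof -
  obtain x0 x y0 y where zz: "z = ((x0, x), (y0, y))" by (metis prod.collapse)
  define n where "n = norm (y0, y)"
  define r where "r = n * (1 - x0)"
  have n0: "0 \<le> n" by (simp add: n_def)
  have x0: "x0 \<le> 1" "x0\<^sup>2 + x \<bullet> x = 1" using V_fst_le[OF z] z zz V_iff[of x0 x y0 y] by auto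
  have r0: "0 \<le> r" "r \<le> 1/16" using r zz x0 n0 by (auto simp: r_def n_def)
  have "x \<bullet> x \<le> 1" using x0(2) zero_le_power2[of x0] by linarith
  then have nx: "norm x \<le> 1" by (simp add: norm_le_square power2_norm_eq_inner)
  have cx: "\<bar>x $ i\<bar> \<le> norm x" for i by (rule component_le_norm_cart)
  have cy: "\<bar>y $ i\<bar> \<le> n" for i
    using component_le_norm_cart[of y i] norm_snd_le[of y y0] by (simp add: n_def)
  \<comment> \<open>Since x2^2 is at most 2 (1 - x0), the square of n x2 is at most 2 n r; the
    arithmetic-geometric mean does the rest.\<close>
  have x2: "n * \<bar>x $ 2\<bar> \<le> r + n / 2"
  proof -
    have "(x $ 2)\<^sup>2 \<le> (norm x)\<^sup>2" using cx[of 2] by (metis abs_le_square_iff abs_norm_cancel)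
    also have "(norm x)\<^sup>2 = (1 - x0) * (1 + x0)" using x0(2) unfolding power2_norm_eq_inner by (simp add: power2_eq_square algebra_simps)
    also have "\<dots> \<le> (1 - x0) * 2" using x0(1) by (intro mult_left_mono) auto
    finally have xx: "(x $ 2)\<^sup>2 \<le> (1 - x0) * 2" .
    have "(n * \<bar>x $ 2\<bar>)\<^sup>2 = n\<^sup>2 * (x $ 2)\<^sup>2" by (simp add: power_mult_distrib)
    also have "\<dots> \<le> n\<^sup>2 * ((1 - x0) * 2)" by (rule mult_left_mono[OF xx]) simp
    also have "\<dots> = 4 * (r * (n / 2))" by (simp add: r_def power2_eq_square)
    also have "\<dots> \<le> (r + n / 2)\<^sup>2" using zero_le_power2[of "r - n / 2"] by (simp add: power2_eq_square algebra_simps)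
    finally have sq: "(n * \<bar>x $ 2\<bar>)\<^sup>2 \<le> (r + n / 2)\<^sup>2" .
    show ?thesis by (rule power2_le_imp_le[OF sq]) (use r0 n0 in simp)
  qed
  define R where "R = norm (pos \<mu> P + (1 - x0) *\<^sub>R y + y0 *\<^sub>R x - pos \<mu> (other P))"
  have R: "1/2 < R"
  proof -
    have "norm (fst (moser \<mu> P z) - pos \<mu> P) < 1/2" by (rule V_pos_norm[OF z])
    then have "norm ((1 - x0) *\<^sub>R y + y0 *\<^sub>R x) < 1/2" by (simp add: moser_alt zz add.assoc)
    moreover have "norm (pos \<mu> (other P) - pos \<mu> P) \<le> norm ((1 - x0) *\<^sub>R y + y0 *\<^sub>R x) + R"
      unfolding R_def by (rule order_trans[OF _ norm_triangle_ineq4]) (simp add: algebra_simps norm_minus_commute)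
    ultimately show ?thesis unfolding norm_pos_other by linarith
  qed
  have mo: "0 < mass \<mu> (other P)" "mass \<mu> (other P) < 1" "mass \<mu> P < 1" using mass_bounds[OF \<mu>] by auto
  have iR: "inverse R \<le> 2" using R by (simp add: inverse_eq_divide pos_divide_le_eq)
  have M: "\<bar>mass \<mu> (other P) * inverse R\<bar> \<le> 2"
    using mult_mono[OF less_imp_le[OF mo(2)] iR] mo R by (simp add: abs_mult)
  have J: "\<bar>x $ 1 * y $ 2 - x $ 2 * y $ 1\<bar> \<le> 2 * n"
  proof -
    have "\<bar>x $ i\<bar> * \<bar>y $ j\<bar> \<le> 1 * n" for i j using order_trans[OF cx nx] cy n0 by (intro mult_mono) auto
    then have "\<bar>x $ 1 * y $ 2\<bar> \<le> n" "\<bar>x $ 2 * y $ 1\<bar> \<le> n" by (simp_all add: abs_mult)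
    then show ?thesis by linarith
  qed
  define a where "a = pos \<mu> P $ 1"
  have a: "\<bar>a\<bar> \<le> 1" using \<mu> by (cases P) (auto simp: a_def pos_component)
  define T where "T = x $ 1 * y $ 2 - x $ 2 * y $ 1 + mass \<mu> (other P) * inverse R + e"
  have T: "\<bar>T\<bar> \<le> 2 * n + 2 + \<bar>e\<bar>" unfolding T_def using J M by linarith
  have "n * ((1 + x0) / 2 + a * x $ 2 - (1 - x0) * T) = mass \<mu> P"
    using K by (simp add: coll_ham_def Let_def zz n_def a_def T_def R_def)
  then have "n - r / 2 + a * (n * x $ 2) - r * T = mass \<mu> P"
    unfolding r_def by (simp add: algebra_simps) (simp add: field_simps)
  moreover have "\<bar>a * (n * x $ 2)\<bar> \<le> r + n / 2"
  proof -
    have "\<bar>a\<bar> * (n * \<bar>x $ 2\<bar>) \<le> 1 * (n * \<bar>x $ 2\<bar>)" using a n0 by (intro mult_right_mono) auto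
    then show ?thesis using x2 n0 by (simp add: abs_mult)
  qed
  moreover have "\<bar>r * T\<bar> \<le> 1/16 * (2 * n + 2 + \<bar>e\<bar>)"
    unfolding abs_mult using r0 T by (intro mult_mono) auto
  ultimately have "n \<le> 8 * (2 + \<bar>e\<bar>)" using mo(3) r0 n0 abs_ge_zero[of e] by (auto simp: abs_le_iff)
  then show ?thesis by (simp add: n_def zz)
qed


text \<open>The argument of \<open>locally_transverse_Reg\<close> in Moser's chart. The sequence may
  mix regular and collision points; all are lifted to \<open>V\<close>, bounded by
  \<open>coll_ham_eta_bound\<close>, and the limit is shown to be a collision point of the
  surface.\<close>

lemma locally_transverse_Coll:
  assumes \<mu>: "0 < \<mu>" "\<mu> < 1" and g: "regularizing \<mu> g" and L: "liouville_field \<mu> A B XA XV"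
    and lim: "\<And>\<eta>. norm \<eta> = mass \<mu> P \<Longrightarrow> \<eta> \<noteq> 0 \<Longrightarrow> (north, (0, \<eta>)) \<in> B P \<and>
      frechet_derivative (coll_ham \<mu> P c) (at (north, (0, \<eta>))) (XV P (north, (0, \<eta>))) \<noteq> 0"
  shows "locally_transverse \<mu> g A B XA XV K Ps c (pos \<mu> P)"
proof (rule ccontr)
  assume "\<not> ?thesis"
  then obtain e w where ew: "e \<longlonglongrightarrow> c" "(\<lambda>n. wproj \<mu> (w n)) \<longlonglongrightarrow> pos \<mu> P" "\<forall>n::nat. w n \<in> surf_hull \<mu> K Ps (e n)"
    "\<forall>n. \<not> transverse_at \<mu> g A B XA XV (e n) (inverse (Suc n)) (w n)" by (rule not_locally_transverse)
  obtain N where N: "open N" "pos \<mu> P \<in> N"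
    "\<forall>z\<in>V. \<forall>c. fst (moser \<mu> P z) \<in> N \<longrightarrow> regK \<mu> g c (glue \<mu> P z) = coll_ham \<mu> P c z"
    by (rule regK_glue_near_collision[OF g, of P])
  \<comment> \<open>1/16 is the radius required by \<open>coll_ham_eta_bound\<close>; being below
    1/2 it also keeps the points inside the chart.\<close>
  let ?N = "N \<inter> ball (pos \<mu> P) (1/16)"
  have "\<forall>\<^sub>F n in sequentially. wproj \<mu> (w n) \<in> ?N"
    by (rule topological_tendstoD[OF ew(2)]) (use N in auto)
  then obtain n0 where n0: "\<And>n. n \<ge> n0 \<Longrightarrow> wproj \<mu> (w n) \<in> ?N" unfolding eventually_sequentially by blast
  define z where "z n = un_glue \<mu> P (w (n + n0))" for n
  define E where "E n = e (n + n0)" for n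
  have z: "z n \<in> V \<and> glue \<mu> P (z n) = w (n + n0)" for n
  proof -
    have wn: "w (n + n0) \<in> surf_hull \<mu> K Ps (e (n + n0))" "norm (wproj \<mu> (w (n + n0)) - pos \<mu> P) < 1/16"
      using ew(3) n0[of "n + n0"] by (auto simp: dist_norm norm_minus_commute)
    from wn(1) show ?thesis
    proof (cases rule: surf_hull_cases)
      case (1 v)
      have v: "fst v \<noteq> pos \<mu> P" "norm (fst v - pos \<mu> P) < 1/2" using 1 wn(2) phase_space_iff[of v \<mu> P] by auto
      show ?thesis using moser_inv_in_V(1,2)[OF v] 1 by (simp add: z_def glue_def moser_moser_inv)
    next
      case (2 Q \<eta>)
      have "Q = P"
      proof (rule ccontr)
        assume "Q \<noteq> P"
        then have "Q = other P" by (cases Q; cases P) auto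
        then show False using wn(2) 2 norm_pos_other[of \<mu> P] by simp
      qed
      then show ?thesis using 2 by (simp add: z_def glue_def north_in_V)
    qed
  qed
  have zV: "z n \<in> V" for n using z by blast
  have fm: "fst (moser \<mu> P (z n)) = wproj \<mu> (w (n + n0))" for n
    using wproj_glue[of \<mu> P "z n"] conjunct2[OF z[of n]] by simp
  have inN: "fst (moser \<mu> P (z n)) \<in> N" "fst (moser \<mu> P (z n)) \<in> ball (pos \<mu> P) (1/16)" for n
    using n0[of "n + n0"] unfolding fm by auto
  have kw: "regK \<mu> g (E n) (w (n + n0)) = 0" for n
    using ew(3)[rule_format, of "n + n0"] by (cases rule: surf_hull_cases) (auto simp: E_def)
  have ch: "coll_ham \<mu> P (E n) (z n) = 0" for n
  proof -
    have "regK \<mu> g (E n) (glue \<mu> P (z n)) = coll_ham \<mu> P (E n) (z n)" using N(3) zV[of n] inN(1)[of n] by blast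
    then show ?thesis unfolding conjunct2[OF z[of n]] kw by simp
  qed
  have Elim: "E \<longlonglongrightarrow> c" unfolding E_def by (rule LIMSEQ_ignore_initial_segment[OF ew(1)])
  have plim: "(\<lambda>n. fst (moser \<mu> P (z n))) \<longlonglongrightarrow> pos \<mu> P"
    unfolding fm by (rule LIMSEQ_ignore_initial_segment[OF ew(2)])
  have rn: "norm (fst (moser \<mu> P (z n)) - pos \<mu> P) = norm (snd (z n)) * (1 - fst (fst (z n)))" for n
    by (rule moser_dist[OF zV])
  have "(\<lambda>n. norm (fst (moser \<mu> P (z n)) - pos \<mu> P)) \<longlonglongrightarrow> 0" by (intro tendsto_norm_zero LIM_zero plim)
  then have rlim: "(\<lambda>n. norm (snd (z n)) * (1 - fst (fst (z n)))) \<longlonglongrightarrow> 0" unfolding rn .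
  have eb: "norm (snd (z n)) \<le> 8 * (2 + \<bar>E n\<bar>)" for n
  proof (rule coll_ham_eta_bound[OF \<mu> zV _ ch])
    show "norm (snd (z n)) * (1 - fst (fst (z n))) \<le> 1/16"
      using inN(2)[of n] unfolding rn[symmetric] by (simp add: dist_norm norm_minus_commute)
  qed
  have "Bseq E" by (rule convergent_imp_Bseq[OF convergentI[OF Elim]])
  then obtain M where M: "\<And>n. \<bar>E n\<bar> \<le> M" by (auto simp: Bseq_def)
  have "norm (z n) \<le> 1 + 8 * (2 + M)" for n
  proof -
    have "norm (z n) \<le> norm (fst (z n)) + norm (snd (z n))" by (metis norm_Pair_le prod.collapse)
    moreover have "norm (fst (z n)) = 1" using zV[of n] by (auto simp: V_def)
    ultimately have "norm (z n) \<le> 1 + 8 * (2 + \<bar>E n\<bar>)" using eb[of n] by linarith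
    also have "\<dots> \<le> 1 + 8 * (2 + M)" using M[of n] by simp
    finally show ?thesis .
  qed
  then have "bounded (range z)" by (auto simp: bounded_iff)
  then obtain \<zeta> \<sigma> where \<sigma>: "strict_mono \<sigma>" "(z \<circ> \<sigma>) \<longlonglongrightarrow> \<zeta>"
    using bounded_imp_convergent_subsequence by blast
  have zs: "(\<lambda>n. z (\<sigma> n)) \<longlonglongrightarrow> \<zeta>" using \<sigma>(2) by (simp add: o_def)
  have Es: "(\<lambda>n. E (\<sigma> n)) \<longlonglongrightarrow> c" using LIMSEQ_subseq_LIMSEQ[OF Elim \<sigma>(1)] by (simp add: o_def)
  have cl1: "norm (fst \<zeta>) = 1"
  proof -
    have "(\<lambda>n. norm (fst (z (\<sigma> n)))) \<longlonglongrightarrow> norm (fst \<zeta>)" by (intro tendsto_intros zs)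
    moreover have "norm (fst (z n)) = 1" for n using zV[of n] by (auto simp: V_def)
    ultimately show ?thesis by (simp add: LIMSEQ_const_iff)
  qed
  have cl2: "fst \<zeta> \<bullet> snd \<zeta> = 0"
  proof -
    have "(\<lambda>n. fst (z (\<sigma> n)) \<bullet> snd (z (\<sigma> n))) \<longlonglongrightarrow> fst \<zeta> \<bullet> snd \<zeta>" by (intro tendsto_intros zs)
    moreover have "fst (z n) \<bullet> snd (z n) = 0" for n using zV[of n] by (auto simp: V_def)
    ultimately show ?thesis by (simp add: LIMSEQ_const_iff)
  qed
  have cl3: "norm (snd \<zeta>) * (1 - fst (fst \<zeta>)) = 0"
  proof -
    have "(\<lambda>n. norm (snd (z (\<sigma> n))) * (1 - fst (fst (z (\<sigma> n))))) \<longlonglongrightarrow> norm (snd \<zeta>) * (1 - fst (fst \<zeta>))"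
      by (intro tendsto_intros zs)
    moreover have "(\<lambda>n. norm (snd (z (\<sigma> n))) * (1 - fst (fst (z (\<sigma> n))))) \<longlonglongrightarrow> 0"
      using LIMSEQ_subseq_LIMSEQ[OF rlim \<sigma>(1)] by (simp add: o_def)
    ultimately show ?thesis by (rule LIMSEQ_unique)
  qed
  have mz: "fst (moser \<mu> P \<zeta>) = pos \<mu> P"
  proof -
    have "isCont (\<lambda>z. fst (moser \<mu> P z)) \<zeta>"
      by (rule bspec[OF iffD1[OF continuous_on_eq_continuous_at[OF open_UNIV] continuous_moser_fst] UNIV_I])
    from isCont_tendsto_compose[OF this zs]
    have "(\<lambda>n. fst (moser \<mu> P (z (\<sigma> n)))) \<longlonglongrightarrow> fst (moser \<mu> P \<zeta>)" .
    moreover have "(\<lambda>n. fst (moser \<mu> P (z (\<sigma> n)))) \<longlonglongrightarrow> pos \<mu> P"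
      using LIMSEQ_subseq_LIMSEQ[OF plim \<sigma>(1)] by (simp add: o_def)
    ultimately show ?thesis by (rule LIMSEQ_unique)
  qed
  have "fst (moser \<mu> P \<zeta>) - pos \<mu> (other P) \<noteq> 0" unfolding mz using pos_other_neq[of \<mu> P] by auto
  then have ne: "norm (pos \<mu> P + (1 - fst (fst \<zeta>)) *\<^sub>R snd (snd \<zeta>) + fst (snd \<zeta>) *\<^sub>R snd (fst \<zeta>) - pos \<mu> (other P)) \<noteq> 0"
    unfolding moser_alt fst_conv norm_eq_zero .
  have "(\<lambda>n. coll_ham \<mu> P (E (\<sigma> n)) (z (\<sigma> n))) \<longlonglongrightarrow> coll_ham \<mu> P c \<zeta>"
    unfolding coll_ham_def Let_def by (intro tendsto_intros zs Es ne) auto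
  then have cz: "coll_ham \<mu> P c \<zeta> = 0" by (simp add: ch LIMSEQ_const_iff)
  \<comment> \<open>At \<eta> = 0 the function \<open>coll_ham\<close> equals minus the mass, so the
    zero level excludes the only degenerate limit; then 1 - \<xi>0 must vanish.\<close>
  have nz: "snd \<zeta> \<noteq> 0" using cz mass_bounds(1)[OF \<mu>, of P] by (auto simp: coll_ham_def Let_def)
  obtain x0 x y0 y where zz: "\<zeta> = ((x0, x), (y0, y))" by (metis prod.collapse)
  have x0: "x0 = 1" using cl3 nz by (simp add: zz)
  have x: "x = 0" using cl1 x0 by (simp add: zz norm_Pair)
  have y0: "y0 = 0" using cl2 x0 x by (simp add: zz)
  have \<zeta>: "\<zeta> = (north, (0, y))" by (simp add: zz x0 x y0)
  have ny: "norm y = mass \<mu> P" using cz coll_ham_north[of \<mu> P c "(0, y)"] by (simp add: \<zeta> norm_Pair)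
  have "y \<noteq> 0" using nz by (auto simp: \<zeta> zero_prod_def)
  from lim[OF ny this] have li: "\<zeta> \<in> B P" "frechet_derivative (coll_ham \<mu> P c) (at \<zeta>) (XV P \<zeta>) \<noteq> 0"
    by (simp_all add: \<zeta>)
  have LB: "openin (top_of_set V) (B P)" "smooth_on (B P) (XV P)" "\<forall>z\<in>B P. XV P z \<in> TV z"
    "\<forall>z\<in>B P. fst z \<noteq> north \<longrightarrow> moser \<mu> P z \<in> A \<and> dmoser z (XV P z) = XA (moser \<mu> P z)"
    using L by (auto simp: liouville_field_def)
  obtain T where T: "open T" "B P = V \<inter> T" using LB(1) by (auto simp: openin_open)
  obtain U F where U: "open U" "\<zeta> \<in> U" "smooth U F" "\<forall>y\<in>B P \<inter> U. F y = XV P y"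
    by (rule smooth_onE[OF LB(2) li(1)])
  let ?U = "U \<inter> T \<inter> coll_dom \<mu> P"
  have oU: "open ?U" using U(1) T(1) open_coll_dom by blast
  have zU: "\<zeta> \<in> ?U" using U(2) li(1) T(2) V_coll_dom[of \<mu> P] by blast
  define r where "r z = norm (snd z) * (1 - fst (fst z))" for z :: "R4 \<times> R4"
  have sr: "smooth (coll_dom \<mu> P) r" unfolding r_def[abs_def]
    by (intro smooth_intros open_coll_dom) (auto simp: coll_dom_def)
  define \<Psi>1 where "\<Psi>1 z = frechet_derivative (coll_ham \<mu> P c) (at z) (F z)" for z
  define \<Psi>2 where "\<Psi>2 z = frechet_derivative r (at z) (F z)" for z
  have FU: "smooth ?U F" by (rule smooth_subset[OF U(3)]) auto
  have "smooth ?U \<Psi>1" unfolding \<Psi>1_def[abs_def]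
    by (rule smooth_frechet_vary[OF oU smooth_subset[OF smooth_coll_ham] FU]) auto
  then have cont1: "isCont \<Psi>1 \<zeta>" using oU zU by (rule smooth_isCont)
  have "smooth ?U \<Psi>2" unfolding \<Psi>2_def[abs_def]
    by (rule smooth_frechet_vary[OF oU smooth_subset[OF sr] FU]) auto
  then have cont2: "isCont \<Psi>2 \<zeta>" using oU zU by (rule smooth_isCont)
  have "(\<lambda>n. \<Psi>1 (z (\<sigma> n)) + (c - E (\<sigma> n)) * \<Psi>2 (z (\<sigma> n))) \<longlonglongrightarrow> \<Psi>1 \<zeta> + (c - c) * \<Psi>2 \<zeta>"
    by (intro tendsto_intros isCont_tendsto_compose[OF cont1 zs] isCont_tendsto_compose[OF cont2 zs] Es)
  then have lim1: "(\<lambda>n. \<Psi>1 (z (\<sigma> n)) + (c - E (\<sigma> n)) * \<Psi>2 (z (\<sigma> n))) \<longlonglongrightarrow> \<Psi>1 \<zeta>" by simp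
  \<comment> \<open>On tangent vectors any derivative within \<open>V\<close> equals that of the
    ambient function \<open>coll_ham\<close>, whose dependence on the energy is explicit.\<close>
  have key: "D u = frechet_derivative (coll_ham \<mu> P c) (at (z n)) u + (c - E n) * frechet_derivative r (at (z n)) u"
    if D: "((regK \<mu> g (E n) \<circ> glue \<mu> P) has_derivative D) (at (z n) within V)" and u: "u \<in> TV (z n)" for n D u
  proof -
    have "open ((\<lambda>z. fst (moser \<mu> P z)) -` N)" by (rule open_vimage[OF N(1) continuous_moser_fst])
    then obtain d where d: "0 < d" "ball (z n) d \<subseteq> (\<lambda>z. fst (moser \<mu> P z)) -` N"
      using inN(1)[of n] unfolding open_contains_ball by (metis vimageI2)
    have D': "(coll_ham \<mu> P (E n) has_derivative D) (at (z n) within V)"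
    proof (rule has_derivative_transform_within[OF D d(1) zV])
      fix x assume x: "x \<in> V" "dist x (z n) < d"
      then have "fst (moser \<mu> P x) \<in> N" using d(2) by (auto simp: dist_commute)
      then show "(regK \<mu> g (E n) \<circ> glue \<mu> P) x = coll_ham \<mu> P (E n) x" using N(3) x(1) by auto
    qed
    have zd: "z n \<in> coll_dom \<mu> P" using zV V_coll_dom by blast
    have eq: "coll_ham \<mu> P (E n) x = coll_ham \<mu> P c x + (c - E n) * r x" for x
      using coll_ham_shift[of \<mu> P "E n" x] coll_ham_shift[of \<mu> P c x] by (simp add: r_def left_diff_distrib)
    have d': "((\<lambda>x. coll_ham \<mu> P c x + (c - E n) * r x) has_derivative
        (\<lambda>u. frechet_derivative (coll_ham \<mu> P c) (at (z n)) u + (c - E n) * frechet_derivative r (at (z n)) u))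
        (at (z n) within V)"
      by (rule has_derivative_at_withinI, rule has_derivative_add, rule smooth_has_derivative[OF smooth_coll_ham zd],
          rule has_derivative_mult_right, rule smooth_has_derivative[OF sr zd])
    have uT: "u \<in> tangent_space V (z n)" using u tangent_space_V[OF zV, of n] by simp
    show ?thesis by (rule tangent_space_derivative_unique[OF uT D' d' eq])
  qed
  have "\<forall>\<^sub>F n in sequentially. z (\<sigma> n) \<in> ?U" by (rule topological_tendstoD[OF zs oU zU])
  then have evb: "\<forall>\<^sub>F n in sequentially. \<bar>\<Psi>1 (z (\<sigma> n)) + (c - E (\<sigma> n)) * \<Psi>2 (z (\<sigma> n))\<bar> \<le> inverse (Suc (\<sigma> n + n0))"
  proof eventually_elim
    case (elim n)
    let ?m = "\<sigma> n"
    have B: "z ?m \<in> B P" using elim zV T(2) by blast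
    then have XF: "F (z ?m) = XV P (z ?m)" using U(4) elim by blast
    have XT: "XV P (z ?m) \<in> TV (z ?m)" using LB(3) B by blast
    have nt: "\<not> transverse_at \<mu> g A B XA XV (E ?m) (inverse (Suc (?m + n0))) (w (?m + n0))"
      unfolding E_def by (rule spec[OF ew(4)])
    have wz: "w (?m + n0) = glue \<mu> P (z ?m)" using z by simp
    obtain D where D: "((regK \<mu> g (E ?m) \<circ> glue \<mu> P) has_derivative D) (at (z ?m) within V)"
      "\<bar>D (XV P (z ?m))\<bar> < inverse (Suc (?m + n0))"
    proof (cases "fst (z ?m) = north")
      case True
      then have "fst (snd (z ?m)) = 0" using zV[of ?m] by (auto simp: V_def)
      then have zz: "(north, (0, snd (snd (z ?m)))) = z ?m" using True by (simp add: prod_eq_iff)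
      have "w (?m + n0) = Coll P (snd (snd (z ?m)))" unfolding wz using True by (simp add: glue_def)
      then show thesis using nt B that unfolding transverse_at_def by (auto simp: zz not_le)
    next
      case False
      have wR: "w (?m + n0) = Reg (moser \<mu> P (z ?m))" unfolding wz using False by (simp add: glue_def)
      have mA: "moser \<mu> P (z ?m) \<in> A" "dmoser (z ?m) (XV P (z ?m)) = XA (moser \<mu> P (z ?m))"
        using LB(4) B False by auto
      obtain D where D: "((regK \<mu> g (E ?m) \<circ> Reg) has_derivative D) (at (moser \<mu> P (z ?m)))"
        "\<bar>D (XA (moser \<mu> P (z ?m)))\<bar> < inverse (Suc (?m + n0))"
        using nt mA(1) unfolding wR transverse_at_def by (auto simp: not_le)
      have kv: "(regK \<mu> g (E ?m) \<circ> glue \<mu> P) x = (regK \<mu> g (E ?m) \<circ> Reg) (moser \<mu> P x)" if "fst x \<noteq> north" for x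
        using that by (simp add: glue_def)
      have hd1: "((regK \<mu> g (E ?m) \<circ> glue \<mu> P) has_derivative (\<lambda>u. D (dmoser (z ?m) u))) (at (z ?m) within V)"
        by (rule dmoser_ham_vf(2)[OF zV False open_phase_space moser_phase_space[OF zV False] D(1)]) (rule kv)
      have "\<bar>D (dmoser (z ?m) (XV P (z ?m)))\<bar> < inverse (Suc (?m + n0))" unfolding mA(2) by (rule D(2))
      then show thesis by (rule that[OF hd1])
    qed
    have "D (XV P (z ?m)) = \<Psi>1 (z ?m) + (c - E ?m) * \<Psi>2 (z ?m)"
      unfolding \<Psi>1_def \<Psi>2_def XF by (rule key[OF D(1) XT])
    then show ?case using D(2) by simp
  qed
  have invl: "(\<lambda>n. inverse (real (Suc (\<sigma> n + n0)))) \<longlonglongrightarrow> 0"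
    using LIMSEQ_subseq_LIMSEQ[OF LIMSEQ_ignore_initial_segment[OF LIMSEQ_inverse_real_of_nat, of n0] \<sigma>(1)] by (simp add: o_def)
  have "(\<lambda>n. \<Psi>1 (z (\<sigma> n)) + (c - E (\<sigma> n)) * \<Psi>2 (z (\<sigma> n))) \<longlonglongrightarrow> 0"
    by (rule Lim_null_comparison[OF _ invl]) (use evb in \<open>simp only: real_norm_def\<close>)
  then have "\<Psi>1 \<zeta> = 0" by (rule LIMSEQ_unique[OF lim1])
  then show False using li U(2,4) by (simp add: \<Psi>1_def)
qed

text \<open>Transversality is tested only at the limit energy \<open>c 1\<close>; local uniformity
  and continuity of \<open>c\<close> extend it to all \<open>s\<close> close to 1.\<close>

lemma no_catastrophe_hull:
  assumes g: "regularizing \<mu> g" and c: "smooth_on {0..1} c" and L: "liouville_field \<mu> A B XA XV"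
    and K: "compact K" and PK: "\<And>P. P \<in> Ps \<Longrightarrow> pos \<mu> P \<in> K"
    and loc: "\<And>q. q \<in> K \<Longrightarrow> locally_transverse \<mu> g A B XA XV K Ps (c 1) q"
    and sub: "\<And>s. s \<in> {0..1} \<Longrightarrow> S (c s) \<subseteq> surf_hull \<mu> K Ps (c s)"
  shows "\<not> blue_sky_catastrophe \<mu> g S c"
proof -
  obtain \<delta> where \<delta>: "0 < \<delta>"
    "\<forall>e w. \<bar>e - c 1\<bar> < \<delta> \<longrightarrow> w \<in> surf_hull \<mu> K Ps e \<longrightarrow> transverse_at \<mu> g A B XA XV e \<delta> w"
    using locally_transverse_uniform[OF K PK loc] by metis
  have "continuous_on {0..1} c" by (rule smooth_on_continuous[OF c])
  then obtain d where d: "0 < d" "\<And>s. s \<in> {0..1} \<Longrightarrow> dist s 1 < d \<Longrightarrow> dist (c s) (c 1) < \<delta>"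
    using \<delta>(1) unfolding continuous_on_iff by (metis atLeastAtMost_iff order_refl zero_le_one)
  have "compact (gext \<mu> g ` K)"
    by (intro compact_continuous_image continuous_on_subset[OF continuous_gext[OF g]] K) auto
  then obtain G where "\<forall>x\<in>gext \<mu> g ` K. norm x \<le> G"
    using compact_imp_bounded bounded_iff[of "gext \<mu> g ` K"] by blast
  then have G: "\<bar>gext \<mu> g q\<bar> \<le> G" if "q \<in> K" for q using that by auto
  have hull: "w \<in> surf_hull \<mu> K Ps (c s)" "transverse_at \<mu> g A B XA XV (c s) \<delta> w"
    if "max 0 (1 - d) < s" "s < 1" "w \<in> S (c s)" for s w
  proof -
    have s: "s \<in> {0..1}" "dist s 1 < d" using that by (auto simp: dist_real_def)
    show w: "w \<in> surf_hull \<mu> K Ps (c s)" using sub[OF s(1)] that(3) by blast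
    have "\<bar>c s - c 1\<bar> < \<delta>" using d(2)[OF s] by (simp add: dist_real_def)
    then show "transverse_at \<mu> g A B XA XV (c s) \<delta> w" using \<delta>(2) w by blast
  qed
  show ?thesis
  proof (rule no_catastrophe[OF g c L _ \<delta>(1), of "max 0 (1 - d)" S G])
    show "max 0 (1 - d) < 1" using d(1) by simp
  next
    fix s w assume "max 0 (1 - d) < s" "s < 1" "w \<in> S (c s)"
    from hull(1)[OF this] show "w \<in> W \<mu> \<and> regK \<mu> g (c s) w = 0 \<and> \<bar>gext \<mu> g (wproj \<mu> w)\<bar> \<le> G"
    proof (cases rule: surf_hull_cases)
      case (1 z)
      then show ?thesis using G Reg_W by simp
    next
      case (2 P \<eta>)
      then have "glue \<mu> P (north, (0, \<eta>)) = w" "(north, (0, \<eta>)) \<in> V" by (simp_all add: glue_def north_in_V)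
      then have "w \<in> W \<mu>" using glue_W by metis
      then show ?thesis using 2 G[OF PK] by simp
    qed
  next
    fix s w D assume "max 0 (1 - d) < s" "s < 1" "Reg w \<in> S (c s)"
    from hull(2)[OF this] show "w \<in> A \<and> (((regK \<mu> g (c s) \<circ> Reg) has_derivative D) (at w) \<longrightarrow> \<delta> \<le> \<bar>D (XA w)\<bar>)"
      by (simp add: transverse_at_def)
  next
    fix s P \<eta> D assume "max 0 (1 - d) < s" "s < 1" "Coll P \<eta> \<in> S (c s)"
    from hull(2)[OF this] show "(north, (0, \<eta>)) \<in> B P \<and>
      (((regK \<mu> g (c s) \<circ> glue \<mu> P) has_derivative D) (at (north, (0, \<eta>)) within V) \<longrightarrow>
         \<delta> \<le> \<bar>D (XV P (north, (0, \<eta>)))\<bar>)" by (simp add: transverse_at_def)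
  qed
qed

lemma regK_Reg_derivative:
  assumes g: "regularizing \<mu> g" and z: "z \<in> phase_space \<mu>" "H \<mu> z = c"
  shows "frechet_derivative (regK \<mu> g c \<circ> Reg) (at z) u =
    g (fst z) * (vel z \<bullet> vel u + grad_effpot \<mu> (fst z) \<bullet> fst u)"
proof -
  let ?A = "UNIV - {pos \<mu> Earth, pos \<mu> Moon}"
  have "fst z \<in> ?A" using z(1) phase_space_iff[of z \<mu> Earth] by simp
  then have "(g has_derivative frechet_derivative g (at (fst z))) (at (fst z))"
    by (rule smooth_has_derivative[OF smooth_g[OF g]])
  from has_derivative_compose[OF has_derivative_fst[OF has_derivative_ident] this]
  have 1: "((\<lambda>z. g (fst z)) has_derivative (\<lambda>u. frechet_derivative g (at (fst z)) (fst u))) (at z)" .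
  have "((\<lambda>z. H \<mu> z - c) has_derivative (\<lambda>u. vel z \<bullet> vel u + grad_effpot \<mu> (fst z) \<bullet> fst u)) (at z)"
    using has_derivative_diff[OF H_has_derivative[OF z(1)] has_derivative_const[of c]] by simp
  from has_derivative_mult[OF 1 this]
  have "((\<lambda>z. g (fst z) * (H \<mu> z - c)) has_derivative
    (\<lambda>u. g (fst z) * (vel z \<bullet> vel u + grad_effpot \<mu> (fst z) \<bullet> fst u))) (at z)" using z(2) by simp
  then have "((regK \<mu> g c \<circ> Reg) has_derivative
    (\<lambda>u. g (fst z) * (vel z \<bullet> vel u + grad_effpot \<mu> (fst z) \<bullet> fst u))) (at z)" by (simp add: o_def)
  from fun_cong[OF frechet_derivative_at[OF this], of u] show ?thesis by (simp only:)
qed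

text \<open>On the collision fibre \<open>coll_ham\<close> is |\<eta>| minus a constant, and the
  dilation field differentiates a function of degree one to itself.\<close>

lemma coll_ham_fibre_derivative:
  assumes "\<eta> \<noteq> 0"
  shows "frechet_derivative (coll_ham \<mu> P c) (at (north, (0, \<eta>))) (0, (0, \<eta>)) = norm \<eta>"
proof -
  define \<gamma> :: "real \<Rightarrow> R4 \<times> R4" where "\<gamma> t = (north, (0, (1 + t) *\<^sub>R \<eta>))" for t
  have \<gamma>0: "\<gamma> 0 = (north, (0, \<eta>))" by (simp add: \<gamma>_def)
  have "\<gamma> 0 \<in> coll_dom \<mu> P" unfolding \<gamma>0 using assms north_in_V V_coll_dom by blast
  moreover have "(\<gamma> has_vector_derivative (0, (0, \<eta>))) (at 0)"
    unfolding \<gamma>_def[abs_def] has_vector_derivative_def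
    by (auto intro!: derivative_eq_intros simp: zero_prod_def)
  ultimately have 1: "((\<lambda>t. coll_ham \<mu> P c (\<gamma> t)) has_vector_derivative
      frechet_derivative (coll_ham \<mu> P c) (at (\<gamma> 0)) (0, (0, \<eta>))) (at 0)"
    by (rule smooth_curve_derivative[OF smooth_coll_ham])
  have "((\<lambda>t. (1 + t) * norm \<eta> - mass \<mu> P) has_vector_derivative norm \<eta>) (at 0)"
    by (auto intro!: derivative_eq_intros simp: has_real_derivative_iff_has_vector_derivative[symmetric])
  then have "((\<lambda>t. coll_ham \<mu> P c (\<gamma> t)) has_vector_derivative norm \<eta>) (at 0)"
    by (rule has_vector_derivative_transform_within_open[of _ _ _ "{-1<..}"])
      (auto simp: \<gamma>_def coll_ham_north norm_Pair)
  from vector_derivative_unique_at[OF 1 this] show ?thesis unfolding \<gamma>0 .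
qed

section \<open>Below the first critical value\<close>

lemma liouville_on_linear:
  fixes X :: "'v::euclidean_space \<times> 'v \<Rightarrow> 'v \<times> 'v"
  assumes X: "\<And>z. (X has_derivative D) (at z)" "smooth UNIV X"
    and D: "\<And>u v. symp (D u) v + symp u (D v) = symp u v"
  shows "liouville_on Z X"
  unfolding liouville_on_def lie_symp_def Let_def
proof (intro ballI)
  fix z u v assume z: "z \<in> Z" and uv: "u \<in> tangent_space Z z" "v \<in> tangent_space Z z"
  have "frechet_derivative X (at z within Z) u = D u" if u: "u \<in> tangent_space Z z" for u
  proof -
    have "\<forall>y\<in>Z \<inter> UNIV. X y = X y" by simp
    from smooth_frechet_within(2)[OF X(2) UNIV_I open_UNIV z this u]
    show ?thesis by (simp add: frechet_derivative_at[OF X(1)[of z], symmetric])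
  qed
  then show "symp (frechet_derivative X (at z within Z) u) v + symp u (frechet_derivative X (at z within Z) v) = symp u v"
    using D uv by simp
qed

text \<open>In Moser's map q - P is linear in \<eta> and p does not depend on it, so the dilation of
  \<eta> goes over into the dilation of q - P. Only the chart at \<open>P\<close> is equipped with a
  domain.\<close>

lemma radial_liouville_field:
  "liouville_field \<mu> {z \<in> phase_space \<mu>. norm (fst z - pos \<mu> P) < s}
     (\<lambda>Q. if Q = P then {z \<in> V. norm (snd z) * (1 - fst (fst z)) < s} else {})
     (\<lambda>z. (fst z - pos \<mu> P, 0)) (\<lambda>Q z. (0, snd z))"
proof -
  let ?A = "{z \<in> phase_space \<mu>. norm (fst z - pos \<mu> P) < s}"
  let ?B = "{z \<in> V. norm (snd z) * (1 - fst (fst z)) < s}"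
  have sA: "smooth UNIV (\<lambda>z::phase. (fst z - pos \<mu> P, 0::real^3))" by (intro smooth_intros) auto
  have sB: "smooth UNIV (\<lambda>z::R4 \<times> R4. (0::R4, snd z))" by (intro smooth_intros) auto
  have "?A = phase_space \<mu> \<inter> {z. norm (fst z - pos \<mu> P) < s}" by auto
  moreover have "open {z::phase. norm (fst z - pos \<mu> P) < s}" by (intro open_Collect_less continuous_intros)
  ultimately have oA: "open ?A" using open_phase_space by auto
  have "?B = V \<inter> {z. norm (snd z) * (1 - fst (fst z)) < s}" by auto
  moreover have "open {z::R4 \<times> R4. norm (snd z) * (1 - fst (fst z)) < s}" by (intro open_Collect_less continuous_intros)
  ultimately have oB: "openin (top_of_set V) ?B" by (simp add: openin_open_Int)
  have LA: "liouville_on ?A (\<lambda>z. (fst z - pos \<mu> P, 0))"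
    by (rule liouville_on_linear[where D="\<lambda>u. (fst u, 0)", OF _ sA])
      (auto intro!: derivative_eq_intros simp: symp_def)
  have LB: "liouville_on Z (\<lambda>z. (0, snd z))" for Z :: "(R4 \<times> R4) set"
    by (rule liouville_on_linear[where D="\<lambda>u. (0, snd u)", OF _ sB])
      (auto intro!: derivative_eq_intros simp: symp_def)
  have m: "moser \<mu> P z \<in> ?A \<and> dmoser z (0, snd z) = (fst (moser \<mu> P z) - pos \<mu> P, 0)"
    if "z \<in> ?B" "fst z \<noteq> north" for z
    using that moser_phase_space[of z \<mu> P] moser_dist[of z \<mu> P] by (simp add: dmoser_def moser_alt zero_prod_def Let_def)
  have t: "(0, snd z) \<in> TV z" if "z \<in> V" for z using that by (auto simp: TV_def V_def)
  show ?thesis unfolding liouville_field_def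
  proof (intro conjI allI)
    show "smooth_on ?A (\<lambda>z. (fst z - pos \<mu> P, 0 :: real^3))" by (rule smooth_imp_smooth_on[OF open_UNIV sA]) simp
    show "smooth_on (if Q = P then ?B else {}) (\<lambda>z. (0 :: R4, snd z))" for Q
      by (rule smooth_imp_smooth_on[OF open_UNIV sB]) simp
    show "openin (top_of_set V) (if Q = P then ?B else {})" for Q using oB by simp
    show "\<forall>z\<in>if Q = P then ?B else {}. (0, snd z) \<in> TV z \<and> (fst z \<noteq> north \<longrightarrow>
      moser \<mu> Q z \<in> ?A \<and> dmoser z (0, snd z) = (fst (moser \<mu> Q z) - pos \<mu> P, 0))" for Q
    proof (cases "Q = P")
      case True
      have "(0, snd z) \<in> TV z \<and> (fst z \<noteq> north \<longrightarrow>
        moser \<mu> P z \<in> ?A \<and> dmoser z (0, snd z) = (fst (moser \<mu> P z) - pos \<mu> P, 0))" if "z \<in> ?B" for z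
        using m[OF that] t[of z] that by blast
      then show ?thesis unfolding True by (simp only: if_True simp_thms) blast
    qed simp
  qed (use oA LA LB in auto)
qed

lemma effpot_le_of_level: "H \<mu> z = c \<Longrightarrow> effpot \<mu> (fst z) \<le> c"
  using H_effpot[of \<mu> z] inner_ge_zero[of "vel z"] by linarith

text \<open>The ball reaches to L1. Its closure serves as the compact set, although the field is
  defined over the open ball only.\<close>

lemma no_catastrophe_below:
  assumes \<mu>: "0 < \<mu>" "\<mu> < 1" and g: "regularizing \<mu> g" and c: "smooth_on {0..1} c"
    and low: "\<forall>s\<in>{0..1}. c s < H \<mu> (L1 \<mu>)"
  shows "\<not> blue_sky_catastrophe \<mu> g (reg_surface \<mu> P) c"
proof -
  obtain s where s: "0 < s" "s < 1" "lagr_eq (mass \<mu> P) s = 0"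
    and Hs: "H \<mu> (L1 \<mu>) = - (mass \<mu> P * hfun s + mass \<mu> (other P) * hfun (1 - s)) + \<mu> * (1 - \<mu>) / 2"
    by (rule L1_point[OF \<mu>])
  let ?A = "{z \<in> phase_space \<mu>. norm (fst z - pos \<mu> P) < s}"
  let ?B = "\<lambda>Q. if Q = P then {z \<in> V. norm (snd z) * (1 - fst (fst z)) < s} else {}"
  let ?K = "cball (pos \<mu> P) s"
  have c1: "c 1 < H \<mu> (L1 \<mu>)" using low by simp
  show ?thesis
  proof (rule no_catastrophe_hull[OF g c radial_liouville_field[of \<mu> P s], of ?K "{P}"])
    fix q assume q: "q \<in> ?K"
    show "locally_transverse \<mu> g ?A ?B (\<lambda>z. (fst z - pos \<mu> P, 0)) (\<lambda>Q z. (0, snd z)) ?K {P} (c 1) q"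
    proof (cases "q = pos \<mu> P")
      case True
      show ?thesis unfolding True
      proof (rule locally_transverse_Coll[OF \<mu> g radial_liouville_field])
        fix \<eta> :: "real^3" assume \<eta>: "\<eta> \<noteq> 0"
        then have "(north, (0, \<eta>)) \<in> V" by (simp add: north_in_V)
        then show "(north, (0, \<eta>)) \<in> ?B P \<and>
           frechet_derivative (coll_ham \<mu> P (c 1)) (at (north, (0, \<eta>))) (0, snd (north, (0, \<eta>))) \<noteq> 0"
          using \<eta> s coll_ham_fibre_derivative[OF \<eta>, of \<mu> P "c 1"] by simp
      qed
    next
      case False
      have "norm (q - pos \<mu> P) \<le> s" using q by (simp add: dist_norm norm_minus_commute)
      then have "q \<noteq> pos \<mu> (other P)" using norm_pos_other[of \<mu> P] s by auto
      then have qn: "q \<notin> {pos \<mu> Earth, pos \<mu> Moon}" using False by (simp add: primaries[of \<mu> P])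
      show ?thesis
      proof (rule locally_transverse_Reg[OF g radial_liouville_field closed_cball qn])
        fix z assume z: "z \<in> phase_space \<mu>" "H \<mu> z = c 1" "fst z = q"
        \<comment> \<open>On the bounding sphere the potential is at least
          \<open>H \<mu> (L1 \<mu>)\<close>, so no point of energy \<open>c 1\<close> lies over it
          and limit points fall into the domain of the field.\<close>
        have "norm (q - pos \<mu> P) \<noteq> s"
        proof
          assume "norm (q - pos \<mu> P) = s"
          from effpot_sphere[OF \<mu> this s(1,2)] Hs have "H \<mu> (L1 \<mu>) \<le> effpot \<mu> q" by simp
          then show False using effpot_le_of_level[OF z(2)] z(3) c1 by simp
        qed
        then have n: "norm (q - pos \<mu> P) < s" using \<open>norm (q - pos \<mu> P) \<le> s\<close> by simp
        have "0 < vel z \<bullet> vel (fst z - pos \<mu> P, 0) + grad_effpot \<mu> (fst z) \<bullet> (fst z - pos \<mu> P)"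
          by (rule radial_transverse[OF \<mu> c1 s Hs]) (use z n False in \<open>auto simp: level_set_def\<close>)
        moreover have "0 < g (fst z)" using g qn z(3) unfolding regularizing_def by blast
        ultimately show "z \<in> ?A \<and> frechet_derivative (regK \<mu> g (c 1) \<circ> Reg) (at z) (fst z - pos \<mu> P, 0) \<noteq> 0"
          using z n unfolding regK_Reg_derivative[OF g z(1,2)] by simp
      qed
    qed
  next
    fix t :: real assume "t \<in> {0..1}"
    then have "c t < H \<mu> (L1 \<mu>)" using low by blast
    from hill_component_subset_ball[OF \<mu> this s(1,2) Hs]
    show "reg_surface \<mu> P (c t) \<subseteq> surf_hull \<mu> ?K {P} (c t)"
      by (auto simp: reg_surface_def surf_hull_def)
  qed (use s in auto)
qed

section \<open>Above the first critical value\<close>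

text \<open>Turns nontangency in the sense of curves into a nonzero derivative: a vector
  \<open>v\<close> killed by dF is realized by moving along \<open>v\<close>, correcting along a
  direction \<open>n\<close> with dF(n) \<noteq> 0, and retracting by \<open>r\<close>. In phase
  space \<open>r\<close> is the identity, in Moser's chart \<open>sphere_ret\<close>.\<close>

lemma tangent_space_retract_level_set:
  fixes r :: "'a::euclidean_space \<Rightarrow> 'a" and F :: "'a \<Rightarrow> real"
  assumes M: "open M" "z \<in> M" and r: "smooth M r" "r z = z"
    and F: "open T" "r ` M \<subseteq> T" "smooth T F" "F z = 0"
    and fixd: "frechet_derivative r (at z) v = v" "frechet_derivative r (at z) n = n"
    and D: "frechet_derivative F (at z) v = 0" "frechet_derivative F (at z) n \<noteq> 0"
    and S: "\<And>y. y \<in> M \<Longrightarrow> F (r y) = 0 \<Longrightarrow> r y \<in> S"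
  shows "v \<in> tangent_space S z"
proof -
  define \<kappa> where "\<kappa> x = z + (fst x *\<^sub>R v + snd x *\<^sub>R n)" for x :: "real \<times> real"
  have \<kappa>0: "\<kappa> (0, 0) = z" by (simp add: \<kappa>_def)
  have d\<kappa>: "(\<kappa> has_derivative (\<lambda>x. fst x *\<^sub>R v + snd x *\<^sub>R n)) (at (0, 0))"
    unfolding \<kappa>_def[abs_def] by (auto intro!: derivative_eq_intros)
  have s\<kappa>: "smooth UNIV \<kappa>" unfolding \<kappa>_def[abs_def] by (intro smooth_intros) auto
  define Q where "Q = \<kappa> -` M"
  have oQ: "open Q" unfolding Q_def by (rule open_vimage[OF M(1) smooth_continuous_on[OF s\<kappa>]])
  have Q0: "(0, 0) \<in> Q" using M(2) by (simp add: Q_def \<kappa>0)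
  have sk: "smooth Q (\<lambda>x. r (\<kappa> x))"
    by (rule smooth_compose[OF oQ M(1) _ smooth_subset[OF s\<kappa>] r(1)]) (auto simp: Q_def)
  have sf: "smooth Q (\<lambda>x. F (r (\<kappa> x)))"
    by (rule smooth_compose[OF oQ F(1) _ sk F(3)]) (use F(2) in \<open>auto simp: Q_def\<close>)
  have dr: "(r has_derivative frechet_derivative r (at z)) (at (\<kappa> (0, 0)))"
    unfolding \<kappa>0 by (rule smooth_has_derivative[OF r(1) M(2)])
  have zT: "z \<in> T" using F(2) M(2) r(2) by force
  have dF: "(F has_derivative frechet_derivative F (at z)) (at (r (\<kappa> (0, 0))))"
    unfolding \<kappa>0 r(2) by (rule smooth_has_derivative[OF F(3) zT])
  note dk = has_derivative_compose[OF d\<kappa> dr]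
  note df = has_derivative_compose[OF dk dF]
  have k1: "frechet_derivative (\<lambda>x. r (\<kappa> x)) (at (0, 0)) (1, 0) = v"
    using fixd(1) by (simp add: frechet_derivative_at[OF dk, symmetric])
  have f1: "frechet_derivative (\<lambda>x. F (r (\<kappa> x))) (at (0, 0)) (1, 0) = 0"
    using fixd(1) D(1) by (simp add: frechet_derivative_at[OF df, symmetric])
  have f2: "frechet_derivative (\<lambda>x. F (r (\<kappa> x))) (at (0, 0)) (0, 1) \<noteq> 0"
    using fixd(2) D(2) by (simp add: frechet_derivative_at[OF df, symmetric])
  have "frechet_derivative (\<lambda>x. r (\<kappa> x)) (at (0, 0)) (1, 0) \<in> tangent_space S z"
    by (rule tangent_space_level_set[OF oQ Q0 sk _ sf _ _ f1 f2]) (use \<kappa>0 r(2) F(4) S in \<open>auto simp: Q_def\<close>)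
  then show ?thesis unfolding k1 .
qed

text \<open>The Liouville field is taken from the contact hypothesis at the limit energy alone. Were
  dK(X) = 0 at a point of that surface, X would be tangent to it there, against contact
  type.\<close>

lemma no_catastrophe_above:
  assumes \<mu>: "0 < \<mu>" "\<mu> < 1" and g: "regularizing \<mu> g" and c: "smooth_on {0..1} c"
    and mid: "\<forall>s\<in>{0..1}. H \<mu> (L1 \<mu>) < c s \<and> c s < second_critical_value \<mu>"
    and ct: "contact_type \<mu> (reg_surface_EM \<mu> (c 1))"
  shows "\<not> blue_sky_catastrophe \<mu> g (reg_surface_EM \<mu>) c"
proof -
  have c1: "H \<mu> (L1 \<mu>) < c 1" "c 1 < second_critical_value \<mu>" using mid by auto
  obtain D where D: "open D" "bounded D" "pos \<mu> Earth \<in> D" "pos \<mu> Moon \<in> D"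
    "\<forall>q\<in>closure D - D. second_critical_value \<mu> \<le> effpot \<mu> q"
    and EM: "\<And>e. H \<mu> (L1 \<mu>) < e \<Longrightarrow> e < second_critical_value \<mu> \<Longrightarrow> hill_component_EM \<mu> e = hill_region \<mu> e \<inter> D"
    using hill_component_EM_eq[OF \<mu> c1] by metis
  have posD: "pos \<mu> P \<in> D" for P using D(3,4) by (cases P) auto
  define S where "S = reg_surface_EM \<mu> (c 1)"
  have S_Reg: "Reg z \<in> S" if "z \<in> phase_space \<mu>" "H \<mu> z = c 1" "fst z \<in> D" for z
  proof -
    have "z \<in> level_set \<mu> (c 1)" using that by (simp add: level_set_def)
    moreover from this have "fst z \<in> hill_component_EM \<mu> (c 1)"
      unfolding EM[OF c1] using that(3) by (auto simp: hill_region_def)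
    ultimately show ?thesis by (auto simp: S_def reg_surface_EM_def)
  qed
  have S_Coll: "collision_set \<mu> P \<subseteq> S" for P by (cases P) (auto simp: S_def reg_surface_EM_def)
  obtain U XA XV where U: "open_W \<mu> U" "S \<subseteq> U" "vector_field_W \<mu> U XA XV"
    "liouville_on (phase_space \<mu> \<inter> Reg -` U) XA" "\<forall>P. liouville_on (V \<inter> glue \<mu> P -` U) (XV P)"
    and tA: "\<forall>z\<in>phase_space \<mu> \<inter> Reg -` S. XA z \<notin> tangent_space (phase_space \<mu> \<inter> Reg -` S) z"
    and tV: "\<forall>P. \<forall>z\<in>V \<inter> glue \<mu> P -` S. XV P z \<notin> tangent_space (V \<inter> glue \<mu> P -` S) z"
    using ct unfolding contact_type_def S_def[symmetric] by (elim exE conjE) (rule that)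
  let ?A = "phase_space \<mu> \<inter> Reg -` U"
  let ?B = "\<lambda>P. V \<inter> glue \<mu> P -` U"
  have oW: "openin (top_of_set (phase_space \<mu>)) ?A" "\<forall>P. openin (top_of_set V) (?B P)"
    using U(1) unfolding open_W_def by auto
  have vf: "smooth_on ?A XA" "\<forall>P. smooth_on (?B P) (XV P)"
    "\<forall>P. \<forall>z\<in>?B P. XV P z \<in> tangent_space V z \<and>
           (fst z \<noteq> north \<longrightarrow> frechet_derivative (moser \<mu> P) (at z) (XV P z) = XA (moser \<mu> P z))"
    using U(3) unfolding vector_field_W_def by auto
  have L: "liouville_field \<mu> ?A ?B XA XV" unfolding liouville_field_def
  proof (intro conjI allI ballI impI)
    show "open ?A" by (rule openin_open_trans[OF oW(1) open_phase_space])
    fix P z assume z: "z \<in> ?B P"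
    then show "XV P z \<in> TV z" using vf(3) tangent_space_V[of z] by blast
    assume n: "fst z \<noteq> north"
    have "glue \<mu> P z = Reg (moser \<mu> P z)" using n by (simp add: glue_def)
    then show "moser \<mu> P z \<in> ?A" using z moser_phase_space[OF _ n, of \<mu> P] by simp
    have "fst (fst z) \<noteq> 1" using V_fst_less[OF _ n] z by force
    from frechet_derivative_at[OF moser_has_derivative[OF this, of \<mu> P]]
    show "dmoser z (XV P z) = XA (moser \<mu> P z)" using vf(3) z n by metis
  qed (use vf oW U in auto)
  let ?K = "closure D"
  show ?thesis
  proof (rule no_catastrophe_hull[OF g c L, of ?K UNIV])
    show "compact ?K" using D(2) by simp
    show "pos \<mu> P \<in> ?K" for P using posD closure_subset by blast
  next
    fix t :: real assume "t \<in> {0..1}"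
    then have "hill_component_EM \<mu> (c t) = hill_region \<mu> (c t) \<inter> D" using mid EM by blast
    then show "reg_surface_EM \<mu> (c t) \<subseteq> surf_hull \<mu> ?K UNIV (c t)"
      using closure_subset[of D] by (auto simp: reg_surface_EM_def surf_hull_def)
  next
    fix q assume "q \<in> ?K"
    show "locally_transverse \<mu> g ?A ?B XA XV ?K UNIV (c 1) q"
    proof (cases "q \<in> {pos \<mu> Earth, pos \<mu> Moon}")
      case True
      then obtain P where q: "q = pos \<mu> P" by blast
      show ?thesis unfolding q
      proof (rule locally_transverse_Coll[OF \<mu> g L])
        fix \<eta> :: "real^3" assume \<eta>: "norm \<eta> = mass \<mu> P" "\<eta> \<noteq> 0"
        define \<zeta> :: "R4 \<times> R4" where "\<zeta> = (north, (0, \<eta>))"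
        have zV: "\<zeta> \<in> V" using \<eta> by (simp add: \<zeta>_def north_in_V)
        have "Coll P \<eta> \<in> collision_set \<mu> P" using \<eta> zV by (simp add: collision_set_iff \<zeta>_def)
        then have zS: "\<zeta> \<in> V \<inter> glue \<mu> P -` S" using S_Coll zV by (auto simp: \<zeta>_def glue_def)
        then have zB: "\<zeta> \<in> ?B P" using U(2) by auto
        have XT: "XV P \<zeta> \<in> TV \<zeta>" using L zB unfolding liouville_field_def by blast
        \<comment> \<open>The fibre direction is the transverse one: by
          \<open>coll_ham_fibre_derivative\<close> the Hamiltonian has derivative |\<eta>| along
          it.\<close>
        have nT: "(0, (0, \<eta>)) \<in> TV \<zeta>" by (simp add: TV_def \<zeta>_def)
        have "frechet_derivative (coll_ham \<mu> P (c 1)) (at \<zeta>) (XV P \<zeta>) \<noteq> 0"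
        proof
          assume 0: "frechet_derivative (coll_ham \<mu> P (c 1)) (at \<zeta>) (XV P \<zeta>) = 0"
          let ?M1 = "{z. fst z \<noteq> 0 \<and> sphere_ret z \<in> V}"
          let ?T = "(\<lambda>z. fst (moser \<mu> P z)) -` D"
          define M where "M = sphere_ret -` ?T \<inter> ?M1"
          have sM1: "smooth ?M1 sphere_ret" by (rule smooth_subset[OF smooth_sphere_ret]) auto
          have oT: "open ?T" by (rule open_vimage[OF D(1) continuous_moser_fst])
          have oM: "open M" unfolding M_def
            using continuous_on_open_vimage[OF V_retract_nbhd] smooth_continuous_on[OF sM1] oT by blast
          have "fst (moser \<mu> P \<zeta>) = pos \<mu> P" by (rule moser_north) (simp add: \<zeta>_def)
          then have zM: "\<zeta> \<in> M" using zV posD V_fst_nonzero[OF zV] by (simp add: M_def sphere_ret_id[OF zV])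
          have "XV P \<zeta> \<in> tangent_space (V \<inter> glue \<mu> P -` S) \<zeta>"
          proof (rule tangent_space_retract_level_set[OF oM zM smooth_subset[OF sM1] sphere_ret_id[OF zV]
                open_coll_dom _ smooth_coll_ham _ sphere_ret_derivative[OF zV XT] sphere_ret_derivative[OF zV nT] 0])
            show "M \<subseteq> ?M1" by (auto simp: M_def)
            show "sphere_ret ` M \<subseteq> coll_dom \<mu> P" using V_coll_dom[of \<mu> P] unfolding M_def by blast
            show "coll_ham \<mu> P (c 1) \<zeta> = 0" using \<eta> mass_bounds(1)[OF \<mu>, of P] by (simp add: \<zeta>_def coll_ham_north norm_Pair)
            show "frechet_derivative (coll_ham \<mu> P (c 1)) (at \<zeta>) (0, (0, \<eta>)) \<noteq> 0"
              using \<eta>(2) by (simp add: \<zeta>_def coll_ham_fibre_derivative)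
            fix y assume "y \<in> M" and h0: "coll_ham \<mu> P (c 1) (sphere_ret y) = 0"
            define x where "x = sphere_ret y"
            have x: "x \<in> V" "fst (moser \<mu> P x) \<in> D" "coll_ham \<mu> P (c 1) x = 0"
              using \<open>y \<in> M\<close> h0 by (auto simp: M_def x_def)
            have "glue \<mu> P x \<in> S"
            proof (cases "fst x = north")
              case True
              then have "norm (snd x) = mass \<mu> P"
                using x(3) coll_ham_north[of \<mu> P "c 1" "snd x"] by (metis eq_iff_diff_eq_0 prod.collapse)
              then have "glue \<mu> P x \<in> collision_set \<mu> P" using x(1) True unfolding collision_set_def by blast
              then show ?thesis using S_Coll by blast
            next
              case False
              have "H \<mu> (moser \<mu> P x) = c 1"
                using coll_ham_moser[OF x(1) False, of \<mu> P "c 1"] x(3) V_moser_neq[OF x(1) False, of \<mu> P] by simp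
              then have "Reg (moser \<mu> P x) \<in> S" using x(2) moser_phase_space[OF x(1) False] by (intro S_Reg) auto
              then show ?thesis using False by (simp add: glue_def)
            qed
            then show "sphere_ret y \<in> V \<inter> glue \<mu> P -` S" using x(1) by (simp add: x_def)
          qed
          then show False using tV zS by blast
        qed
        then show "(north, (0, \<eta>)) \<in> ?B P \<and>
          frechet_derivative (coll_ham \<mu> P (c 1)) (at (north, (0, \<eta>))) (XV P (north, (0, \<eta>))) \<noteq> 0"
          using zB unfolding \<zeta>_def by blast
      qed
    next
      case False
      show ?thesis
      proof (rule locally_transverse_Reg[OF g L closed_closure False])
        fix z assume z: "z \<in> phase_space \<mu>" "H \<mu> z = c 1" "fst z = q" and qK: "q \<in> ?K"
        have "effpot \<mu> q \<le> c 1" using effpot_le_of_level[OF z(2)] z(3) by simp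
        \<comment> \<open>On the boundary of \<open>D\<close> the potential is at least the second
          critical value, which exceeds \<open>c 1\<close>; so \<open>q\<close> is interior.\<close>
        then have qD: "fst z \<in> D" using D(5) qK c1(2) z(3) by force
        have zS: "z \<in> phase_space \<mu> \<inter> Reg -` S" using S_Reg[OF z(1,2) qD] z(1) by simp
        let ?dH = "frechet_derivative (H \<mu>) (at z)"
        have dH: "?dH u = vel z \<bullet> vel u + grad_effpot \<mu> (fst z) \<bullet> fst u" for u
          by (simp add: frechet_derivative_at[OF H_has_derivative[OF z(1)], symmetric])
        have hd: "(H \<mu> has_derivative ?dH) (at z)" by (rule smooth_has_derivative[OF smooth_H z(1)])
        \<comment> \<open>A critical point at this energy would have a value other than
          \<open>H \<mu> (L1 \<mu>)\<close> and still below the infimum of such values.\<close>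
        have "\<exists>n. ?dH n \<noteq> 0"
        proof (rule ccontr)
          assume "\<nexists>n. ?dH n \<noteq> 0"
          then have "?dH = (\<lambda>_. 0)" by auto
          then have "z \<in> critical_points \<mu>" using hd z(1) by (simp add: critical_points_def)
          moreover have "H \<mu> z \<noteq> H \<mu> (L1 \<mu>)" using c1(1) z(2) by simp
          ultimately have "second_critical_value \<mu> \<le> H \<mu> z" by (rule critical_value_ge[OF \<mu>])
          then show False using c1(2) z(2) by simp
        qed
        then obtain n where n: "?dH n \<noteq> 0" by blast
        have "?dH (XA z) \<noteq> 0"
        proof
          assume 0: "?dH (XA z) = 0"
          let ?M = "phase_space \<mu> \<inter> fst -` D"
          have oM: "open ?M" using open_phase_space open_vimage[OF D(1) continuous_on_fst[OF continuous_on_id]] by blast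
          have id: "frechet_derivative (\<lambda>x. x) (at z) u = u" for u :: phase
            by (simp add: frechet_derivative_at[OF has_derivative_ident, symmetric])
          have dc: "frechet_derivative (\<lambda>z. H \<mu> z - c 1) (at z) u = ?dH u" for u
          proof -
            have "((\<lambda>z. H \<mu> z - c 1) has_derivative ?dH) (at z)"
              using has_derivative_diff[OF hd has_derivative_const[of "c 1"]] by simp
            from frechet_derivative_at[OF this] show ?thesis by metis
          qed
          have "XA z \<in> tangent_space (phase_space \<mu> \<inter> Reg -` S) z"
          proof (rule tangent_space_retract_level_set[OF oM _ smooth_id[OF oM] refl open_phase_space _ _ _ id id,
                where F="\<lambda>z. H \<mu> z - c 1" and n=n])
            show "smooth (phase_space \<mu>) (\<lambda>z. H \<mu> z - c 1)"
              by (intro smooth_diff open_phase_space smooth_H smooth_const)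
          qed (use z qD 0 n dc S_Reg in auto)
          then show False using tA zS by blast
        qed
        moreover have "0 < g (fst z)" using g False z(3) unfolding regularizing_def by blast
        ultimately show "z \<in> ?A \<and> frechet_derivative (regK \<mu> g (c 1) \<circ> Reg) (at z) (XA z) \<noteq> 0"
          using zS U(2) unfolding regK_Reg_derivative[OF g z(1,2)] dH by auto
      qed
    qed
  qed
qed

theorem corollary1p2:
  fixes \<mu> \<epsilon> :: real and g :: "real^3 \<Rightarrow> real"
  assumes "0 < \<mu>" and "\<mu> < 1"
    and "0 < \<epsilon>"
    and "H \<mu> (L1 \<mu>) + \<epsilon> \<le> second_critical_value \<mu>"
    and "\<And>e. H \<mu> (L1 \<mu>) < e \<Longrightarrow> e < H \<mu> (L1 \<mu>) + \<epsilon> \<Longrightarrow> contact_type \<mu> (reg_surface_EM \<mu> e)"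
    and "regularizing \<mu> g"
  shows "\<forall>c :: real \<Rightarrow> real. smooth_on {0..1} c \<longrightarrow>
      ((\<forall>s\<in>{0..1}. c s < H \<mu> (L1 \<mu>)) \<longrightarrow>
         \<not> blue_sky_catastrophe \<mu> g (reg_surface \<mu> Earth) c \<and>
         \<not> blue_sky_catastrophe \<mu> g (reg_surface \<mu> Moon) c) \<and>
      ((\<forall>s\<in>{0..1}. H \<mu> (L1 \<mu>) < c s \<and> c s < H \<mu> (L1 \<mu>) + \<epsilon>) \<longrightarrow>
         \<not> blue_sky_catastrophe \<mu> g (reg_surface_EM \<mu>) c)"
proof (intro allI impI conjI)
  fix c :: "real \<Rightarrow> real" assume c: "smooth_on {0..1} c"
  assume low: "\<forall>s\<in>{0..1}. c s < H \<mu> (L1 \<mu>)"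
  show "\<not> blue_sky_catastrophe \<mu> g (reg_surface \<mu> Earth) c" "\<not> blue_sky_catastrophe \<mu> g (reg_surface \<mu> Moon) c"
    by (rule no_catastrophe_below[OF assms(1,2,6) c low])+
next
  fix c :: "real \<Rightarrow> real" assume c: "smooth_on {0..1} c"
  assume mid: "\<forall>s\<in>{0..1}. H \<mu> (L1 \<mu>) < c s \<and> c s < H \<mu> (L1 \<mu>) + \<epsilon>"
  show "\<not> blue_sky_catastrophe \<mu> g (reg_surface_EM \<mu>) c"
  proof (rule no_catastrophe_above[OF assms(1,2,6) c])
    show "\<forall>s\<in>{0..1}. H \<mu> (L1 \<mu>) < c s \<and> c s < second_critical_value \<mu>"
      using mid assms(4) by (meson less_le_trans)
    show "contact_type \<mu> (reg_surface_EM \<mu> (c 1))" using mid by (intro assms(5)) auto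
  qed
qed

end
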